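(* Let $M$ and $N$ be von Neumann algebras. Suppose that $U(M)$ and $U(N)$ are quantum logic isomorphic. Then $M$ and $N$ are Jordan $*$-isomorphic.
   Context: For a von Neumann algebra $M$, $U(M)$ denotes the set of tripotents (partial isometries), i.e. $u\in M$ with $uu^*u=u$. With the triple product $\{a,b,c\}=\frac12(ab^*c+cb^*a)$ and $L(a,b)c=\{a,b,c\}$, tripotents $u,v$ are orthogonal ($u\perp v$) if $L(u,v)=0$, and $u\le v$ means that $v-u$ is a tripotent orthogonal to $u$. If $u\perp v$, then $u\vee v=u+v$ in $U(M)$. A map $\varphi:U(M)\to U(N)$ is a quantum logic morphism if $\varphi(0)=0$ and, whenever $u\perp v$, $\varphi(u)\perp\varphi(v)$ and $\varphi(u\vee v)=\varphi(u)\vee\varphi(v)$. $U(M)$ and $U(N)$ are quantum logic isomorphic if there is a bijection $\varphi$ between them such that $\varphi$ and $\varphi^{-1}$ are quantum logic morphisms. $M$ and $N$ are Jordan $*$-isomorphic if there is a linear bijection $J:M\to N$ with $J(a\circ b)=J(a)\circ J(b)$ and $J(a^* )=J(a)^*$, where $a\circ b=\frac12(ab+ba)$. *)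

theory Defs
  imports "HOL-Analysis.Analysis"
begin

class scaleC =
  fixes scaleC :: "complex \<Rightarrow> 'a \<Rightarrow> 'a"  (infixr \<open>*\<^sub>C\<close> 75)

text \<open>
  The real part of the complex inner product is the real inner product of the class
  \<^class>\<open>real_inner\<close>, so norm, distance and topology are those of the library.  Positive
  definiteness is inherited: \<open>cinner x x\<close> is real by \<open>cinner_commute\<close>, hence equals
  \<open>inner x x\<close>.  The complex inner product is linear in its first argument.
\<close>

class complex_hilbert_space = real_inner + complete_space + scaleC +
  fixes cinner :: "'a \<Rightarrow> 'a \<Rightarrow> complex"
  assumes scaleC_add_right: "c *\<^sub>C (x + y) = c *\<^sub>C x + c *\<^sub>C y"
    and scaleC_add_left: "(c + d) *\<^sub>C x = c *\<^sub>C x + d *\<^sub>C x"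
    and scaleC_scaleC: "c *\<^sub>C d *\<^sub>C x = (c * d) *\<^sub>C x"
    and scaleC_of_real: "complex_of_real r *\<^sub>C x = r *\<^sub>R x"
    and cinner_commute: "cinner x y = cnj (cinner y x)"
    and cinner_add_left: "cinner (x + y) z = cinner x z + cinner y z"
    and cinner_scaleC_left: "cinner (c *\<^sub>C x) y = c * cinner x y"
    and Re_cinner: "Re (cinner x y) = inner x y"
begin

lemma scaleC_one: "1 *\<^sub>C x = x"
  using scaleC_of_real[of 1 x] scaleR_one[of x] by simp

lemma cinner_add_right: "cinner x (y + z) = cinner x y + cinner x z"
  by (metis cinner_add_left cinner_commute complex_cnj_add)

lemma cinner_scaleC_right: "cinner x (c *\<^sub>C y) = cnj c * cinner x y"
  by (metis cinner_commute cinner_scaleC_left complex_cnj_mult)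

lemma Im_cinner: "Im (cinner x y) = - inner (\<i> *\<^sub>C x) y"
  by (simp add: Re_cinner[symmetric] cinner_scaleC_left)

lemma cinner_eqI:
  assumes "\<And>c. inner (c *\<^sub>C x) y = inner (c *\<^sub>C x') y'"
  shows "cinner x y = cinner x' y'"
proof (rule complex_eqI)
  show "Re (cinner x y) = Re (cinner x' y')"
    using assms[of 1] by (simp add: Re_cinner scaleC_one)
  show "Im (cinner x y) = Im (cinner x' y')"
    using assms[of \<i>] by (simp add: Im_cinner)
qed

lemma cinner_self: "cinner x x = complex_of_real ((norm x)\<^sup>2)"
proof (rule complex_eqI)
  show "Re (cinner x x) = Re (complex_of_real ((norm x)\<^sup>2))"
    by (simp add: Re_cinner power2_norm_eq_inner)
  show "Im (cinner x x) = Im (complex_of_real ((norm x)\<^sup>2))"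
    by (metis Reals_cnj_iff cinner_commute complex_is_Real_iff Im_complex_of_real)
qed

lemma cinner_ext_left: "x = y" if "\<And>z. cinner x z = cinner y z"
proof -
  have "inner x z = inner y z" for z
    using that[of z] by (simp add: Re_cinner[symmetric])
  then have "inner (x - y) (x - y) = 0"
    by (simp add: inner_diff_left)
  then show ?thesis by simp
qed

lemma cinner_ext: "x = y" if "\<And>z. cinner z x = cinner z y"
proof (rule cinner_ext_left)
  show "cinner x z = cinner y z" for z
    using that[of z] cinner_commute[of x z] cinner_commute[of y z] by simp
qed

end

instantiation complex :: complex_hilbert_space
begin

definition scaleC_complex :: "complex \<Rightarrow> complex \<Rightarrow> complex" where
  "scaleC_complex c x = c * x"

definition cinner_complex :: "complex \<Rightarrow> complex \<Rightarrow> complex" where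
  "cinner_complex x y = x * cnj y"

instance
  by standard
    (simp_all add: scaleC_complex_def cinner_complex_def algebra_simps scaleR_conv_of_real
      inner_complex_def)

end

typedef (overloaded) ('a::complex_hilbert_space) bop =
  "{f :: 'a \<Rightarrow> 'a. bounded_linear f \<and> (\<forall>c x. f (c *\<^sub>C x) = c *\<^sub>C f x)}"
  morphisms bop_apply Bop
  by (rule exI[of _ "\<lambda>x. x"]) (simp add: bounded_linear_ident)

setup_lifting type_definition_bop

lemma bounded_linear_bop_apply: "bounded_linear (bop_apply a)"
  using bop_apply[of a] by simp

lemma bop_apply_scaleC: "bop_apply a (c *\<^sub>C x) = c *\<^sub>C bop_apply a x"
  using bop_apply[of a] by simp

lemma bop_apply_add: "bop_apply a (x + y) = bop_apply a x + bop_apply a y"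
  by (rule linear_add[OF bounded_linear.linear[OF bounded_linear_bop_apply]])

lemma bop_eqI: "a = b" if "\<And>x. bop_apply a x = bop_apply b x"
  using that by (simp add: bop_apply_inject[symmetric] fun_eq_iff)

lemma scaleC_minus_right: "c *\<^sub>C (- x) = - (c *\<^sub>C x)" for x :: "'a::complex_hilbert_space"
proof -
  have "c *\<^sub>C (- x) = c *\<^sub>C complex_of_real (-1) *\<^sub>C x"
    by (simp only: scaleC_of_real) simp
  also have "\<dots> = complex_of_real (-1) *\<^sub>C c *\<^sub>C x"
    by (simp only: scaleC_scaleC mult.commute)
  also have "\<dots> = - (c *\<^sub>C x)" by (simp only: scaleC_of_real) simp
  finally show ?thesis .
qed

lemma scaleC_diff_right: "c *\<^sub>C (x - y) = c *\<^sub>C x - c *\<^sub>C y" for x :: "'a::complex_hilbert_space"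
  by (metis add_uminus_conv_diff scaleC_add_right scaleC_minus_right)

lemma scaleC_zero_right: "c *\<^sub>C 0 = (0::'a::complex_hilbert_space)"
  by (metis diff_self scaleC_diff_right)

lemma bounded_linear_scaleC: "bounded_linear (\<lambda>x::'a::complex_hilbert_space. c *\<^sub>C x)"
proof (rule bounded_linear_intro[where K = "cmod c"])
  fix x y :: 'a and r :: real
  show "c *\<^sub>C (x + y) = c *\<^sub>C x + c *\<^sub>C y" by (rule scaleC_add_right)
  show "c *\<^sub>C (r *\<^sub>R x) = r *\<^sub>R (c *\<^sub>C x)"
    by (simp only: scaleC_of_real[symmetric] scaleC_scaleC mult.commute)
  have "complex_of_real ((norm (c *\<^sub>C x))\<^sup>2) = complex_of_real ((cmod c * norm x)\<^sup>2)"
    unfolding cinner_self[symmetric] cinner_scaleC_left cinner_scaleC_right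
    by (simp add: cinner_self power_mult_distrib complex_norm_square[symmetric] ac_simps)
  then have "(norm (c *\<^sub>C x))\<^sup>2 = (cmod c * norm x)\<^sup>2"
    by (simp only: of_real_eq_iff)
  then show "norm (c *\<^sub>C x) \<le> norm x * cmod c"
    by (simp add: mult.commute)
qed

instantiation bop :: (complex_hilbert_space) "{ring, monoid_mult, scaleC}"
begin

lift_definition zero_bop :: "'a bop" is "\<lambda>x. 0"
  by (simp add: scaleC_zero_right)
lift_definition one_bop :: "'a bop" is "\<lambda>x. x"
  by simp
lift_definition plus_bop :: "'a bop \<Rightarrow> 'a bop \<Rightarrow> 'a bop" is "\<lambda>a b x. a x + b x"
  by (simp add: bounded_linear_add scaleC_add_right)
lift_definition minus_bop :: "'a bop \<Rightarrow> 'a bop \<Rightarrow> 'a bop" is "\<lambda>a b x. a x - b x"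
  by (simp add: bounded_linear_sub scaleC_diff_right)
lift_definition uminus_bop :: "'a bop \<Rightarrow> 'a bop" is "\<lambda>a x. - a x"
  by (simp add: bounded_linear_minus scaleC_minus_right)
lift_definition times_bop :: "'a bop \<Rightarrow> 'a bop \<Rightarrow> 'a bop" is "\<lambda>a b x. a (b x)"
  by (simp add: bounded_linear_compose)
lift_definition scaleC_bop :: "complex \<Rightarrow> 'a bop \<Rightarrow> 'a bop" is "\<lambda>c a x. c *\<^sub>C a x"
  by (auto intro: bounded_linear_compose[OF bounded_linear_scaleC]
      simp: scaleC_scaleC mult.commute)

instance
  by standard
    (transfer; auto simp: fun_eq_iff algebra_simps
      dest: linear_add[OF bounded_linear.linear])+

end

text \<open>The adjoint; its existence and uniqueness are shown in \<open>cinner_adj\<close> and \<open>adj_eqI\<close>.\<close>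

definition adj :: "'a::complex_hilbert_space bop \<Rightarrow> 'a bop" where
  "adj a = (THE b. \<forall>x y. cinner (bop_apply a x) y = cinner x (bop_apply b y))"

lemma riesz_representation:
  fixes f :: "'a::{real_inner, complete_space} \<Rightarrow> real"
  assumes "bounded_linear f"
  shows "\<exists>y. \<forall>x. f x = inner x y"
proof -
  interpret f: bounded_linear f by fact
  obtain K where K: "\<And>x. norm (f x) \<le> norm x * K" using f.bounded by blast
  define g where "g x = (norm x)\<^sup>2 / 2 - f x" for x
  have g_lower: "- K\<^sup>2 / 2 \<le> g x" for x
  proof -
    have "f x \<le> norm x * K" using K[of x] by simp
    moreover have "0 \<le> (norm x - K)\<^sup>2" by simp
    ultimately show ?thesis unfolding g_def by (simp add: power2_diff)
  qed
  have bdd: "bdd_below (range g)" using g_lower by (auto intro!: bdd_belowI)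
  define m where "m = Inf (range g)"
  have m_le: "m \<le> g x" for x unfolding m_def by (rule cInf_lower[OF _ bdd]) simp
  have "\<exists>x. g x < m + inverse (real (Suc n))" for n
    using cInf_less_iff[of "range g" "m + inverse (real (Suc n))"] bdd
    unfolding m_def by auto
  then obtain X where X: "\<And>n. g (X n) < m + inverse (real (Suc n))" by metis
  have par: "(norm (a - b))\<^sup>2 / 8 = g a / 2 + g b / 2 - g ((1/2) *\<^sub>R (a + b))" for a b
    unfolding g_def f.scaleR f.add power2_norm_eq_inner
    by (simp add: inner_simps inner_commute field_simps)
  have dist: "(norm (a - b))\<^sup>2 \<le> 8 * e" if "g a < m + e" "g b < m + e" for a b e
    using par[of a b] m_le[of "(1/2) *\<^sub>R (a + b)"] that by simp
  have "Cauchy X"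
  proof (rule metric_CauchyI)
    fix e :: real assume "0 < e"
    then obtain N where N: "inverse (real (Suc N)) < e\<^sup>2 / 8"
      using reals_Archimedean[of "e\<^sup>2 / 8"] by auto
    have close: "g (X n) < m + inverse (real (Suc N))" if "N \<le> n" for n
    proof -
      have "inverse (real (Suc n)) \<le> inverse (real (Suc N))" using that by simp
      with X[of n] show ?thesis by linarith
    qed
    have "dist (X i) (X j) < e" if "N \<le> i" "N \<le> j" for i j
    proof -
      have "(norm (X i - X j))\<^sup>2 < e\<^sup>2"
        using dist[OF close[OF that(1)] close[OF that(2)]] N by linarith
      then show ?thesis using \<open>0 < e\<close> by (simp add: dist_norm power_less_imp_less_base)
    qed
    then show "\<exists>M. \<forall>i\<ge>M. \<forall>j\<ge>M. dist (X i) (X j) < e" by blast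
  qed
  then obtain y where y: "X \<longlonglongrightarrow> y" using Cauchy_convergent convergent_def by blast
  have "(\<lambda>n. g (X n)) \<longlonglongrightarrow> g y"
    unfolding g_def by (intro tendsto_intros y f.tendsto) simp
  moreover have "(\<lambda>n. m + inverse (real (Suc n))) \<longlonglongrightarrow> m + 0"
    by (intro tendsto_intros LIMSEQ_inverse_real_of_nat)
  ultimately have gy: "g y \<le> m"
    using X LIMSEQ_le[of "\<lambda>n. g (X n)" "g y" "\<lambda>n. m + inverse (real (Suc n))" "m + 0"]
    by (auto intro: less_imp_le)
  have "f x = inner x y" for x
  proof (cases "x = 0")
    case True then show ?thesis by (simp add: f.zero)
  next
    case False
    define d where "d = f x - inner x y"
    define t where "t = d / (norm x)\<^sup>2"
    have nx: "(norm x)\<^sup>2 > 0" using False by simp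
    have "g (y + t *\<^sub>R x) = g y + t\<^sup>2 * (norm x)\<^sup>2 / 2 - t * d"
      unfolding g_def d_def f.scaleR f.add power2_norm_eq_inner
      by (simp add: inner_simps inner_commute power2_eq_square field_simps)
    then have "0 \<le> t\<^sup>2 * (norm x)\<^sup>2 / 2 - t * d"
      using gy m_le[of "y + t *\<^sub>R x"] by linarith
    also have "\<dots> = - (d\<^sup>2 / (2 * (norm x)\<^sup>2))"
      using nx unfolding t_def by (simp add: field_simps power2_eq_square)
    finally have "d\<^sup>2 / (2 * (norm x)\<^sup>2) \<le> 0" by simp
    then have "d\<^sup>2 \<le> 0" using nx by (simp add: divide_le_0_iff)
    then show ?thesis unfolding d_def by simp
  qed
  then show ?thesis by blast
qed

lemma adjoint_unique:
  assumes "\<forall>x y. cinner (bop_apply a x) y = cinner x (bop_apply b y)"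
    and "\<forall>x y. cinner (bop_apply a x) y = cinner x (bop_apply b' y)"
  shows "b = b'"
proof (rule bop_eqI, rule cinner_ext)
  show "cinner x (bop_apply b y) = cinner x (bop_apply b' y)" for x y
    using assms by simp
qed

lemma adjoint_exists: "\<exists>b. \<forall>x y. cinner (bop_apply a x) y = cinner x (bop_apply b y)"
proof -
  have "\<exists>z. \<forall>x. inner (bop_apply a x) y = inner x z" for y
    by (rule riesz_representation)
      (rule bounded_linear_compose[OF bounded_linear_inner_left bounded_linear_bop_apply])
  then obtain h where h: "\<And>x y. inner (bop_apply a x) y = inner x (h y)" by metis
  have ch: "cinner (bop_apply a x) y = cinner x (h y)" for x y
    by (rule cinner_eqI) (simp add: bop_apply_scaleC[symmetric] h)
  have h_add: "h (x + y) = h x + h y" for x y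
    by (rule cinner_ext) (simp add: ch[symmetric] cinner_add_right)
  have h_scaleC: "h (c *\<^sub>C x) = c *\<^sub>C h x" for c x
    by (rule cinner_ext) (simp add: ch[symmetric] cinner_scaleC_right)
  obtain K where K: "\<And>x. norm (bop_apply a x) \<le> norm x * K" "0 < K"
    using bounded_linear.pos_bounded[OF bounded_linear_bop_apply] by blast
  have h_bd: "norm (h y) \<le> norm y * K" for y
  proof (cases "h y = 0")
    case True then show ?thesis using K(2) by simp
  next
    case False
    have "norm (h y) * norm (h y) = inner (bop_apply a (h y)) y"
      by (simp add: h power2_norm_eq_inner[symmetric] power2_eq_square)
    also have "\<dots> \<le> norm (bop_apply a (h y)) * norm y" by (rule norm_cauchy_schwarz)
    also have "\<dots> \<le> (norm (h y) * K) * norm y" by (intro mult_right_mono K) simp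
    finally show ?thesis using False by (simp add: mult.assoc mult.commute)
  qed
  have "bounded_linear h"
    by (rule bounded_linear_intro[OF h_add _ h_bd])
      (simp only: scaleC_of_real[symmetric] h_scaleC)
  then have "bop_apply (Bop h) = h" using h_scaleC by (simp add: Bop_inverse)
  then show ?thesis using ch by metis
qed

lemma cinner_adj: "cinner (bop_apply a x) y = cinner x (bop_apply (adj a) y)"
proof -
  have "\<exists>!b. \<forall>x y. cinner (bop_apply a x) y = cinner x (bop_apply b y)"
    by (rule ex_ex1I[OF adjoint_exists adjoint_unique])
  from theI'[OF this] show ?thesis unfolding adj_def by blast
qed

lemma adj_eqI:
  "adj a = b" if "\<And>x y. cinner (bop_apply a x) y = cinner x (bop_apply b y)"
  by (rule adjoint_unique[of a]) (simp_all add: that cinner_adj[symmetric])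

lemma adj_adj [simp]: "adj (adj a) = a"
proof (rule adj_eqI)
  fix x y
  have "cinner (bop_apply (adj a) x) y = cnj (cinner y (bop_apply (adj a) x))"
    by (rule cinner_commute)
  also have "\<dots> = cnj (cinner (bop_apply a y) x)" by (simp only: cinner_adj)
  also have "\<dots> = cinner x (bop_apply a y)" by (rule cinner_commute[symmetric])
  finally show "cinner (bop_apply (adj a) x) y = cinner x (bop_apply a y)" .
qed

lemma adj_add: "adj (a + b) = adj a + adj b"
  by (rule adj_eqI) (simp add: plus_bop.rep_eq cinner_add_left cinner_add_right cinner_adj)

lemma adj_mult: "adj (a * b) = adj b * adj a"
  by (rule adj_eqI) (simp add: times_bop.rep_eq cinner_adj)

lemma adj_zero [simp]: "adj 0 = 0"
  using adj_add[of 0 0] by simp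

lemma adj_minus: "adj (- a) = - adj a"
  using adj_add[of a "- a"] by (simp add: eq_neg_iff_add_eq_0 add.commute)

lemma adj_diff: "adj (a - b) = adj a - adj b"
  using adj_add[of a "- b"] by (simp add: adj_minus)

lemma adj_mult_self_eq_0: "a = 0" if "adj a * a = 0"
proof (rule bop_eqI)
  fix x
  have "complex_of_real ((norm (bop_apply a x))\<^sup>2) = cinner x (bop_apply (adj a * a) x)"
    by (simp only: cinner_self[symmetric] cinner_adj times_bop.rep_eq)
  also have "\<dots> = 0"
    using cinner_scaleC_right[of x 0 "0::'a"]
    by (simp add: that zero_bop.rep_eq scaleC_zero_right)
  finally show "bop_apply a x = bop_apply 0 x"
    by (simp add: zero_bop.rep_eq)
qed

definition commutant :: "'a::complex_hilbert_space bop set \<Rightarrow> 'a bop set" where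
  "commutant S = {a. \<forall>b\<in>S. a * b = b * a}"

text \<open>
  A von Neumann algebra acting on a Hilbert space: a self-adjoint set of operators equal to its
  bicommutant.  Being a commutant, it is automatically a unital subalgebra.
\<close>

definition von_neumann_algebra :: "'a::complex_hilbert_space bop set \<Rightarrow> bool" where
  "von_neumann_algebra M \<longleftrightarrow> (\<forall>a\<in>M. adj a \<in> M) \<and> commutant (commutant M) = M"

definition triple_product ::
  "'a::complex_hilbert_space bop \<Rightarrow> 'a bop \<Rightarrow> 'a bop \<Rightarrow> 'a bop" where
  "triple_product a b c = (1/2) *\<^sub>C (a * adj b * c + c * adj b * a)"

definition tripotents :: "'a::complex_hilbert_space bop set \<Rightarrow> 'a bop set" where
  "tripotents M = {u\<in>M. u * adj u * u = u}"

definition trip_orth :: "'a::complex_hilbert_space bop set \<Rightarrow> 'a bop \<Rightarrow> 'a bop \<Rightarrow> bool" where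
  "trip_orth M u v \<longleftrightarrow> (\<forall>c\<in>M. triple_product u v c = 0)"

definition trip_le :: "'a::complex_hilbert_space bop set \<Rightarrow> 'a bop \<Rightarrow> 'a bop \<Rightarrow> bool" where
  "trip_le M u v \<longleftrightarrow> v - u \<in> tripotents M \<and> trip_orth M (v - u) u"

text \<open>
  The supremum of two tripotents in the ordered set of tripotents, unspecified if there is none.
  For orthogonal tripotents it is the sum, see \<open>trip_join_eq_sum\<close>.
\<close>

definition is_trip_join ::
  "'a::complex_hilbert_space bop set \<Rightarrow> 'a bop \<Rightarrow> 'a bop \<Rightarrow> 'a bop \<Rightarrow> bool" where
  "is_trip_join M u v w \<longleftrightarrow> w \<in> tripotents M \<and> trip_le M u w \<and> trip_le M v w \<and>
     (\<forall>x\<in>tripotents M. trip_le M u x \<and> trip_le M v x \<longrightarrow> trip_le M w x)"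

definition trip_join ::
  "'a::complex_hilbert_space bop set \<Rightarrow> 'a bop \<Rightarrow> 'a bop \<Rightarrow> 'a bop" where
  "trip_join M u v = (THE w. is_trip_join M u v w)"

definition quantum_logic_morphism ::
  "'a::complex_hilbert_space bop set \<Rightarrow> 'b::complex_hilbert_space bop set \<Rightarrow>
     ('a bop \<Rightarrow> 'b bop) \<Rightarrow> bool" where
  "quantum_logic_morphism M N \<phi> \<longleftrightarrow>
     \<phi> \<in> tripotents M \<rightarrow> tripotents N \<and> \<phi> 0 = 0 \<and>
     (\<forall>u\<in>tripotents M. \<forall>v\<in>tripotents M. trip_orth M u v \<longrightarrow>
        trip_orth N (\<phi> u) (\<phi> v) \<and> \<phi> (trip_join M u v) = trip_join N (\<phi> u) (\<phi> v))"

definition quantum_logic_isomorphic ::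
  "'a::complex_hilbert_space bop set \<Rightarrow> 'b::complex_hilbert_space bop set \<Rightarrow> bool" where
  "quantum_logic_isomorphic M N \<longleftrightarrow>
     (\<exists>\<phi>. bij_betw \<phi> (tripotents M) (tripotents N) \<and>
          quantum_logic_morphism M N \<phi> \<and>
          quantum_logic_morphism N M (inv_into (tripotents M) \<phi>))"

definition jordan_product ::
  "'a::complex_hilbert_space bop \<Rightarrow> 'a bop \<Rightarrow> 'a bop" where
  "jordan_product a b = (1/2) *\<^sub>C (a * b + b * a)"

definition jordan_star_isomorphic ::
  "'a::complex_hilbert_space bop set \<Rightarrow> 'b::complex_hilbert_space bop set \<Rightarrow> bool" where
  "jordan_star_isomorphic M N \<longleftrightarrow>
     (\<exists>J. bij_betw J M N \<and>
          (\<forall>a\<in>M. \<forall>b\<in>M. J (a + b) = J a + J b) \<and>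
          (\<forall>c. \<forall>a\<in>M. J (c *\<^sub>C a) = c *\<^sub>C J a) \<and>
          (\<forall>a\<in>M. \<forall>b\<in>M. J (jordan_product a b) = jordan_product (J a) (J b)) \<and>
          (\<forall>a\<in>M. J (adj a) = adj (J a)))"

lemma vN_add: "a + b \<in> M" if "von_neumann_algebra M" "a \<in> M" "b \<in> M"
proof -
  have "a + b \<in> commutant (commutant M)"
    using that unfolding von_neumann_algebra_def commutant_def
    by (auto simp: distrib_left distrib_right)
  then show ?thesis using that(1) by (simp add: von_neumann_algebra_def)
qed

lemma vN_minus: "- a \<in> M" if "von_neumann_algebra M" "a \<in> M"
proof -
  have "- a \<in> commutant (commutant M)"
    using that unfolding von_neumann_algebra_def commutant_def by auto
  then show ?thesis using that(1) by (simp add: von_neumann_algebra_def)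
qed

lemma vN_diff: "a - b \<in> M" if "von_neumann_algebra M" "a \<in> M" "b \<in> M"
  using vN_add[OF that(1,2) vN_minus[OF that(1,3)]] by simp

lemma half_scaleC_eq_0_iff: "(1/2) *\<^sub>C a = 0 \<longleftrightarrow> a = 0" for a :: "'a::complex_hilbert_space bop"
proof
  assume *: "(1/2) *\<^sub>C a = 0"
  have "bop_apply a x = 0" for x
  proof -
    have "bop_apply a x = 2 *\<^sub>C bop_apply ((1/2) *\<^sub>C a) x"
      by (simp add: scaleC_bop.rep_eq scaleC_scaleC scaleC_one)
    then show ?thesis by (simp add: * zero_bop.rep_eq scaleC_zero_right)
  qed
  then show "a = 0" by (intro bop_eqI) (simp add: zero_bop.rep_eq)
next
  assume "a = 0"
  then show "(1/2) *\<^sub>C a = 0"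
    by (intro bop_eqI) (simp add: scaleC_bop.rep_eq zero_bop.rep_eq scaleC_zero_right)
qed

lemma trip_orth_iff:
  assumes "v \<in> tripotents M"
  shows "trip_orth M u v \<longleftrightarrow> u * adj v = 0 \<and> adj v * u = 0"
proof
  assume orth: "trip_orth M u v"
  have v: "v * adj v * v = v" "v \<in> M" using assms by (auto simp: tripotents_def)
  have v': "adj v * v * adj v = adj v"
    using arg_cong[OF v(1), of adj] by (simp add: adj_mult mult.assoc)
  have eq: "u * adj v * v + v * adj v * u = 0"
    using orth v(2) unfolding trip_orth_def triple_product_def half_scaleC_eq_0_iff by blast
  have A: "u * adj v = - (v * adj v * u * adj v)"
  proof -
    have "0 = (u * adj v * v + v * adj v * u) * adj v" by (simp add: eq)
    also have "\<dots> = u * (adj v * v * adj v) + v * adj v * u * adj v"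
      by (simp only: distrib_right mult.assoc)
    finally show ?thesis by (simp add: v' eq_neg_iff_add_eq_0)
  qed
  have "v * adj v * (u * adj v) = - (v * adj v * v * adj v * u * adj v)"
    by (subst A) (simp add: mult.assoc)
  also have "\<dots> = - (v * adj v * u * adj v)" by (simp only: v(1))
  finally have "v * adj v * u * adj v = - (v * adj v * u * adj v)" by (simp add: mult.assoc)
  then have "v * adj v * u * adj v + v * adj v * u * adj v = 0"
    by (simp add: eq_neg_iff_add_eq_0)
  moreover have "x = 0" if "x + x = 0" for x :: "'a bop"
  proof (rule bop_eqI)
    fix y
    have "bop_apply x y + bop_apply x y = 0"
      using arg_cong[OF that, of "\<lambda>z. bop_apply z y"]
      by (simp add: plus_bop.rep_eq zero_bop.rep_eq)
    then show "bop_apply x y = bop_apply 0 y"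
      by (simp add: zero_bop.rep_eq scaleR_2[symmetric])
  qed
  ultimately have "v * adj v * u * adj v = 0" by blast
  with A have B: "u * adj v = 0" by simp
  have "v * adj v * u = 0" using eq B by simp
  then have "adj v * (v * adj v * u) = 0" by simp
  then have "adj v * v * adj v * u = 0" by (simp only: mult.assoc)
  then show "u * adj v = 0 \<and> adj v * u = 0" using B by (simp add: v')
next
  assume "u * adj v = 0 \<and> adj v * u = 0"
  then show "trip_orth M u v"
    unfolding trip_orth_def triple_product_def half_scaleC_eq_0_iff by (simp add: mult.assoc)
qed

lemma trip_orthD:
  assumes "v \<in> tripotents M" "trip_orth M u v"
  shows "u * adj v = 0" "adj v * u = 0" "v * adj u = 0" "adj u * v = 0"
proof -
  show *: "u * adj v = 0" "adj v * u = 0" using trip_orth_iff[OF assms(1)] assms(2) by auto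
  show "v * adj u = 0" "adj u * v = 0"
    using arg_cong[OF *(1), of adj] arg_cong[OF *(2), of adj] by (simp_all add: adj_mult)
qed

lemma trip_sum:
  assumes M: "von_neumann_algebra M" and u: "u \<in> tripotents M" and v: "v \<in> tripotents M"
    and orth: "trip_orth M u v"
  shows "u + v \<in> tripotents M"
proof -
  note o = trip_orthD[OF v orth]
  have "(u + v) * adj (u + v) * (u + v) = u * adj u * u + v * adj v * v"
    by (simp add: adj_add distrib_left distrib_right mult.assoc o)
  then show ?thesis using u v vN_add[OF M] by (auto simp: tripotents_def)
qed

lemma trip_le_antisym:
  assumes u: "u \<in> tripotents M" and w: "w \<in> tripotents M"
    and le: "trip_le M u w" "trip_le M w u"
  shows "u = w"
proof -
  define d where "d = w - u"
  have "trip_orth M d u" using le(1) by (simp add: trip_le_def d_def)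
  from trip_orthD[OF u this] have 1: "adj u * d = 0" by simp
  have "trip_orth M (u - w) w" using le(2) by (simp add: trip_le_def)
  from trip_orthD[OF w this] have "adj w * (u - w) = 0" by simp
  then have "adj w * d = 0" by (simp add: d_def right_diff_distrib)
  with 1 have "adj d * d = 0" by (simp add: d_def adj_diff left_diff_distrib)
  then have "d = 0" by (rule adj_mult_self_eq_0)
  then show ?thesis by (simp add: d_def)
qed

lemma is_trip_join_sum:
  assumes M: "von_neumann_algebra M" and u: "u \<in> tripotents M" and v: "v \<in> tripotents M"
    and orth: "trip_orth M u v"
  shows "is_trip_join M u v (u + v)"
  unfolding is_trip_join_def
proof (intro conjI ballI impI)
  note o = trip_orthD[OF v orth]
  show uv: "u + v \<in> tripotents M" by (rule trip_sum[OF assms])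
  show "trip_le M u (u + v)" using v o by (simp add: trip_le_def trip_orth_iff[OF u])
  show "trip_le M v (u + v)" using u orth by (simp add: trip_le_def)
  fix w assume w: "w \<in> tripotents M" and le: "trip_le M u w \<and> trip_le M v w"
  define f where "f = w - (u + v)"
  have uu: "u * adj u * u = u" and vv: "v * adj v * v = v" and ww: "w * adj w * w = w"
    using u v w by (auto simp: tripotents_def)
  have du: "(w - u) * adj u = 0" "adj u * (w - u) = 0"
    and dv: "(w - v) * adj v = 0" "adj v * (w - v) = 0"
    using le trip_orthD(1,2)[OF u] trip_orthD(1,2)[OF v] by (auto simp: trip_le_def)
  have fu: "f * adj u = 0" "adj u * f = 0"
    using du o by (simp_all add: f_def algebra_simps)
  have fv: "f * adj v = 0" "adj v * f = 0"
    using dv o by (simp_all add: f_def algebra_simps)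
  have fuv: "f * adj (u + v) = 0" "adj (u + v) * f = 0"
    by (simp_all add: adj_add distrib_left distrib_right fu fv)
  have fuv': "(u + v) * adj f = 0" "adj f * (u + v) = 0"
    using arg_cong[OF fuv(1), of adj] arg_cong[OF fuv(2), of adj] by (simp_all add: adj_mult)
  have w_eq: "w = (u + v) + f" by (simp add: f_def)
  have ring_fact: "(p + f) * (adj p + adj f) * (p + f) = p * adj p * p + f * adj f * f"
    if "f * adj p = 0" "adj p * f = 0" "p * adj f = 0" "adj f * p = 0" for p
    by (simp add: distrib_left distrib_right mult.assoc that)
  have "(u + v) * adj (u + v) * (u + v) + f * adj f * f = w * adj w * w"
    unfolding w_eq adj_add[of "u + v" f] by (rule ring_fact[OF fuv fuv', symmetric])
  moreover have "(u + v) * adj (u + v) * (u + v) = u + v"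
    using uv by (simp add: tripotents_def)
  ultimately have "(u + v) + f * adj f * f = (u + v) + f"
    using ww w_eq by simp
  then have "f * adj f * f = f" by simp
  moreover have "f \<in> M"
    using u v w vN_add[OF M] vN_diff[OF M] by (simp add: f_def tripotents_def)
  ultimately show "trip_le M (u + v) w"
    using fuv by (simp add: trip_le_def trip_orth_iff[OF uv] f_def[symmetric] tripotents_def)
qed

lemma trip_join_eq_sum:
  assumes "von_neumann_algebra M" "u \<in> tripotents M" "v \<in> tripotents M" "trip_orth M u v"
  shows "trip_join M u v = u + v"
  unfolding trip_join_def
proof (rule the_equality)
  show *: "is_trip_join M u v (u + v)" by (rule is_trip_join_sum[OF assms])
  fix w assume "is_trip_join M u v w"
  with * show "w = u + v" unfolding is_trip_join_def using trip_le_antisym by metis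
qed

end

theory Submission
  imports Defs
begin

text \<open>
  Let \<open>\<phi>\<close> be a quantum logic isomorphism.  The tripotent \<open>w = \<phi> 1\<close> is maximal, hence an isometry on
  one central summand of \<open>N\<close>, cut out by \<open>c\<close>, and a co-isometry on the other.  Therefore
  \<open>\<theta> p = (1 - c) \<phi>(p) w\<^sup>* + c w\<^sup>* \<phi>(p)\<close> is a bijection between the projections of \<open>M\<close> and \<open>N\<close> that
  preserves orthogonality in both directions, and so an isomorphism of lattices.

  As in von Neumann's coordinatisation, an operator \<open>a\<close> from \<open>e\<close> to \<open>1 - e\<close> is encoded by the
  projection onto its graph, and products and sums become lattice operations on graphs.  Adjoints
  come from the orthocomplement: given three equivalent orthogonal projections, orthogonality
  alone recognises which graphs make an angle of \<open>\<pi>/4\<close> with the axes, so \<open>\<theta>\<close> sends graphs of partial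
  isometries to such graphs.  This yields an additive bijection \<open>M e \<rightarrow> N \<theta>(e)\<close> that respects the
  products \<open>x\<^sup>* y\<close>.  Maximal families of triples exhaust \<open>M\<close> up to a part governed by an abelian
  projection, on whose corner \<open>\<theta>\<close> is a Boolean isomorphism that extends by spectral approximation.

  Together these give an additive bijection of full one-sided ideals; it transports left
  multiplication by unitaries, hence by all of \<open>M\<close>, which is a ring isomorphism \<open>J : M \<rightarrow> N\<close> commuting
  with \<open>*\<close>.  As \<open>J(i 1)\<close> is central with square \<open>- 1\<close>, \<open>J\<close> is linear on one central summand and
  antilinear on the other, where \<open>a \<mapsto> J(a\<^sup>*)\<close> is a linear anti-isomorphism.
\<close>

section \<open>Operators and von Neumann algebras\<close>

text \<open>Two obstacles shape the construction. First, on a summand of two by two matrices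
  \<theta> need not come from a Jordan isomorphism at all: there it may permute the pairs of
  complementary rank one projections arbitrarily. Coordinates are therefore taken only where three
  orthogonal equivalent projections exist. On the rest, which is commutative or consists of two by
  two matrices over a commutative algebra, \<theta> only transports one abelian corner and the
  equivalence of two projections; the second row is supplied by a partial isometry, and the
  resulting map need not extend \<theta>. Secondly, a linear anti-isomorphism \<open>A\<close> and
  the antilinear ring isomorphism sending \<open>a\<close> to \<open>A (adj a)\<close> agree on
  projections, so the lattice cannot tell how scalars act. Hence the map obtained from \<theta> is
  only shown to respect sums, products and adjoints, and the scalars are repaired at the end by
  central projections.\<close>

lemma inner_adj: "inner (bop_apply a x) y = inner x (bop_apply (adj a) y)"
  by (simp add: Re_cinner[symmetric] cinner_adj)

lemma bop_scaleC_mult_left [simp]: "(c *\<^sub>C a) * b = c *\<^sub>C (a * b)"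
  for a b :: "'a::complex_hilbert_space bop"
  by (rule bop_eqI) (simp add: times_bop.rep_eq scaleC_bop.rep_eq)

lemma bop_scaleC_mult_right [simp]: "a * (c *\<^sub>C b) = c *\<^sub>C (a * b)"
  for a b :: "'a::complex_hilbert_space bop"
  by (rule bop_eqI) (simp add: times_bop.rep_eq scaleC_bop.rep_eq bop_apply_scaleC)

lemma bop_scaleC_scaleC [simp]: "c *\<^sub>C d *\<^sub>C a = (c * d) *\<^sub>C a"
  for a :: "'a::complex_hilbert_space bop"
  by (rule bop_eqI) (simp add: scaleC_bop.rep_eq scaleC_scaleC)

lemma bop_scaleC_add_right: "c *\<^sub>C (a + b) = c *\<^sub>C a + c *\<^sub>C b"
  for a b :: "'a::complex_hilbert_space bop"
  by (rule bop_eqI) (simp add: scaleC_bop.rep_eq plus_bop.rep_eq scaleC_add_right)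

lemma bop_scaleC_add_left: "(c + d) *\<^sub>C a = c *\<^sub>C a + d *\<^sub>C a"
  for a :: "'a::complex_hilbert_space bop"
  by (rule bop_eqI) (simp add: scaleC_bop.rep_eq plus_bop.rep_eq scaleC_add_left)

lemma bop_scaleC_one [simp]: "1 *\<^sub>C a = a" for a :: "'a::complex_hilbert_space bop"
  by (rule bop_eqI) (simp add: scaleC_bop.rep_eq scaleC_one)

lemma bop_scaleC_zero_right [simp]: "c *\<^sub>C 0 = (0 :: 'a::complex_hilbert_space bop)"
  by (rule bop_eqI) (simp add: scaleC_bop.rep_eq zero_bop.rep_eq scaleC_zero_right)

lemma bop_scaleC_zero_left [simp]: "0 *\<^sub>C a = 0" for a :: "'a::complex_hilbert_space bop"
  using bop_scaleC_add_left[of 0 0 a] by simp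

lemma bop_scaleC_minus_left: "(- c) *\<^sub>C a = - (c *\<^sub>C a)" for a :: "'a::complex_hilbert_space bop"
  using bop_scaleC_add_left[of "- c" c a] by (simp add: eq_neg_iff_add_eq_0)

lemma bop_scaleC_minus_right: "c *\<^sub>C (- a) = - (c *\<^sub>C a)" for a :: "'a::complex_hilbert_space bop"
  using bop_scaleC_add_right[of c "- a" a] by (simp add: eq_neg_iff_add_eq_0)

lemma bop_scaleC_diff_right: "c *\<^sub>C (a - b) = c *\<^sub>C a - c *\<^sub>C b"
  for a b :: "'a::complex_hilbert_space bop"
  using bop_scaleC_add_right[of c a "- b"] by (simp add: bop_scaleC_minus_right)

lemma bop_scaleC_two: "2 *\<^sub>C a = a + a" for a :: "'a::complex_hilbert_space bop"
  using bop_scaleC_add_left[of 1 1 a] by simp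

lemma bop_half_double: "(1/2) *\<^sub>C (a + a) = a" for a :: "'a::complex_hilbert_space bop"
  by (simp add: bop_scaleC_two[symmetric])

lemma bop_half_add_half: "(1/2) *\<^sub>C a + (1/2) *\<^sub>C a = a" for a :: "'a::complex_hilbert_space bop"
  by (simp add: bop_scaleC_add_left[symmetric])

lemma bop_double_eq_0 [simp]: "a + a = 0 \<longleftrightarrow> a = 0" for a :: "'a::complex_hilbert_space bop"
  by (metis bop_half_double bop_scaleC_zero_right add_0)

lemma adj_one [simp]: "adj 1 = 1"
  by (rule adj_eqI) (simp add: one_bop.rep_eq)

lemma adj_scaleC [simp]: "adj (c *\<^sub>C a) = cnj c *\<^sub>C adj a"
  by (rule adj_eqI)
    (simp add: scaleC_bop.rep_eq cinner_scaleC_left cinner_scaleC_right cinner_adj)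

lemma adj_eq_0_iff [simp]: "adj a = 0 \<longleftrightarrow> a = 0"
  by (metis adj_adj adj_zero)

lemma adj_mult_self_eq_0_iff [simp]: "adj a * a = 0 \<longleftrightarrow> a = 0"
  by (metis adj_mult_self_eq_0 mult_zero_right)

lemma mult_adj_self_eq_0_iff [simp]: "a * adj a = 0 \<longleftrightarrow> a = 0"
  using adj_mult_self_eq_0_iff[of "adj a"] by simp

text \<open>The form in which an equation \<open>x * y = z\<close> can be used inside a product
  nested to the right.\<close>

lemma mult_eq_assoc: "x * y = z \<Longrightarrow> x * (y * w) = z * w" for x :: "'a::semigroup_mult"
  by (metis mult.assoc)

lemma vN_I:
  assumes "von_neumann_algebra M" "\<And>b. b \<in> commutant M \<Longrightarrow> a * b = b * a"
  shows "a \<in> M"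
proof -
  have "a \<in> commutant (commutant M)" using assms(2) by (simp add: commutant_def)
  then show ?thesis using assms(1) by (simp add: von_neumann_algebra_def)
qed

lemma vN_comm: "a \<in> M \<Longrightarrow> b \<in> commutant M \<Longrightarrow> a * b = b * a"
  by (simp add: commutant_def)

lemma vN_adj: "von_neumann_algebra M \<Longrightarrow> a \<in> M \<Longrightarrow> adj a \<in> M"
  by (simp add: von_neumann_algebra_def)

lemma vN_mult:
  assumes "von_neumann_algebra M" "a \<in> M" "b \<in> M"
  shows "a * b \<in> M"
proof (rule vN_I[OF assms(1)])
  fix c assume "c \<in> commutant M"
  then show "a * b * c = c * (a * b)"
    using vN_comm[OF assms(2)] vN_comm[OF assms(3)] by (metis mult.assoc)
qed

lemma vN_zero: "von_neumann_algebra M \<Longrightarrow> 0 \<in> M"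
  by (rule vN_I) auto

lemma vN_one: "von_neumann_algebra M \<Longrightarrow> 1 \<in> M"
  by (rule vN_I) auto

lemma vN_scaleC: "von_neumann_algebra M \<Longrightarrow> a \<in> M \<Longrightarrow> c *\<^sub>C a \<in> M"
  by (rule vN_I) (simp_all add: vN_comm[of a M])

lemmas vN_closed = vN_add vN_diff vN_minus vN_mult vN_adj vN_zero vN_one vN_scaleC

lemma commutant_adj:
  assumes "von_neumann_algebra M" "b \<in> commutant M"
  shows "adj b \<in> commutant M"
  unfolding commutant_def
proof safe
  fix a assume "a \<in> M"
  then have "adj a * b = b * adj a" using vN_comm vN_adj assms by blast
  from arg_cong[OF this, of adj] show "adj b * a = a * adj b" by (simp add: adj_mult)
qed

section \<open>Orthogonal projections onto closed subspaces\<close>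

text \<open>A sequence minimising the distance is Cauchy by the parallelogram law, and moving the
  minimiser along \<open>s\<close> cannot decrease the distance.\<close>

lemma ex_nearest_point:
  fixes S :: "'a::{real_inner, complete_space} set"
  assumes "closed S" "subspace S"
  shows "\<exists>y\<in>S. \<forall>s\<in>S. inner (x - y) s = 0"
proof -
  define g where "g y = (norm (x - y))\<^sup>2" for y
  define m where "m = Inf (g ` S)"
  have "0 \<in> S" using assms(2) by (rule subspace_0)
  have bdd: "bdd_below (g ` S)" by (auto intro!: bdd_belowI[of _ 0] simp: g_def)
  have m_le: "m \<le> g y" if "y \<in> S" for y
    unfolding m_def by (rule cInf_lower[OF _ bdd]) (use that in simp)
  have "\<exists>y\<in>S. g y < m + inverse (real (Suc n))" for n
    using cInf_less_iff[of "g ` S" "m + inverse (real (Suc n))"] bdd \<open>0 \<in> S\<close>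
    unfolding m_def by auto
  then obtain X where X: "\<And>n. X n \<in> S" "\<And>n. g (X n) < m + inverse (real (Suc n))" by metis
  have par: "(norm (a - b))\<^sup>2 / 4 = g a / 2 + g b / 2 - g ((1/2) *\<^sub>R (a + b))" for a b
    unfolding g_def power2_norm_eq_inner
    by (simp add: inner_simps inner_commute field_simps)
  have dist: "(norm (a - b))\<^sup>2 \<le> 4 * e" if "g a < m + e" "g b < m + e" "a \<in> S" "b \<in> S" for a b e
    using par[of a b] m_le[of "(1/2) *\<^sub>R (a + b)"] that assms(2)
    by (simp add: subspace_add subspace_scale)
  have "Cauchy X"
  proof (rule metric_CauchyI)
    fix e :: real assume "0 < e"
    then obtain N where N: "inverse (real (Suc N)) < e\<^sup>2 / 4"
      using reals_Archimedean[of "e\<^sup>2 / 4"] by auto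
    have close: "g (X n) < m + inverse (real (Suc N))" if "N \<le> n" for n
    proof -
      have "inverse (real (Suc n)) \<le> inverse (real (Suc N))" using that by simp
      with X(2)[of n] show ?thesis by linarith
    qed
    have "dist (X i) (X j) < e" if "N \<le> i" "N \<le> j" for i j
    proof -
      have "(norm (X i - X j))\<^sup>2 < e\<^sup>2"
        using dist[OF close[OF that(1)] close[OF that(2)] X(1) X(1)] N by linarith
      then show ?thesis using \<open>0 < e\<close> by (simp add: dist_norm power_less_imp_less_base)
    qed
    then show "\<exists>M. \<forall>i\<ge>M. \<forall>j\<ge>M. dist (X i) (X j) < e" by blast
  qed
  then obtain y where y: "X \<longlonglongrightarrow> y" using Cauchy_convergent convergent_def by blast
  have "y \<in> S" using assms(1) X(1) y by (rule closed_sequentially)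
  have "(\<lambda>n. g (X n)) \<longlonglongrightarrow> g y"
    unfolding g_def by (intro tendsto_intros y)
  moreover have "(\<lambda>n. m + inverse (real (Suc n))) \<longlonglongrightarrow> m + 0"
    by (intro tendsto_intros LIMSEQ_inverse_real_of_nat)
  ultimately have gy: "g y \<le> m"
    using X(2) LIMSEQ_le[of "\<lambda>n. g (X n)" "g y" "\<lambda>n. m + inverse (real (Suc n))" "m + 0"]
    by (auto intro: less_imp_le)
  have "inner (x - y) s = 0" if "s \<in> S" for s
  proof (cases "s = 0")
    case False
    define d where "d = inner (x - y) s"
    \<comment> \<open>The minimiser of the quadratic in \<open>t\<close> computed below.\<close>
    define t where "t = d / (norm s)\<^sup>2"
    have ns: "(norm s)\<^sup>2 > 0" using False by simp
    have "g (y + t *\<^sub>R s) = g y + t\<^sup>2 * (norm s)\<^sup>2 - 2 * t * d"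
      unfolding g_def d_def power2_norm_eq_inner
      by (simp add: inner_simps inner_commute power2_eq_square algebra_simps)
    then have "0 \<le> t\<^sup>2 * (norm s)\<^sup>2 - 2 * t * d"
      using gy m_le[of "y + t *\<^sub>R s"] that \<open>y \<in> S\<close> assms(2)
      by (simp add: subspace_add subspace_scale)
    also have "\<dots> = - (d\<^sup>2 / (norm s)\<^sup>2)"
      using ns unfolding t_def by (simp add: field_simps power2_eq_square)
    finally have "d\<^sup>2 / (norm s)\<^sup>2 \<le> 0" by simp
    then have "d\<^sup>2 \<le> 0" using ns by (simp add: divide_le_0_iff)
    then show ?thesis unfolding d_def by simp
  qed simp
  with \<open>y \<in> S\<close> show ?thesis by blast
qed

definition csubspace :: "'a::complex_hilbert_space set \<Rightarrow> bool" where
  "csubspace S \<longleftrightarrow> 0 \<in> S \<and> (\<forall>x\<in>S. \<forall>y\<in>S. x + y \<in> S) \<and> (\<forall>c. \<forall>x\<in>S. c *\<^sub>C x \<in> S)"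

lemma csubspace_imp_subspace: "csubspace S \<Longrightarrow> subspace S"
  unfolding csubspace_def subspace_def by (metis scaleC_of_real)

text \<open>Orthogonality of \<open>x - P x\<close> to \<open>S\<close> determines
  \<open>P x\<close>; linearity follows from this uniqueness, the bound and the symmetry from the
  orthogonality.\<close>

lemma ex_subspace_projection:
  assumes "closed S" "csubspace S"
  shows "\<exists>p. adj p = p \<and> p * p = p \<and> (\<forall>x. bop_apply p x \<in> S) \<and> (\<forall>x\<in>S. bop_apply p x = x)"
proof -
  note sub = csubspace_imp_subspace[OF assms(2)]
  obtain P where P: "\<And>x. P x \<in> S" "\<And>x s. s \<in> S \<Longrightarrow> inner (x - P x) s = 0"
    using ex_nearest_point[OF assms(1) sub] by metis
  have P_eqI: "P x = y" if "y \<in> S" "\<And>s. s \<in> S \<Longrightarrow> inner (x - y) s = 0" for x y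
  proof -
    have d: "P x - y \<in> S" using sub P(1) that(1) by (rule subspace_diff)
    have "inner (P x - y) (P x - y) = inner (x - y) (P x - y) - inner (x - P x) (P x - y)"
      by (simp add: inner_simps)
    also have "\<dots> = 0" using d that(2) P(2) by simp
    finally show ?thesis by simp
  qed
  have iadd: "inner (i *\<^sub>C u) v = inner u (cnj i *\<^sub>C v)" for i :: complex and u v :: 'a
    by (simp add: Re_cinner[symmetric] cinner_scaleC_left cinner_scaleC_right)
  have add: "P (x + y) = P x + P y" for x y
  proof (rule P_eqI)
    show "P x + P y \<in> S" by (rule subspace_add[OF sub P(1) P(1)])
    fix s assume "s \<in> S"
    then show "inner (x + y - (P x + P y)) s = 0"
      using P(2)[of s x] P(2)[of s y] by (simp add: inner_simps)
  qed
  have scale: "P (c *\<^sub>C x) = c *\<^sub>C P x" for c x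
  proof (rule P_eqI)
    show "c *\<^sub>C P x \<in> S" using assms(2) P(1) by (simp add: csubspace_def)
    fix s assume "s \<in> S"
    then have "cnj c *\<^sub>C s \<in> S" using assms(2) by (simp add: csubspace_def)
    then show "inner (c *\<^sub>C x - c *\<^sub>C P x) s = 0"
      by (simp add: scaleC_diff_right[symmetric] iadd P(2))
  qed
  have bound: "norm (P x) \<le> norm x * 1" for x
  proof (cases "P x = 0")
    case False
    have "norm (P x) * norm (P x) = inner x (P x)"
      using P(2)[OF P(1), of x x]
      by (simp add: inner_diff_left power2_norm_eq_inner[symmetric] power2_eq_square)
    also have "\<dots> \<le> norm x * norm (P x)" by (rule norm_cauchy_schwarz)
    finally show ?thesis using False by simp
  qed simp
  have "bounded_linear P"
    by (rule bounded_linear_intro[OF add _ bound]) (simp only: scaleC_of_real[symmetric] scale)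
  then have ap: "bop_apply (Bop P) = P" using scale by (simp add: Bop_inverse)
  have id: "P x = x" if "x \<in> S" for x by (rule P_eqI[OF that]) simp
  have sym: "inner (P x) y = inner x (P y)" for x y
    using P(2)[OF P(1)[of y], of x] P(2)[OF P(1)[of x], of y]
    by (simp add: inner_diff_left inner_commute[of x "P y"] inner_commute[of y "P x"] inner_commute[of "P y" "P x"])
  have "adj (Bop P) = Bop P"
    by (rule adj_eqI, rule cinner_eqI) (simp add: ap sym scale[symmetric])
  moreover have "Bop P * Bop P = Bop P"
    by (rule bop_eqI) (simp add: times_bop.rep_eq ap id P(1))
  ultimately show ?thesis using ap P(1) id by metis
qed

text \<open>The range of \<open>p\<close> is the common kernel of \<open>F\<close>, expressed
  through operators \<open>b\<close> instead of vectors so that later arguments can stay inside the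
  ring.\<close>

lemma ex_kernel_projection:
  fixes F :: "'a::complex_hilbert_space bop set"
  shows "\<exists>p. adj p = p \<and> p * p = p \<and> (\<forall>T\<in>F. T * p = 0) \<and> (\<forall>b. (\<forall>T\<in>F. T * b = 0) \<longrightarrow> p * b = b)"
proof -
  define S where "S = (\<Inter>T\<in>F. {x. bop_apply T x = 0})"
  have "closed {x. bop_apply T x = 0}" for T :: "'a bop"
    by (intro closed_Collect_eq continuous_intros linear_continuous_on bounded_linear_bop_apply)
  then have "closed S" unfolding S_def by (intro closed_INT) auto
  moreover have "bop_apply T 0 = 0" for T :: "'a bop" using bop_apply_add[of T 0 0] by simp
  then have "csubspace S"
    by (auto simp: S_def csubspace_def bop_apply_add bop_apply_scaleC scaleC_zero_right)
  ultimately obtain p where p: "adj p = p" "p * p = p" "\<And>x. bop_apply p x \<in> S"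
      "\<And>x. x \<in> S \<Longrightarrow> bop_apply p x = x"
    using ex_subspace_projection by metis
  have "T * p = 0" if "T \<in> F" for T
    by (rule bop_eqI) (use p(3) that in \<open>auto simp: times_bop.rep_eq zero_bop.rep_eq S_def\<close>)
  moreover have "p * b = b" if "\<forall>T\<in>F. T * b = 0" for b
  proof (rule bop_eqI)
    fix x
    have "bop_apply T (bop_apply b x) = 0" if "T \<in> F" for T
      using \<open>\<forall>T\<in>F. T * b = 0\<close> that by (metis times_bop.rep_eq zero_bop.rep_eq)
    then show "bop_apply (p * b) x = bop_apply b x"
      by (simp add: times_bop.rep_eq p(4) S_def)
  qed
  ultimately show ?thesis using p(1,2) by blast
qed

section \<open>Operator bounds and completeness\<close>

text \<open>The operator norm of \<open>a\<close> is at most \<open>C\<close>; a relation spares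
  forming a supremum, and the sign of \<open>C\<close> is assumed where it matters.\<close>

definition bdd_by :: "'a::complex_hilbert_space bop \<Rightarrow> real \<Rightarrow> bool" where
  "bdd_by a C \<longleftrightarrow> (\<forall>x. norm (bop_apply a x) \<le> C * norm x)"

lemma bdd_byD: "bdd_by a C \<Longrightarrow> norm (bop_apply a x) \<le> C * norm x"
  by (simp add: bdd_by_def)

lemma ex_bdd_by: "\<exists>C>0. bdd_by a C"
  using bounded_linear.pos_bounded[OF bounded_linear_bop_apply[of a]]
  unfolding bdd_by_def by (metis mult.commute)

lemma bdd_by_mono: "bdd_by a C \<Longrightarrow> C \<le> D \<Longrightarrow> bdd_by a D"
  unfolding bdd_by_def by (meson mult_right_mono norm_ge_zero order_trans)

lemma bdd_by_zero [simp]: "0 \<le> C \<Longrightarrow> bdd_by 0 C"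
  by (simp add: bdd_by_def zero_bop.rep_eq)

lemma bdd_by_one: "bdd_by 1 1"
  by (simp add: bdd_by_def one_bop.rep_eq)

lemma bdd_by_add: "bdd_by a C \<Longrightarrow> bdd_by b D \<Longrightarrow> bdd_by (a + b) (C + D)"
  unfolding bdd_by_def plus_bop.rep_eq
  by (metis add_mono distrib_right norm_triangle_le)

lemma bdd_by_minus: "bdd_by a C \<Longrightarrow> bdd_by (- a) C"
  by (simp add: bdd_by_def uminus_bop.rep_eq)

lemma bdd_by_diff: "bdd_by a C \<Longrightarrow> bdd_by b D \<Longrightarrow> bdd_by (a - b) (C + D)"
  using bdd_by_add[of a C "- b" D] by (simp add: bdd_by_minus)

lemma bdd_by_mult:
  assumes "bdd_by a C" "bdd_by b D" "0 \<le> C"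
  shows "bdd_by (a * b) (C * D)"
  unfolding bdd_by_def times_bop.rep_eq
proof
  fix x
  have "norm (bop_apply a (bop_apply b x)) \<le> C * norm (bop_apply b x)"
    using assms(1) by (rule bdd_byD)
  also have "\<dots> \<le> C * (D * norm x)" by (intro mult_left_mono bdd_byD assms)
  finally show "norm (bop_apply a (bop_apply b x)) \<le> C * D * norm x" by (simp add: mult.assoc)
qed

lemma norm_scaleC: "norm (c *\<^sub>C x) = cmod c * norm x" for x :: "'a::complex_hilbert_space"
proof -
  have "complex_of_real ((norm (c *\<^sub>C x))\<^sup>2) = complex_of_real ((cmod c * norm x)\<^sup>2)"
    unfolding cinner_self[symmetric] cinner_scaleC_left cinner_scaleC_right
    by (simp add: cinner_self power_mult_distrib complex_norm_square[symmetric] ac_simps)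
  then have "(norm (c *\<^sub>C x))\<^sup>2 = (cmod c * norm x)\<^sup>2"
    by (simp only: of_real_eq_iff)
  then show ?thesis by simp
qed

lemma bdd_by_scaleC: "bdd_by a C \<Longrightarrow> bdd_by (c *\<^sub>C a) (cmod c * C)"
  by (simp add: bdd_by_def scaleC_bop.rep_eq norm_scaleC mult.assoc mult_left_mono)

lemma bdd_by_adj:
  assumes "bdd_by a C" "0 \<le> C"
  shows "bdd_by (adj a) C"
  unfolding bdd_by_def
proof
  fix y
  let ?h = "bop_apply (adj a) y"
  show "norm ?h \<le> C * norm y"
  proof (cases "?h = 0")
    case False
    have "norm ?h * norm ?h = inner (bop_apply a ?h) y"
      by (simp add: inner_adj power2_norm_eq_inner[symmetric] power2_eq_square)
    also have "\<dots> \<le> norm (bop_apply a ?h) * norm y" by (rule norm_cauchy_schwarz)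
    also have "\<dots> \<le> (C * norm ?h) * norm y" by (intro mult_right_mono bdd_byD assms) simp
    finally show ?thesis using False by (simp add: ac_simps)
  qed (use assms in simp)
qed

lemma bdd_by_arbitrarily_small:
  assumes "\<And>e. 0 < e \<Longrightarrow> bdd_by a e"
  shows "a = 0"
proof (rule bop_eqI)
  fix x
  have "norm (bop_apply a x) \<le> e" if "0 < e" for e
  proof -
    have "norm (bop_apply a x) \<le> e / (norm x + 1) * norm x"
      by (intro bdd_byD assms divide_pos_pos that) (simp add: add_nonneg_pos)
    also have "\<dots> \<le> e / (norm x + 1) * (norm x + 1)"
      using that by (intro mult_left_mono divide_nonneg_nonneg) simp_all
    also have "\<dots> = e" using add_nonneg_pos[of "norm x" 1] by simp
    finally show ?thesis .
  qed
  then have "norm (bop_apply a x) \<le> 0" by (rule field_le_epsilon) simp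
  then show "bop_apply a x = bop_apply 0 x" by (simp add: zero_bop.rep_eq)
qed

lemma bop_eq_bdd_by_limit:
  assumes "\<And>n. bdd_by a (e n)" "e \<longlonglongrightarrow> 0"
  shows "a = 0"
proof (rule bdd_by_arbitrarily_small)
  fix r :: real assume "0 < r"
  then have "\<forall>\<^sub>F n in sequentially. e n < r" using assms(2) by (simp add: order_tendstoD)
  then obtain n where "e n < r" by (auto simp: eventually_sequentially)
  then show "bdd_by a r" using assms(1)[of n] by (meson bdd_by_mono less_imp_le)
qed

text \<open>The pointwise limit keeps the rate \<open>e\<close>, because the bounds on
  \<open>X m - X n\<close> pass to the limit in \<open>m\<close>.\<close>

lemma bop_complete:
  fixes X :: "nat \<Rightarrow> 'a::complex_hilbert_space bop"
  assumes X: "\<And>n m. n \<le> m \<Longrightarrow> bdd_by (X m - X n) (e n)" and e: "e \<longlonglongrightarrow> 0"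
  shows "\<exists>T. \<forall>n. bdd_by (T - X n) (e n)"
proof -
  have close: "norm (bop_apply (X m) x - bop_apply (X n) x) \<le> e n * norm x" if "n \<le> m" for n m x
    using bdd_byD[OF X[OF that], of x] by (simp add: minus_bop.rep_eq)
  have "Cauchy (\<lambda>n. bop_apply (X n) x)" for x
  proof (rule metric_CauchyI)
    fix r :: real assume "0 < r"
    have "(\<lambda>n. e n * norm x) \<longlonglongrightarrow> 0 * norm x" by (intro tendsto_intros e)
    then have "\<forall>\<^sub>F n in sequentially. e n * norm x < r / 2"
      by (rule order_tendstoD) (use \<open>0 < r\<close> in simp)
    then obtain n where n: "e n * norm x < r / 2" by (auto simp: eventually_sequentially)
    have "dist (bop_apply (X i) x) (bop_apply (X j) x) < r" if "n \<le> i" "n \<le> j" for i j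
      using dist_triangle2[of "bop_apply (X i) x" "bop_apply (X j) x" "bop_apply (X n) x"]
        close[OF that(1), of x] close[OF that(2), of x] n by (simp add: dist_norm)
    then show "\<exists>M. \<forall>i\<ge>M. \<forall>j\<ge>M. dist (bop_apply (X i) x) (bop_apply (X j) x) < r" by blast
  qed
  then have "\<exists>y. (\<lambda>n. bop_apply (X n) x) \<longlonglongrightarrow> y" for x
    using Cauchy_convergent convergent_def by blast
  then obtain T where T: "\<And>x. (\<lambda>n. bop_apply (X n) x) \<longlonglongrightarrow> T x" by metis
  have bd: "norm (T x - bop_apply (X n) x) \<le> e n * norm x" for x n
  proof (rule LIMSEQ_le_const2)
    show "(\<lambda>m. norm (bop_apply (X m) x - bop_apply (X n) x)) \<longlonglongrightarrow> norm (T x - bop_apply (X n) x)"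
      by (intro tendsto_intros T)
    show "\<exists>N. \<forall>m\<ge>N. norm (bop_apply (X m) x - bop_apply (X n) x) \<le> e n * norm x"
      using close by blast
  qed
  have add: "T (x + y) = T x + T y" for x y
  proof -
    have "(\<lambda>n. bop_apply (X n) (x + y)) \<longlonglongrightarrow> T x + T y"
      unfolding bop_apply_add by (intro tendsto_intros T)
    then show ?thesis using T[of "x + y"] by (metis LIMSEQ_unique)
  qed
  have scale: "T (c *\<^sub>C x) = c *\<^sub>C T x" for c x
  proof -
    have "(\<lambda>n. bop_apply (X n) (c *\<^sub>C x)) \<longlonglongrightarrow> c *\<^sub>C T x"
      unfolding bop_apply_scaleC by (rule bounded_linear.tendsto[OF bounded_linear_scaleC T])
    then show ?thesis using T[of "c *\<^sub>C x"] by (metis LIMSEQ_unique)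
  qed
  obtain C where C: "bdd_by (X 0) C" using ex_bdd_by by blast
  have bound: "norm (T x) \<le> norm x * (e 0 + C)" for x
  proof -
    have "norm (T x) \<le> norm (T x - bop_apply (X 0) x) + norm (bop_apply (X 0) x)"
      using norm_triangle_ineq[of "T x - bop_apply (X 0) x" "bop_apply (X 0) x"] by simp
    also have "\<dots> \<le> e 0 * norm x + C * norm x" using bd[of x 0] bdd_byD[OF C] by (rule add_mono)
    finally show ?thesis by (simp add: algebra_simps)
  qed
  have "bounded_linear T"
    by (rule bounded_linear_intro[OF add _ bound]) (simp only: scaleC_of_real[symmetric] scale)
  then have "bop_apply (Bop T) = T" using scale by (simp add: Bop_inverse)
  then have "bdd_by (Bop T - X n) (e n)" for n by (simp add: bdd_by_def minus_bop.rep_eq bd)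
  then show ?thesis by blast
qed

text \<open>In the commutator with an element of the commutant, \<open>T\<close> may be replaced by
  \<open>T - X n\<close>, which is small.\<close>

lemma vN_closed_limit:
  assumes M: "von_neumann_algebra M" and lim: "\<And>n. bdd_by (T - X n) (e n)" "\<And>n. X n \<in> M"
    and e: "e \<longlonglongrightarrow> 0"
  shows "T \<in> M"
proof (rule vN_I[OF M])
  fix b assume b: "b \<in> commutant M"
  obtain C where C: "0 < C" "bdd_by b C" using ex_bdd_by by blast
  have "bdd_by (T * b - b * T) (C * \<bar>e n\<bar> + C * \<bar>e n\<bar>)" for n
  proof -
    have 1: "bdd_by (T - X n) \<bar>e n\<bar>" using lim(1) by (rule bdd_by_mono) simp
    have "T * b - b * T = (T - X n) * b - b * (T - X n)"
      using vN_comm[OF lim(2) b, of n] by (simp add: algebra_simps)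
    then show ?thesis
      using bdd_by_diff[OF bdd_by_mult[OF 1 C(2)] bdd_by_mult[OF C(2) 1]] C(1)
      by (simp add: mult.commute)
  qed
  moreover have "(\<lambda>n. C * \<bar>e n\<bar> + C * \<bar>e n\<bar>) \<longlonglongrightarrow> C * \<bar>0\<bar> + C * \<bar>0\<bar>"
    by (intro tendsto_intros e)
  then have "(\<lambda>n. C * \<bar>e n\<bar> + C * \<bar>e n\<bar>) \<longlonglongrightarrow> 0" by (simp only: abs_zero mult_zero_right add_0)
  ultimately have "T * b - b * T = 0" by (rule bop_eq_bdd_by_limit)
  then show "T * b = b * T" by simp
qed

section \<open>Square roots\<close>

lemma adj_mult_self_apply: "inner (bop_apply (adj a * a) x) x = (norm (bop_apply a x))\<^sup>2"
  by (simp add: times_bop.rep_eq inner_adj power2_norm_eq_inner)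

lemma bdd_by_one_if_between:
  assumes "adj x = x" "\<And>z. 0 \<le> inner (bop_apply x z) z"
    and "\<And>z. inner (bop_apply x z) z \<le> (norm z)\<^sup>2"
  shows "bdd_by x 1"
  unfolding bdd_by_def
proof
  fix z
  \<comment> \<open>\<open>x - x\<^sup>2 = x (1 - x) x + (1 - x) x (1 - x)\<close> is positive\<close>
  let ?u = "bop_apply x z" and ?v = "z - bop_apply x z"
  have sym: "inner (bop_apply x a) b = inner a (bop_apply x b)" for a b
    by (simp add: inner_adj assms(1))
  have diff: "bop_apply x (a - b) = bop_apply x a - bop_apply x b" for a b
    by (rule linear_diff[OF bounded_linear.linear[OF bounded_linear_bop_apply]])
  have "0 \<le> (inner ?u ?u - inner (bop_apply x ?u) ?u) + inner (bop_apply x ?v) ?v"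
    using assms(2)[of ?v] assms(3)[of ?u] by (simp add: power2_norm_eq_inner)
  also have "\<dots> = inner ?u z - inner ?u ?u"
    by (simp add: diff inner_diff_left inner_diff_right sym[of "bop_apply x z" z])
  also have "\<dots> \<le> (norm z)\<^sup>2 - (norm ?u)\<^sup>2"
    using assms(3)[of z] by (simp add: power2_norm_eq_inner)
  finally have "(norm ?u)\<^sup>2 \<le> (norm z)\<^sup>2" by simp
  then show "norm ?u \<le> 1 * norm z" by simp
qed

text \<open>
  The fixed point of \<open>y \<mapsto> (x + y\<^sup>2) / 2\<close> is \<open>1 - (1 - x)\<^sup>1\<^sup>/\<^sup>2\<close>; the iteration from \<open>0\<close> is
  dominated in norm by the same iteration with the scalar \<open>1\<close> in place of \<open>x\<close>.
\<close>

lemma ex_sqrt_fixpoint: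
  fixes x :: "'a::complex_hilbert_space bop"
  assumes x: "bdd_by x 1"
  shows "\<exists>y. bdd_by y 1 \<and> y + y = x + y * y \<and> (\<forall>b. b * x = x * b \<longrightarrow> b * y = y * b) \<and>
    (adj x = x \<longrightarrow> adj y = y)"
proof -
  define Y where "Y = rec_nat (0 :: 'a bop) (\<lambda>_ y. (1/2) *\<^sub>C (x + y * y))"
  define r where "r = rec_nat (0 :: real) (\<lambda>_ r. (1 + r * r) / 2)"
  have Y0: "Y 0 = 0" and YS: "Y (Suc n) = (1/2) *\<^sub>C (x + Y n * Y n)" for n
    by (simp_all add: Y_def)
  have r0: "r 0 = 0" and rS: "r (Suc n) = (1 + r n * r n) / 2" for n by (simp_all add: r_def)
  have comm: "b * Y n = Y n * b" if "b * x = x * b" for b n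
  proof (induction n)
    case (Suc n)
    have "b * (Y n * Y n) = Y n * Y n * b" using Suc by (metis mult.assoc)
    then show ?case using that by (simp add: YS distrib_left distrib_right)
  qed (simp add: Y0)
  have YY: "Y m * Y n = Y n * Y m" for m n 
    by (rule comm) (rule comm[OF refl, symmetric])
  have rpos: "0 \<le> r n \<and> r n \<le> 1" for n
  proof (induction n)
    case (Suc n)
    then have "r n * r n \<le> 1" by (intro mult_le_one) auto
    then show ?case by (simp add: rS)
  qed (simp add: r0)
  have r_mono: "r n \<le> r (Suc n)" for n
    using zero_le_square[of "1 - r n"] by (simp add: rS algebra_simps)
  have bY: "bdd_by (Y n) (r n)" for n
  proof (induction n)
    case (Suc n)
    have "bdd_by (x + Y n * Y n) (1 + r n * r n)"
      by (intro bdd_by_add bdd_by_mult Suc x) (use rpos in auto)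
    from bdd_by_scaleC[OF this, of "1/2"] show ?case by (simp add: YS rS)
  qed (simp add: Y0 r0)
  \<comment> \<open>The iterates commute, so a difference of squares factors and the scalar
    increments dominate the operator increments.\<close>
  have step: "bdd_by (Y (Suc n) - Y n) (r (Suc n) - r n)" for n
  proof (induction n)
    case 0
    show ?case using bdd_by_scaleC[OF x, of "1/2"] by (simp add: Y0 YS r0 rS)
  next
    case (Suc n)
    have "(Y (Suc n) - Y n) * (Y (Suc n) + Y n) = Y (Suc n) * Y (Suc n) - Y n * Y n"
      using YY[of "Suc n" n] by (simp add: algebra_simps)
    then have 1: "Y (Suc (Suc n)) - Y (Suc n) = (1/2) *\<^sub>C ((Y (Suc n) - Y n) * (Y (Suc n) + Y n))"
      by (simp only: YS[of "Suc n"] YS[of n] bop_scaleC_diff_right[symmetric]) (simp add: YS[symmetric])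
    have 2: "r (Suc (Suc n)) - r (Suc n) = 1/2 * ((r (Suc n) - r n) * (r (Suc n) + r n))"
      by (simp only: rS[of "Suc n"] rS[of n]) (simp add: field_simps)
    have 3: "bdd_by ((Y (Suc n) - Y n) * (Y (Suc n) + Y n)) ((r (Suc n) - r n) * (r (Suc n) + r n))"
      using Suc r_mono[of n] by (intro bdd_by_mult bdd_by_add bY) auto
    show ?case unfolding 1 2 using bdd_by_scaleC[OF 3, of "1/2"] by simp
  qed
  have diff: "bdd_by (Y (n + k) - Y n) (r (n + k) - r n)" for n k
  proof (induction k)
    case (Suc k)
    show ?case using bdd_by_add[OF step[of "n + k"] Suc] by simp
  qed simp
  obtain L where L: "r \<longlonglongrightarrow> L" "\<And>n. r n \<le> L"
    using incseq_convergent[of r 1] incseq_SucI[of r] rpos r_mono by blast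
  have L1: "L \<le> 1" using L(1) rpos by (intro LIMSEQ_le_const2) auto
  define e where "e n = L - r n" for n
  have e: "e \<longlonglongrightarrow> 0" using tendsto_diff[OF tendsto_const L(1), of L] by (simp add: e_def[abs_def])
  have e0: "0 \<le> e n" for n using L(2) by (simp add: e_def)
  have "bdd_by (Y m - Y n) (e n)" if "n \<le> m" for n m
    using diff[of n "m - n"] that L(2)[of m] by (auto intro: bdd_by_mono simp: e_def)
  then obtain y where y: "\<And>n. bdd_by (y - Y n) (e n)" using bop_complete[of Y e] e by blast
  have y1: "bdd_by y 1"
    using bdd_by_add[OF y[of 0] bY[of 0]] L1 by (auto intro: bdd_by_mono simp: e_def Y0)
  have "bdd_by (y + y - (x + y * y)) (2 * e (Suc n) + 2 * e n)" for n
  proof -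
    have "Y (Suc n) + Y (Suc n) = x + Y n * Y n" by (simp add: YS bop_half_add_half)
    then have 1: "y + y - (x + y * y) =
        ((y - Y (Suc n)) + (y - Y (Suc n))) - (y * (y - Y n) + (y - Y n) * Y n)"
      by (simp add: algebra_simps)
    have "bdd_by (((y - Y (Suc n)) + (y - Y (Suc n))) - (y * (y - Y n) + (y - Y n) * Y n))
        ((e (Suc n) + e (Suc n)) + (1 * e n + e n * 1))"
      using bdd_by_mono[OF bY] rpos e0
      by (intro bdd_by_diff bdd_by_add bdd_by_mult y y1) auto
    then show ?thesis unfolding 1 by (rule bdd_by_mono) simp
  qed
  moreover have "(\<lambda>n. 2 * e (Suc n) + 2 * e n) \<longlonglongrightarrow> 2 * 0 + 2 * 0"
    by (intro tendsto_intros e LIMSEQ_Suc)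
  ultimately have eq: "y + y = x + y * y"
    using bop_eq_bdd_by_limit[of "y + y - (x + y * y)" "\<lambda>n. 2 * e (Suc n) + 2 * e n"] by simp
  have "b * y = y * b" if b: "b * x = x * b" for b
  proof -
    obtain C where C: "0 < C" "bdd_by b C" using ex_bdd_by by blast
    have "bdd_by (b * y - y * b) (C * e n + e n * C)" for n
    proof -
      have "b * y - y * b = b * (y - Y n) - (y - Y n) * b"
        using comm[OF b, of n] by (simp add: algebra_simps)
      moreover have "bdd_by \<dots> (C * e n + e n * C)"
        using C e0 by (intro bdd_by_diff bdd_by_mult y) auto
      ultimately show ?thesis by simp
    qed
    moreover have "(\<lambda>n. C * e n + e n * C) \<longlonglongrightarrow> C * 0 + 0 * C" by (intro tendsto_intros e)
    ultimately show ?thesis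
      using bop_eq_bdd_by_limit[of "b * y - y * b" "\<lambda>n. C * e n + e n * C"] by simp
  qed
  moreover have "adj y = y" if "adj x = x"
  proof -
    have aY: "adj (Y n) = Y n" for n
      by (induction n) (simp_all add: Y0 YS adj_add adj_mult that)
    have "bdd_by (adj y - y) (e n + e n)" for n
    proof -
      have "adj y - y = adj (y - Y n) - (y - Y n)" by (simp add: adj_diff aY)
      then show ?thesis by (simp only:) (intro bdd_by_diff bdd_by_adj y e0)
    qed
    moreover have "(\<lambda>n. e n + e n) \<longlonglongrightarrow> 0 + 0" by (intro tendsto_intros e)
    ultimately show ?thesis using bop_eq_bdd_by_limit[of "adj y - y" "\<lambda>n. e n + e n"] by simp
  qed
  ultimately show ?thesis using y1 eq by blast
qed

text \<open>For \<open>x = 1 - a\<close> the fixed point equation \<open>y + y = x + y * y\<close>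
  says that \<open>1 - y\<close> squares to \<open>a\<close>. The commutation clause is what later
  places such roots in a von Neumann algebra.\<close>

lemma ex_sqrt:
  fixes a :: "'a::complex_hilbert_space bop"
  assumes a: "adj a = a" "\<And>z. 0 \<le> inner (bop_apply a z) z"
    "\<And>z. inner (bop_apply a z) z \<le> (norm z)\<^sup>2"
  shows "\<exists>b. adj b = b \<and> b * b = a \<and> (\<forall>z. 0 \<le> inner (bop_apply b z) z) \<and> bdd_by b 1 \<and>
    (\<forall>c. c * a = a * c \<longrightarrow> c * b = b * c)"
proof -
  have sa: "adj (1 - a) = 1 - a" by (simp add: adj_diff a)
  have "bdd_by (1 - a) 1"
  proof (rule bdd_by_one_if_between)
    show "0 \<le> inner (bop_apply (1 - a) z) z" for z
      using a(3)[of z]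
      by (simp add: minus_bop.rep_eq one_bop.rep_eq inner_diff_left power2_norm_eq_inner)
    show "inner (bop_apply (1 - a) z) z \<le> (norm z)\<^sup>2" for z
      using a(2)[of z]
      by (simp add: minus_bop.rep_eq one_bop.rep_eq inner_diff_left power2_norm_eq_inner)
  qed (rule sa)
  from ex_sqrt_fixpoint[OF this] obtain y where y: "bdd_by y 1" "y + y = (1 - a) + y * y"
      "\<And>b. b * (1 - a) = (1 - a) * b \<Longrightarrow> b * y = y * b" "adj y = y"
    using sa by blast
  define b where "b = 1 - y"
  have b: "adj b = b" by (simp add: b_def adj_diff y)
  have "b * b = 1 - (y + y) + y * y" by (simp add: b_def algebra_simps)
  also have "\<dots> = a" by (simp add: y(2))
  finally have bb: "b * b = a" .
  have "0 \<le> inner (bop_apply b z) z" for z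
  proof -
    have "inner (bop_apply y z) z \<le> norm (bop_apply y z) * norm z" by (rule norm_cauchy_schwarz)
    also have "\<dots> \<le> norm z * norm z" using bdd_byD[OF y(1), of z] by (intro mult_right_mono) auto
    finally show ?thesis
      by (simp add: b_def minus_bop.rep_eq one_bop.rep_eq inner_diff_left
          power2_norm_eq_inner[symmetric] power2_eq_square)
  qed
  moreover have "bdd_by b 1"
    unfolding bdd_by_def
  proof
    fix z
    have "(norm (bop_apply b z))\<^sup>2 \<le> (norm z)\<^sup>2"
      using adj_mult_self_apply[of b z] a(3)[of z] by (simp add: b bb)
    then show "norm (bop_apply b z) \<le> 1 * norm z" by simp
  qed
  moreover have "c * b = b * c" if "c * a = a * c" for c
    using y(3)[of c] that by (simp add: b_def algebra_simps)
  ultimately show ?thesis using b bb by blast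
qed

section \<open>Isometric extension\<close>

text \<open>The commutant of \<open>M\<close> commutes with \<open>a\<close>, hence with
  \<open>b\<close>; so functions of \<open>a\<close> such as square roots stay in
  \<open>M\<close>.\<close>

lemma vN_if_commutes_with_commuting:
  assumes "von_neumann_algebra M" "a \<in> M" "\<And>c. c * a = a * c \<Longrightarrow> c * b = b * c"
  shows "b \<in> M"
  by (rule vN_I[OF assms(1)]) (metis assms(2,3) vN_comm)

lemma closure_seq: "x \<in> closure D \<Longrightarrow> \<exists>X. (\<forall>n. X n \<in> D) \<and> X \<longlonglongrightarrow> x"
  for x :: "'a::metric_space"
  by (simp add: closure_sequential)

lemma csubspace_closure:
  assumes "csubspace D"
  shows "csubspace (closure D)"
  unfolding csubspace_def
proof (intro conjI ballI allI)
  show "0 \<in> closure D" using assms closure_subset by (auto simp: csubspace_def)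
next
  fix x y assume "x \<in> closure D" "y \<in> closure D"
  then obtain X Y where "\<And>n. X n \<in> D" "X \<longlonglongrightarrow> x" "\<And>n. Y n \<in> D" "Y \<longlonglongrightarrow> y"
    using closure_seq by meson
  moreover then have "\<And>n. X n + Y n \<in> D" using assms by (simp add: csubspace_def)
  ultimately show "x + y \<in> closure D" unfolding closure_sequential
    by (intro exI[of _ "\<lambda>n. X n + Y n"]) (auto intro: tendsto_add)
next
  fix c x assume "x \<in> closure D"
  then obtain X where "\<And>n. X n \<in> D" "X \<longlonglongrightarrow> x" using closure_seq by meson
  moreover then have "\<And>n. c *\<^sub>C X n \<in> D" using assms by (simp add: csubspace_def)
  ultimately show "c *\<^sub>C x \<in> closure D" unfolding closure_sequential
    by (intro exI[of _ "\<lambda>n. c *\<^sub>C X n"])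
      (auto intro: bounded_linear.tendsto[OF bounded_linear_scaleC])
qed

text \<open>An isometry is uniformly continuous, so it extends to the closure of \<open>D\<close>;
  composing with the projection onto that closure makes it zero on the complement.\<close>

lemma ex_isometric_extension_vec:
  fixes f :: "'a::complex_hilbert_space \<Rightarrow> 'a"
  assumes D: "csubspace D"
    and add: "\<And>x y. x \<in> D \<Longrightarrow> y \<in> D \<Longrightarrow> f (x + y) = f x + f y"
    and scale: "\<And>c x. x \<in> D \<Longrightarrow> f (c *\<^sub>C x) = c *\<^sub>C f x"
    and norm: "\<And>x. x \<in> D \<Longrightarrow> norm (f x) = norm x"
  shows "\<exists>T. (\<forall>x\<in>D. bop_apply T x = f x) \<and> (\<forall>z. (\<forall>x\<in>D. inner x z = 0) \<longrightarrow> bop_apply T z = 0)"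
proof -
  note sub = csubspace_imp_subspace[OF D]
  have "norm (f x - f y) = norm (x - y)" if "x \<in> D" "y \<in> D" for x y
  proof -
    have neg: "- y \<in> D" using sub that(2) by (rule subspace_neg)
    have "f (- y) = - f y" using add[OF that(2) neg] add[of 0 0] D
      by (simp add: csubspace_def eq_neg_iff_add_eq_0 add.commute)
    then have "f x - f y = f (x - y)" using add[OF that(1) neg] by simp
    then show ?thesis using norm[of "x - y"] subspace_diff[OF sub that] by simp
  qed
  then have uc: "uniformly_continuous_on D f"
    unfolding uniformly_continuous_on_def dist_norm by fastforce
  have "\<exists>g. uniformly_continuous_on (closure D) g \<and> (\<forall>x\<in>D. f x = g x)"
  proof (rule uniformly_continuous_on_extension_on_closure[OF uc])
    fix g assume "uniformly_continuous_on (closure D) g" "\<And>x. x \<in> D \<Longrightarrow> f x = g x"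
    then show "\<exists>g. uniformly_continuous_on (closure D) g \<and> (\<forall>x\<in>D. f x = g x)" by blast
  qed
  then obtain g where g: "uniformly_continuous_on (closure D) g" "\<And>x. x \<in> D \<Longrightarrow> f x = g x"
    by blast
  have lim: "(\<lambda>n. f (X n)) \<longlonglongrightarrow> g x" if "X \<longlonglongrightarrow> x" "x \<in> closure D" "\<And>n. X n \<in> D" for X x
  proof -
    have "(\<lambda>n. g (X n)) \<longlonglongrightarrow> g x"
      using uniformly_continuous_imp_continuous[OF g(1)] that subsetD[OF closure_subset, of _ D]
      by (intro continuous_on_tendsto_compose[of "closure D" g] always_eventually allI) auto
    then show ?thesis using g(2) that(3) by simp
  qed
  note D' = csubspace_closure[OF D]
  obtain p where p: "adj p = p" "p * p = p" "\<And>x. bop_apply p x \<in> closure D"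
      "\<And>x. x \<in> closure D \<Longrightarrow> bop_apply p x = x"
    using ex_subspace_projection[OF closed_closure D'] by metis
  have gadd: "g (x + y) = g x + g y" if xy: "x \<in> closure D" "y \<in> closure D" for x y
  proof -
    obtain X Y where *: "\<And>n. X n \<in> D" "X \<longlonglongrightarrow> x" "\<And>n. Y n \<in> D" "Y \<longlonglongrightarrow> y"
      using closure_seq xy by meson
    have "(\<lambda>n. f (X n + Y n)) \<longlonglongrightarrow> g (x + y)"
      by (intro lim tendsto_add *) (use D' D xy * in \<open>auto simp: csubspace_def\<close>)
    moreover have "(\<lambda>n. f (X n + Y n)) \<longlonglongrightarrow> g x + g y"
      by (simp add: add *) (intro tendsto_add lim * xy)
    ultimately show ?thesis by (rule LIMSEQ_unique)
  qed
  have gscale: "g (c *\<^sub>C x) = c *\<^sub>C g x" if x: "x \<in> closure D" for c x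
  proof -
    obtain X where *: "\<And>n. X n \<in> D" "X \<longlonglongrightarrow> x" using closure_seq x by meson
    have "(\<lambda>n. f (c *\<^sub>C X n)) \<longlonglongrightarrow> g (c *\<^sub>C x)"
      by (intro lim bounded_linear.tendsto[OF bounded_linear_scaleC] *)
        (use D' D x * in \<open>auto simp: csubspace_def\<close>)
    moreover have "(\<lambda>n. f (c *\<^sub>C X n)) \<longlonglongrightarrow> c *\<^sub>C g x"
      by (simp add: scale *) (intro bounded_linear.tendsto[OF bounded_linear_scaleC] lim * x)
    ultimately show ?thesis by (rule LIMSEQ_unique)
  qed
  have gnorm: "norm (g x) = norm x" if x: "x \<in> closure D" for x
  proof -
    obtain X where *: "\<And>n. X n \<in> D" "X \<longlonglongrightarrow> x" using closure_seq x by meson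
    have "(\<lambda>n. norm (f (X n))) \<longlonglongrightarrow> norm (g x)" by (intro tendsto_norm lim * x)
    moreover have "(\<lambda>n. norm (f (X n))) \<longlonglongrightarrow> norm x" by (simp add: norm *) (intro tendsto_norm *)
    ultimately show ?thesis by (rule LIMSEQ_unique)
  qed
  define h where "h x = g (bop_apply p x)" for x
  obtain C where C: "\<And>x. norm (bop_apply p x) \<le> C * norm x" using ex_bdd_by bdd_byD by metis
  have h_add: "h (x + y) = h x + h y" for x y by (simp add: h_def bop_apply_add gadd p)
  have h_scale: "h (c *\<^sub>C x) = c *\<^sub>C h x" for c x by (simp add: h_def bop_apply_scaleC gscale p)
  have h_bd: "norm (h x) \<le> norm x * C" for x using C[of x] by (simp add: h_def gnorm p mult.commute)
  have "bounded_linear h"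
    by (rule bounded_linear_intro[OF h_add _ h_bd]) (simp only: scaleC_of_real[symmetric] h_scale)
  then have ap: "bop_apply (Bop h) = h" using h_scale by (simp add: Bop_inverse)
  have "bop_apply (Bop h) z = 0" if z: "\<forall>x\<in>D. inner x z = 0" for z
  proof -
    have "inner x z = 0" if x: "x \<in> closure D" for x
    proof -
      obtain X where *: "\<And>n. X n \<in> D" "X \<longlonglongrightarrow> x" using closure_seq x by meson
      have "(\<lambda>n. inner (X n) z) \<longlonglongrightarrow> inner x z" by (intro tendsto_intros *)
      then show ?thesis using z *(1) by (simp add: LIMSEQ_const_iff)
    qed
    then have "inner (bop_apply p z) z = 0" using p(3) by blast
    moreover have "inner (bop_apply p z) (bop_apply p z) = inner (bop_apply p z) z"
      using inner_adj[of p "bop_apply p z" z] p(1,2) by (metis times_bop.rep_eq)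
    ultimately have "bop_apply p z = 0" by simp
    moreover have "g 0 = 0" using gnorm[of 0] D' by (simp add: csubspace_def)
    ultimately show ?thesis by (simp add: ap h_def)
  qed
  moreover have "bop_apply (Bop h) x = f x" if "x \<in> D" for x
    using that closure_subset[of D] p(4)[of x] g(2)[of x] by (auto simp: ap h_def)
  ultimately show ?thesis by blast
qed

text \<open>Equal Gram operators \<open>adj A' * A\<close> make the assignment of \<open>B h\<close>
  to \<open>A h\<close> well defined and isometric on the span of all ranges. Polar decomposition,
  sums of centrally orthogonal partial isometries and the operators implementing unitaries are all
  instances.\<close>

lemma ex_isometric_extension:
  fixes S :: "('a::complex_hilbert_space bop \<times> 'a bop) set"
  assumes S: "\<And>A B A' B'. (A, B) \<in> S \<Longrightarrow> (A', B') \<in> S \<Longrightarrow> adj A' * A = adj B' * B"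
  shows "\<exists>T. (\<forall>(A, B)\<in>S. T * A = B) \<and> (\<forall>b. (\<forall>(A, B)\<in>S. adj A * b = 0) \<longrightarrow> T * b = 0)"
proof -
  \<comment> \<open>A list names a vector of the span together with a representation of it;
    \<open>sa\<close> and \<open>sb\<close> evaluate the same list on the two sides.\<close>
  define sa where "sa xs = sum_list (map (\<lambda>((A, B), h). bop_apply A h) xs)"
    for xs :: "(('a bop \<times> 'a bop) \<times> 'a) list"
  define sb where "sb xs = sum_list (map (\<lambda>((A, B), h). bop_apply B h) xs)"
    for xs :: "(('a bop \<times> 'a bop) \<times> 'a) list"
  let ?ok = "\<lambda>xs. fst ` set xs \<subseteq> S"
  have inn: "inner (bop_apply A h) (bop_apply A' k) = inner (bop_apply B h) (bop_apply B' k)"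
    if "(A, B) \<in> S" "(A', B') \<in> S" for A B A' B' h k
  proof -
    have "inner (bop_apply A h) (bop_apply A' k) = inner (bop_apply (adj A' * A) h) k"
      by (simp add: times_bop.rep_eq inner_adj)
    also have "\<dots> = inner (bop_apply B h) (bop_apply B' k)"
      by (simp add: S[OF that] times_bop.rep_eq inner_adj)
    finally show ?thesis .
  qed
  have inn1: "inner (bop_apply A h) (sa ys) = inner (bop_apply B h) (sb ys)"
    if "(A, B) \<in> S" "?ok ys" for A B h ys
    using that by (induction ys) (auto simp: sa_def sb_def inner_add_right inn)
  have inn2: "inner (sa xs) (sa ys) = inner (sb xs) (sb ys)" if "?ok xs" "?ok ys" for xs ys
    using that(1) by (induction xs)
      (auto simp: inner_add_left inn1 that(2) sa_def[of "_ # _"] sb_def[of "_ # _"]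
        sa_def[symmetric] sb_def[symmetric] sa_def[of "[]"] sb_def[of "[]"])
  have nrm: "norm (sa xs - sa ys) = norm (sb xs - sb ys)" if "?ok xs" "?ok ys" for xs ys
    unfolding norm_eq_sqrt_inner
    using inn2[OF that(1) that(1)] inn2[OF that(1) that(2)] inn2[OF that(2) that(2)]
      inn2[OF that(2) that(1)] by (simp add: inner_diff_left inner_diff_right)
  define D where "D = sa ` {xs. ?ok xs}"
  define f where "f x = sb (SOME xs. ?ok xs \<and> sa xs = x)" for x
  have f: "f (sa xs) = sb xs" if "?ok xs" for xs
  proof -
    have "?ok (SOME ys. ?ok ys \<and> sa ys = sa xs) \<and> sa (SOME ys. ?ok ys \<and> sa ys = sa xs) = sa xs"
      by (rule someI[of _ xs]) (use that in simp)
    then show ?thesis unfolding f_def using nrm[OF _ that] by fastforce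
  qed
  have sa_app: "sa (xs @ ys) = sa xs + sa ys" and sb_app: "sb (xs @ ys) = sb xs + sb ys" for xs ys
    by (simp_all add: sa_def sb_def)
  define sc where "sc c xs = map (\<lambda>(AB, h). (AB, c *\<^sub>C h)) xs"
    for c and xs :: "(('a bop \<times> 'a bop) \<times> 'a) list"
  have sc: "sa (sc c xs) = c *\<^sub>C sa xs" "sb (sc c xs) = c *\<^sub>C sb xs" "fst ` set (sc c xs) = fst ` set xs"
    for c xs
    by (induction xs)
      (auto simp: sa_def sb_def sc_def scaleC_zero_right scaleC_add_right bop_apply_scaleC)
  have "csubspace D" unfolding csubspace_def
  proof (intro conjI ballI allI)
    have "sa [] \<in> D" unfolding D_def by (rule imageI) simp
    then show "0 \<in> D" by (simp add: sa_def)
  next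
    fix x y assume "x \<in> D" "y \<in> D"
    from \<open>x \<in> D\<close> obtain xs where "?ok xs" "x = sa xs" by (auto simp: D_def)
    moreover from \<open>y \<in> D\<close> obtain ys where "?ok ys" "y = sa ys" by (auto simp: D_def)
    ultimately have "?ok (xs @ ys)" "x + y = sa (xs @ ys)" by (auto simp: sa_app)
    then show "x + y \<in> D" unfolding D_def by blast
  next
    fix c x assume "x \<in> D"
    then obtain xs where "?ok xs" "x = sa xs" by (auto simp: D_def)
    then have "?ok (sc c xs)" "c *\<^sub>C x = sa (sc c xs)" by (simp_all add: sc)
    then show "c *\<^sub>C x \<in> D" unfolding D_def by blast
  qed
  moreover have "f (x + y) = f x + f y" if "x \<in> D" "y \<in> D" for x y
  proof -
    from that(1) obtain xs where 1: "?ok xs" "x = sa xs" by (auto simp: D_def)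
    from that(2) obtain ys where 2: "?ok ys" "y = sa ys" by (auto simp: D_def)
    note * = 1 2
    then have "f (sa (xs @ ys)) = sb (xs @ ys)" by (intro f) auto
    with * show ?thesis by (simp add: f sa_app sb_app)
  qed
  moreover have "f (c *\<^sub>C x) = c *\<^sub>C f x" if "x \<in> D" for c x
  proof -
    from that obtain xs where *: "?ok xs" "x = sa xs" by (auto simp: D_def)
    then have "f (sa (sc c xs)) = sb (sc c xs)" by (intro f) (simp add: sc)
    with * show ?thesis by (simp add: f sc)
  qed
  moreover have "norm (f x) = norm x" if "x \<in> D" for x
  proof -
    from that obtain xs where *: "?ok xs" "x = sa xs" by (auto simp: D_def)
    then show ?thesis using nrm[of xs "[]"] f[of xs] by (simp add: sa_def[of "[]"] sb_def[of "[]"])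
  qed
  ultimately obtain T where T: "\<And>x. x \<in> D \<Longrightarrow> bop_apply T x = f x"
      "\<And>z. \<forall>x\<in>D. inner x z = 0 \<Longrightarrow> bop_apply T z = 0"
    using ex_isometric_extension_vec[of D f] by blast
  have "T * A = B" if "(A, B) \<in> S" for A B
  proof (rule bop_eqI)
    fix h :: 'a
    have ok: "?ok [((A, B), h)]" using that by simp
    have "sa [((A, B), h)] \<in> D" unfolding D_def using ok by blast
    then have "bop_apply T (sa [((A, B), h)]) = sb [((A, B), h)]" using T(1) f[OF ok] by simp
    then show "bop_apply (T * A) h = bop_apply B h" by (simp add: times_bop.rep_eq sa_def sb_def)
  qed
  moreover have "T * b = 0" if b: "\<forall>(A, B)\<in>S. adj A * b = 0" for b
  proof (rule bop_eqI)
    fix h :: 'a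
    have "inner (sa xs) (bop_apply b h) = 0" if "?ok xs" for xs
      using that
    proof (induction xs)
      case (Cons x xs)
      obtain A B k where x: "x = ((A, B), k)" by (metis surj_pair)
      then have "adj A * b = 0" using b Cons(2) by auto
      then have "inner (bop_apply A k) (bop_apply b h) = 0"
        by (metis inner_adj inner_zero_right times_bop.rep_eq zero_bop.rep_eq)
      then show ?case using Cons by (simp add: sa_def x inner_add_left)
    qed (simp add: sa_def)
    then have "bop_apply T (bop_apply b h) = 0" by (intro T(2)) (auto simp: D_def)
    then show "bop_apply (T * b) h = bop_apply 0 h" by (simp add: times_bop.rep_eq zero_bop.rep_eq)
  qed
  ultimately show ?thesis by blast
qed

section \<open>Projections, polar decomposition and unitaries\<close>

lemma mult_zero_adj: "a * b = 0 \<Longrightarrow> adj b * adj a = 0"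
  by (metis adj_mult adj_zero)

definition projs :: "'a::complex_hilbert_space bop set \<Rightarrow> 'a bop set" where
  "projs M = {p\<in>M. adj p = p \<and> p * p = p}"

lemma projsD:
  assumes "p \<in> projs M"
  shows "p \<in> M" "adj p = p" "p * p = p" "p * (p * x) = p * x"
  using assms by (auto simp: projs_def mult_eq_assoc)

lemma projs_one: "von_neumann_algebra M \<Longrightarrow> 1 \<in> projs M"
  by (simp add: projs_def vN_one)

lemma projs_zero: "von_neumann_algebra M \<Longrightarrow> 0 \<in> projs M"
  by (simp add: projs_def vN_zero)

lemma projs_compl: "von_neumann_algebra M \<Longrightarrow> p \<in> projs M \<Longrightarrow> 1 - p \<in> projs M"
  by (auto simp: projs_def adj_diff algebra_simps intro: vN_closed)

lemma proj_comm_zero: "p \<in> projs M \<Longrightarrow> q \<in> projs M \<Longrightarrow> p * q = 0 \<Longrightarrow> q * p = 0"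
  using mult_zero_adj[of p q] by (simp add: projsD)

lemma proj_comm_le: "p \<in> projs M \<Longrightarrow> q \<in> projs M \<Longrightarrow> p * q = p \<longleftrightarrow> q * p = p"
  by (metis adj_mult projsD(2))

lemma projs_add:
  assumes "von_neumann_algebra M" "p \<in> projs M" "q \<in> projs M" "p * q = 0"
  shows "p + q \<in> projs M"
  using assms proj_comm_zero[OF assms(2-4)]
  by (auto simp: projs_def adj_add algebra_simps intro: vN_add)

lemma projs_diff:
  assumes "von_neumann_algebra M" "p \<in> projs M" "q \<in> projs M" "q * p = q"
  shows "p - q \<in> projs M"
  using assms proj_comm_le[OF assms(3,2)]
  by (auto simp: projs_def adj_diff algebra_simps intro: vN_diff)

lemma projs_tripotent_right:
  "von_neumann_algebra M \<Longrightarrow> v \<in> M \<Longrightarrow> v * adj v * v = v \<Longrightarrow> adj v * v \<in> projs M"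
  by (simp add: projs_def adj_mult vN_closed) (metis mult.assoc)

lemma projs_tripotent_left:
  "von_neumann_algebra M \<Longrightarrow> v \<in> M \<Longrightarrow> v * adj v * v = v \<Longrightarrow> v * adj v \<in> projs M"
  by (simp add: projs_def adj_mult vN_closed) (metis mult.assoc)

lemma adj_tripotent: "v * adj v * v = v \<Longrightarrow> adj v * v * adj v = adj v"
  by (metis adj_adj adj_mult mult.assoc)

text \<open>The commutant, which is closed under adjoints, leaves the common kernel invariant, so
  the projection commutes with it.\<close>

lemma ex_kernel_projection_vN:
  assumes M: "von_neumann_algebra M" and F: "F \<subseteq> M"
  shows "\<exists>p\<in>projs M. (\<forall>T\<in>F. T * p = 0) \<and> (\<forall>b. (\<forall>T\<in>F. T * b = 0) \<longrightarrow> p * b = b)"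
proof -
  obtain p where p: "adj p = p" "p * p = p" "\<And>T. T \<in> F \<Longrightarrow> T * p = 0"
      "\<And>b. \<forall>T\<in>F. T * b = 0 \<Longrightarrow> p * b = b"
    using ex_kernel_projection by metis
  have inv: "p * (c * p) = c * p" if "c \<in> commutant M" for c
  proof (rule p(4), safe)
    fix T assume "T \<in> F"
    then have "T * c = c * T" using F that vN_comm by blast
    then show "T * (c * p) = 0" using p(3)[OF \<open>T \<in> F\<close>] by (metis mult.assoc mult_zero_right)
  qed
  have "p \<in> M"
  proof (rule vN_I[OF M])
    fix c assume c: "c \<in> commutant M"
    have "p * c * p = p * c"
      using arg_cong[OF inv[OF commutant_adj[OF M c]], of adj] by (simp add: adj_mult p)
    then show "p * c = c * p" using inv[OF c] by (simp add: mult.assoc)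
  qed
  then show ?thesis using p unfolding projs_def by blast
qed

text \<open>The range projection of \<open>T\<close>: the kernel of \<open>adj T\<close> is the
  orthogonal complement of the closed range.\<close>

definition rp :: "'a::complex_hilbert_space bop \<Rightarrow> 'a bop" where
  "rp T = 1 - (SOME p. adj p = p \<and> p * p = p \<and> adj T * p = 0 \<and> (\<forall>b. adj T * b = 0 \<longrightarrow> p * b = b))"

lemma rp:
  shows adj_rp: "adj (rp T) = rp T" and rp_idem: "rp T * rp T = rp T" and rp_mult: "rp T * T = T"
    and rp_least: "\<And>b. b * T = 0 \<Longrightarrow> b * rp T = 0"
proof -
  define p where "p = (SOME p. adj p = p \<and> p * p = p \<and> adj T * p = 0 \<and> (\<forall>b. adj T * b = 0 \<longrightarrow> p * b = b))"
  have p: "adj p = p \<and> p * p = p \<and> adj T * p = 0 \<and> (\<forall>b. adj T * b = 0 \<longrightarrow> p * b = b)"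
    unfolding p_def by (rule someI_ex) (use ex_kernel_projection[of "{adj T}"] in simp)
  have r: "rp T = 1 - p" by (simp add: rp_def p_def)
  show "adj (rp T) = rp T" "rp T * rp T = rp T" using p by (simp_all add: r adj_diff algebra_simps)
  have "p * T = 0" using p mult_zero_adj[of "adj T" p] by simp
  then show "rp T * T = T" by (simp add: r algebra_simps)
  fix b assume "b * T = 0"
  then have "adj T * adj b = 0" by (simp add: adj_mult[symmetric])
  then have "p * adj b = adj b" using p by blast
  from arg_cong[OF this, of adj] have "b * p = b" by (simp add: adj_mult p)
  then show "b * rp T = 0" by (simp add: r algebra_simps)
qed

lemma rp_eqI:
  assumes "adj r = r" "r * T = T" "\<And>b. b * T = 0 \<Longrightarrow> b * r = 0"
  shows "rp T = r"
proof -
  have "(1 - r) * rp T = 0" by (rule rp_least) (simp add: algebra_simps assms)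
  then have 1: "r * rp T = rp T" by (simp add: algebra_simps)
  have "(1 - rp T) * r = 0" by (rule assms(3)) (simp add: algebra_simps rp_mult)
  then have "rp T * r = r" by (simp add: algebra_simps)
  from arg_cong[OF this, of adj] have "r * rp T = r" by (simp add: adj_mult assms adj_rp)
  with 1 show ?thesis by simp
qed

text \<open>The projection is chosen among all operators; uniqueness identifies it with the
  complement of a kernel projection found in \<open>M\<close>.\<close>

lemma rp_projs:
  assumes M: "von_neumann_algebra M" and T: "T \<in> M"
  shows "rp T \<in> projs M"
proof -
  obtain p where p: "p \<in> projs M" "adj T * p = 0" "\<And>b. adj T * b = 0 \<Longrightarrow> p * b = b"
    using ex_kernel_projection_vN[OF M, of "{adj T}"] vN_adj[OF M T] by auto
  have "rp T = 1 - p"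
  proof (rule rp_eqI)
    show "adj (1 - p) = 1 - p" using p(1) by (simp add: adj_diff projsD)
    have "p * T = 0" using p mult_zero_adj[of "adj T" p] by (simp add: projsD)
    then show "(1 - p) * T = T" by (simp add: algebra_simps)
    fix b assume "b * T = 0"
    then have "adj T * adj b = 0" by (simp add: adj_mult[symmetric])
    from arg_cong[OF p(3)[OF this], of adj] have "b * p = b" by (simp add: adj_mult projsD[OF p(1)])
    then show "b * (1 - p) = 0" by (simp add: algebra_simps)
  qed
  then show ?thesis using projs_compl[OF M p(1)] by simp
qed

lemma rp_eq_0_iff: "rp T = 0 \<longleftrightarrow> T = 0"
  by (metis mult_zero_left mult_1_left rp_least rp_mult)

lemma rp_least_left: "adj T * b = 0 \<Longrightarrow> rp T * b = 0"
proof -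
  assume "adj T * b = 0"
  then have "adj b * T = 0" using mult_zero_adj[of "adj T" b] by simp
  from arg_cong[OF rp_least[OF this], of adj] show ?thesis by (simp add: adj_mult adj_rp)
qed

lemma rp_orth:
  assumes "adj S * T = 0"
  shows "rp S * rp T = 0"
  by (rule rp_least, rule rp_least_left, rule assms)

lemma rp_le:
  assumes "p * T = T" shows "p * rp T = rp T"
proof -
  have "(1 - p) * rp T = 0" by (rule rp_least) (simp add: algebra_simps assms)
  then show ?thesis by (simp add: algebra_simps)
qed

text \<open>\<open>Z\<close> projects onto the closed span of the ranges of \<open>m * E\<close>.
  Its complement is the common kernel of all \<open>E * m\<close>; these operators are stable under
  right multiplication by \<open>M\<close>, which makes the complement central.\<close>

lemma ex_central_support:
  assumes M: "von_neumann_algebra M" and E: "E \<in> projs M"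
  shows "\<exists>Z\<in>projs M. (\<forall>m\<in>M. Z * m = m * Z) \<and> Z * E = E \<and>
    (\<forall>b. (\<forall>m\<in>M. b * m * E = 0) \<longrightarrow> b * Z = 0)"
proof -
  note E' = projsD[OF E]
  have "(\<lambda>m. E * m) ` M \<subseteq> M" using vN_mult[OF M E'(1)] by auto
  then obtain p where p: "p \<in> projs M" "\<And>m. m \<in> M \<Longrightarrow> E * m * p = 0"
      "\<And>b. (\<And>m. m \<in> M \<Longrightarrow> E * m * b = 0) \<Longrightarrow> p * b = b"
    using ex_kernel_projection_vN[OF M, of "(\<lambda>m. E * m) ` M"] by auto
  note p' = projsD[OF p(1)]
  have inv: "p * (m * p) = m * p" if "m \<in> M" for m
    by (rule p(3)) (use p(2)[OF vN_mult[OF M _ that]] in \<open>simp add: mult.assoc\<close>)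
  have comm: "p * m = m * p" if "m \<in> M" for m
    using arg_cong[OF inv[OF vN_adj[OF M that]], of adj] inv[OF that]
    by (simp add: adj_mult p' mult.assoc)
  have "E * p = 0" using p(2)[OF vN_one[OF M]] by simp
  then have "p * E = 0" by (rule proj_comm_zero[OF E p(1)])
  then have "(1 - p) * E = E" by (simp add: algebra_simps)
  moreover have "b * (1 - p) = 0" if b: "\<forall>m\<in>M. b * m * E = 0" for b
  proof -
    have "E * m * adj b = 0" if "m \<in> M" for m
    proof -
      have "b * adj m * E = 0" using b vN_adj[OF M that] by blast
      from arg_cong[OF this, of adj] show ?thesis by (simp add: adj_mult E' mult.assoc)
    qed
    then have "p * adj b = adj b" by (rule p(3))
    from arg_cong[OF this, of adj] have "b * p = b" by (simp add: adj_mult p')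
    then show ?thesis by (simp add: algebra_simps)
  qed
  ultimately show ?thesis using projs_compl[OF M p(1)] comm
    by (intro bexI[of _ "1 - p"]) (auto simp: algebra_simps)
qed

text \<open>\<open>T\<close> is isometric on the span of the ranges of the \<open>A\<close> and zero
  on its complement, hence a partial isometry. It lies in \<open>M\<close> because an element of the
  commutant commutes with all pairs and so respects this description.\<close>

lemma ex_tripotent_extension:
  assumes M: "von_neumann_algebra M" and SM: "S \<subseteq> M \<times> M"
    and S: "\<And>A B A' B'. (A, B) \<in> S \<Longrightarrow> (A', B') \<in> S \<Longrightarrow> adj A' * A = adj B' * B"
  shows "\<exists>T\<in>M. T * adj T * T = T \<and> (\<forall>(A, B)\<in>S. T * A = B \<and> adj T * T * A = A) \<and>
    (\<forall>b. (\<forall>(A, B)\<in>S. adj A * b = 0) \<longrightarrow> T * b = 0) \<and>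
    (\<forall>b. (\<forall>(A, B)\<in>S. b * B = 0) \<longrightarrow> b * T = 0)"
proof -
  from ex_isometric_extension[of S, OF S] obtain T
    where T: "\<forall>(A, B)\<in>S. T * A = B" "\<forall>b. (\<forall>(A, B)\<in>S. adj A * b = 0) \<longrightarrow> T * b = 0"
    by blast
  have TA: "T * A = B" if "(A, B) \<in> S" for A B using T(1) that by auto
  have T0: "T * b = 0" if "\<And>A B. (A, B) \<in> S \<Longrightarrow> adj A * b = 0" for b using T(2) that by blast
  have PA: "adj T * T * A = A" if AB: "(A, B) \<in> S" for A B
  proof -
    define X where "X = adj T * T * A - A"
    have "adj A' * X = 0" if "(A', B') \<in> S" for A' B'
    proof -
      have "adj A' * (adj T * T * A) = adj (T * A') * (T * A)" by (simp add: adj_mult mult.assoc)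
      then show ?thesis by (simp add: X_def right_diff_distrib TA[OF AB] TA[OF that] S[OF AB that])
    qed
    then have 1: "T * X = 0" "adj A * X = 0" using T0 AB by blast+
    have "adj X * X = adj A * adj T * (T * X) - adj A * X"
      by (simp add: X_def[of] adj_diff adj_mult left_diff_distrib mult.assoc)
    then have "adj X * X = 0" using 1 by simp
    then show ?thesis by (simp add: X_def)
  qed
  have adjA: "adj A * (adj T * T) = adj A" if "(A, B) \<in> S" for A B
    using arg_cong[OF PA[OF that], of adj] by (simp add: adj_mult mult.assoc)
  have "T * (1 - adj T * T) = 0"
    by (rule T0) (simp add: right_diff_distrib adjA)
  then have trip: "T * adj T * T = T" by (simp add: right_diff_distrib mult.assoc)
  have "T \<in> M"
  proof (rule vN_I[OF M])
    fix c assume c: "c \<in> commutant M"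
    define X where "X = c * T - T * c"
    have XA: "X * A = 0" if "(A, B) \<in> S" for A B
    proof -
      have "A * c = c * A" "B * c = c * B" using SM that c vN_comm by blast+
      then have "X * A = c * (T * A) - (T * A) * c"
        by (simp add: X_def left_diff_distrib mult.assoc)
      then show ?thesis using TA[OF that] \<open>B * c = c * B\<close> by simp
    qed
    have "T * adj X = 0"
      by (rule T0) (rule mult_zero_adj, rule XA)
    then have "X * adj T = 0" using mult_zero_adj[of T "adj X"] by simp
    then have 1: "X * (adj T * T) = 0" by (simp add: mult.assoc[symmetric])
    have "T * (c * (1 - adj T * T)) = 0"
    proof (rule T0)
      fix A B assume AB: "(A, B) \<in> S"
      have "adj A * c = c * adj A" using SM AB c vN_comm[OF vN_adj[OF M]] by blast
      then have "adj A * (c * (1 - adj T * T)) = c * (adj A * (1 - adj T * T))"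
        by (simp add: mult.assoc[symmetric])
      then show "adj A * (c * (1 - adj T * T)) = 0" using adjA[OF AB] by (simp add: right_diff_distrib)
    qed
    then have "X * (1 - adj T * T) = c * (T * (1 - adj T * T))"
      by (simp add: X_def left_diff_distrib mult.assoc)
    then have "X * (1 - adj T * T) = 0" using \<open>T * (1 - adj T * T) = 0\<close> by simp
    with 1 have "X = 0" by (simp add: right_diff_distrib)
    then show "T * c = c * T" by (simp add: X_def)
  qed
  moreover have "b * T = 0" if b: "\<forall>(A, B)\<in>S. b * B = 0" for b
  proof -
    have "T * adj (b * T) = 0"
    proof (rule T0)
      fix A B assume AB: "(A, B) \<in> S"
      have "b * T * A = 0" using TA[OF AB] b AB by (auto simp: mult.assoc)
      from arg_cong[OF this, of adj] show "adj A * adj (b * T) = 0" by (simp add: adj_mult)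
    qed
    then have "b * T * adj (b * T) = 0" by (simp add: mult.assoc)
    then show ?thesis by simp
  qed
  moreover have "\<forall>(A, B)\<in>S. T * A = B \<and> adj T * T * A = A" using TA PA by auto
  ultimately show ?thesis using trip T(2) by blast
qed

text \<open>The modulus \<open>c\<close> and \<open>T\<close> itself have the same Gram operator.
  The annihilator clauses say that \<open>v\<close> and \<open>T\<close> share their kernel and
  their closed range.\<close>

lemma polar_decomposition:
  assumes M: "von_neumann_algebra M" and T: "T \<in> M" and T1: "bdd_by T 1"
  shows "\<exists>v\<in>M. \<exists>c\<in>M. adj c = c \<and> bdd_by c 1 \<and> v * adj v * v = v \<and> v * c = T \<and>
    (\<forall>b. T * b = 0 \<longleftrightarrow> v * b = 0) \<and> (\<forall>b. b * T = 0 \<longleftrightarrow> b * v = 0) \<and>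
    (\<forall>b. b * (adj T * T) = adj T * T * b \<longrightarrow> b * c = c * b)"
proof -
  have "inner (bop_apply (adj T * T) z) z \<le> (norm z)\<^sup>2" for z
    unfolding adj_mult_self_apply using bdd_byD[OF T1, of z] by (simp add: power_mono)
  moreover have "0 \<le> inner (bop_apply (adj T * T) z) z" for z unfolding adj_mult_self_apply by simp
  moreover have "adj (adj T * T) = adj T * T" by (simp add: adj_mult)
  ultimately obtain c where c: "adj c = c" "c * c = adj T * T" "bdd_by c 1"
      "\<And>b. b * (adj T * T) = adj T * T * b \<Longrightarrow> b * c = c * b"
    using ex_sqrt[of "adj T * T"] by blast
  have cM: "c \<in> M"
    by (rule vN_if_commutes_with_commuting[OF M _ c(4)]) (auto intro: vN_closed M T)
  have "\<exists>v\<in>M. v * adj v * v = v \<and> (\<forall>(A, B)\<in>{(c, T)}. v * A = B \<and> adj v * v * A = A) \<and>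
      (\<forall>b. (\<forall>(A, B)\<in>{(c, T)}. adj A * b = 0) \<longrightarrow> v * b = 0) \<and>
      (\<forall>b. (\<forall>(A, B)\<in>{(c, T)}. b * B = 0) \<longrightarrow> b * v = 0)"
    by (rule ex_tripotent_extension[OF M]) (use T cM c(1,2) in simp_all)
  then obtain v where v: "v \<in> M" "v * adj v * v = v" "v * c = T" "adj v * v * c = c"
      "\<And>b. c * b = 0 \<Longrightarrow> v * b = 0" "\<And>b. b * T = 0 \<Longrightarrow> b * v = 0"
    by (simp add: c(1)) blast
  have Tc: "T * b = 0 \<longleftrightarrow> c * b = 0" for b
  proof
    assume "T * b = 0"
    have "adj (c * b) * (c * b) = adj b * (c * c) * b" by (simp add: adj_mult c(1) mult.assoc)
    also have "\<dots> = adj b * adj T * (T * b)" by (simp add: c(2) mult.assoc)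
    finally have "adj (c * b) * (c * b) = 0" using \<open>T * b = 0\<close> by simp
    then show "c * b = 0" by simp
  next
    assume "c * b = 0"
    then show "T * b = 0" by (metis mult.assoc mult_zero_right v(3))
  qed
  have cv: "c * (adj v * v) = c"
    using arg_cong[OF v(4), of adj] by (simp add: adj_mult c(1) mult.assoc)
  have 1: "T * b = 0 \<longleftrightarrow> v * b = 0" for b
    using Tc v(5) cv by (metis mult.assoc mult_zero_right)
  have 2: "b * T = 0 \<longleftrightarrow> b * v = 0" for b
    using v(3,6) by (metis mult.assoc mult_zero_left)
  show ?thesis using v(1-3) cM c 1 2 by blast
qed

text \<open>Annihilators do not change under a nonzero scalar, so the bound required for polar
  decomposition can be arranged.\<close>

lemma ex_same_annihilator_tripotent:
  assumes M: "von_neumann_algebra M" and T: "T \<in> M"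
  shows "\<exists>v\<in>M. v * adj v * v = v \<and> (\<forall>b. T * b = 0 \<longleftrightarrow> v * b = 0) \<and> (\<forall>b. b * T = 0 \<longleftrightarrow> b * v = 0)"
proof -
  obtain C where C: "0 < C" "bdd_by T C" using ex_bdd_by by blast
  define d where "d = complex_of_real (1 / C)"
  have d: "d \<noteq> 0" "bdd_by (d *\<^sub>C T) 1" using bdd_by_scaleC[OF C(2), of d] C(1) by (auto simp: d_def norm_divide)
  have sc: "d *\<^sub>C x = 0 \<longleftrightarrow> x = 0" for x :: "'a bop"
    by (metis bop_scaleC_one bop_scaleC_scaleC bop_scaleC_zero_right d(1) left_inverse)
  obtain v where "v \<in> M" "v * adj v * v = v" "\<forall>b. (d *\<^sub>C T) * b = 0 \<longleftrightarrow> v * b = 0"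
      "\<forall>b. b * (d *\<^sub>C T) = 0 \<longleftrightarrow> b * v = 0"
    using polar_decomposition[OF M vN_scaleC[OF M T] d(2)] by blast
  then show ?thesis by (auto simp: sc)
qed

text \<open>Comparison of projections in the form used later: a nonvanishing block
  \<open>f M e\<close> contains a nonzero partial isometry.\<close>

lemma ex_tripotent_between:
  assumes M: "von_neumann_algebra M" and T: "T \<in> M" "f * T = T" "T * e = T"
  shows "\<exists>v\<in>M. v * adj v * v = v \<and> f * v = v \<and> v * e = v \<and> (T \<noteq> 0 \<longrightarrow> v \<noteq> 0)"
proof -
  obtain v where v: "v \<in> M" "v * adj v * v = v" "\<And>b. T * b = 0 \<longleftrightarrow> v * b = 0"
      "\<And>b. b * T = 0 \<longleftrightarrow> b * v = 0"
    using ex_same_annihilator_tripotent[OF M T(1)] by blast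
  have "f * v = v" using v(4)[of "1 - f"] T(2) by (simp add: algebra_simps)
  moreover have "v * e = v" using v(3)[of "1 - e"] T(3) by (simp add: algebra_simps)
  moreover have "T \<noteq> 0 \<longrightarrow> v \<noteq> 0" using v(3)[of 1] by simp
  ultimately show ?thesis using v by blast
qed

text \<open>\<open>u\<close> is \<open>c\<close> plus \<open>\<i>\<close> times the square root of
  \<open>1 - c * c\<close>, as for a cosine.\<close>

lemma ex_unitary_real_part:
  assumes M: "von_neumann_algebra M" and c: "c \<in> M" "adj c = c" "bdd_by c 1"
  shows "\<exists>u\<in>M. adj u * u = 1 \<and> u * adj u = 1 \<and> u + adj u = c + c \<and> (\<forall>b. b * c = c * b \<longrightarrow> b * u = u * b)"
proof -
  have eq: "inner (bop_apply (1 - c * c) z) z = (norm z)\<^sup>2 - (norm (bop_apply c z))\<^sup>2" for z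
    using adj_mult_self_apply[of c z]
    by (simp add: c(2) minus_bop.rep_eq one_bop.rep_eq inner_diff_left power2_norm_eq_inner)
  have "0 \<le> inner (bop_apply (1 - c * c) z) z" for z
    unfolding eq using bdd_byD[OF c(3), of z] by (simp add: power_mono)
  moreover have "inner (bop_apply (1 - c * c) z) z \<le> (norm z)\<^sup>2" for z unfolding eq by simp
  moreover have "adj (1 - c * c) = 1 - c * c" by (simp add: adj_diff adj_mult c)
  ultimately obtain s where s: "adj s = s" "s * s = 1 - c * c"
      "\<And>b. b * (1 - c * c) = (1 - c * c) * b \<Longrightarrow> b * s = s * b"
    using ex_sqrt[of "1 - c * c"] by blast
  have sM: "s \<in> M"
    by (rule vN_if_commutes_with_commuting[OF M _ s(3)]) (auto intro: vN_closed M c)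
  have s3: "b * s = s * b" if "b * c = c * b" for b
  proof (rule s(3))
    have "b * (c * c) = c * c * b" using that by (metis mult.assoc)
    then show "b * (1 - c * c) = (1 - c * c) * b" by (simp add: algebra_simps)
  qed
  have cs: "c * s = s * c" by (rule s3) simp
  define u where "u = c + \<i> *\<^sub>C s"
  have au: "adj u = c - \<i> *\<^sub>C s"
    by (simp add: u_def adj_add c s bop_scaleC_minus_left)
  have "adj u * u = c * c + s * s"
    unfolding au unfolding u_def by (simp add: algebra_simps cs bop_scaleC_minus_left bop_scaleC_diff_right bop_scaleC_add_right)
  moreover have "u * adj u = c * c + s * s"
    unfolding au unfolding u_def by (simp add: algebra_simps cs bop_scaleC_minus_left bop_scaleC_diff_right bop_scaleC_add_right)
  moreover have "u + adj u = c + c" unfolding au unfolding u_def by simp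
  moreover have "b * u = u * b" if "b * c = c * b" for b
    unfolding u_def using that s3[OF that] by (simp add: algebra_simps)
  moreover have "u \<in> M" unfolding u_def by (intro vN_closed M c sM)
  ultimately show ?thesis using s(2) by auto
qed

section \<open>Elements as finite sums of partial isometries or of unitaries\<close>

lemma additive_of_nat_scaleC:
  assumes add: "\<And>a b. a \<in> M \<Longrightarrow> b \<in> M \<Longrightarrow> P a \<Longrightarrow> P b \<Longrightarrow> P (a + b)"
    and M: "von_neumann_algebra M" and a: "a \<in> M" "P a"
  shows "P (of_nat (Suc n) *\<^sub>C a)"
proof (induction n)
  case (Suc n)
  have "of_nat (Suc (Suc n)) *\<^sub>C a = of_nat (Suc n) *\<^sub>C a + a"
    using bop_scaleC_add_left[of "of_nat (Suc n)" 1 a] by (simp add: add.commute)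
  then show ?case using add[OF vN_scaleC[OF M a(1)] a(1) Suc a(2)] by simp
qed (use a in simp)

text \<open>The induction predicates below are closed under addition only, so the rescaling has to
  be undone by an integer multiple; the factor 2 accounts for
  \<open>u + adj u = c + c\<close>.\<close>

lemma ex_contraction_multiple:
  fixes a :: "'a::complex_hilbert_space bop"
  shows "\<exists>n. bdd_by (complex_of_real (1 / (2 * real (Suc n))) *\<^sub>C a) 1"
proof -
  obtain C where C: "0 < C" "bdd_by a C" using ex_bdd_by by blast
  obtain n where "C < real n" using reals_Archimedean2 by blast
  then have "cmod (complex_of_real (1 / (2 * real (Suc n)))) * C \<le> 1"
    unfolding norm_of_real by (simp add: field_simps)
  then show ?thesis using bdd_by_mono[OF bdd_by_scaleC[OF C(2)]] by blast
qed

lemma of_nat_scaleC_cancel: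
  fixes a :: "'a::complex_hilbert_space bop"
  shows "of_nat (Suc n) *\<^sub>C (complex_of_real (1 / (2 * real (Suc n))) *\<^sub>C a +
    complex_of_real (1 / (2 * real (Suc n))) *\<^sub>C a) = a"
proof -
  have "of_nat (Suc n) * complex_of_real (1 / (2 * real (Suc n))) = 1 / 2"
    by (simp add: field_simps del: of_nat_Suc)
  then show ?thesis by (simp only: bop_scaleC_add_right bop_scaleC_scaleC bop_half_add_half)
qed

text \<open>With \<open>T = v * c\<close> and \<open>c + c = u + adj u\<close>, the sum
  \<open>T + T\<close> splits into the partial isometries \<open>v * u\<close> and
  \<open>v * adj u\<close>. They stay in \<open>f M e\<close> because \<open>u\<close> commutes with
  everything that commutes with \<open>adj T * T\<close>, in particular with
  \<open>e\<close>.\<close>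

lemma vN_tripotent_induct [consumes 5, case_names tripotent add]:
  assumes M: "von_neumann_algebra M" and a: "a \<in> M" "f * a = a" "a * e = a" "adj e = e"
    and trip: "\<And>v. v \<in> M \<Longrightarrow> v * adj v * v = v \<Longrightarrow> f * v = v \<Longrightarrow> v * e = v \<Longrightarrow> P v"
    and add: "\<And>a b. a \<in> M \<Longrightarrow> b \<in> M \<Longrightarrow> f * a = a \<Longrightarrow> a * e = a \<Longrightarrow> f * b = b \<Longrightarrow> b * e = b \<Longrightarrow>
      P a \<Longrightarrow> P b \<Longrightarrow> P (a + b)"
  shows "P a"
proof -
  obtain n where n: "bdd_by (complex_of_real (1 / (2 * real (Suc n))) *\<^sub>C a) 1"
    using ex_contraction_multiple by blast
  define T where "T = complex_of_real (1 / (2 * real (Suc n))) *\<^sub>C a"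
  have T: "T \<in> M" "f * T = T" "T * e = T" unfolding T_def using a vN_scaleC[OF M] by auto
  have T1: "bdd_by T 1" using n by (simp add: T_def)
  obtain v c where vc: "v \<in> M" "c \<in> M" "adj c = c" "bdd_by c 1" "v * adj v * v = v" "v * c = T"
      "\<And>b. T * b = 0 \<longleftrightarrow> v * b = 0" "\<And>b. b * T = 0 \<longleftrightarrow> b * v = 0"
      "\<And>b. b * (adj T * T) = adj T * T * b \<Longrightarrow> b * c = c * b"
    using polar_decomposition[OF M T(1) T1] by blast
  obtain u where u: "u \<in> M" "adj u * u = 1" "u * adj u = 1" "u + adj u = c + c"
      "\<And>b. b * c = c * b \<Longrightarrow> b * u = u * b"
    using ex_unitary_real_part[OF M vc(2-4)] by blast
  have eT: "e * adj T = adj T" using arg_cong[OF T(3), of adj] by (simp add: adj_mult a(4))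
  have "e * (adj T * T) = adj T * T * e" by (simp add: mult.assoc[symmetric] eT) (simp add: mult.assoc T)
  then have eu: "e * u = u * e" using u(5) vc(9) by blast
  have eu': "e * adj u = adj u * e" using arg_cong[OF eu, of adj] by (simp add: adj_mult a(4))
  have fv: "f * v = v" using vc(8)[of "1 - f"] T(2) by (simp add: algebra_simps)
  have ve: "v * e = v" using vc(7)[of "1 - e"] T(3) by (simp add: algebra_simps)
  let ?Q = "\<lambda>a. f * a = a \<and> a * e = a \<and> P a"
  have Q: "?Q (v * w)" if w: "w \<in> M" "w * adj w = 1" "e * w = w * e" for w
  proof -
    have 1: "f * (v * w) = v * w" by (simp add: mult.assoc[symmetric] fv)
    have 2: "v * w * e = v * w" by (metis mult.assoc ve w(3))
    have "v * w * adj (v * w) * (v * w) = v * (w * adj w) * adj v * v * w"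
      by (simp add: adj_mult mult.assoc)
    then have "v * w * adj (v * w) * (v * w) = v * w" by (simp add: w vc(5))
    then show ?thesis using trip[OF vN_mult[OF M vc(1) w(1)] _ 1 2] 1 2 by blast
  qed
  have Qadd: "?Q (a + b)" if "a \<in> M" "b \<in> M" "?Q a" "?Q b" for a b
    using add[of a b] that by (auto simp: distrib_left distrib_right)
  have "?Q (v * u + v * adj u)"
  proof (rule Qadd)
    show "v * u \<in> M" "v * adj u \<in> M" by (intro vN_closed M vc u)+
    show "?Q (v * u)" by (rule Q[OF u(1,3) eu])
    show "?Q (v * adj u)" by (rule Q[OF vN_adj[OF M u(1)] _ eu']) (simp add: u)
  qed
  moreover have "v * u + v * adj u = T + T"
    by (simp add: distrib_left[symmetric] u(4)) (simp add: distrib_left vc)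
  ultimately have Q2: "?Q (T + T)" by simp
  have "?Q (of_nat (Suc n) *\<^sub>C (T + T))"
    using additive_of_nat_scaleC[of M ?Q, OF Qadd M _ Q2] T(1) vN_add[OF M] by blast
  then show ?thesis unfolding T_def of_nat_scaleC_cancel by blast
qed

text \<open>\<open>m\<close> is \<open>h\<close> plus \<open>\<i>\<close> times \<open>k\<close>
  with both self-adjoint, and each of these is a multiple of a sum of two unitaries. The scalar
  \<open>\<i>\<close> is absorbed into the unitaries, as \<open>P\<close> is closed under addition
  only.\<close>

lemma vN_unitary_induct [consumes 2, case_names unitary add]:
  assumes M: "von_neumann_algebra M" and m: "m \<in> M"
    and unitary: "\<And>u. u \<in> M \<Longrightarrow> adj u * u = 1 \<Longrightarrow> u * adj u = 1 \<Longrightarrow> P u"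
    and add: "\<And>a b. a \<in> M \<Longrightarrow> b \<in> M \<Longrightarrow> P a \<Longrightarrow> P b \<Longrightarrow> P (a + b)"
  shows "P m"
proof -
  have sa: "P (k *\<^sub>C h)" if h: "h \<in> M" "adj h = h" and k: "cmod k = 1" for h k
  proof -
    obtain n where n: "bdd_by (complex_of_real (1 / (2 * real (Suc n))) *\<^sub>C h) 1"
      using ex_contraction_multiple by blast
    define c where "c = complex_of_real (1 / (2 * real (Suc n))) *\<^sub>C h"
    have c: "c \<in> M" "adj c = c" "bdd_by c 1" using n h vN_scaleC[OF M] by (auto simp: c_def)
    obtain u where u: "u \<in> M" "adj u * u = 1" "u * adj u = 1" "u + adj u = c + c"
      using ex_unitary_real_part[OF M c] by blast
    have k': "cnj k * k = 1" "k * cnj k = 1" using k by (simp_all add: complex_norm_square[symmetric] mult.commute)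
    have "P (k *\<^sub>C u)" by (rule unitary) (simp_all add: u k' vN_scaleC[OF M])
    moreover have "P (k *\<^sub>C adj u)" by (rule unitary) (simp_all add: u k' vN_closed M)
    ultimately have "P (k *\<^sub>C u + k *\<^sub>C adj u)" by (intro add vN_closed M u)
    then have "P (k *\<^sub>C (c + c))" by (simp only: bop_scaleC_add_right[symmetric] u(4))
    then have "P (of_nat (Suc n) *\<^sub>C (k *\<^sub>C (c + c)))"
      by (intro additive_of_nat_scaleC[of M P, OF add M]) (auto intro: vN_closed M c)
    moreover have "of_nat (Suc n) *\<^sub>C (k *\<^sub>C (c + c)) = k *\<^sub>C (of_nat (Suc n) *\<^sub>C (c + c))"
      by (simp only: bop_scaleC_scaleC mult.commute)
    ultimately show ?thesis unfolding c_def of_nat_scaleC_cancel by simp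
  qed
  define h where "h = (1/2) *\<^sub>C (m + adj m)"
  define k where "k = (- \<i> / 2) *\<^sub>C (m - adj m)"
  have "P (1 *\<^sub>C h + \<i> *\<^sub>C k)"
  proof (intro add sa)
    show "h \<in> M" "k \<in> M" unfolding h_def k_def by (intro vN_closed M m)+
    then show "1 *\<^sub>C h \<in> M" "\<i> *\<^sub>C k \<in> M" by (auto intro: vN_closed M)
    show "adj h = h" by (simp add: h_def adj_add add.commute)
    show "adj k = k"
      by (simp add: k_def adj_diff bop_scaleC_diff_right bop_scaleC_minus_left)
  qed simp_all
  moreover have "1 *\<^sub>C h + \<i> *\<^sub>C k = m"
    by (simp add: h_def k_def bop_scaleC_add_right bop_scaleC_diff_right)
      (simp add: bop_half_add_half)
  ultimately show ?thesis by simp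
qed

section \<open>Orthogonality-preserving bijections of projections\<close>

text \<open>The order \<open>p \<le> r\<close> is written \<open>r * p = p\<close>. As a relation, a
  supremum can be exhibited by an explicit operator on each side of \<theta> and then
  matched.\<close>

definition is_sup :: "'a::complex_hilbert_space bop set \<Rightarrow> 'a bop \<Rightarrow> 'a bop \<Rightarrow> 'a bop \<Rightarrow> bool" where
  "is_sup M p q r \<longleftrightarrow> r \<in> projs M \<and> r * p = p \<and> r * q = q \<and>
    (\<forall>s\<in>projs M. s * p = p \<and> s * q = q \<longrightarrow> s * r = r)"

definition is_inf :: "'a::complex_hilbert_space bop set \<Rightarrow> 'a bop \<Rightarrow> 'a bop \<Rightarrow> 'a bop \<Rightarrow> bool" where
  "is_inf M p q r \<longleftrightarrow> r \<in> projs M \<and> p * r = r \<and> q * r = r \<and>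
    (\<forall>s\<in>projs M. p * s = s \<and> q * s = s \<longrightarrow> r * s = s)"

lemma mult_zero_between: "x * p = x \<Longrightarrow> q * y = y \<Longrightarrow> p * q = 0 \<Longrightarrow> x * y = 0"
  for x :: "'a::ring"
  by (metis mult.assoc mult_zero_left mult_zero_right)

lemma rp_proj: "adj p = p \<Longrightarrow> p * p = p \<Longrightarrow> rp p = p"
  by (rule rp_eqI) auto

lemma rp_cong: "S = T * X \<Longrightarrow> T = S * Y \<Longrightarrow> rp S = rp T"
proof (rule rp_eqI[OF adj_rp])
  assume *: "S = T * X" "T = S * Y"
  show "rp T * S = S" by (simp add: *(1) mult.assoc[symmetric] rp_mult)
  show "b * rp T = 0" if "b * S = 0" for b
    by (rule rp_least) (metis *(2) that mult.assoc mult_zero_left)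
qed

text \<open>The hypotheses say that the range of \<open>T\<close> is the sum of the ranges of
  \<open>T1\<close> and \<open>T2\<close>; operator identities replace any argument about
  closures.\<close>

lemma is_sup_rp:
  assumes M: "von_neumann_algebra M" "T \<in> M"
    and "T * T1 = T1" "T * T2 = T2" "T = T1 * X + T2 * Y"
  shows "is_sup M (rp T1) (rp T2) (rp T)"
proof -
  have le: "rp T * S = S" if "T * S = S" for S by (metis that mult.assoc rp_mult)
  have s: "s * rp T = rp T" if "s * rp T1 = rp T1" "s * rp T2 = rp T2" for s
  proof (rule rp_le)
    have 1: "s * T1 = T1" "s * T2 = T2" using that rp_mult by (metis mult.assoc)+
    show "s * T = T" by (simp add: assms(5) distrib_left mult.assoc[symmetric] 1)
  qed
  show ?thesis unfolding is_sup_def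
    using rp_projs[OF M] s rp_le[OF le[OF assms(3)]] rp_le[OF le[OF assms(4)]] by blast
qed

text \<open>For an idempotent, self-adjoint or not, lying in the range is an equation; lattice
  questions about ranges thus become ring identities.\<close>

lemma rp_idempotent_iff:
  assumes "T * T = T"
  shows "rp T * b = b \<longleftrightarrow> T * b = b"
proof
  have "T * rp T = rp T" using assms by (rule rp_le)
  then show "rp T * b = b \<Longrightarrow> T * b = b" by (metis mult.assoc)
  show "T * b = b \<Longrightarrow> rp T * b = b" by (metis mult.assoc rp_mult)
qed

lemma is_inf_rp:
  assumes M: "von_neumann_algebra M" "T \<in> M"
    and "T1 * T1 = T1" "T2 * T2 = T2" "T * T = T" "T1 * T = T" "T2 * T = T"
    and "\<And>s. T1 * s = s \<Longrightarrow> T2 * s = s \<Longrightarrow> T * s = s"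
  shows "is_inf M (rp T1) (rp T2) (rp T)"
  unfolding is_inf_def using rp_projs[OF M] assms(6-8)
  by (simp add: rp_idempotent_iff assms(3-5) rp_le)

locale ortho_iso =
  fixes M :: "'a::complex_hilbert_space bop set" and N :: "'b::complex_hilbert_space bop set"
    and \<theta> :: "'a bop \<Rightarrow> 'b bop"
  assumes M: "von_neumann_algebra M" and N: "von_neumann_algebra N"
    and bij: "bij_betw \<theta> (projs M) (projs N)"
    and orth: "\<And>p q. p \<in> projs M \<Longrightarrow> q \<in> projs M \<Longrightarrow> \<theta> p * \<theta> q = 0 \<longleftrightarrow> p * q = 0"
    and add: "\<And>p q. p \<in> projs M \<Longrightarrow> q \<in> projs M \<Longrightarrow> p * q = 0 \<Longrightarrow> \<theta> (p + q) = \<theta> p + \<theta> q"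
begin

lemma proj: "p \<in> projs M \<Longrightarrow> \<theta> p \<in> projs N"
  using bij bij_betwE by blast

lemma inj: "p \<in> projs M \<Longrightarrow> q \<in> projs M \<Longrightarrow> \<theta> p = \<theta> q \<longleftrightarrow> p = q"
  using bij by (meson bij_betw_imp_inj_on inj_on_eq_iff)

lemma surj: "r \<in> projs N \<Longrightarrow> \<exists>p\<in>projs M. \<theta> p = r"
  using bij by (metis bij_betw_imp_surj_on imageE)

lemma zero [simp]: "\<theta> 0 = 0"
  using add[OF projs_zero[OF M] projs_zero[OF M]] by simp

lemma one [simp]: "\<theta> 1 = 1"
proof -
  obtain p where p: "p \<in> projs M" "\<theta> p = 1" using surj projs_one[OF N] by blast
  have q: "1 - p \<in> projs M" "p * (1 - p) = 0"
    using projs_compl[OF M p(1)] projsD[OF p(1)] by (simp_all add: algebra_simps)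
  have "\<theta> p * \<theta> (1 - p) = 0" using orth[OF p(1) q(1)] q(2) by simp
  then have "\<theta> (1 - p) = 0" using p(2) by simp
  then show ?thesis using add[OF p(1) q] p(2) by simp
qed

lemma diff: "p \<in> projs M \<Longrightarrow> q \<in> projs M \<Longrightarrow> q * p = q \<Longrightarrow> \<theta> (p - q) = \<theta> p - \<theta> q"
  using add[of "p - q" q] projs_diff[OF M, of p q] proj_comm_le[of q M p]
  by (simp add: algebra_simps projsD)

lemma le_iff:
  assumes "p \<in> projs M" "q \<in> projs M"
  shows "\<theta> q * \<theta> p = \<theta> p \<longleftrightarrow> q * p = p"
proof -
  have "q * p = p \<longleftrightarrow> (1 - q) * p = 0" by (auto simp: algebra_simps)
  also have "\<dots> \<longleftrightarrow> \<theta> (1 - q) * \<theta> p = 0" using orth projs_compl[OF M assms(2)] assms(1) by blast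
  also have "\<dots> \<longleftrightarrow> (1 - \<theta> q) * \<theta> p = 0"
    using diff[OF projs_one[OF M] assms(2)] by simp
  also have "\<dots> \<longleftrightarrow> \<theta> q * \<theta> p = \<theta> p" by (auto simp: algebra_simps)
  finally show ?thesis by simp
qed

lemma proj_antisym: "p \<in> projs L \<Longrightarrow> q \<in> projs L \<Longrightarrow> p * q = q \<Longrightarrow> q * p = p \<Longrightarrow> p = q"
  by (metis proj_comm_le)

lemma sup_transfer:
  assumes pq: "p \<in> projs M" "q \<in> projs M" and r: "is_sup M p q r" and r': "is_sup N (\<theta> p) (\<theta> q) r'"
  shows "\<theta> r = r'"
proof -
  have rM: "r \<in> projs M" and rN: "r' \<in> projs N" using r r' by (auto simp: is_sup_def)
  obtain s where s: "s \<in> projs M" "\<theta> s = r'" using surj rN by blast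
  have "\<theta> r * \<theta> p = \<theta> p" "\<theta> r * \<theta> q = \<theta> q" using r le_iff rM pq by (auto simp: is_sup_def)
  then have 1: "\<theta> r * r' = r'" using r' proj[OF rM] by (auto simp: is_sup_def)
  have "s * p = p" "s * q = q" using r' le_iff s pq by (auto simp: is_sup_def)
  then have "s * r = r" using r s by (auto simp: is_sup_def)
  then have "r' * \<theta> r = \<theta> r" using le_iff s rM by auto
  with 1 show ?thesis using proj_antisym[OF proj[OF rM] rN] by blast
qed

lemma inf_transfer:
  assumes pq: "p \<in> projs M" "q \<in> projs M" and r: "is_inf M p q r" and r': "is_inf N (\<theta> p) (\<theta> q) r'"
  shows "\<theta> r = r'"
proof -
  have rM: "r \<in> projs M" and rN: "r' \<in> projs N" using r r' by (auto simp: is_inf_def)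
  obtain s where s: "s \<in> projs M" "\<theta> s = r'" using surj rN by blast
  have "\<theta> p * \<theta> r = \<theta> r" "\<theta> q * \<theta> r = \<theta> r" using r le_iff rM pq by (auto simp: is_inf_def)
  then have 1: "r' * \<theta> r = \<theta> r" using r' proj[OF rM] by (auto simp: is_inf_def)
  have "p * s = s" "q * s = s" using r' le_iff s pq by (auto simp: is_inf_def)
  then have "r * s = s" using r s by (auto simp: is_inf_def)
  then have "\<theta> r * r' = r'" using le_iff s rM by auto
  with 1 show ?thesis using proj_antisym[OF proj[OF rM] rN] by blast
qed

text \<open>Every statement about \<theta> becomes available in both directions; surjectivity and
  fullness are obtained in this way.\<close>

lemma inverse: "ortho_iso N M (inv_into (projs M) \<theta>)"
proof
  let ?i = "inv_into (projs M) \<theta>"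
  show "von_neumann_algebra M" "von_neumann_algebra N" by (fact M, fact N)
  show bij': "bij_betw ?i (projs N) (projs M)" by (rule bij_betw_inv_into[OF bij])
  have i: "?i p \<in> projs M" "\<theta> (?i p) = p" if "p \<in> projs N" for p
    using that bij' bij by (auto simp: bij_betw_inv_into_right dest: bij_betwE)
  fix p q assume pq: "p \<in> projs N" "q \<in> projs N"
  show o: "?i p * ?i q = 0 \<longleftrightarrow> p * q = 0" using orth[OF i(1) i(1), OF pq] i(2) pq by simp
  assume "p * q = 0"
  with o have "\<theta> (?i p + ?i q) = p + q" "?i p + ?i q \<in> projs M"
    using add[OF i(1) i(1), OF pq] projs_add[OF M i(1) i(1), OF pq] i(2) pq by auto
  then show "?i (p + q) = ?i p + ?i q" using bij by (metis bij_betw_inv_into_left)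
qed

text \<open>
  \<open>rp (e + a)\<close> is the projection onto the graph of \<open>a : eH \<rightarrow> (1 - e)H\<close>.  The relation says that
  \<open>\<theta>\<close> maps the graph of \<open>a\<close> to the graph of a bounded operator \<open>a'\<close>.
\<close>

definition good :: "'a bop \<Rightarrow> 'a bop \<Rightarrow> 'b bop \<Rightarrow> bool" where
  "good e a a' \<longleftrightarrow> a \<in> M \<and> a * e = a \<and> e * a = 0 \<and> a' \<in> N \<and> a' * \<theta> e = a' \<and> \<theta> e * a' = 0 \<and>
    \<theta> (rp (e + a)) = rp (\<theta> e + a')"

text \<open>\<open>e + a\<close> is the oblique projection onto the graph of \<open>a\<close> along
  the kernel of \<open>e\<close>.\<close>

lemma graph_idem:
  fixes e a :: "'c::complex_hilbert_space bop"
  assumes "e * e = e" "a * e = a" "e * a = 0"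
  shows "(e + a) * (e + a) = e + a"
proof -
  have "a * a = a * (e * a)" by (rule mult_eq_assoc[OF assms(2), symmetric])
  then have "a * a = 0" by (simp add: assms(3))
  then show ?thesis by (simp add: algebra_simps assms)
qed

lemma graph_inj:
  fixes e a b :: "'c::complex_hilbert_space bop"
  assumes "e * e = e" "a * e = a" "e * a = 0" "b * e = b" "e * b = 0" "rp (e + a) = rp (e + b)"
  shows "a = b"
proof -
  have "rp (e + b) * (e + a) = e + a" using assms(6) rp_mult by metis
  then have "(e + b) * (e + a) = e + a"
    using rp_idempotent_iff[OF graph_idem[OF assms(1,4,5)]] by blast
  moreover have "b * a = 0" using mult_eq_assoc[OF assms(4), of a] by (simp add: assms(3))
  ultimately show ?thesis by (simp add: algebra_simps assms)
qed

lemma graph_projs: "e \<in> projs M \<Longrightarrow> a \<in> M \<Longrightarrow> rp (e + a) \<in> projs M"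
  by (intro rp_projs[OF M] vN_add[OF M] projsD(1)[of e M])

lemma good_unique_right:
  assumes "e \<in> projs M" "good e a a'" "good e a b'"
  shows "a' = b'"
  using graph_inj[of "\<theta> e" a' b'] assms(2,3) projsD(3)[OF proj[OF assms(1)]] by (auto simp: good_def)

lemma good_unique_left:
  assumes e: "e \<in> projs M" and "good e a a'" "good e b a'"
  shows "a = b"
proof -
  have "\<theta> (rp (e + a)) = \<theta> (rp (e + b))" using assms(2,3) by (simp add: good_def)
  then have "rp (e + a) = rp (e + b)"
    using inj[of "rp (e + a)" "rp (e + b)"] graph_projs[OF e] assms(2,3) by (simp only: good_def)
  then show ?thesis using graph_inj[of e a b] assms(2,3) projsD(3)[OF e] by (auto simp: good_def)
qed

lemma good_zero: "e \<in> projs M \<Longrightarrow> good e 0 0"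
  using vN_zero[OF M] vN_zero[OF N] rp_proj[OF projsD(2,3)[of e M]]
    rp_proj[OF projsD(2,3)[OF proj[of e]]] by (simp add: good_def)

text \<open>\<open>a\<close> maps into \<open>f\<close> exactly when its graph lies below
  \<open>e + f\<close>, and that is an order relation.\<close>

lemma good_range:
  assumes e: "e \<in> projs M" and f: "f \<in> projs M" and ef: "e * f = 0" and fa: "f * a = a"
    and good: "good e a a'"
  shows "\<theta> f * a' = a'"
proof -
  have s: "e + f \<in> projs M" by (rule projs_add[OF M e f ef])
  have g: "a \<in> M" "e * a = 0" "\<theta> e * a' = 0" "\<theta> (rp (e + a)) = rp (\<theta> e + a')"
    using good by (auto simp: good_def)
  have fe: "f * e = 0" by (rule proj_comm_zero[OF e f ef])
  have "(e + f) * (e + a) = e + a" by (simp add: algebra_simps projsD[OF e] fe fa g)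
  then have "(e + f) * rp (e + a) = rp (e + a)" by (rule rp_le)
  then have "\<theta> (e + f) * rp (\<theta> e + a') = rp (\<theta> e + a')"
    using le_iff[OF graph_projs[OF e g(1)] s] g(4) by simp
  then have "\<theta> (e + f) * (\<theta> e + a') = \<theta> e + a'" by (metis mult.assoc rp_mult)
  moreover have "\<theta> f * \<theta> e = 0" using orth[OF f e] fe by simp
  ultimately show ?thesis
    by (simp add: algebra_simps add[OF e f ef] projsD(3)[OF proj[OF e]] g(3))
qed

end

text \<open>The join of the two graphs consists of the vectors \<open>x + a x + y + b y\<close> with
  \<open>x\<close> in \<open>e\<close> and \<open>y\<close> in \<open>f\<close>; it is itself a
  graph over \<open>e + f\<close>, that of \<open>b - b * a\<close>. The meet with
  \<open>e + g\<close> forces \<open>y = - a x\<close> and leaves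
  \<open>x - b (a x)\<close>.\<close>

lemma graph_mult_lattice:
  fixes M :: "'a::complex_hilbert_space bop set"
  assumes M: "von_neumann_algebra M" and e: "e \<in> projs M" and f: "f \<in> projs M" and g: "g \<in> projs M"
    and orth: "e * f = 0" "e * g = 0" "f * g = 0"
    and a: "a \<in> M" "a * e = a" "f * a = a" and b: "b \<in> M" "b * f = b" "g * b = b"
  shows "is_sup M (rp (e + a)) (rp (f + b)) (rp ((e + f) + (b - b * a)))"
    and "is_inf M (rp ((e + f) + (b - b * a))) (e + g) (rp (e - b * a))"
proof -
  have orth': "f * e = 0" "g * e = 0" "g * f = 0" using proj_comm_zero e f g orth by metis+
  have z: "a * f = 0" "a * g = 0" "e * a = 0" "g * a = 0" "b * e = 0" "b * g = 0" "e * b = 0" "f * b = 0"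
    "a * a = 0" "b * b = 0" "a * b = 0"
    using a(2,3) b(2,3) orth orth' projsD(3)[OF e] projsD(3)[OF f] projsD(3)[OF g]
    by (blast intro: mult_zero_between)+
  note r = orth orth' z a(2,3) b(2,3) projsD(3)[OF e] projsD(3)[OF f] projsD(3)[OF g]
  note r = r r[THEN mult_eq_assoc]
  let ?T = "(e + f) + (b - b * a)"
  have T: "?T \<in> M" by (intro vN_closed M a b projsD(1)[OF e] projsD(1)[OF f])
  show "is_sup M (rp (e + a)) (rp (f + b)) (rp ?T)"
    by (rule is_sup_rp[OF M T, where X = e and Y = "f - a"]) (simp_all add: algebra_simps r)
  have "is_inf M (rp ?T) (rp (e + g)) (rp (e - b * a))"
  proof (rule is_inf_rp[OF M])
    show "e - b * a \<in> M" by (intro vN_closed M a b projsD(1)[OF e])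
    fix s assume 1: "?T * s = s" and 2: "(e + g) * s = s"
    have "f * ((e + g) * s) = 0" by (simp add: algebra_simps r)
    then have fs: "f * s = 0" using 2 by simp
    have "b * s = b * (f * s)" by (simp add: r)
    then have "b * s = 0" using fs by simp
    then show "(e - b * a) * s = s" using 1 fs by (simp add: algebra_simps)
  qed (simp_all add: algebra_simps r)
  moreover have "rp (e + g) = e + g"
    using projsD(2,3)[OF projs_add[OF M e g orth(2)]] by (rule rp_proj)
  ultimately show "is_inf M (rp ?T) (e + g) (rp (e - b * a))" by simp
qed

text \<open>Joining the graph of \<open>a\<close> with \<open>g\<close> frees the \<open>g\<close>
  component, joining that of \<open>b\<close> with \<open>f\<close> frees the \<open>f\<close>
  component; the meet fixes both.\<close>

lemma graph_sum_lattice: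
  fixes M :: "'a::complex_hilbert_space bop set"
  assumes M: "von_neumann_algebra M" and e: "e \<in> projs M" and f: "f \<in> projs M" and g: "g \<in> projs M"
    and orth: "e * f = 0" "e * g = 0" "f * g = 0"
    and a: "a \<in> M" "a * e = a" "f * a = a" and b: "b \<in> M" "b * e = b" "g * b = b"
  shows "is_sup M (rp (e + a)) g (rp ((e + g) + a))"
    and "is_inf M (rp ((e + g) + a)) (rp ((e + f) + b)) (rp (e + (a + b)))"
proof -
  have orth': "f * e = 0" "g * e = 0" "g * f = 0" using proj_comm_zero e f g orth by metis+
  have z: "a * f = 0" "a * g = 0" "e * a = 0" "g * a = 0" "b * f = 0" "b * g = 0" "e * b = 0" "f * b = 0"
    "a * a = 0" "b * b = 0" "a * b = 0" "b * a = 0"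
    using a(2,3) b(2,3) orth orth' projsD(3)[OF e] projsD(3)[OF f] projsD(3)[OF g]
    by (blast intro: mult_zero_between)+
  note r = orth orth' z a(2,3) b(2,3) projsD(3)[OF e] projsD(3)[OF f] projsD(3)[OF g]
  note r = r r[THEN mult_eq_assoc]
  have T: "(e + g) + a \<in> M" by (intro vN_closed M a b projsD(1)[OF e] projsD(1)[OF g])
  have "is_sup M (rp (e + a)) (rp g) (rp ((e + g) + a))"
    by (rule is_sup_rp[OF M T, where X = e and Y = g]) (simp_all add: algebra_simps r)
  then show "is_sup M (rp (e + a)) g (rp ((e + g) + a))"
    using rp_proj[OF projsD(2,3)[OF g]] by simp
  show "is_inf M (rp ((e + g) + a)) (rp ((e + f) + b)) (rp (e + (a + b)))"
  proof (rule is_inf_rp[OF M])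
    show "e + (a + b) \<in> M" by (intro vN_closed M a b projsD(1)[OF e])
    fix s assume 1: "((e + g) + a) * s = s" and 2: "((e + f) + b) * s = s"
    have "g * (((e + f) + b) * s) = b * s" by (simp add: algebra_simps r)
    then have "g * s = b * s" using 2 by simp
    then show "(e + (a + b)) * s = s" using 1 by (simp add: algebra_simps)
  qed (simp_all add: algebra_simps r)
qed

text \<open>Both summands map into \<open>f\<close>, so their graphs cannot be combined by freeing
  components; the range of \<open>w\<close> serves as a second copy of \<open>e\<close>. The join
  contains \<open>x + a x + w x + y - b (adj w y)\<close>, and vanishing of the \<open>g\<close>
  component forces \<open>y = - w x\<close>, which adds \<open>b x\<close>.\<close>

lemma graph_add_lattice:
  fixes M :: "'a::complex_hilbert_space bop set"
  assumes M: "von_neumann_algebra M" and e: "e \<in> projs M" and f: "f \<in> projs M" and g: "g \<in> projs M"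
    and orth: "e * f = 0" "e * g = 0" "f * g = 0"
    and a: "a \<in> M" "a * e = a" "f * a = a" and b: "b \<in> M" "b * e = b" "f * b = b"
    and w: "w \<in> M" "adj w * w = e" "w * adj w = g"
  shows "is_sup M (rp (e + (a + w))) (rp (g - b * adj w)) (rp ((e + g) + (a + b - b * adj w)))"
    and "is_inf M (rp ((e + g) + (a + b - b * adj w))) (e + f) (rp (e + (a + b)))"
proof -
  have orth': "f * e = 0" "g * e = 0" "g * f = 0" using proj_comm_zero e f g orth by metis+
  have we: "w * e = w" and gw: "g * w = w"
  proof -
    have "adj (w - w * e) * (w - w * e) = 0"
      by (simp add: adj_diff adj_mult algebra_simps projsD[OF e] w(2) mult_eq_assoc[OF w(2)])
    then show "w * e = w" by simp
    then show "g * w = w" by (metis mult.assoc w(2,3))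
  qed
  have w': "e * adj w = adj w" "adj w * g = adj w"
    using arg_cong[OF we, of adj] arg_cong[OF gw, of adj] by (simp_all add: adj_mult projsD[OF e] projsD[OF g])
  have z: "a * f = 0" "a * g = 0" "e * a = 0" "g * a = 0" "b * f = 0" "b * g = 0" "e * b = 0" "g * b = 0"
    "a * a = 0" "b * b = 0" "a * b = 0" "b * a = 0" "w * g = 0" "w * f = 0" "e * w = 0" "f * w = 0"
    "adj w * e = 0" "adj w * f = 0" "g * adj w = 0" "f * adj w = 0" "w * a = 0" "w * b = 0" "a * w = 0" "b * w = 0"
    "adj w * a = 0" "adj w * b = 0" "w * w = 0" "adj w * adj w = 0"
    using a(2,3) b(2,3) we gw w' orth orth' projsD(3)[OF e] projsD(3)[OF f] projsD(3)[OF g]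
    by (blast intro: mult_zero_between)+
  note r = orth orth' z a(2,3) b(2,3) projsD(3)[OF e] projsD(3)[OF f] projsD(3)[OF g] we gw w' w(2,3)
  note r = r r[THEN mult_eq_assoc]
  let ?T = "(e + g) + (a + b - b * adj w)"
  have T: "?T \<in> M" by (intro vN_closed M a b w projsD(1)[OF e] projsD(1)[OF g])
  show "is_sup M (rp (e + (a + w))) (rp (g - b * adj w)) (rp ?T)"
    by (rule is_sup_rp[OF M T, where X = e and Y = "g - w"]) (simp_all add: algebra_simps r)
  have "is_inf M (rp ?T) (rp (e + f)) (rp (e + (a + b)))"
  proof (rule is_inf_rp[OF M])
    show "e + (a + b) \<in> M" by (intro vN_closed M a b projsD(1)[OF e])
    fix s assume 1: "?T * s = s" and 2: "(e + f) * s = s"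
    have "g * ((e + f) * s) = 0" by (simp add: algebra_simps r)
    then have gs: "g * s = 0" using 2 by simp
    have "b * adj w * s = b * (adj w * (g * s))" by (simp add: r mult.assoc)
    then have "b * adj w * s = 0" using gs by simp
    then show "(e + (a + b)) * s = s" using 1 gs by (simp add: algebra_simps)
  qed (simp_all add: algebra_simps r)
  moreover have "rp (e + f) = e + f"
    using projsD(2,3)[OF projs_add[OF M e f orth(1)]] by (rule rp_proj)
  ultimately show "is_inf M (rp ?T) (e + f) (rp (e + (a + b)))" by simp
qed

text \<open>Inside \<open>e + f\<close> the vectors orthogonal to all \<open>x + a x\<close> are the
  \<open>y - adj a y\<close>, which is how adjoints enter the lattice.\<close>

lemma graph_compl:
  fixes M :: "'a::complex_hilbert_space bop set"
  assumes e: "e \<in> projs M" and f: "f \<in> projs M" and orth: "e * f = 0"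
    and a: "a * e = a" "f * a = a"
  shows "e + f - rp (e + a) = rp (f - adj a)"
proof (rule sym, rule rp_eqI)
  have fe: "f * e = 0" using proj_comm_zero e f orth by metis
  have z: "e * a = 0" "a * f = 0" "a * a = 0" "f * a = a"
    using a orth fe projsD(3)[OF e] projsD(3)[OF f] by (blast intro: mult_zero_between)+
  have a': "e * adj a = adj a" "adj a * f = adj a" "adj a * e = 0" "f * adj a = 0" "adj a * adj a = 0"
    using arg_cong[OF a(1), of adj] arg_cong[OF a(2), of adj] mult_zero_adj[OF z(1)]
      mult_zero_adj[OF z(2)] mult_zero_adj[OF z(3)] by (simp_all add: adj_mult projsD[OF e] projsD[OF f])
  show "adj (e + f - rp (e + a)) = e + f - rp (e + a)"
    by (simp add: adj_add adj_diff adj_rp projsD[OF e] projsD[OF f])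
  have "rp (e + a) * (f - adj a) = 0"
    by (rule rp_least_left) (simp add: adj_add algebra_simps projsD[OF e] orth a')
  then show "(e + f - rp (e + a)) * (f - adj a) = f - adj a"
    by (simp add: algebra_simps projsD[OF f] orth a')
  fix b assume b: "b * (f - adj a) = 0"
  define r where "r = e + f - rp (e + a)"
  have "(e + f) * rp (e + a) = rp (e + a)"
    by (rule rp_le) (simp add: algebra_simps projsD[OF e] fe z)
  then have 1: "(e + f) * r = r"
    by (simp add: r_def algebra_simps projsD[OF e] projsD[OF f] orth fe)
  have "adj (e + a) * rp (e + a) = adj (e + a)"
    using arg_cong[OF rp_mult[of "e + a"], of adj] by (simp add: adj_mult adj_rp)
  then have "(e + adj a) * rp (e + a) = e + adj a" by (simp add: adj_add projsD[OF e])
  moreover have "(e + adj a) * (e + f) = e + adj a" by (simp add: algebra_simps projsD[OF e] orth a')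
  ultimately have "(e + adj a) * r = 0" by (simp add: r_def right_diff_distrib)
  then have "e * r = - (adj a * r)" by (simp add: distrib_right eq_neg_iff_add_eq_0)
  then have "(f - adj a) * r = (e + f) * r" by (simp add: left_diff_distrib distrib_right)
  then have "r = (f - adj a) * r" using 1 by simp
  then have "b * r = 0" by (metis b mult.assoc mult_zero_left)
  then show "b * (e + f - rp (e + a)) = 0" by (simp add: r_def)
qed

text \<open>\<open>v\<close> vanishes on \<open>e - p\<close>, so over that part its graph is
  \<open>e - p\<close> itself.\<close>

lemma graph_support_split:
  fixes M :: "'a::complex_hilbert_space bop set"
  assumes e: "e \<in> projs M" and p: "p \<in> projs M" and pe: "p * e = p" and v: "v * p = v" "e * v = 0"
  shows "rp (e + v) = rp (p + v) + (e - p)"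
proof (rule rp_eqI)
  have ep: "e * p = p" using proj_comm_le[OF p e] pe by simp
  have pv: "p * v = 0" using mult_eq_assoc[OF pe, of v] by (simp add: v)
  have ve: "v * e = v" using mult_eq_assoc[OF v(1), of e] by (simp add: pe v)
  have "adj v * e = 0" "adj v * p = 0"
    using mult_zero_adj[OF v(2)] mult_zero_adj[OF pv] by (simp_all add: projsD[OF e] projsD[OF p])
  then have "rp (p + v) * (e - p) = 0"
    by (intro rp_least_left) (simp add: adj_add algebra_simps projsD[OF p] pe)
  then show "(rp (p + v) + (e - p)) * (e + v) = e + v"
    using rp_mult[of "p + v"] by (simp add: algebra_simps projsD[OF e] projsD[OF p] pe v pv)
  show "adj (rp (p + v) + (e - p)) = rp (p + v) + (e - p)"
    by (simp add: adj_add adj_diff adj_rp projsD[OF e] projsD[OF p])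
  fix b assume b: "b * (e + v) = 0"
  have "(e + v) * p = p + v" "(e + v) * (e - p) = e - p"
    by (simp_all add: algebra_simps ep v ve projsD[OF e])
  then have 1: "b * (p + v) = 0" "b * (e - p) = 0" using b by (metis mult.assoc mult_zero_left)+
  show "b * (rp (p + v) + (e - p)) = 0"
    unfolding distrib_left rp_least[OF 1(1)] 1(2) by simp
qed

section \<open>Graph operations carried through \<theta>\<close>

context ortho_iso
begin

lemma goodD:
  assumes "good e a a'"
  shows "a \<in> M" "a * e = a" "e * a = 0" "a' \<in> N" "a' * \<theta> e = a'" "\<theta> e * a' = 0"
    "\<theta> (rp (e + a)) = rp (\<theta> e + a')"
  using assms by (auto simp: good_def)

text \<open>The signs stem from the meet in \<open>graph_mult_lattice\<close>; they are removed once
  additive inverses are known to be transported.\<close>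

lemma good_mult:
  assumes e: "e \<in> projs M" and f: "f \<in> projs M" and g: "g \<in> projs M"
    and orths: "e * f = 0" "e * g = 0" "f * g = 0"
    and a: "good e a a'" "f * a = a" and b: "good f b b'" "g * b = b"
  shows "good e (- (b * a)) (- (b' * a'))"
proof -
  note aD = goodD[OF a(1)] and bD = goodD[OF b(1)]
  note e' = proj[OF e] and f' = proj[OF f] and g' = proj[OF g]
  have orths': "\<theta> e * \<theta> f = 0" "\<theta> e * \<theta> g = 0" "\<theta> f * \<theta> g = 0" using orth e f g orths by auto
  have a': "\<theta> f * a' = a'" by (rule good_range[OF e f orths(1) a(2,1)])
  have b': "\<theta> g * b' = b'" by (rule good_range[OF f g orths(3) b(2,1)])
  note LM = graph_mult_lattice[OF M e f g orths aD(1,2) a(2) bD(1,2) b(2)]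
  note LN = graph_mult_lattice[OF N e' f' g' orths' aD(4,5) a' bD(4,5) b']
  have 1: "\<theta> (rp ((e + f) + (b - b * a))) = rp ((\<theta> e + \<theta> f) + (b' - b' * a'))"
    using LM(1) LN(1) sup_transfer[OF graph_projs[OF e aD(1)] graph_projs[OF f bD(1)]] aD(7) bD(7)
    by simp
  have 2: "rp ((e + f) + (b - b * a)) \<in> projs M" using LM(1) by (simp add: is_sup_def)
  have "\<theta> (rp (e - b * a)) = rp (\<theta> e - b' * a')"
    using LM(2) LN(2) inf_transfer[OF 2 projs_add[OF M e g orths(2)]] 1 add[OF e g orths(2)] by simp
  moreover have "e * b = 0" "\<theta> e * b' = 0"
    using orths(2) orths'(2) b(2) b' projsD(3)[OF e] projsD(3)[OF e'] by (blast intro: mult_zero_between)+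
  ultimately show ?thesis
    unfolding good_def using aD bD by (simp add: vN_closed M N mult.assoc mult_eq_assoc)
qed

lemma good_sum:
  assumes e: "e \<in> projs M" and f: "f \<in> projs M" and g: "g \<in> projs M"
    and orths: "e * f = 0" "e * g = 0" "f * g = 0"
    and a: "good e a a'" "f * a = a" and b: "good e b b'" "g * b = b"
  shows "good e (a + b) (a' + b')"
proof -
  note aD = goodD[OF a(1)] and bD = goodD[OF b(1)]
  note e' = proj[OF e] and f' = proj[OF f] and g' = proj[OF g]
  have orths': "\<theta> e * \<theta> f = 0" "\<theta> e * \<theta> g = 0" "\<theta> f * \<theta> g = 0" using orth e f g orths by auto
  have gf: "g * f = 0" "\<theta> g * \<theta> f = 0" using proj_comm_zero f g f' g' orths orths' by metis+
  have a': "\<theta> f * a' = a'" by (rule good_range[OF e f orths(1) a(2,1)])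
  have b': "\<theta> g * b' = b'" by (rule good_range[OF e g orths(2) b(2,1)])
  note LM = graph_sum_lattice[OF M e f g orths aD(1,2) a(2) bD(1,2) b(2)]
  note LN = graph_sum_lattice[OF N e' f' g' orths' aD(4,5) a' bD(4,5) b']
  note LM' = graph_sum_lattice[OF M e g f orths(2,1) gf(1) bD(1,2) b(2) aD(1,2) a(2)]
  note LN' = graph_sum_lattice[OF N e' g' f' orths'(2,1) gf(2) bD(4,5) b' aD(4,5) a']
  have 1: "\<theta> (rp ((e + g) + a)) = rp ((\<theta> e + \<theta> g) + a')"
    using LM(1) LN(1) sup_transfer[OF graph_projs[OF e aD(1)] g] aD(7) by simp
  have 2: "\<theta> (rp ((e + f) + b)) = rp ((\<theta> e + \<theta> f) + b')"
    using LM'(1) LN'(1) sup_transfer[OF graph_projs[OF e bD(1)] f] bD(7) by simp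
  have 3: "rp ((e + g) + a) \<in> projs M" "rp ((e + f) + b) \<in> projs M"
    using LM(1) LM'(1) by (simp_all add: is_sup_def)
  have "\<theta> (rp (e + (a + b))) = rp (\<theta> e + (a' + b'))"
    using LM(2) LN(2) inf_transfer[OF 3] 1 2 by simp
  then show ?thesis
    unfolding good_def using aD bD by (simp add: vN_closed M N distrib_left distrib_right)
qed

text \<open>The graph of an isometry is also the graph of its inverse, read in the other
  direction.\<close>

lemma good_adj_isometry:
  assumes e: "e \<in> projs M" and g: "g \<in> projs M"
    and w: "good e w w'" "adj w * w = e" "w * adj w = g" "adj w' * w' = \<theta> e" "w' * adj w' = \<theta> g"
  shows "good g (adj w) (adj w')"
proof -
  note wD = goodD[OF w(1)]
  have eg: "e * g = 0" by (simp add: w(3)[symmetric] mult.assoc[symmetric] wD)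
  have eg': "\<theta> e * \<theta> g = 0" using orth[OF e g] eg by simp
  have h1: "g * w = w" "\<theta> g * w' = w'" by (metis wD(2,5) w(2-5) mult.assoc)+
  have h2: "adj w * g = adj w" "adj w' * \<theta> g = adj w'" "e * adj w = adj w" "\<theta> e * adj w' = adj w'"
    using arg_cong[OF h1(1), of adj] arg_cong[OF h1(2), of adj]
      arg_cong[OF wD(2), of adj] arg_cong[OF wD(5), of adj]
    by (simp_all add: adj_mult projsD[OF g] projsD[OF e] projsD[OF proj[OF g]] projsD[OF proj[OF e]])
  have "g * adj w = 0" "\<theta> g * adj w' = 0"
    using h2 proj_comm_zero[OF e g eg] proj_comm_zero[OF proj[OF e] proj[OF g] eg']
      projsD(3)[OF g] projsD(3)[OF proj[OF g]] by (blast intro: mult_zero_between)+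
  note h2 = h2 this
  have "rp (g + adj w) = rp (e + w)"
    by (rule rp_cong[where X = "adj w" and Y = w]) (simp_all add: algebra_simps h1 h2 w wD)
  moreover have "rp (\<theta> g + adj w') = rp (\<theta> e + w')"
    by (rule rp_cong[where X = "adj w'" and Y = w']) (simp_all add: algebra_simps h1 h2 w wD)
  ultimately show ?thesis
    unfolding good_def using wD h2 by (simp add: vN_closed M N)
qed

text \<open>\<open>w\<close> and \<open>w'\<close> supply matching copies of \<open>e\<close> and
  \<open>\<theta> e\<close>; the sum and product formulas provide the two graphs whose join is
  needed.\<close>

lemma good_add:
  assumes e: "e \<in> projs M" and f: "f \<in> projs M" and g: "g \<in> projs M"
    and orths: "e * f = 0" "e * g = 0" "f * g = 0"
    and a: "good e a a'" "f * a = a" and b: "good e b b'" "f * b = b"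
    and w: "good e w w'" "adj w * w = e" "w * adj w = g" "adj w' * w' = \<theta> e" "w' * adj w' = \<theta> g"
  shows "good e (a + b) (a' + b')"
proof -
  note aD = goodD[OF a(1)] and bD = goodD[OF b(1)] and wD = goodD[OF w(1)]
  note e' = proj[OF e] and f' = proj[OF f] and g' = proj[OF g]
  have orths': "\<theta> e * \<theta> f = 0" "\<theta> e * \<theta> g = 0" "\<theta> f * \<theta> g = 0" using orth e f g orths by auto
  have a': "\<theta> f * a' = a'" by (rule good_range[OF e f orths(1) a(2,1)])
  have b': "\<theta> f * b' = b'" by (rule good_range[OF e f orths(1) b(2,1)])
  have gw: "g * w = w" by (metis wD(2) w(2,3) mult.assoc)
  have ge: "g * e = 0" and gf: "g * f = 0" using proj_comm_zero e f g orths by metis+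
  have ew: "e * adj w = adj w"
    using arg_cong[OF wD(2), of adj] by (simp add: adj_mult projsD[OF e])
  note 1 = good_adj_isometry[OF e g w]
  have 2: "good g (- (b * adj w)) (- (b' * adj w'))"
    by (rule good_mult[OF g e f ge gf orths(1) 1 ew b])
  have 3: "good e (a + w) (a' + w')" by (rule good_sum[OF e f g orths a w(1) gw])
  note 2 = goodD[OF 2] and 3 = goodD[OF 3]
  note LM = graph_add_lattice[OF M e f g orths aD(1,2) a(2) bD(1,2) b(2) wD(1) w(2,3)]
  note LN = graph_add_lattice[OF N e' f' g' orths' aD(4,5) a' bD(4,5) b' wD(4) w(4,5)]
  have 4: "\<theta> (rp ((e + g) + (a + b - b * adj w))) = rp ((\<theta> e + \<theta> g) + (a' + b' - b' * adj w'))"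
    using LM(1) LN(1) sup_transfer[OF graph_projs[OF e 3(1)] graph_projs[OF g 2(1)]] 2(7) 3(7) by simp
  have 5: "rp ((e + g) + (a + b - b * adj w)) \<in> projs M" using LM(1) by (simp add: is_sup_def)
  have "\<theta> (rp (e + (a + b))) = rp (\<theta> e + (a' + b'))"
    using LM(2) LN(2) inf_transfer[OF 5 projs_add[OF M e f orths(1)]] 4 add[OF e f orths(1)] by simp
  then show ?thesis
    unfolding good_def using aD bD by (simp add: vN_closed M N distrib_left distrib_right)
qed

lemma good_adj:
  assumes e: "e \<in> projs M" and f: "f \<in> projs M" and ef: "e * f = 0"
    and a: "good e a a'" "f * a = a"
  shows "good f (- adj a) (- adj a')"
proof -
  note aD = goodD[OF a(1)]
  have ef': "\<theta> e * \<theta> f = 0" using orth[OF e f] ef by simp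
  have fe: "f * e = 0" "\<theta> f * \<theta> e = 0"
    using proj_comm_zero[OF e f ef] proj_comm_zero[OF proj[OF e] proj[OF f] ef'] by auto
  have a': "\<theta> f * a' = a'" by (rule good_range[OF e f ef a(2,1)])
  have r: "rp (e + a) \<in> projs M" by (rule graph_projs[OF e aD(1)])
  have s: "e + f \<in> projs M" by (rule projs_add[OF M e f ef])
  have "(e + f) * rp (e + a) = rp (e + a)"
    by (rule rp_le) (simp add: algebra_simps projsD[OF e] fe aD a)
  then have le: "rp (e + a) * (e + f) = rp (e + a)" using proj_comm_le[OF r s] by simp
  have "\<theta> (rp (f - adj a)) = \<theta> (e + f) - \<theta> (rp (e + a))"
    using diff[OF s r le] graph_compl[OF e f ef aD(2) a(2)] by simp
  also have "\<dots> = \<theta> e + \<theta> f - rp (\<theta> e + a')" using add[OF e f ef] aD(7) by simp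
  also have "\<dots> = rp (\<theta> f - adj a')" by (rule graph_compl[OF proj[OF e] proj[OF f] ef' aD(5) a'])
  finally have 1: "\<theta> (rp (f - adj a)) = rp (\<theta> f - adj a')" .
  have "adj a * f = adj a" "adj a' * \<theta> f = adj a'"
    using arg_cong[OF a(2), of adj] arg_cong[OF a', of adj]
    by (simp_all add: adj_mult projsD[OF f] projsD[OF proj[OF f]])
  moreover have "e * adj a = adj a" "\<theta> e * adj a' = adj a'"
    using arg_cong[OF aD(2), of adj] arg_cong[OF aD(5), of adj]
    by (simp_all add: adj_mult projsD[OF e] projsD[OF proj[OF e]])
  then have "f * adj a = 0" "\<theta> f * adj a' = 0"
    using fe projsD(3)[OF f] projsD(3)[OF proj[OF f]] by (blast intro: mult_zero_between)+
  ultimately show ?thesis unfolding good_def using 1 aD by (simp add: vN_closed M N)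
qed

end

section \<open>Frames\<close>

text \<open>Three orthogonal equivalent projections \<open>e\<close>, \<open>v * adj v\<close>,
  \<open>w * adj w\<close>, given by the first column of a system of 3 by 3 matrix units.\<close>

definition frame :: "'a::complex_hilbert_space bop set \<Rightarrow> 'a bop \<Rightarrow> 'a bop \<Rightarrow> 'a bop \<Rightarrow> bool" where
  "frame M e v w \<longleftrightarrow> e \<in> projs M \<and> v \<in> M \<and> w \<in> M \<and> adj v * v = e \<and> adj w * w = e \<and>
    e * v = 0 \<and> e * w = 0 \<and> adj v * w = 0"

lemma isometry_support:
  assumes "adj v * v = e" "e * e = e" shows "v * e = v"
proof -
  have e: "adj e = e" by (metis adj_adj adj_mult assms(1))
  have "adj (v - v * e) * (v - v * e) = 0"
    by (simp add: adj_diff adj_mult algebra_simps e assms mult_eq_assoc[OF assms(1)])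
  then show ?thesis by simp
qed

lemma isometry_tripotent: "adj v * v = e \<Longrightarrow> e * e = e \<Longrightarrow> v * adj v * v = v"
  using isometry_support[of v e] by (simp add: mult.assoc)

lemma bop_double_cancel: "a + a = b + b \<Longrightarrow> a = b" for a b :: "'a::complex_hilbert_space bop"
  by (metis bop_half_double)

lemma frameD:
  assumes "frame M e v w"
  shows "e \<in> projs M" "v \<in> M" "w \<in> M" "adj v * v = e" "adj w * w = e" "e * v = 0" "e * w = 0"
    "adj v * w = 0" "adj w * v = 0" "v * e = v" "w * e = w" "adj v * e = 0" "adj w * e = 0"
    "e * adj v = adj v" "e * adj w = adj w" "e * e = e" "adj e = e" "v * v = 0" "w * w = 0"
    "v * w = 0" "w * v = 0"
proof -
  show *: "e \<in> projs M" "v \<in> M" "w \<in> M" "adj v * v = e" "adj w * w = e" "e * v = 0" "e * w = 0"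
    "adj v * w = 0"
    using assms by (auto simp: frame_def)
  show ee: "e * e = e" "adj e = e" using *(1) by (auto simp: projsD)
  show "adj w * v = 0" using mult_zero_adj[OF *(8)] by simp
  show ve: "v * e = v" "w * e = w" using isometry_support *(4,5) ee by blast+
  show "adj v * e = 0" "adj w * e = 0"
    using mult_zero_adj[OF *(6)] mult_zero_adj[OF *(7)] by (simp_all add: ee)
  show "e * adj v = adj v" "e * adj w = adj w"
    using arg_cong[OF ve(1), of adj] arg_cong[OF ve(2), of adj] by (simp_all add: adj_mult ee)
  show "v * v = 0" "w * w = 0" "v * w = 0" "w * v = 0"
    using mult_eq_assoc[OF ve(1)] mult_eq_assoc[OF ve(2)] *(6,7) by (metis mult_zero_right)+
qed

lemma frame_swap: "frame M e v w \<Longrightarrow> frame M e w v"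
  unfolding frame_def by (metis adj_adj adj_mult adj_zero)

lemma frame_uminus: "von_neumann_algebra M \<Longrightarrow> frame M e v w \<Longrightarrow> frame M e (- v) w"
  unfolding frame_def by (simp add: adj_minus vN_minus)

text \<open>The diagonals \<open>x + y\<close> and \<open>x - y\<close> are orthogonal and together
  span the ranges of \<open>x\<close> and \<open>y\<close>.\<close>

lemma rp_sum_diff:
  assumes p: "p * p = p" and x: "adj x * x = p" and y: "adj y * y = p" and xy: "adj x * y = 0"
  shows "rp (x + y) + rp (x - y) = x * adj x + y * adj y" (is "?r = ?s")
proof -
  have yx: "adj y * x = 0" using mult_zero_adj[OF xy] by simp
  have xp: "x * p = x" "y * p = y" using isometry_support x y p by blast+
  have o: "rp (x + y) * (x - y) = 0" "rp (x - y) * (x + y) = 0"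
    by (rule rp_least_left, simp add: adj_add adj_diff algebra_simps x y xy yx)+
  have "?r * (x + y) = x + y" "?r * (x - y) = x - y"
    by (simp_all only: distrib_right o rp_mult add_0 add_0_right)
  then have "?r * (x + y) + ?r * (x - y) = x + x" "?r * (x + y) - ?r * (x - y) = y + y"
    by simp_all
  then have "?r * x + ?r * x = x + x" "?r * y + ?r * y = y + y"
    by (simp_all add: distrib_left right_diff_distrib)
  then have rx: "?r * x = x" "?r * y = y" by (blast intro: bop_double_cancel)+
  have rs: "?r * ?s = ?s"
    unfolding distrib_left[of ?r] mult.assoc[symmetric] rx by (rule refl)
  have "?s * (x + y) = x + y" "?s * (x - y) = x - y"
    by (simp_all add: algebra_simps x y xy yx xp)
  then have "?s * rp (x + y) = rp (x + y) \<and> ?s * rp (x - y) = rp (x - y)" by (blast intro: rp_le)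
  then have sr: "?s * ?r = ?r" unfolding distrib_left[of ?s] by simp
  have "adj ?r = ?r" "adj ?s = ?s" by (simp_all add: adj_add adj_rp adj_mult)
  then show ?thesis using rs sr by (metis adj_mult)
qed

context ortho_iso
begin

text \<open>
  In the coordinates of the frame, \<open>x\<close>, \<open>y\<close> below are the lines spanned by \<open>(1, 1, 1)\<close> and
  \<open>(1, 1, -1)\<close>.  They are orthogonal to \<open>(1, -1, 0)\<close>, to one of \<open>(1, 0, \<plusminus>1)\<close> and to one of
  \<open>(0, 1, \<plusminus>1)\<close> each, while \<open>(1, 1, 0)\<close> is orthogonal to neither of them; these relations,
  preserved by \<open>\<theta>\<close>, force the image of \<open>(1, 1, 0)\<close> to make the angle \<open>\<pi>/4\<close> with the axes.
\<close>

lemma diagonal_compression_zero: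
  assumes fr: "frame M e v w"
  shows "\<theta> (rp (e + v)) * (\<theta> e - \<theta> (v * adj v)) * \<theta> (rp (e + v)) = 0"
proof -
  note F = frameD[OF fr]
  note r = F(4-16) F(18-21) F(4-16)[THEN mult_eq_assoc] F(18-21)[THEN mult_eq_assoc] F(17)
  define q where "q = v * adj v"
  define s where "s = w * adj w"
  have P: "e \<in> projs M" "q \<in> projs M" "s \<in> projs M"
    unfolding q_def s_def using F isometry_tripotent projs_tripotent_left[OF M] by blast+
  have [intro]: "rp T \<in> projs M" if "T \<in> M" for T using rp_projs[OF M that] .
  have eM: "e \<in> M" by (rule projsD(1)[OF F(1)])
  define A where "A = rp (e + v)"
  define A2 where "A2 = rp (e - v)"
  define B where "B = rp (e + w)"
  define B2 where "B2 = rp (e - w)"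
  define C where "C = rp (v + w)"
  define C2 where "C2 = rp (v - w)"
  define x where "x = rp (e + v + w)"
  define y where "y = rp (e + v - w)"
  have R: "A \<in> projs M" "A2 \<in> projs M" "B \<in> projs M" "B2 \<in> projs M" "C \<in> projs M" "C2 \<in> projs M"
    "x \<in> projs M" "y \<in> projs M"
    unfolding A_def A2_def B_def B2_def C_def C2_def x_def y_def
    by (intro rp_projs M vN_add[OF M] vN_diff[OF M] eM F(2,3))+
  have eqs: "A + A2 = e + q" "B + B2 = e + s" "C + C2 = q + s"
    unfolding A_def A2_def B_def B2_def C_def C2_def q_def s_def
    using rp_sum_diff[of e e v] rp_sum_diff[of e e w] rp_sum_diff[of e v w] r by simp_all
  have o: "x * A2 = 0" "y * A2 = 0" "x * B2 = 0" "B * y = 0" "x * C2 = 0" "C * y = 0"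
    "A * A2 = 0" "B * B2 = 0" "C * C2 = 0" "e * q = 0" "e * s = 0" "q * s = 0"
    unfolding A_def A2_def B_def B2_def C_def C2_def x_def y_def q_def s_def
    by (intro rp_orth, simp add: adj_add adj_diff algebra_simps r)+
      (simp_all add: algebra_simps r)
  have A2y: "A2 * y = 0" using proj_comm_zero[OF R(8,2) o(2)] .
  have img: "\<theta> A + \<theta> A2 = \<theta> e + \<theta> q" "\<theta> B + \<theta> B2 = \<theta> e + \<theta> s" "\<theta> C + \<theta> C2 = \<theta> q + \<theta> s"
    using add[OF R(1,2) o(7)] add[OF R(3,4) o(8)] add[OF R(5,6) o(9)]
      add[OF P(1,2) o(10)] add[OF P(1,3) o(11)] add[OF P(2,3) o(12)] eqs by simp_all
  have o': "\<theta> x * \<theta> A2 = 0" "\<theta> A2 * \<theta> y = 0" "\<theta> x * \<theta> B2 = 0" "\<theta> B * \<theta> y = 0" "\<theta> x * \<theta> C2 = 0"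
    "\<theta> C * \<theta> y = 0" "\<theta> e * \<theta> q = 0"
    using o A2y orth R P by auto
  have qe': "\<theta> q * \<theta> e = 0" using proj_comm_zero[OF proj[OF P(1)] proj[OF P(2)] o'(7)] .
  define \<sigma> where "\<sigma> = \<theta> e - \<theta> q"
  \<comment> \<open>\<open>e + s\<close> and \<open>q + s\<close> are sums of two diagonals of which
    one is orthogonal to \<open>x\<close> and the other to \<open>y\<close>; the difference of the
    two identities removes \<open>s\<close>.\<close>
  have 1: "\<theta> x * (\<theta> e + \<theta> s) * \<theta> y = 0" "\<theta> x * (\<theta> q + \<theta> s) * \<theta> y = 0"
    by (simp_all add: img(2,3)[symmetric] distrib_left distrib_right o' mult.assoc)
  have xsy: "\<theta> x * \<sigma> * \<theta> y = \<theta> x * (\<theta> e + \<theta> s) * \<theta> y - \<theta> x * (\<theta> q + \<theta> s) * \<theta> y"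
    by (simp add: \<sigma>_def algebra_simps)
  have \<sigma>: "\<sigma> = (\<theta> e + \<theta> q) * \<sigma> * (\<theta> e + \<theta> q)"
    by (simp add: \<sigma>_def algebra_simps o' qe' projsD(3)[OF proj[OF P(1)]] projsD(3)[OF proj[OF P(2)]])
  \<comment> \<open>Both \<open>x\<close> and \<open>y\<close> are orthogonal to \<open>A2\<close>,
    so they see the plane \<open>e + q\<close> only through \<open>A\<close>.\<close>
  have xA: "\<theta> x * (\<theta> e + \<theta> q) = \<theta> x * \<theta> A" "(\<theta> e + \<theta> q) * \<theta> y = \<theta> A * \<theta> y"
    by (simp_all add: img(1)[symmetric] distrib_left distrib_right o')
  define Q where "Q = \<theta> A * \<sigma> * \<theta> A"
  have "\<theta> x * \<sigma> * \<theta> y = (\<theta> x * (\<theta> e + \<theta> q)) * \<sigma> * ((\<theta> e + \<theta> q) * \<theta> y)"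
    by (subst \<sigma>) (simp only: mult.assoc)
  also have "\<dots> = \<theta> x * (Q * \<theta> y)" unfolding xA Q_def by (simp only: mult.assoc)
  finally have xQy: "\<theta> x * (Q * \<theta> y) = 0" using xsy 1 by simp
  \<comment> \<open>No nonzero part of \<open>\<theta> A\<close> is orthogonal to
    \<open>\<theta> x\<close> or to \<open>\<theta> y\<close>; this is applied twice to strip the
    outer factors from \<open>\<theta> x * (Q * \<theta> y) = 0\<close>.\<close>
  have triv: "r = 0" if r: "r \<in> projs N" "\<theta> A * r = r" and z: "z = w \<or> z = - w"
      and zr: "\<theta> (rp (e + v + z)) * r = 0" for r z
  proof -
    have zM: "z \<in> M" using z F(3) vN_minus[OF M] by auto
    have T: "rp (e + v + z) \<in> projs M" by (intro rp_projs M vN_add[OF M] eM F(2) zM)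
    obtain t where t: "t \<in> projs M" "\<theta> t = r" using surj r(1) by blast
    have At: "A * t = t" using le_iff[OF t(1) R(1)] r(2) t(2) by simp
    have "rp (e + v + z) * t = 0" using orth[OF T t(1)] zr t(2) by simp
    then have yt: "adj (e + v + z) * t = 0"
      using arg_cong[OF rp_mult[of "e + v + z"], of adj]
      by (metis adj_mult adj_rp mult.assoc mult_zero_right)
    have "adj z * (e + v) = 0" using z by (auto simp: adj_minus algebra_simps r F)
    then have zA: "adj z * A = 0" unfolding A_def by (rule rp_least)
    have "adj (e + v + z) * t = adj (e + v) * t + adj z * A * t"
      using At by (simp add: adj_add distrib_right mult.assoc)
    then have "adj (e + v) * t = 0" using yt zA by simp
    then have "A * t = 0" unfolding A_def by (rule rp_least_left)
    then show ?thesis using At t(2) by simp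
  qed
  have QN: "Q \<in> N" unfolding Q_def \<sigma>_def
    by (intro vN_mult[OF N] vN_diff[OF N] projsD(1)[OF proj] R P)
  have AQ: "\<theta> A * Q = Q" unfolding Q_def by (simp add: mult.assoc projsD(3,4)[OF proj[OF R(1)]])
  have "rp (Q * \<theta> y) = 0"
  proof (rule triv[of _ w])
    show "rp (Q * \<theta> y) \<in> projs N" by (intro rp_projs N vN_mult QN projsD(1)[OF proj] R)
    show "\<theta> A * rp (Q * \<theta> y) = rp (Q * \<theta> y)" by (rule rp_le) (simp add: mult.assoc[symmetric] AQ)
    show "\<theta> (rp (e + v + w)) * rp (Q * \<theta> y) = 0" using xQy unfolding x_def by (rule rp_least)
  qed simp
  then have "Q * \<theta> y = 0" by (simp add: rp_eq_0_iff)
  moreover have "adj Q = Q" unfolding Q_def \<sigma>_def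
    by (simp add: adj_mult adj_diff mult.assoc projsD(2)[OF proj] R P)
  ultimately have yQ: "\<theta> y * Q = 0" using mult_zero_adj[of Q "\<theta> y"] projsD(2)[OF proj[OF R(8)]] by simp
  have "rp Q = 0"
  proof (rule triv[of _ "- w"])
    show "rp Q \<in> projs N" by (rule rp_projs[OF N QN])
    show "\<theta> A * rp Q = rp Q" by (rule rp_le[OF AQ])
    show "\<theta> (rp (e + v + - w)) * rp Q = 0" using yQ unfolding y_def by (simp add: rp_least)
  qed simp
  then show ?thesis by (simp add: rp_eq_0_iff Q_def \<sigma>_def A_def q_def)
qed

text \<open>In the two by two picture of \<open>a\<close> relative to \<open>f1\<close> and
  \<open>f2\<close>, the vanishing compressions say that the diagonal blocks are one half; then the
  off-diagonal block is half of a partial isometry from \<open>f1\<close> onto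
  \<open>f2\<close>.\<close>

lemma good_frame:
  assumes fr: "frame M e v w"
  shows "\<exists>v'. good e v v' \<and> adj v' * v' = \<theta> e \<and> v' * adj v' = \<theta> (v * adj v)"
proof -
  note F = frameD[OF fr]
  define q where "q = v * adj v"
  have e: "e \<in> projs M" and q: "q \<in> projs M"
    unfolding q_def using F isometry_tripotent projs_tripotent_left[OF M] by blast+
  have eq: "e * q = 0" by (simp add: q_def mult.assoc[symmetric] F)
  have AM: "rp (e + v) \<in> projs M" "rp (e - v) \<in> projs M"
    by (intro rp_projs M vN_add[OF M] vN_diff[OF M] projsD(1)[OF e] F(2))+
  define a where "a = \<theta> (rp (e + v))"
  define b where "b = \<theta> (rp (e - v))"
  define f1 where "f1 = \<theta> e"
  define f2 where "f2 = \<theta> q"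
  define \<sigma> where "\<sigma> = f1 - f2"
  have f: "f1 \<in> projs N" "f2 \<in> projs N" "a \<in> projs N" "b \<in> projs N"
    unfolding f1_def f2_def a_def b_def using proj e q AM by auto
  have f12: "f1 * f2 = 0" using orth[OF e q] eq by (simp add: f1_def f2_def)
  have f21: "f2 * f1 = 0" using proj_comm_zero[OF f(1,2) f12] .
  note fD = projsD(2-4)[OF f(1)] projsD(2-4)[OF f(2)] projsD(2-4)[OF f(3)] projsD(2-4)[OF f(4)]
  have sum: "rp (e + v) + rp (e - v) = e + q"
    unfolding q_def using rp_sum_diff[of e e v] F by simp
  have "rp (e + v) * rp (e - v) = 0"
    by (rule rp_orth) (simp add: adj_add algebra_simps F)
  then have ab: "a + b = f1 + f2"
    using add[OF AM] add[OF e q eq] sum by (simp add: a_def b_def f1_def f2_def)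
  have "a * \<sigma> * a = 0"
    using diagonal_compression_zero[OF fr] by (simp add: a_def \<sigma>_def f1_def f2_def q_def)
  moreover have "b * \<sigma> * b = 0"
    using diagonal_compression_zero[OF frame_uminus[OF M fr]]
    by (simp add: b_def \<sigma>_def f1_def f2_def q_def adj_minus)
  moreover have \<sigma>F: "\<sigma> * (a + b) = \<sigma>" "(a + b) * \<sigma> = \<sigma>"
    unfolding ab \<sigma>_def by (simp_all add: algebra_simps fD f12 f21)
  \<comment> \<open>\<sigma> has no diagonal blocks relative to \<open>a\<close> and
    \<open>b\<close>, hence anticommutes with \<open>a - b\<close>; this is the same condition
    written with \<open>a\<close> alone.\<close>
  ultimately have as: "\<sigma> * a + a * \<sigma> = \<sigma>"
  proof -
    assume 1: "a * \<sigma> * a = 0" and 2: "b * \<sigma> * b = 0"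
    have "\<sigma> * a = (a + b) * \<sigma> * a" by (simp only: \<sigma>F)
    then have 3: "\<sigma> * a = b * \<sigma> * a" by (simp only: distrib_right 1 add_0)
    have "a * \<sigma> = a * (\<sigma> * (a + b))" by (simp only: \<sigma>F)
    then have 4: "a * \<sigma> = a * \<sigma> * b" by (simp only: distrib_left mult.assoc[symmetric] 1 add_0)
    have "\<sigma> = (a + b) * \<sigma> * (a + b)" by (simp only: \<sigma>F)
    also have "\<dots> = b * \<sigma> * a + a * \<sigma> * b"
      by (simp only: distrib_left distrib_right 1 2 add_0 add_0_right)
    finally show ?thesis using 3 4 by simp
  qed
  have h1: "f1 * a * f1 + f1 * a * f1 = f1"
  proof -
    have "f1 * (\<sigma> * a + a * \<sigma>) * f1 = f1 * \<sigma> * f1" by (simp only: as)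
    then show ?thesis by (simp add: \<sigma>_def algebra_simps fD f12 f21 mult_eq_assoc[OF f12])
  qed
  have h2: "f2 * a * f2 + f2 * a * f2 = f2"
  proof -
    have "f2 * (\<sigma> * a + a * \<sigma>) * f2 = f2 * \<sigma> * f2" by (simp only: as)
    then have "- (f2 * a * f2 + f2 * a * f2) = - f2"
      by (simp add: \<sigma>_def algebra_simps fD f12 f21 mult_eq_assoc[OF f21])
    then show ?thesis by (simp only: neg_equal_iff_equal)
  qed
  \<comment> \<open>\<open>Y\<close> is half of \<open>a\<close>, since \<open>a * f1 * a\<close>
    and \<open>a * f2 * a\<close> agree and add up to \<open>a\<close>.\<close>
  define Y where "Y = a * f1 * a"
  have Y2: "Y = a * f2 * a"
    using \<open>a * \<sigma> * a = 0\<close> by (simp add: Y_def \<sigma>_def algebra_simps)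
  have "a * b = 0" using orth[OF AM] \<open>rp (e + v) * rp (e - v) = 0\<close> by (simp add: a_def b_def)
  then have "b * a = 0" using proj_comm_zero[OF f(3,4)] by simp
  then have Fa: "(f1 + f2) * a = a" by (simp add: ab[symmetric] distrib_right fD)
  have "a * ((f1 + f2) * a) = a" by (simp add: Fa fD)
  then have YY: "Y + Y = a" using Y2 by (simp add: Y_def[symmetric] distrib_left distrib_right mult.assoc)
      (simp add: Y_def mult.assoc)
  define X where "X = f2 * a * f1"
  \<comment> \<open>The graph projection of an isometry from \<open>f1\<close> onto
    \<open>f2\<close> has half of that isometry as its lower left block; doubling recovers
    it.\<close>
  define v' where "v' = X + X"
  have "adj X * X = f1 * (a * f2 * a) * f1" "X * adj X = f2 * (a * f1 * a) * f2"
    unfolding X_def by (simp_all add: adj_mult fD mult.assoc)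
  then have X: "adj X * X = f1 * Y * f1" "X * adj X = f2 * Y * f2"
    unfolding Y2[symmetric] Y_def[symmetric] .
  have v'1: "adj v' * v' = f1"
  proof -
    have "adj v' * v' = (adj X * X + adj X * X) + (adj X * X + adj X * X)"
      by (simp add: v'_def adj_add algebra_simps)
    also have "adj X * X + adj X * X = f1 * a * f1"
      by (simp add: X YY[symmetric] distrib_left distrib_right)
    finally show ?thesis by (simp add: h1)
  qed
  have v'2: "v' * adj v' = f2"
  proof -
    have "v' * adj v' = (X * adj X + X * adj X) + (X * adj X + X * adj X)"
      by (simp add: v'_def adj_add algebra_simps)
    also have "X * adj X + X * adj X = f2 * a * f2"
      by (simp add: X YY[symmetric] distrib_left distrib_right)
    finally show ?thesis by (simp add: h2)
  qed
  have g: "f1 + v' = a * f1 + a * f1"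
  proof -
    have h: "a * f1 = f1 * a * f1 + X" using arg_cong[OF Fa, of "\<lambda>z. z * f1"]
      by (simp add: X_def distrib_right)
    have "a * f1 + a * f1 = (f1 * a * f1 + X) + (f1 * a * f1 + X)"
      by (rule arg_cong2[of _ _ _ _ "(+)", OF h h])
    also have "\<dots> = (f1 * a * f1 + f1 * a * f1) + (X + X)" by (simp add: add_ac)
    finally have "a * f1 + a * f1 = (f1 * a * f1 + f1 * a * f1) + (X + X)" .
    then show ?thesis by (simp add: h1 v'_def)
  qed
  have "rp (f1 + v') = a"
  proof (rule rp_eqI)
    show "adj a = a" by (simp add: fD)
    show "a * (f1 + v') = f1 + v'" unfolding g by (simp add: distrib_left fD)
    fix c assume "c * (f1 + v') = 0"
    then have "c * (a * f1) + c * (a * f1) = 0" unfolding g distrib_left .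
    then have "c * (a * f1) = 0" by simp
    then have "c * Y = 0" by (simp add: Y_def mult.assoc[symmetric])
    then show "c * a = 0" by (simp add: YY[symmetric] distrib_left)
  qed
  moreover have "v' * f1 = v'" "f1 * v' = 0"
    by (simp_all add: v'_def X_def algebra_simps fD mult_eq_assoc[OF f12])
  moreover have "v' \<in> N" unfolding v'_def X_def by (intro vN_add[OF N] vN_mult[OF N] projsD(1)[OF f(1)] projsD(1)[OF f(2)] projsD(1)[OF f(3)])
  ultimately have "good e v v'"
    unfolding good_def using F by (simp add: f1_def[symmetric] a_def[symmetric])
  then show ?thesis using v'1 v'2 unfolding f1_def f2_def q_def by blast
qed

text \<open>Restricting to the initial projection \<open>p\<close> of \<open>v\<close> makes
  \<open>v\<close> and \<open>w * p\<close> the legs of a frame; over \<open>e - p\<close> the graph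
  of \<open>v\<close> is trivial on both sides of \<theta>.\<close>

lemma good_tripotent:
  assumes e: "e \<in> projs M" and v: "v \<in> M" "v * adj v * v = v" "v * e = v" "e * v = 0"
    and w: "w \<in> M" "adj w * w = e" "e * w = 0" "adj v * w = 0"
  shows "\<exists>v'. good e v v'"
proof -
  define p where "p = adj v * v"
  have p: "p \<in> projs M" unfolding p_def by (rule projs_tripotent_right[OF M v(1,2)])
  have pe: "p * e = p" by (simp add: p_def mult.assoc v)
  have ep: "e * p = p" using proj_comm_le[OF p e] pe by simp
  have vp: "v * p = v" by (simp add: p_def mult.assoc[symmetric] v)
  have vv: "v * v = 0" "v * w = 0" using mult_eq_assoc[OF v(3)] v(4) w(3) by (metis mult_zero_right)+
  have "frame M p v (w * p)"
    unfolding frame_def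
  proof (intro conjI)
    show "adj v * v = p" by (simp add: p_def)
    show "adj (w * p) * (w * p) = p" by (simp add: adj_mult projsD[OF p] mult.assoc mult_eq_assoc[OF w(2)] ep)
    show "p * v = 0" "p * (w * p) = 0" by (simp_all add: p_def mult.assoc vv mult_eq_assoc[OF vv(2)])
    show "adj v * (w * p) = 0" by (simp add: mult_eq_assoc[OF w(4)])
  qed (use p v w in \<open>auto intro: vN_mult M projsD(1)\<close>)
  then obtain v' where v': "good p v v'" "adj v' * v' = \<theta> p" "v' * adj v' = \<theta> (v * adj v)"
    using good_frame by blast
  have q: "v * adj v \<in> projs M" by (rule projs_tripotent_left[OF M v(1,2)])
  have "e * (v * adj v) = 0" by (simp add: mult.assoc[symmetric] v)
  then have o: "\<theta> e * (v' * adj v') = 0" using orth[OF e q] v'(3) by simp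
  have "\<theta> e * v' = \<theta> e * (v' * adj v') * v'"
    using isometry_tripotent[OF v'(2)] projsD(3)[OF proj[OF p]] by (simp add: mult.assoc)
  then have ev': "\<theta> e * v' = 0" using o by simp
  have epM: "e - p \<in> projs M" by (rule projs_diff[OF M e p pe])
  note G = goodD[OF v'(1)]
  have pe': "\<theta> p * \<theta> e = \<theta> p" using le_iff[OF p e] ep proj_comm_le[OF proj[OF p] proj[OF e]] by simp
  have "rp (p + v) * (e - p) = 0"
  proof (rule rp_least_left)
    have "adj v * e = 0" using mult_zero_adj[OF v(4)] by (simp add: projsD[OF e])
    moreover have "adj v * p = 0" using mult_zero_adj[OF G(3)] by (simp add: projsD[OF p])
    ultimately show "adj (p + v) * (e - p) = 0" by (simp add: adj_add algebra_simps projsD[OF p] pe)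
  qed
  then have "\<theta> (rp (e + v)) = \<theta> (rp (p + v)) + \<theta> (e - p)"
    using graph_support_split[OF e p pe vp v(4)] add[OF graph_projs[OF p v(1)] epM] by simp
  also have "\<dots> = rp (\<theta> p + v') + (\<theta> e - \<theta> p)" using G(7) diff[OF e p pe] by simp
  also have "\<dots> = rp (\<theta> e + v')"
    by (rule graph_support_split[OF proj[OF e] proj[OF p] pe' G(5) ev', symmetric])
  finally have "\<theta> (rp (e + v)) = rp (\<theta> e + v')" .
  moreover have "v' * \<theta> e = v'" using mult_eq_assoc[OF G(5), of "\<theta> e"] by (simp add: pe' G)
  ultimately show ?thesis unfolding good_def using v G ev' by blast
qed

text \<open>Partial isometries generate \<open>f M e\<close> additively, and the spare isometry
  \<open>w\<close> with range orthogonal to \<open>f\<close> is what the graph formula for sums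
  requires.\<close>

lemma good_all:
  assumes e: "e \<in> projs M" and f: "f \<in> projs M" and ef: "e * f = 0"
    and w: "good e w w'" "adj w * w = e" "adj w' * w' = \<theta> e" "w' * adj w' = \<theta> (w * adj w)" "f * w = 0"
    and a: "a \<in> M" "f * a = a" "a * e = a"
  shows "\<exists>a'. good e a a'"
proof -
  note wD = goodD[OF w(1)]
  have g: "w * adj w \<in> projs M"
    by (rule projs_tripotent_left[OF M wD(1) isometry_tripotent[OF w(2) projsD(3)[OF e]]])
  have eg: "e * (w * adj w) = 0" "f * (w * adj w) = 0"
    using wD w by (simp_all add: mult.assoc[symmetric])
  have ev: "e * v = 0" if "f * v = v" for v using mult_eq_assoc[OF ef, of v] that by simp
  show ?thesis using M a(1) a(2,3) projsD(2)[OF e]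
  proof (induction rule: vN_tripotent_induct)
    case (tripotent v)
    have "adj w * f = 0" using mult_zero_adj[OF w(5)] by (simp add: projsD[OF f])
    then have "adj w * v = 0" using tripotent(3) by (metis mult.assoc mult_zero_left)
    then have "adj v * w = 0" using mult_zero_adj by fastforce
    then show ?case using good_tripotent[OF e tripotent(1,2,4) ev[OF tripotent(3)] wD(1) w(2) wD(3)] by blast
  next
    case (add a b)
    then show ?case using good_add[OF e f g ef eg _ _ _ _ w(1,2) refl w(3,4)] by blast
  qed
qed

end

section \<open>Isomorphisms of one-sided ideals\<close>

text \<open>
  Only equality of the products \<open>x\<^sup>* y\<close> is transferred, so \<open>\<Theta>\<close> need not come with an isomorphism of
  the corners \<open>e M e\<close> and \<open>f N f\<close>.
\<close>

definition module_iso :: "'a::complex_hilbert_space bop set \<Rightarrow> 'a bop \<Rightarrow>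
    'b::complex_hilbert_space bop set \<Rightarrow> 'b bop \<Rightarrow> ('a bop \<Rightarrow> 'b bop) \<Rightarrow> bool" where
  "module_iso M e N f \<Theta> \<longleftrightarrow> bij_betw \<Theta> {x\<in>M. x * e = x} {y\<in>N. y * f = y} \<and>
    (\<forall>x y. x \<in> M \<and> x * e = x \<and> y \<in> M \<and> y * e = y \<longrightarrow> \<Theta> (x + y) = \<Theta> x + \<Theta> y) \<and>
    (\<forall>x y x' y'. x \<in> M \<and> x * e = x \<and> y \<in> M \<and> y * e = y \<and> x' \<in> M \<and> x' * e = x' \<and> y' \<in> M \<and> y' * e = y' \<longrightarrow>
      (adj (\<Theta> x) * \<Theta> y = adj (\<Theta> x') * \<Theta> y' \<longleftrightarrow> adj x * y = adj x' * y'))"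

text \<open>The ranges of the \<open>m * e\<close> span a dense subspace; for a projection
  \<open>e\<close> this means central support 1.\<close>

definition full :: "'a::complex_hilbert_space bop set \<Rightarrow> 'a bop \<Rightarrow> bool" where
  "full M e \<longleftrightarrow> (\<forall>b. (\<forall>m\<in>M. b * m * e = 0) \<longrightarrow> b = 0)"

lemma fullD: "full M e \<Longrightarrow> (\<And>m. m \<in> M \<Longrightarrow> b * m * e = 0) \<Longrightarrow> b = 0"
  unfolding full_def by blast

lemma module_isoD:
  assumes "module_iso M e N f \<Theta>"
  shows "bij_betw \<Theta> {x\<in>M. x * e = x} {y\<in>N. y * f = y}"
    "\<And>x. x \<in> M \<Longrightarrow> x * e = x \<Longrightarrow> \<Theta> x \<in> N" "\<And>x. x \<in> M \<Longrightarrow> x * e = x \<Longrightarrow> \<Theta> x * f = \<Theta> x"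
    "\<And>x y. x \<in> M \<Longrightarrow> x * e = x \<Longrightarrow> y \<in> M \<Longrightarrow> y * e = y \<Longrightarrow> \<Theta> (x + y) = \<Theta> x + \<Theta> y"
    "\<And>x y x' y'. x \<in> M \<Longrightarrow> x * e = x \<Longrightarrow> y \<in> M \<Longrightarrow> y * e = y \<Longrightarrow> x' \<in> M \<Longrightarrow> x' * e = x' \<Longrightarrow>
      y' \<in> M \<Longrightarrow> y' * e = y' \<Longrightarrow>
      adj (\<Theta> x) * \<Theta> y = adj (\<Theta> x') * \<Theta> y' \<longleftrightarrow> adj x * y = adj x' * y'"
    "\<And>y. y \<in> N \<Longrightarrow> y * f = y \<Longrightarrow> \<exists>x\<in>M. x * e = x \<and> \<Theta> x = y"
proof -
  show b: "bij_betw \<Theta> {x\<in>M. x * e = x} {y\<in>N. y * f = y}" using assms by (simp add: module_iso_def)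
  show "\<Theta> x \<in> N" "\<Theta> x * f = \<Theta> x" if "x \<in> M" "x * e = x" for x
    using bij_betwE[OF b] that by auto
  show "\<exists>x\<in>M. x * e = x \<and> \<Theta> x = y" if "y \<in> N" "y * f = y" for y
  proof -
    have "y \<in> \<Theta> ` {x\<in>M. x * e = x}" using bij_betw_imp_surj_on[OF b] that by simp
    then show ?thesis by auto
  qed
qed (use assms in \<open>simp_all add: module_iso_def\<close>)

lemma module_iso_inv:
  assumes M: "von_neumann_algebra M" and m: "module_iso M e N f \<Theta>"
  shows "module_iso N f M e (inv_into {x\<in>M. x * e = x} \<Theta>)"
proof -
  note D = module_isoD[OF m]
  let ?i = "inv_into {x\<in>M. x * e = x} \<Theta>"
  have b: "bij_betw ?i {y\<in>N. y * f = y} {x\<in>M. x * e = x}" by (rule bij_betw_inv_into[OF D(1)])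
  have i: "?i y \<in> M" "?i y * e = ?i y" "\<Theta> (?i y) = y" if "y \<in> N" "y * f = y" for y
    using bij_betwE[OF b] that bij_betw_inv_into_right[OF D(1), of y] by auto
  have il: "?i (\<Theta> x) = x" if "x \<in> M" "x * e = x" for x
    using bij_betw_inv_into_left[OF D(1)] that by simp
  have "?i (x + y) = ?i x + ?i y" if xy: "x \<in> N" "x * f = x" "y \<in> N" "y * f = y" for x y
    using D(4)[OF i(1,2)[OF xy(1,2)] i(1,2)[OF xy(3,4)]] il[of "?i x + ?i y"]
      i[OF xy(1,2)] i[OF xy(3,4)] vN_add[OF M] by (simp add: distrib_right)
  moreover have "adj (?i x) * ?i y = adj (?i x') * ?i y' \<longleftrightarrow> adj x * y = adj x' * y'"
    if "x \<in> N" "x * f = x" "y \<in> N" "y * f = y" "x' \<in> N" "x' * f = x'" "y' \<in> N" "y' * f = y'" for x y x' y'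
    using D(5)[of "?i x" "?i y" "?i x'" "?i y'"] i that by simp
  ultimately show ?thesis using b unfolding module_iso_def by blast
qed

text \<open>A unitary \<open>u\<close> preserves the products \<open>adj x * y\<close>, so
  \<open>\<Theta> x\<close> and \<open>\<Theta> (u * x)\<close> have equal Gram operators and an
  isometric extension implements \<open>u\<close>. Sums of unitaries give all of \<open>M\<close>;
  fullness makes the multiplier unique.\<close>

lemma module_iso_left_mult:
  assumes M: "von_neumann_algebra M" and N: "von_neumann_algebra N" and f: "f \<in> projs N"
    and m: "module_iso M e N f \<Theta>" and full: "full N f" and a: "a \<in> M"
  shows "\<exists>!T. T \<in> N \<and> (\<forall>x\<in>M. x * e = x \<longrightarrow> T * \<Theta> x = \<Theta> (a * x))"
proof (rule ex_ex1I)
  note D = module_isoD[OF m]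
  have mM: "a * x \<in> M" "a * x * e = a * x" if "a \<in> M" "x \<in> M" "x * e = x" for a x
    using that vN_mult[OF M] by (simp_all add: mult.assoc)
  show "\<exists>T. T \<in> N \<and> (\<forall>x\<in>M. x * e = x \<longrightarrow> T * \<Theta> x = \<Theta> (a * x))"
    using M a
  proof (induction rule: vN_unitary_induct)
    case (unitary u)
    let ?S = "{(\<Theta> x, \<Theta> (u * x)) | x. x \<in> M \<and> x * e = x}"
    have "\<exists>T\<in>N. T * adj T * T = T \<and> (\<forall>(A, B)\<in>?S. T * A = B \<and> adj T * T * A = A) \<and>
      (\<forall>b. (\<forall>(A, B)\<in>?S. adj A * b = 0) \<longrightarrow> T * b = 0) \<and>
      (\<forall>b. (\<forall>(A, B)\<in>?S. b * B = 0) \<longrightarrow> b * T = 0)"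
    proof (rule ex_tripotent_extension[OF N])
      show "?S \<subseteq> N \<times> N" using D(2) mM[OF unitary(1)] by auto
      fix A B A' B' assume "(A, B) \<in> ?S" "(A', B') \<in> ?S"
      then obtain x y where x: "x \<in> M" "x * e = x" "A = \<Theta> x" "B = \<Theta> (u * x)"
        and y: "y \<in> M" "y * e = y" "A' = \<Theta> y" "B' = \<Theta> (u * y)" by blast
      have "adj (u * y) * (u * x) = adj y * x"
        by (simp add: adj_mult mult.assoc mult_eq_assoc[OF unitary(2)])
      then show "adj A' * A = adj B' * B"
        using D(5)[OF y(1,2) x(1,2) mM[OF unitary(1) y(1,2)] mM[OF unitary(1) x(1,2)]] x y by simp
    qed
    then obtain T where T: "T \<in> N" "\<forall>(A, B)\<in>?S. T * A = B \<and> adj T * T * A = A" by blast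
    have "T * \<Theta> x = \<Theta> (u * x)" if "x \<in> M" "x * e = x" for x
      using bspec[OF T(2), of "(\<Theta> x, \<Theta> (u * x))"] that by auto
    with T(1) show ?case by blast
  next
    case (add a b)
    then obtain S T where "S \<in> N" "\<forall>x\<in>M. x * e = x \<longrightarrow> S * \<Theta> x = \<Theta> (a * x)"
      "T \<in> N" "\<forall>x\<in>M. x * e = x \<longrightarrow> T * \<Theta> x = \<Theta> (b * x)" by blast
    then have "(S + T) * \<Theta> x = \<Theta> ((a + b) * x)" if "x \<in> M" "x * e = x" for x
      using D(4)[OF mM[OF add(1) that] mM[OF add(2) that]] that by (simp add: distrib_right)
    then show ?case using vN_add[OF N \<open>S \<in> N\<close> \<open>T \<in> N\<close>] by blast
  qed
  fix S T assume S: "S \<in> N \<and> (\<forall>x\<in>M. x * e = x \<longrightarrow> S * \<Theta> x = \<Theta> (a * x))"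
    and T: "T \<in> N \<and> (\<forall>x\<in>M. x * e = x \<longrightarrow> T * \<Theta> x = \<Theta> (a * x))"
  have "(S - T) * n * f = 0" if n: "n \<in> N" for n
  proof -
    have "n * f \<in> N" "n * f * f = n * f"
      using vN_mult[OF N n projsD(1)[OF f]] by (simp_all add: mult.assoc projsD[OF f])
    then obtain x where "x \<in> M" "x * e = x" "\<Theta> x = n * f" using D(6) by blast
    then have "S * (n * f) = T * (n * f)" using S T by metis
    then show ?thesis by (simp add: left_diff_distrib mult.assoc)
  qed
  then have "S - T = 0" by (rule fullD[OF full])
  then show "S = T" by simp
qed

text \<open>\<open>J a\<close> is the left multiplier corresponding to \<open>a\<close> under
  \<Theta>; uniqueness of multipliers yields the algebraic identities for \<open>J\<close>, and the
  inverse of \<Theta> yields surjectivity.\<close>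

lemma star_ring_iso_of_module_iso:
  assumes M: "von_neumann_algebra M" and N: "von_neumann_algebra N"
    and e: "e \<in> projs M" and f: "f \<in> projs N" and m: "module_iso M e N f \<Theta>"
    and full: "full M e" "full N f"
  shows "\<exists>J. bij_betw J M N \<and> (\<forall>a\<in>M. \<forall>b\<in>M. J (a + b) = J a + J b) \<and>
    (\<forall>a\<in>M. \<forall>b\<in>M. J (a * b) = J a * J b) \<and> (\<forall>a\<in>M. J (adj a) = adj (J a))"
proof -
  note D = module_isoD[OF m]
  define \<Psi> where "\<Psi> = inv_into {x\<in>M. x * e = x} \<Theta>"
  have m': "module_iso N f M e \<Psi>" unfolding \<Psi>_def by (rule module_iso_inv[OF M m])
  have \<Psi>\<Theta>: "\<Psi> (\<Theta> x) = x" if "x \<in> M" "x * e = x" for x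
    unfolding \<Psi>_def using bij_betw_inv_into_left[OF D(1)] that by simp
  have \<Theta>\<Psi>: "\<Theta> (\<Psi> y) = y" if "y \<in> N" "y * f = y" for y
    unfolding \<Psi>_def using bij_betw_inv_into_right[OF D(1)] that by simp
  have ex: "\<exists>!T. T \<in> N \<and> (\<forall>x\<in>M. x * e = x \<longrightarrow> T * \<Theta> x = \<Theta> (a * x))" if "a \<in> M" for a
    by (rule module_iso_left_mult[OF M N f m full(2) that])
  define J where "J a = (THE T. T \<in> N \<and> (\<forall>x\<in>M. x * e = x \<longrightarrow> T * \<Theta> x = \<Theta> (a * x)))" for a
  have J: "J a \<in> N" "\<And>x. x \<in> M \<Longrightarrow> x * e = x \<Longrightarrow> J a * \<Theta> x = \<Theta> (a * x)" if "a \<in> M" for a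
    using theI'[OF ex[OF that]] unfolding J_def by auto
  have J_eqI: "J a = T" if "a \<in> M" "T \<in> N" "\<And>x. x \<in> M \<Longrightarrow> x * e = x \<Longrightarrow> T * \<Theta> x = \<Theta> (a * x)" for a T
    unfolding J_def by (rule the1_equality[OF ex[OF that(1)]]) (use that in blast)
  have mM: "a * x \<in> M" "a * x * e = a * x" if "a \<in> M" "x \<in> M" "x * e = x" for a x
    using that vN_mult[OF M] by (simp_all add: mult.assoc)
  have Jadd: "J (a + b) = J a + J b" if ab: "a \<in> M" "b \<in> M" for a b
  proof (rule J_eqI)
    fix x assume x: "x \<in> M" "x * e = x"
    show "(J a + J b) * \<Theta> x = \<Theta> ((a + b) * x)"
      using D(4)[OF mM[OF ab(1) x] mM[OF ab(2) x]] by (simp add: distrib_right J ab x)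
  qed (intro vN_add M N J(1) ab)+
  have Jmult: "J (a * b) = J a * J b" if ab: "a \<in> M" "b \<in> M" for a b
  proof (rule J_eqI)
    fix x assume x: "x \<in> M" "x * e = x"
    show "J a * J b * \<Theta> x = \<Theta> (a * b * x)"
      using mM[OF ab(2) x] by (simp add: mult.assoc J ab x)
  qed (intro vN_mult M N J(1) ab)+
  have Jadj: "J (adj a) = adj (J a)" if a: "a \<in> M" for a
  proof (rule J_eqI)
    fix x assume x: "x \<in> M" "x * e = x"
    have a': "adj a \<in> M" by (rule vN_adj[OF M a])
    define X where "X = adj (J a) * \<Theta> x - \<Theta> (adj a * x)"
    have "adj X * n * f = 0" if n: "n \<in> N" for n
    proof -
      have "n * f \<in> N" "n * f * f = n * f"
        using vN_mult[OF N n projsD(1)[OF f]] by (simp_all add: mult.assoc projsD[OF f])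
      then obtain y where y: "y \<in> M" "y * e = y" "\<Theta> y = n * f" using D(6) by blast
      have "adj (J a * \<Theta> y) * \<Theta> x = adj (\<Theta> (a * y)) * \<Theta> x"
        by (simp only: J(2)[OF a y(1,2)])
      also have "\<dots> = adj (\<Theta> y) * \<Theta> (adj a * x)"
        using D(5)[OF mM[OF a y(1,2)] x y(1,2) mM[OF a' x]] by (simp add: adj_mult mult.assoc)
      finally have "adj (\<Theta> y) * X = 0" by (simp add: X_def adj_mult right_diff_distrib mult.assoc)
      then have "adj X * \<Theta> y = 0" using mult_zero_adj by fastforce
      then show ?thesis by (simp add: y mult.assoc)
    qed
    then have "adj X = 0" by (rule fullD[OF full(2)])
    then show "adj (J a) * \<Theta> x = \<Theta> (adj a * x)" by (simp add: X_def)
  qed (intro vN_adj M N J(1) a)+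
  have "bij_betw J M N"
  proof (rule bij_betwI')
    fix a b assume ab: "a \<in> M" "b \<in> M"
    show "J a = J b \<longleftrightarrow> a = b"
    proof
      assume eq: "J a = J b"
      have "(a - b) * m * e = 0" if "m \<in> M" for m
      proof -
        have x: "m * e \<in> M" "m * e * e = m * e"
          using vN_mult[OF M that projsD(1)[OF e]] by (simp_all add: mult.assoc projsD[OF e])
        have "\<Theta> (a * (m * e)) = \<Theta> (b * (m * e))" using J(2)[OF _ x] ab eq by metis
        then have "a * (m * e) = b * (m * e)"
          using \<Psi>\<Theta> mM[OF ab(1) x] mM[OF ab(2) x] by metis
        then show ?thesis by (simp add: left_diff_distrib mult.assoc)
      qed
      then have "a - b = 0" by (rule fullD[OF full(1)])
      then show "a = b" by simp
    qed simp
  next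
    fix a assume "a \<in> M" then show "J a \<in> N" by (rule J)
  next
    fix n assume n: "n \<in> N"
    obtain a where a: "a \<in> M" "\<And>y. y \<in> N \<Longrightarrow> y * f = y \<Longrightarrow> a * \<Psi> y = \<Psi> (n * y)"
      using module_iso_left_mult[OF N M e m' full(1) n] by blast
    have "J a = n"
    proof (rule J_eqI[OF a(1) n])
      fix x assume x: "x \<in> M" "x * e = x"
      have "n * \<Theta> x \<in> N" "n * \<Theta> x * f = n * \<Theta> x"
        using vN_mult[OF N n] D(2,3)[OF x] by (simp_all add: mult.assoc)
      then have "n * \<Theta> x = \<Theta> (\<Psi> (n * \<Theta> x))" using \<Theta>\<Psi> by simp
      also have "\<dots> = \<Theta> (a * x)" using a(2)[OF D(2,3)[OF x]] \<Psi>\<Theta>[OF x] by simp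
      finally show "n * \<Theta> x = \<Theta> (a * x)" .
    qed
    then show "\<exists>a\<in>M. n = J a" using a(1) by blast
  qed
  then show ?thesis using Jadd Jmult Jadj by blast
qed

text \<open>When products are transferred by one injective map of the corner, equality of products
  is reflected as well as preserved.\<close>

lemma module_isoI:
  assumes "bij_betw \<Theta> {x\<in>M. x * e = x} {y\<in>N. y * f = y}"
    and "\<And>x y. x \<in> M \<Longrightarrow> x * e = x \<Longrightarrow> y \<in> M \<Longrightarrow> y * e = y \<Longrightarrow> \<Theta> (x + y) = \<Theta> x + \<Theta> y"
    and "\<And>x y. x \<in> M \<Longrightarrow> x * e = x \<Longrightarrow> y \<in> M \<Longrightarrow> y * e = y \<Longrightarrow> adj (\<Theta> x) * \<Theta> y = \<beta> (adj x * y)"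
    and "inj_on \<beta> {a\<in>M. e * a = a \<and> a * e = a}" and M: "von_neumann_algebra M" and e: "e \<in> projs M"
  shows "module_iso M e N f \<Theta>"
proof -
  have mem: "adj x * y \<in> {a\<in>M. e * a = a \<and> a * e = a}" if "x \<in> M" "x * e = x" "y \<in> M" "y * e = y" for x y
  proof -
    have "e * adj x = adj x" using arg_cong[OF that(2), of adj] by (simp add: adj_mult projsD[OF e])
    then have "e * (adj x * y) = adj x * y" by (rule mult_eq_assoc)
    then show ?thesis using that vN_mult[OF M vN_adj[OF M that(1)] that(3)] by (simp add: mult.assoc)
  qed
  have "\<beta> (adj x * y) = \<beta> (adj x' * y') \<longleftrightarrow> adj x * y = adj x' * y'"
    if "x \<in> M" "x * e = x" "y \<in> M" "y * e = y" "x' \<in> M" "x' * e = x'" "y' \<in> M" "y' * e = y'" for x y x' y'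
    by (rule inj_on_eq_iff[OF assms(4) mem[OF that(1-4)] mem[OF that(5-8)]])
  then have "adj (\<Theta> x) * \<Theta> y = adj (\<Theta> x') * \<Theta> y' \<longleftrightarrow> adj x * y = adj x' * y'"
    if "x \<in> M" "x * e = x" "y \<in> M" "y * e = y" "x' \<in> M" "x' * e = x'" "y' \<in> M" "y' * e = y'" for x y x' y'
    using that by (simp only: assms(3))
  then show ?thesis unfolding module_iso_def using assms(1,2) by blast
qed

section \<open>Gluing over centrally orthogonal parts\<close>

lemma inner_products_split:
  fixes L :: "'a::complex_hilbert_space bop set"
  assumes L: "von_neumann_algebra L" "p1 \<in> projs L" "p2 \<in> projs L" "\<And>m. m \<in> L \<Longrightarrow> p1 * m * p2 = 0"
    and x: "x \<in> L" "x * (p1 + p2) = x" "y \<in> L" "y * (p1 + p2) = y"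
      "x' \<in> L" "x' * (p1 + p2) = x'" "y' \<in> L" "y' * (p1 + p2) = y'"
  shows "adj x * y = adj x' * y' \<longleftrightarrow> adj (x * p1) * (y * p1) = adj (x' * p1) * (y' * p1) \<and>
    adj (x * p2) * (y * p2) = adj (x' * p2) * (y' * p2)"
proof -
  have *: "adj (x * p1) * (y * p1) = p1 * (adj x * y) * p1" "adj (x * p2) * (y * p2) = p2 * (adj x * y) * p2"
    for x y by (simp_all add: adj_mult projsD[OF L(2)] projsD[OF L(3)] mult.assoc)
  have **: "adj x * y = p1 * (adj x * y) * p1 + p2 * (adj x * y) * p2"
    if "x \<in> L" "x * (p1 + p2) = x" "y \<in> L" "y * (p1 + p2) = y" for x y
  proof -
    have m: "adj x * y \<in> L" using that vN_mult[OF L(1) vN_adj[OF L(1)]] by blast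
    have z1: "p1 * (adj x * y) * p2 = 0" by (rule L(4)[OF m])
    have "p1 * adj (adj x * y) * p2 = 0" by (rule L(4)[OF vN_adj[OF L(1) m]])
    from arg_cong[OF this, of adj] have z2: "p2 * (adj x * y) * p1 = 0"
      by (simp add: adj_mult projsD[OF L(2)] projsD[OF L(3)] mult.assoc)
    have "(p1 + p2) * adj x = adj x"
      using arg_cong[OF that(2), of adj] by (simp add: adj_mult adj_add projsD[OF L(2)] projsD[OF L(3)])
    then have "adj x * y = (p1 + p2) * (adj x * y) * (p1 + p2)"
      using that(4) by (metis mult.assoc)
    also have "\<dots> = p1 * (adj x * y) * p1 + p2 * (adj x * y) * p2"
      by (simp only: distrib_left distrib_right z1 z2 add_0 add_0_right)
    finally show ?thesis .
  qed
  show ?thesis unfolding * using **[OF x(1-4)] **[OF x(5-8)] by metis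
qed

text \<open>Central orthogonality kills the cross terms, so an equality of products amounts to the
  two equalities of its diagonal blocks.\<close>

lemma module_iso_sum:
  assumes M: "von_neumann_algebra M" and N: "von_neumann_algebra N"
    and e: "e1 \<in> projs M" "e2 \<in> projs M" and f: "f1 \<in> projs N" "f2 \<in> projs N"
    and em: "\<And>m. m \<in> M \<Longrightarrow> e1 * m * e2 = 0" and fn: "\<And>n. n \<in> N \<Longrightarrow> f1 * n * f2 = 0"
    and m1: "module_iso M e1 N f1 \<Theta>1" and m2: "module_iso M e2 N f2 \<Theta>2"
  shows "module_iso M (e1 + e2) N (f1 + f2) (\<lambda>x. \<Theta>1 (x * e1) + \<Theta>2 (x * e2))"
proof -
  note D1 = module_isoD[OF m1] and D2 = module_isoD[OF m2]
  let ?\<Theta> = "\<lambda>x. \<Theta>1 (x * e1) + \<Theta>2 (x * e2)"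
  have e12: "e1 * e2 = 0" "e2 * e1 = 0" using em[OF vN_one[OF M]] proj_comm_zero[OF e] by simp_all
  have f12: "f1 * f2 = 0" "f2 * f1 = 0" using fn[OF vN_one[OF N]] proj_comm_zero[OF f] by simp_all
  note p = projsD(3)[OF e(1)] projsD(3)[OF e(2)] projsD(3)[OF f(1)] projsD(3)[OF f(2)]
  have c: "x * e1 \<in> M" "x * e1 * e1 = x * e1" "x * e2 \<in> M" "x * e2 * e2 = x * e2" if "x \<in> M" for x
    using vN_mult[OF M that] projsD(1)[OF e(1)] projsD(1)[OF e(2)] by (simp_all add: mult.assoc p)
  have c': "x * f1 \<in> N" "x * f1 * f1 = x * f1" "x * f2 \<in> N" "x * f2 * f2 = x * f2" if "x \<in> N" for x
    using vN_mult[OF N that] projsD(1)[OF f(1)] projsD(1)[OF f(2)] by (simp_all add: mult.assoc p)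
  have comp: "?\<Theta> x * f1 = \<Theta>1 (x * e1)" "?\<Theta> x * f2 = \<Theta>2 (x * e2)" if "x \<in> M" for x
  proof -
    have "\<Theta>1 (x * e1) * f2 = 0" "\<Theta>2 (x * e2) * f1 = 0"
      using D1(3)[OF c(1,2)[OF that]] D2(3)[OF c(3,4)[OF that]] f12 by (metis mult.assoc mult_zero_right)+
    then show "?\<Theta> x * f1 = \<Theta>1 (x * e1)" "?\<Theta> x * f2 = \<Theta>2 (x * e2)"
      using D1(3)[OF c(1,2)[OF that]] D2(3)[OF c(3,4)[OF that]] by (simp_all add: distrib_right)
  qed
  have inN: "?\<Theta> x \<in> N" "?\<Theta> x * (f1 + f2) = ?\<Theta> x" if "x \<in> M" for x
    using comp[OF that] D1(2)[OF c(1,2)[OF that]] D2(2)[OF c(3,4)[OF that]] vN_add[OF N]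
    by (simp_all add: distrib_left)
  have bij: "bij_betw ?\<Theta> {x\<in>M. x * (e1 + e2) = x} {y\<in>N. y * (f1 + f2) = y}"
  proof (rule bij_betwI')
    fix x y assume xy: "x \<in> {x\<in>M. x * (e1 + e2) = x}" "y \<in> {x\<in>M. x * (e1 + e2) = x}"
    show "?\<Theta> x = ?\<Theta> y \<longleftrightarrow> x = y"
    proof
      assume eq: "?\<Theta> x = ?\<Theta> y"
      have M': "x \<in> M" "y \<in> M" using xy by auto
      have "?\<Theta> x * f1 = ?\<Theta> y * f1" by (simp only: eq)
      then have 1: "\<Theta>1 (x * e1) = \<Theta>1 (y * e1)" by (simp only: comp[OF M'(1)] comp[OF M'(2)])
      have "?\<Theta> x * f2 = ?\<Theta> y * f2" by (simp only: eq)
      then have 2: "\<Theta>2 (x * e2) = \<Theta>2 (y * e2)" by (simp only: comp[OF M'(1)] comp[OF M'(2)])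
      from 1 2 have "x * e1 = y * e1" "x * e2 = y * e2"
        using inj_onD[OF bij_betw_imp_inj_on[OF D1(1)], of "x * e1" "y * e1"]
          inj_onD[OF bij_betw_imp_inj_on[OF D2(1)], of "x * e2" "y * e2"] c M' by simp_all
      then show "x = y" using xy by (simp add: distrib_left)
    qed simp
  next
    fix x assume "x \<in> {x\<in>M. x * (e1 + e2) = x}"
    then show "?\<Theta> x \<in> {y\<in>N. y * (f1 + f2) = y}" using inN by simp
  next
    fix y assume y: "y \<in> {y\<in>N. y * (f1 + f2) = y}"
    obtain x1 where x1: "x1 \<in> M" "x1 * e1 = x1" "\<Theta>1 x1 = y * f1" using D1(6)[of "y * f1"] c'(1,2) y by auto
    obtain x2 where x2: "x2 \<in> M" "x2 * e2 = x2" "\<Theta>2 x2 = y * f2" using D2(6)[of "y * f2"] c'(3,4) y by auto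
    have "x1 * e2 = 0" "x2 * e1 = 0" using x1(2) x2(2) e12 by (metis mult.assoc mult_zero_right)+
    then have "(x1 + x2) * e1 = x1" "(x1 + x2) * e2 = x2" using x1 x2 by (simp_all add: distrib_right)
    then have "x1 + x2 \<in> {x\<in>M. x * (e1 + e2) = x}" "y = ?\<Theta> (x1 + x2)"
      using x1 x2 y vN_add[OF M] by (simp_all add: distrib_left)
    then show "\<exists>x\<in>{x\<in>M. x * (e1 + e2) = x}. y = ?\<Theta> x" by (rule bexI[rotated])
  qed
  have add: "?\<Theta> (x + y) = ?\<Theta> x + ?\<Theta> y" if "x \<in> M" "y \<in> M" for x y
    using D1(4)[OF c(1,2)[OF that(1)] c(1,2)[OF that(2)]] D2(4)[OF c(3,4)[OF that(1)] c(3,4)[OF that(2)]]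
    by (simp add: distrib_right)
  have "adj (?\<Theta> x) * ?\<Theta> y = adj (?\<Theta> x') * ?\<Theta> y' \<longleftrightarrow> adj x * y = adj x' * y'"
    if x: "x \<in> M" "x * (e1 + e2) = x" "y \<in> M" "y * (e1 + e2) = y"
      "x' \<in> M" "x' * (e1 + e2) = x'" "y' \<in> M" "y' * (e1 + e2) = y'" for x y x' y'
  proof -
    have 1: "adj (?\<Theta> x) * ?\<Theta> y = adj (?\<Theta> x') * ?\<Theta> y' \<longleftrightarrow>
        adj (\<Theta>1 (x * e1)) * \<Theta>1 (y * e1) = adj (\<Theta>1 (x' * e1)) * \<Theta>1 (y' * e1) \<and>
        adj (\<Theta>2 (x * e2)) * \<Theta>2 (y * e2) = adj (\<Theta>2 (x' * e2)) * \<Theta>2 (y' * e2)"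
      using inner_products_split[OF N f fn inN[OF x(1)] inN[OF x(3)] inN[OF x(5)] inN[OF x(7)]]
      by (simp only: comp x)
    have 2: "adj x * y = adj x' * y' \<longleftrightarrow>
        adj (x * e1) * (y * e1) = adj (x' * e1) * (y' * e1) \<and>
        adj (x * e2) * (y * e2) = adj (x' * e2) * (y' * e2)"
      by (rule inner_products_split[OF M e em x])
    note 3 = D1(5)[OF c(1,2)[OF x(1)] c(1,2)[OF x(3)] c(1,2)[OF x(5)] c(1,2)[OF x(7)]]
      D2(5)[OF c(3,4)[OF x(1)] c(3,4)[OF x(3)] c(3,4)[OF x(5)] c(3,4)[OF x(7)]]
    from 1 2 3 show ?thesis by argo
  qed
  then show ?thesis using bij add unfolding module_iso_def by blast
qed

section \<open>Coordinatisation by a frame\<close>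

context ortho_iso
begin

lemma inverse_good_iff:
  assumes e: "e \<in> projs M"
  shows "ortho_iso.good N M (inv_into (projs M) \<theta>) (\<theta> e) a' a \<longleftrightarrow> good e a a'"
proof -
  interpret I: ortho_iso N M "inv_into (projs M) \<theta>" by (rule inverse)
  have i: "inv_into (projs M) \<theta> (\<theta> p) = p" if "p \<in> projs M" for p
    using bij_betw_inv_into_left[OF bij that] .
  have j: "\<theta> (inv_into (projs M) \<theta> p) = p" if "p \<in> projs N" for p
    using bij_betw_inv_into_right[OF bij that] .
  have "inv_into (projs M) \<theta> (rp (\<theta> e + a')) = rp (e + a) \<longleftrightarrow> \<theta> (rp (e + a)) = rp (\<theta> e + a')"
    if "a \<in> M" "a' \<in> N"
    using i[OF graph_projs[OF e that(1)]] j[OF I.graph_projs[OF proj[OF e] that(2)]] by metis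
  then show ?thesis unfolding I.good_def good_def i[OF e] by blast
qed

end

locale framed_iso = ortho_iso M N \<theta>
  for M :: "'a::complex_hilbert_space bop set" and N :: "'b::complex_hilbert_space bop set"
    and \<theta> :: "'a bop \<Rightarrow> 'b bop" +
  fixes e v w v' w'
  assumes fr: "frame M e v w" and gv: "good e v v'" and gw: "good e w w'"
    and v': "adj v' * v' = \<theta> e" "v' * adj v' = \<theta> (v * adj v)"
    and w': "adj w' * w' = \<theta> e" "w' * adj w' = \<theta> (w * adj w)"
begin

definition "q = v * adj v"
definition "s = w * adj w"
text \<open>The complement of \<open>e\<close> is cut into \<open>q\<close> and \<open>h\<close>
  because adding operators needs a spare orthogonal copy of \<open>e\<close>: \<open>s\<close>
  serves for the block into \<open>q\<close>, and \<open>q\<close> for the block into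
  \<open>h\<close>.\<close>

definition "h = 1 - e - q"

lemmas F = frameD[OF fr]

lemma pe: "e \<in> projs M" and pq: "q \<in> projs M" and ps: "s \<in> projs M"
  unfolding q_def s_def using F isometry_tripotent projs_tripotent_left[OF M] by blast+

lemma eq: "e * q = 0" "q * e = 0" and es: "e * s = 0" "s * e = 0" and qs: "q * s = 0" "s * q = 0"
  by (simp_all add: q_def s_def mult.assoc F mult_eq_assoc[OF F(6)] mult_eq_assoc[OF F(7)]
      mult_eq_assoc[OF F(8)] mult_eq_assoc[OF F(9)])

lemma ph: "h \<in> projs M"
proof -
  have "1 - (e + q) \<in> projs M" by (rule projs_compl[OF M projs_add[OF M pe pq eq(1)]])
  then show ?thesis by (simp add: h_def algebra_simps)
qed

lemma eh: "e * h = 0" "h * e = 0" and qh: "q * h = 0" "h * q = 0"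
  by (simp_all add: h_def algebra_simps projsD[OF pe] projsD[OF pq] eq)

lemma qv: "q * v = v" "q * w = 0" "s * w = w" "h * v = 0"
  by (simp_all add: h_def q_def s_def algebra_simps F)

lemma split: "e * a = 0 \<Longrightarrow> q * a + h * a = a"
  by (simp add: h_def algebra_simps)

lemma good_q: "a \<in> M \<Longrightarrow> q * a = a \<Longrightarrow> a * e = a \<Longrightarrow> \<exists>a'. good e a a'"
  by (rule good_all[OF pe pq eq(1) gw F(5) w' qv(2)])

lemma good_h: "a \<in> M \<Longrightarrow> h * a = a \<Longrightarrow> a * e = a \<Longrightarrow> \<exists>a'. good e a a'"
  by (rule good_all[OF pe ph eh(1) gv F(4) v' qv(4)])

lemma good_split:
  assumes a: "a \<in> M" "a * e = a" "e * a = 0"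
  shows "\<exists>x y. good e (q * a) x \<and> good e (h * a) y \<and> good e a (x + y)"
proof -
  have "q * a \<in> M" "h * a \<in> M" using vN_mult[OF M] a(1) projsD(1)[OF pq] projsD(1)[OF ph] by blast+
  then obtain x y where x: "good e (q * a) x" and y: "good e (h * a) y"
    using good_q[of "q * a"] good_h[of "h * a"] projsD[OF pq] projsD[OF ph] a(2) by (metis mult.assoc)
  have "good e (q * a + h * a) (x + y)"
    by (rule good_sum[OF pe pq ph eq(1) eh(1) qh(1) x _ y]) (simp_all add: projsD[OF pq] projsD[OF ph])
  then show ?thesis using x y split[OF a(3)] by auto
qed

lemma good_plus:
  assumes a: "good e a a'" and b: "good e b b'"
  shows "good e (a + b) (a' + b')"
proof -
  obtain x y where x: "good e (q * a) x" "good e (h * a) y" "good e a (x + y)"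
    using good_split[OF goodD(1-3)[OF a]] by blast
  obtain z t where z: "good e (q * b) z" "good e (h * b) t" "good e b (z + t)"
    using good_split[OF goodD(1-3)[OF b]] by blast
  have a': "a' = x + y" and b': "b' = z + t"
    using good_unique_right[OF pe a x(3)] good_unique_right[OF pe b z(3)] by auto
  have 1: "good e (q * a + q * b) (x + z)"
    by (rule good_add[OF pe pq ps eq(1) es(1) qs(1) x(1) _ z(1) _ gw F(5) _ w'[folded s_def]])
      (simp_all add: projsD[OF pq] s_def)
  have 2: "good e (h * a + h * b) (y + t)"
    by (rule good_add[OF pe ph pq eh(1) eq(1) qh(2) x(2) _ z(2) _ gv F(4) _ v'[folded q_def]])
      (simp_all add: projsD[OF ph] q_def)
  have "good e ((q * a + q * b) + (h * a + h * b)) ((x + z) + (y + t))"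
    by (rule good_sum[OF pe pq ph eq(1) eh(1) qh(1) 1 _ 2])
      (simp_all add: distrib_left projsD[OF pq] projsD[OF ph])
  moreover have "(q * a + q * b) + (h * a + h * b) = a + b"
    using split[OF goodD(3)[OF a]] split[OF goodD(3)[OF b]] by (metis add.assoc add.left_commute)
  ultimately show ?thesis by (simp add: a' b' algebra_simps)
qed

lemma good_total: "a \<in> M \<Longrightarrow> a * e = a \<Longrightarrow> e * a = 0 \<Longrightarrow> \<exists>a'. good e a a'"
  using good_split by blast

text \<open>Additive inverses come from additivity and uniqueness; they undo the signs introduced by
  products.\<close>

lemma good_uminus:
  assumes a: "good e a a'"
  shows "good e (- a) (- a')"
proof -
  obtain b' where b': "good e (- a) b'"
    using good_total[of "- a"] goodD[OF a] vN_minus[OF M] by auto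
  have "a' + b' = 0" using good_plus[OF a b'] good_zero[OF pe] good_unique_right[OF pe] by simp
  then have "b' = - a'" by (simp only: add_eq_0_iff)
  then show ?thesis using b' by simp
qed

text \<open>An element \<open>adj b * a\<close> of the corner of \<open>e\<close> does not run
  between orthogonal projections, so \<open>u\<close> moves its values to \<open>g\<close>. The
  chain is: from \<open>g\<close> through \<open>e\<close> to \<open>k\<close> by
  \<open>b * adj u\<close>, its adjoint from \<open>k\<close> to \<open>g\<close>, and finally from
  \<open>e\<close> through \<open>k\<close> to \<open>g\<close>.\<close>

lemma good_inner_part:
  assumes u: "good e u u'" "adj u * u = e" "adj u' * u' = \<theta> e" "u' * adj u' = \<theta> (u * adj u)"
    and k: "k \<in> projs M" "e * k = 0" "k * u = 0"
    and a: "good e a a'" "k * a = a" and b: "good e b b'" "k * b = b"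
  shows "good e (u * (adj b * a)) (u' * (adj b' * a'))"
proof -
  note U = goodD[OF u(1)]
  define g where "g = u * adj u"
  have g: "g \<in> projs M" unfolding g_def
    by (rule projs_tripotent_left[OF M U(1) isometry_tripotent[OF u(2) projsD(3)[OF pe]]])
  have gk: "k * g = 0" "g * k = 0"
    using proj_comm_zero[OF k(1) g] k(3) by (simp_all add: g_def mult.assoc[symmetric])
  have ge: "e * g = 0" "g * e = 0"
    using proj_comm_zero[OF pe g] U(3) by (simp_all add: g_def mult.assoc[symmetric])
  have eu: "e * adj u = adj u" using arg_cong[OF U(2), of adj] by (simp add: adj_mult projsD[OF pe])
  have gu: "g * u = u" by (simp add: g_def mult.assoc u(2) U(2))
  have 1: "good g (adj u) (adj u')"
    by (rule good_adj_isometry[OF pe g u(1,2) _ u(3)]) (simp_all add: g_def u(4))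
  have 2: "good g (- (b * adj u)) (- (b' * adj u'))"
    by (rule good_mult[OF g pe k(1) ge(2) gk(2) k(2) 1 eu b])
  have "good k (- adj (- (b * adj u))) (- adj (- (b' * adj u')))"
    by (rule good_adj[OF g k(1) gk(2) 2]) (simp add: mult.assoc[symmetric] b(2))
  then have 3: "good k (u * adj b) (u' * adj b')" by (simp add: adj_minus adj_mult)
  have "good e (- (u * adj b * a)) (- (u' * adj b' * a'))"
    by (rule good_mult[OF pe k(1) g k(2) ge(1) gk(1) a 3]) (simp add: mult.assoc[symmetric] gu)
  from good_uminus[OF this] show ?thesis by (simp add: mult.assoc)
qed

text \<open>Composition with \<open>v * adj w\<close>, which runs between the orthogonal projections
  \<open>s\<close> and \<open>q\<close>.\<close>

lemma good_change_column:
  assumes \<alpha>: "good e (w * \<alpha>) (w' * \<alpha>')" "e * \<alpha> = \<alpha>" "\<theta> e * \<alpha>' = \<alpha>'"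
  shows "good e (v * \<alpha>) (v' * \<alpha>')"
proof -
  have 1: "good s (adj w) (adj w')"
    by (rule good_adj_isometry[OF pe ps gw F(5) _ w'(1)]) (simp_all add: s_def w')
  have 2: "good s (- (v * adj w)) (- (v' * adj w'))"
    by (rule good_mult[OF ps pe pq es(2) qs(2) eq(1) 1 F(15) gv qv(1)])
  have "good e (- (- (v * adj w) * (w * \<alpha>))) (- (- (v' * adj w') * (w' * \<alpha>')))"
    by (rule good_mult[OF pe ps pq es(1) eq(1) qs(2) \<alpha>(1) _ 2])
      (simp_all add: mult.assoc[symmetric] qv)
  then show ?thesis
    by (simp add: mult.assoc mult_eq_assoc[OF F(5)] mult_eq_assoc[OF w'(1)] \<alpha>)
qed

text \<open>The part of the product through \<open>h\<close> can use \<open>v\<close> directly. The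
  part through \<open>q\<close> meets the range of \<open>v\<close>, so it is computed with
  \<open>w\<close> first and then moved.\<close>

lemma good_inner:
  assumes a: "good e a a'" and b: "good e b b'"
  shows "good e (v * (adj b * a)) (v' * (adj b' * a'))"
proof -
  obtain x y where x: "good e (q * a) x" "good e (h * a) y" "good e a (x + y)"
    using good_split[OF goodD(1-3)[OF a]] by blast
  obtain z t where z: "good e (q * b) z" "good e (h * b) t" "good e b (z + t)"
    using good_split[OF goodD(1-3)[OF b]] by blast
  have a': "a' = x + y" and b': "b' = z + t"
    using good_unique_right[OF pe a x(3)] good_unique_right[OF pe b z(3)] by auto
  have 1: "good e (v * (adj (h * b) * (h * a))) (v' * (adj t * y))"
    by (rule good_inner_part[OF gv F(4) v' ph eh(1) qv(4) x(2) _ z(2)]) (simp_all add: projsD[OF ph])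
  have "good e (w * (adj (q * b) * (q * a))) (w' * (adj z * x))"
    by (rule good_inner_part[OF gw F(5) w' pq eq(1) qv(2) x(1) _ z(1)]) (simp_all add: projsD[OF pq])
  then have 2: "good e (v * (adj (q * b) * (q * a))) (v' * (adj z * x))"
  proof (rule good_change_column)
    have "e * adj (q * b) = adj (q * b)" "\<theta> e * adj z = adj z"
      using arg_cong[OF goodD(2)[OF z(1)], of adj] arg_cong[OF goodD(5)[OF z(1)], of adj]
      by (simp_all add: adj_mult projsD[OF pe] projsD[OF proj[OF pe]])
    then show "e * (adj (q * b) * (q * a)) = adj (q * b) * (q * a)" "\<theta> e * (adj z * x) = adj z * x"
      by (simp_all only: mult.assoc[symmetric])
  qed
  have "adj b * a = adj (q * b) * (q * a) + adj (h * b) * (h * a)"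
  proof -
    have "adj (q * b) * (q * a) + adj (h * b) * (h * a) = adj b * (q * a) + adj b * (h * a)"
      by (simp add: adj_mult projsD[OF pq] projsD[OF ph] mult.assoc)
    also have "\<dots> = adj b * a" using split[OF goodD(3)[OF a]] by (simp add: distrib_left[symmetric])
    finally show ?thesis by simp
  qed
  moreover have "adj b' * a' = adj z * x + adj t * y"
  proof -
    have "\<theta> q * \<theta> h = 0" "\<theta> h * \<theta> q = 0" using orth[OF pq ph] orth[OF ph pq] qh by auto
    moreover have r: "\<theta> q * x = x" "\<theta> q * z = z" "\<theta> h * y = y" "\<theta> h * t = t"
      using good_range[OF pe pq eq(1) _ x(1)] good_range[OF pe pq eq(1) _ z(1)]
        good_range[OF pe ph eh(1) _ x(2)] good_range[OF pe ph eh(1) _ z(2)]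
      by (simp_all add: projsD[OF pq] projsD[OF ph])
    moreover have "adj z * \<theta> q = adj z" "adj t * \<theta> h = adj t"
      using arg_cong[OF r(2), of adj] arg_cong[OF r(4), of adj]
      by (simp_all add: adj_mult projsD[OF proj[OF pq]] projsD[OF proj[OF ph]])
    ultimately have "adj z * y = 0" "adj t * x = 0" using mult_zero_between by blast+
    then show ?thesis by (simp add: a' b' adj_add distrib_left distrib_right)
  qed
  ultimately show ?thesis using good_plus[OF 2 1] by (simp add: distrib_left)
qed

definition "T a = (THE a'. good e a a')"
text \<open>Elements of the corner of \<open>e\<close> are not operators from \<open>e\<close> to
  its complement and have no graph; they are shifted into the column of \<open>v\<close> and
  back.\<close>

definition "\<beta> \<alpha> = adj v' * T (v * \<alpha>)"

lemma T_eqI: "good e a a' \<Longrightarrow> T a = a'"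
  unfolding T_def using good_unique_right[OF pe] by blast

lemma T_good: "a \<in> M \<Longrightarrow> a * e = a \<Longrightarrow> e * a = 0 \<Longrightarrow> good e a (T a)"
  using good_total[of a] T_eqI by blast

lemma corner_column:
  assumes "\<alpha> \<in> M" "\<alpha> * e = \<alpha>" shows "v * \<alpha> \<in> M" "v * \<alpha> * e = v * \<alpha>" "e * (v * \<alpha>) = 0" "good e (v * \<alpha>) (T (v * \<alpha>))"
proof -
  show *: "v * \<alpha> \<in> M" "v * \<alpha> * e = v * \<alpha>" "e * (v * \<alpha>) = 0"
    using assms F vN_mult[OF M] by (simp_all add: mult.assoc mult_eq_assoc[OF F(6)])
  then show "good e (v * \<alpha>) (T (v * \<alpha>))" by (rule T_good)
qed

lemma v'_\<beta>: "\<alpha> \<in> M \<Longrightarrow> \<alpha> * e = \<alpha> \<Longrightarrow> v' * \<beta> \<alpha> = T (v * \<alpha>)"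
  using good_range[OF pe pq eq(1) _ corner_column(4)[of \<alpha>]]
  by (simp add: \<beta>_def mult.assoc[symmetric] v' q_def[symmetric] qv)

lemma \<beta>_in: "\<alpha> \<in> M \<Longrightarrow> \<alpha> * e = \<alpha> \<Longrightarrow> \<beta> \<alpha> \<in> N \<and> \<theta> e * \<beta> \<alpha> = \<beta> \<alpha> \<and> \<beta> \<alpha> * \<theta> e = \<beta> \<alpha>"
proof -
  assume \<alpha>: "\<alpha> \<in> M" "\<alpha> * e = \<alpha>"
  have "\<theta> e * adj v' = adj v'"
    using arg_cong[OF goodD(5)[OF gv], of adj] by (simp add: adj_mult projsD[OF proj[OF pe]])
  then show ?thesis
    using goodD[OF corner_column(4)[OF \<alpha>]] goodD(4)[OF gv]
    by (simp add: \<beta>_def vN_mult[OF N] vN_adj[OF N] mult.assoc) (metis mult.assoc)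
qed

lemma \<beta>_eqI:
  assumes "\<alpha> \<in> M" "\<alpha> * e = \<alpha>" "\<theta> e * \<alpha>' = \<alpha>'" "good e (v * \<alpha>) (v' * \<alpha>')" shows "\<beta> \<alpha> = \<alpha>'"
  using T_eqI[OF assms(4)] by (simp add: \<beta>_def mult_eq_assoc[OF v'(1)] assms(3))

lemma \<beta>_plus:
  assumes "\<alpha> \<in> M" "\<alpha> * e = \<alpha>" "\<gamma> \<in> M" "\<gamma> * e = \<gamma>" shows "\<beta> (\<alpha> + \<gamma>) = \<beta> \<alpha> + \<beta> \<gamma>"
  using T_eqI[OF good_plus[OF corner_column(4)[OF assms(1,2)] corner_column(4)[OF assms(3,4)]]]
  by (simp add: \<beta>_def distrib_left)

lemma T_inner:
  assumes a: "a \<in> M" "a * e = a" "e * a = 0" and b: "b \<in> M" "b * e = b" "e * b = 0"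
  shows "adj (T b) * T a = \<beta> (adj b * a)"
proof (rule \<beta>_eqI[symmetric])
  have "\<theta> e * adj (T b) = adj (T b)"
    using arg_cong[OF goodD(5)[OF T_good[OF b]], of adj] by (simp add: adj_mult projsD[OF proj[OF pe]])
  then show "\<theta> e * (adj (T b) * T a) = adj (T b) * T a" by (rule mult_eq_assoc)
  show "good e (v * (adj b * a)) (v' * (adj (T b) * T a))"
    by (rule good_inner[OF T_good[OF a] T_good[OF b]])
qed (use a b in \<open>simp_all add: vN_mult[OF M] vN_adj[OF M] mult.assoc\<close>)

lemma \<beta>_inner:
  assumes a: "\<alpha> \<in> M" "\<alpha> * e = \<alpha>" "e * \<alpha> = \<alpha>" and b: "\<gamma> \<in> M" "\<gamma> * e = \<gamma>" "e * \<gamma> = \<gamma>"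
  shows "adj (\<beta> \<gamma>) * \<beta> \<alpha> = \<beta> (adj \<gamma> * \<alpha>)"
proof -
  have "adj (\<beta> \<gamma>) * \<beta> \<alpha> = adj (v' * \<beta> \<gamma>) * (v' * \<beta> \<alpha>)"
    using \<beta>_in[OF a(1,2)] by (simp add: adj_mult mult.assoc mult_eq_assoc[OF v'(1)])
  also have "\<dots> = adj (T (v * \<gamma>)) * T (v * \<alpha>)" by (simp add: v'_\<beta> a b)
  also have "\<dots> = \<beta> (adj (v * \<gamma>) * (v * \<alpha>))"
    by (rule T_inner[OF corner_column(1-3)[OF a(1,2)] corner_column(1-3)[OF b(1,2)]])
  also have "adj (v * \<gamma>) * (v * \<alpha>) = adj \<gamma> * \<alpha>"
    by (simp add: adj_mult mult.assoc mult_eq_assoc[OF F(4)] a)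
  finally show ?thesis .
qed

lemma T_inj: "a \<in> M \<Longrightarrow> a * e = a \<Longrightarrow> e * a = 0 \<Longrightarrow> b \<in> M \<Longrightarrow> b * e = b \<Longrightarrow> e * b = 0 \<Longrightarrow> T a = T b \<Longrightarrow> a = b"
  using good_unique_left[OF pe, of a "T a" b] T_good[of a] T_good[of b] by simp

lemma \<beta>_inj:
  assumes "\<alpha> \<in> M" "\<alpha> * e = \<alpha>" "e * \<alpha> = \<alpha>" "\<gamma> \<in> M" "\<gamma> * e = \<gamma>" "e * \<gamma> = \<gamma>" "\<beta> \<alpha> = \<beta> \<gamma>" shows "\<alpha> = \<gamma>"
proof -
  have "T (v * \<alpha>) = T (v * \<gamma>)"
    by (simp only: v'_\<beta>[OF assms(1,2), symmetric] v'_\<beta>[OF assms(4,5), symmetric] assms(7))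
  then have "v * \<alpha> = v * \<gamma>"
    by (rule T_inj[OF corner_column(1-3)[OF assms(1,2)] corner_column(1-3)[OF assms(4,5)]])
  then have "adj v * (v * \<alpha>) = adj v * (v * \<gamma>)" by simp
  then show ?thesis by (simp add: mult_eq_assoc[OF F(4)] assms)
qed

text \<open>The hypotheses are symmetric in \<open>M\<close> and \<open>N\<close>, so surjectivity
  of \<open>T\<close> and \<beta> becomes totality for the inverse.\<close>

lemma inverse_framed_iso: "framed_iso N M (inv_into (projs M) \<theta>) (\<theta> e) v' w' v w"
proof -
  interpret I: ortho_iso N M "inv_into (projs M) \<theta>" by (rule inverse)
  have i: "inv_into (projs M) \<theta> (\<theta> p) = p" if "p \<in> projs M" for p
    using bij_betw_inv_into_left[OF bij that] .
  have "adj v' * w' = adj v' * (v' * adj v') * ((w' * adj w') * w')"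
    using goodD(5)[OF gv] goodD(5)[OF gw] v'(1) w'(1)
    by (metis adj_adj adj_mult mult.assoc projsD(2)[OF proj[OF pe]])
  also have "\<dots> = adj v' * ((\<theta> q * \<theta> s) * w')" by (simp add: v' w' q_def s_def mult.assoc)
  also have "\<theta> q * \<theta> s = 0" using orth[OF pq ps] qs by simp
  finally have "frame N (\<theta> e) v' w'"
    unfolding frame_def using goodD[OF gv] goodD[OF gw] v' w' proj[OF pe] by simp
  then show ?thesis
    by unfold_locales (use inverse_good_iff[OF pe] gv gw F v' w' i[OF pe] i[OF pq] i[OF ps]
      in \<open>simp_all add: q_def s_def\<close>)
qed

lemma T_surj:
  assumes "b \<in> N" "b * \<theta> e = b" "\<theta> e * b = 0"
  shows "\<exists>a\<in>M. a * e = a \<and> e * a = 0 \<and> T a = b"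
proof -
  interpret J: framed_iso N M "inv_into (projs M) \<theta>" "\<theta> e" v' w' v w by (rule inverse_framed_iso)
  obtain a where "J.good (\<theta> e) b a" using J.good_total assms by blast
  then have "good e a b" using inverse_good_iff[OF pe] by blast
  then show ?thesis using goodD(1-3)[of e a b] T_eqI[of a b] by (intro bexI[of _ a] conjI)
qed

lemma \<beta>_surj:
  assumes b: "b \<in> N" "b * \<theta> e = b" "\<theta> e * b = b"
  shows "\<exists>\<alpha>\<in>M. \<alpha> * e = \<alpha> \<and> e * \<alpha> = \<alpha> \<and> \<beta> \<alpha> = b"
proof -
  interpret J: framed_iso N M "inv_into (projs M) \<theta>" "\<theta> e" v' w' v w by (rule inverse_framed_iso)
  have "v' * b \<in> N" "v' * b * \<theta> e = v' * b" "\<theta> e * (v' * b) = 0"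
    using b goodD[OF gv] vN_mult[OF N] by (simp_all add: mult.assoc mult_eq_assoc[OF goodD(6)[OF gv]])
  then obtain a where a: "J.good (\<theta> e) (v' * b) a" using J.good_total by blast
  then have g: "good e a (v' * b)" using inverse_good_iff[OF pe] by blast
  have i: "inv_into (projs M) \<theta> (\<theta> q) = q" using bij_betw_inv_into_left[OF bij pq] .
  have "\<theta> q * (v' * b) = v' * b"
    by (simp add: q_def v'(2)[symmetric] mult.assoc mult_eq_assoc[OF v'(1)] b)
  then have qa: "q * a = a"
    using J.good_range[OF proj[OF pe] proj[OF pq] _ _ a] orth[OF pe pq] eq by (simp add: i)
  define \<alpha> where "\<alpha> = adj v * a"
  have va: "v * \<alpha> = a" by (simp add: \<alpha>_def mult.assoc[symmetric] q_def[symmetric] qa)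
  have \<alpha>: "\<alpha> \<in> M" "\<alpha> * e = \<alpha>" "e * \<alpha> = \<alpha>"
    using goodD[OF g] F vN_mult[OF M vN_adj[OF M]]
    by (simp_all add: \<alpha>_def mult.assoc mult_eq_assoc[OF F(14)])
  have "\<beta> \<alpha> = b" by (rule \<beta>_eqI[OF \<alpha>(1,2) b(3)]) (simp add: va g)
  then show ?thesis using \<alpha> by blast
qed

text \<open>A column is its entry in the corner, transported by \<beta>, together with its part
  outside \<open>e\<close>, transported by \<open>T\<close>; the products of both parts are
  transferred by the same \<beta>.\<close>

lemma module_iso_framed: "\<exists>\<Theta>. module_iso M e N (\<theta> e) \<Theta>"
proof -
  define \<Theta> where "\<Theta> x = \<beta> (e * x) + T (x - e * x)" for x
  note E = projsD[OF pe] and E' = projsD[OF proj[OF pe]]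
  have c1: "e * x \<in> M" "e * x * e = e * x" "e * (e * x) = e * x" if "x \<in> M" "x * e = x" for x
    using that vN_mult[OF M E(1)] by (simp_all add: mult.assoc E)
  have c2: "x - e * x \<in> M" "(x - e * x) * e = x - e * x" "e * (x - e * x) = 0" if "x \<in> M" "x * e = x" for x
    using that vN_diff[OF M _ c1(1)] by (simp_all add: algebra_simps E)
  have comp: "\<theta> e * \<Theta> x = \<beta> (e * x)" "\<Theta> x - \<theta> e * \<Theta> x = T (x - e * x)"
    "\<Theta> x \<in> N" "\<Theta> x * \<theta> e = \<Theta> x" if "x \<in> M" "x * e = x" for x
  proof -
    note b = \<beta>_in[OF c1(1,2)[OF that]] and t = goodD[OF T_good[OF c2[OF that]]]
    show "\<theta> e * \<Theta> x = \<beta> (e * x)" using b t by (simp add: \<Theta>_def distrib_left)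
    then show "\<Theta> x - \<theta> e * \<Theta> x = T (x - e * x)" by (simp add: \<Theta>_def)
    show "\<Theta> x \<in> N" "\<Theta> x * \<theta> e = \<Theta> x" using b t vN_add[OF N] by (simp_all add: \<Theta>_def distrib_right)
  qed
  have "module_iso M e N (\<theta> e) \<Theta>"
  proof (rule module_isoI[where \<beta> = \<beta>, OF _ _ _ _ M pe])
    fix x y assume x: "x \<in> M" "x * e = x" and y: "y \<in> M" "y * e = y"
    have "T ((x - e * x) + (y - e * y)) = T (x - e * x) + T (y - e * y)"
      by (rule T_eqI[OF good_plus[OF T_good[OF c2[OF x]] T_good[OF c2[OF y]]]])
    moreover have "(x - e * x) + (y - e * y) = (x + y) - e * (x + y)" by (simp add: algebra_simps)
    ultimately show "\<Theta> (x + y) = \<Theta> x + \<Theta> y"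
      using \<beta>_plus[OF c1(1,2)[OF x] c1(1,2)[OF y]] by (simp add: \<Theta>_def distrib_left)
    have "adj (\<Theta> x) * \<Theta> y = adj (\<theta> e * \<Theta> x) * (\<theta> e * \<Theta> y) + adj (\<Theta> x - \<theta> e * \<Theta> x) * (\<Theta> y - \<theta> e * \<Theta> y)"
      by (simp add: adj_mult adj_diff E' algebra_simps)
    also have "\<dots> = \<beta> (adj (e * x) * (e * y)) + \<beta> (adj (x - e * x) * (y - e * y))"
      unfolding comp(2)[OF x] comp(2)[OF y] unfolding comp(1)[OF x] comp(1)[OF y]
      by (simp only: \<beta>_inner[OF c1[OF y] c1[OF x]] T_inner[OF c2[OF y] c2[OF x]])
    also have "\<dots> = \<beta> (adj (e * x) * (e * y) + adj (x - e * x) * (y - e * y))"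
      by (rule \<beta>_plus[symmetric])
        (use c1[OF x] c1[OF y] c2[OF x] c2[OF y] in
          \<open>simp_all add: vN_mult[OF M] vN_adj[OF M] mult.assoc\<close>)
    also have "adj (e * x) * (e * y) + adj (x - e * x) * (y - e * y) = adj x * y"
      by (simp add: adj_mult adj_diff E algebra_simps)
    finally show "adj (\<Theta> x) * \<Theta> y = \<beta> (adj x * y)" .
  next
    show "inj_on \<beta> {a \<in> M. e * a = a \<and> a * e = a}" using \<beta>_inj by (auto simp: inj_on_def)
    show "bij_betw \<Theta> {x \<in> M. x * e = x} {y \<in> N. y * \<theta> e = y}"
    proof (rule bij_betwI')
      fix x y assume "x \<in> {x \<in> M. x * e = x}" "y \<in> {x \<in> M. x * e = x}"
      then have x: "x \<in> M" "x * e = x" and y: "y \<in> M" "y * e = y" by auto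
      show "\<Theta> x = \<Theta> y \<longleftrightarrow> x = y"
      proof
        assume "\<Theta> x = \<Theta> y"
        then have "\<beta> (e * x) = \<beta> (e * y)" "T (x - e * x) = T (y - e * y)"
          using comp(1,2)[OF x] comp(1,2)[OF y] by simp_all
        then have "e * x = e * y" "x - e * x = y - e * y"
          using \<beta>_inj[OF c1[OF x] c1[OF y]] T_inj[OF c2[OF x] c2[OF y]] by blast+
        then show "x = y" by simp
      qed simp
    next
      fix x assume "x \<in> {x \<in> M. x * e = x}"
      then show "\<Theta> x \<in> {y \<in> N. y * \<theta> e = y}" using comp by simp
    next
      fix y assume "y \<in> {y \<in> N. y * \<theta> e = y}"
      then have y: "y \<in> N" "y * \<theta> e = y" by auto
      have "\<theta> e * y \<in> N" "y - \<theta> e * y \<in> N" using vN_mult[OF N E'(1) y(1)] vN_diff[OF N y(1)] by auto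
      then obtain \<alpha> a where \<alpha>: "\<alpha> \<in> M" "\<alpha> * e = \<alpha>" "e * \<alpha> = \<alpha>" "\<beta> \<alpha> = \<theta> e * y"
        and a: "a \<in> M" "a * e = a" "e * a = 0" "T a = y - \<theta> e * y"
        using \<beta>_surj[of "\<theta> e * y"] T_surj[of "y - \<theta> e * y"] y by (auto simp: algebra_simps E')
      have "\<alpha> + a \<in> {x \<in> M. x * e = x}" "y = \<Theta> (\<alpha> + a)"
        using \<alpha> a vN_add[OF M] by (simp_all add: \<Theta>_def distrib_left distrib_right)
      then show "\<exists>x\<in>{x \<in> M. x * e = x}. y = \<Theta> x" by (rule bexI[rotated])
    qed
  qed
  then show ?thesis by blast
qed

end

context ortho_iso
begin

theorem module_iso_frame:
  assumes fr: "frame M e v w"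
  shows "\<exists>\<Theta>. module_iso M e N (\<theta> e) \<Theta>"
proof -
  obtain v' w' where "good e v v' \<and> adj v' * v' = \<theta> e \<and> v' * adj v' = \<theta> (v * adj v)"
    "good e w w' \<and> adj w' * w' = \<theta> e \<and> w' * adj w' = \<theta> (w * adj w)"
    using good_frame[OF fr] good_frame[OF frame_swap[OF fr]] by blast
  then interpret framed_iso M N \<theta> e v w v' w' by unfold_locales (simp_all add: fr)
  show ?thesis by (rule module_iso_framed)
qed

end

section \<open>Spectral approximation\<close>

lemma bdd_by_proj: "adj p = p \<Longrightarrow> p * p = p \<Longrightarrow> bdd_by p 1"
proof (rule bdd_by_one_if_between)
  assume p: "adj p = p" "p * p = p"
  have eq: "inner (bop_apply p z) z = (norm (bop_apply p z))\<^sup>2" for z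
    using adj_mult_self_apply[of p z] p by simp
  show "0 \<le> inner (bop_apply p z) z" for z unfolding eq by simp
  have 1: "adj (1 - p) * (1 - p) = 1 - p" using p by (simp add: adj_diff algebra_simps)
  show "inner (bop_apply p z) z \<le> (norm z)\<^sup>2" for z
  proof -
    have "0 \<le> inner (bop_apply (1 - p) z) z" using adj_mult_self_apply[of "1 - p" z] unfolding 1 by simp
    then show ?thesis
      by (simp add: minus_bop.rep_eq one_bop.rep_eq inner_diff_left power2_norm_eq_inner)
  qed
qed

lemma norm_add_orth:
  assumes "adj X * Y = 0"
  shows "(norm (bop_apply (X + Y) z))\<^sup>2 = (norm (bop_apply X z))\<^sup>2 + (norm (bop_apply Y z))\<^sup>2"
proof -
  have "inner (bop_apply Y z) (bop_apply X z) = inner (bop_apply (adj X * Y) z) z"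
    using inner_adj[of "adj X" "bop_apply Y z" z] by (simp add: times_bop.rep_eq)
  then have "inner (bop_apply Y z) (bop_apply X z) = 0" by (simp add: assms zero_bop.rep_eq)
  then show ?thesis
    by (simp add: plus_bop.rep_eq power2_norm_eq_inner inner_add_left inner_add_right inner_commute)
qed

text \<open>With orthogonal initial and orthogonal final supports, Pythagoras on both sides gives
  the common bound rather than twice it.\<close>

lemma bdd_by_orth_sum:
  assumes X: "bdd_by X C" "X * r = X" and Y: "bdd_by Y C" "Y * s = Y" and C: "0 \<le> C"
    and XY: "adj X * Y = 0" and r: "adj r = r" "r * r = r" and s: "adj s = s" "s * s = s" and rs: "r * s = 0"
  shows "bdd_by (X + Y) C"
  unfolding bdd_by_def
proof
  fix z
  have sr: "s * r = 0" using mult_zero_adj[OF rs] by (simp add: r s)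
  have "bdd_by (r + s) 1" by (rule bdd_by_proj) (simp_all add: adj_add r s algebra_simps rs sr)
  have "(norm (bop_apply (X + Y) z))\<^sup>2 = (norm (bop_apply X (bop_apply r z)))\<^sup>2 + (norm (bop_apply Y (bop_apply s z)))\<^sup>2"
    using norm_add_orth[OF XY, of z] X(2) Y(2) by (metis times_bop.rep_eq)
  also have "\<dots> \<le> (C * norm (bop_apply r z))\<^sup>2 + (C * norm (bop_apply s z))\<^sup>2"
    by (intro add_mono power_mono bdd_byD X Y norm_ge_zero)
  also have "\<dots> = C\<^sup>2 * (norm (bop_apply (r + s) z))\<^sup>2"
    using norm_add_orth[of r s z] rs by (simp add: r power_mult_distrib algebra_simps)
  also have "\<dots> \<le> C\<^sup>2 * (norm z)\<^sup>2"
    using bdd_byD[OF \<open>bdd_by (r + s) 1\<close>, of z] by (intro mult_left_mono power_mono) auto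
  finally have "(norm (bop_apply (X + Y) z))\<^sup>2 \<le> (C * norm z)\<^sup>2" by (simp add: power_mult_distrib)
  then show "norm (bop_apply (X + Y) z) \<le> C * norm z"
    using C by (simp add: power2_le_iff_abs_le)
qed

text \<open>With \<open>k\<close> the modulus of \<open>h\<close>, the closed range of
  \<open>k + h\<close> is where \<open>h\<close> is positive. The last clause keeps \<open>p\<close>
  below every projection that supports \<open>h\<close>.\<close>

lemma ex_spectral_projection:
  assumes M: "von_neumann_algebra M" and h: "h \<in> M" "adj h = h" "bdd_by h 1"
  shows "\<exists>p\<in>projs M. p * h = h * p \<and> (\<forall>z. 0 \<le> inner (bop_apply (p * h * p) z) z) \<and>
    (\<forall>z. inner (bop_apply ((1 - p) * h * (1 - p)) z) z \<le> 0) \<and> (\<forall>b. h * b = 0 \<longrightarrow> p * b = 0)"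
proof -
  have hh: "inner (bop_apply (h * h) z) z = (norm (bop_apply h z))\<^sup>2" for z
    using adj_mult_self_apply[of h z] by (simp add: h)
  have "inner (bop_apply (h * h) z) z \<le> (norm z)\<^sup>2" for z
    unfolding hh using bdd_byD[OF h(3), of z] by (simp add: power_mono)
  moreover have "0 \<le> inner (bop_apply (h * h) z) z" for z unfolding hh by simp
  moreover have "adj (h * h) = h * h" by (simp add: adj_mult h)
  ultimately obtain k where k: "adj k = k" "k * k = h * h" "\<And>z. 0 \<le> inner (bop_apply k z) z"
      "\<And>c. c * (h * h) = h * h * c \<Longrightarrow> c * k = k * c"
    using ex_sqrt[of "h * h"] by blast
  have kM: "k \<in> M"
    by (rule vN_if_commutes_with_commuting[OF M _ k(4)]) (auto intro: vN_mult[OF M] h)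
  have hk: "h * k = k * h" by (rule k(4)) (simp add: mult.assoc)
  define u where "u = k + h"
  define p where "p = rp u"
  have p: "p \<in> projs M" unfolding p_def u_def by (intro rp_projs M vN_add[OF M] kM h)
  note P = projsD[OF p]
  have pu: "p * u = u" by (simp add: p_def rp_mult)
  \<comment> \<open>\<open>k\<close> and \<open>h\<close> commute and have the same square, so they
    agree on the range of \<open>u\<close>.\<close>
  have "(k - h) * u = 0" by (simp add: u_def algebra_simps k hk)
  then have "(k - h) * p = 0" unfolding p_def by (rule rp_least)
  then have "p * (k - h) = 0" using mult_zero_adj[of "k - h" p] by (simp add: adj_diff k h P)
  then have pk: "p * k = p * h" by (simp add: right_diff_distrib)
  then have 2: "p * h + p * h = k + h" using pu by (simp add: u_def distrib_left)
  have "adj (p * h + p * h) = p * h + p * h" unfolding 2 by (simp add: adj_add k h)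
  then have comm: "p * h = h * p"
    using bop_double_cancel[of "p * h" "h * p"]
    by (simp add: adj_add adj_mult P h)
  have "k * p = h * p" using arg_cong[OF pk, of adj] by (simp add: adj_mult P(2) k(1) h(2))
  then have comm': "p * k = k * p" using comm pk by simp
  have "p * h * p = p * k * p" by (simp add: pk)
  moreover have "(1 - p) * h * (1 - p) = - ((1 - p) * k * (1 - p))"
  proof -
    have 3: "(1 - p) * h * (1 - p) = h - p * h" "(1 - p) * k * (1 - p) = k - p * h"
      using comm comm' pk by (simp_all add: algebra_simps P mult_eq_assoc[OF P(3)] mult_eq_assoc[OF comm[symmetric]] mult_eq_assoc[OF comm'[symmetric]])
    show ?thesis unfolding 3 using 2 by (simp add: algebra_simps)
  qed
  moreover have "0 \<le> inner (bop_apply (s * k * s) z) z" if "adj s = s" for s z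
    using k(3)[of "bop_apply s z"] that by (simp add: times_bop.rep_eq inner_adj[of s])
  ultimately have pos: "0 \<le> inner (bop_apply (p * h * p) z) z"
    "inner (bop_apply ((1 - p) * h * (1 - p)) z) z \<le> 0" for z
    using P(2) by (simp_all add: uminus_bop.rep_eq adj_diff)
  have "p * b = 0" if "h * b = 0" for b
  proof -
    have "adj (k * b) * (k * b) = adj b * (k * k) * b" by (simp add: adj_mult k(1) mult.assoc)
    also have "\<dots> = 0" by (simp add: k(2) mult.assoc that)
    finally have "k * b = 0" by simp
    then have "adj u * b = 0" by (simp add: u_def adj_add k h distrib_right that)
    then show ?thesis unfolding p_def by (rule rp_least_left)
  qed
  then show ?thesis using p comm pos by blast
qed

definition lincomb :: "(complex \<times> 'a::complex_hilbert_space bop) list \<Rightarrow> 'a bop" where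
  "lincomb xs = sum_list (map (\<lambda>(c, p). c *\<^sub>C p) xs)"

lemma lincomb_simps [simp]:
  "lincomb [] = 0" "lincomb ((c, p) # xs) = c *\<^sub>C p + lincomb xs"
  "lincomb (xs @ ys) = lincomb xs + lincomb ys"
  by (simp_all add: lincomb_def)

lemma lincomb_scale: "lincomb (map (\<lambda>(c, p). (d * c, p)) xs) = d *\<^sub>C lincomb xs"
  by (induction xs) (auto simp: bop_scaleC_add_right)

text \<open>Binary digits of \<open>a\<close>: if \<open>b\<close> is the current remainder, the
  next digit is the spectral projection \<open>p\<close> of \<open>b + b - e\<close>, and the next
  remainder is \<open>b + b - p\<close>.\<close>

lemma dyadic_approximation:
  assumes M: "von_neumann_algebra M" and e: "e \<in> projs M"
    and a: "a \<in> M" "adj a = a" "a * e = a" "\<And>z. 0 \<le> inner (bop_apply a z) z"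
      "\<And>z. inner (bop_apply a z) z \<le> (norm z)\<^sup>2"
  shows "\<exists>xs. snd ` set xs \<subseteq> {p\<in>projs M. p * e = p} \<and> bdd_by (a - lincomb xs) ((1 / 2) ^ n)"
proof -
  note E = projsD[OF e]
  have "\<exists>xs b. snd ` set xs \<subseteq> {p\<in>projs M. p * e = p} \<and> a = lincomb xs + complex_of_real ((1 / 2) ^ n) *\<^sub>C b \<and>
    b \<in> M \<and> adj b = b \<and> b * e = b \<and> (\<forall>z. 0 \<le> inner (bop_apply b z) z \<and> inner (bop_apply b z) z \<le> (norm z)\<^sup>2)"
  proof (induction n)
    case 0
    show ?case by (rule exI[of _ "[]"], rule exI[of _ a]) (simp add: a)
  next
    case (Suc n)
    then obtain xs b where xs: "snd ` set xs \<subseteq> {p\<in>projs M. p * e = p}"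
        "a = lincomb xs + complex_of_real ((1 / 2) ^ n) *\<^sub>C b"
      and b: "b \<in> M" "adj b = b" "b * e = b" "\<And>z. 0 \<le> inner (bop_apply b z) z"
        "\<And>z. inner (bop_apply b z) z \<le> (norm z)\<^sup>2" by blast
    have eb: "e * b = b" using arg_cong[OF b(3), of adj] by (simp add: adj_mult b(2) E(2))
    define h where "h = b + b - e"
    have h: "h \<in> M" "adj h = h" "h * e = h" "e * h = h"
      using b eb E vN_add[OF M] vN_diff[OF M] by (simp_all add: h_def adj_add adj_diff algebra_simps)
    have b1: "inner (bop_apply b z) z \<le> (norm (bop_apply e z))\<^sup>2" for z
    proof -
      have "bop_apply b z = bop_apply b (bop_apply e z)" using b(3) by (metis times_bop.rep_eq)
      moreover have "bop_apply b z = bop_apply e (bop_apply b z)" using eb by (metis times_bop.rep_eq)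
      ultimately have "inner (bop_apply b z) z = inner (bop_apply b (bop_apply e z)) (bop_apply e z)"
        using inner_adj[of e "bop_apply b z" z] E(2) by metis
      then show ?thesis using b(5)[of "bop_apply e z"] by simp
    qed
    have ee: "inner (bop_apply e z) z = (norm (bop_apply e z))\<^sup>2" for z
      using adj_mult_self_apply[of e z] E by simp
    have hz: "inner (bop_apply h z) z = 2 * inner (bop_apply b z) z - (norm (bop_apply e z))\<^sup>2" for z
      by (simp add: h_def minus_bop.rep_eq plus_bop.rep_eq inner_diff_left inner_add_left ee)
    have e1: "(norm (bop_apply e z))\<^sup>2 \<le> (norm z)\<^sup>2" for z
      using bdd_byD[OF bdd_by_proj[OF E(2,3)], of z] by (simp add: power_mono)
    have hu: "inner (bop_apply h z) z \<le> (norm z)\<^sup>2" "- (norm z)\<^sup>2 \<le> inner (bop_apply h z) z" for z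
      using hz[of z] b1[of z] b(4)[of z] e1[of z] by linarith+
    have "bdd_by (e - b) 1"
    proof (rule bdd_by_one_if_between)
      show "0 \<le> inner (bop_apply (e - b) z) z" "inner (bop_apply (e - b) z) z \<le> (norm z)\<^sup>2" for z
        using b1[of z] b(4)[of z] e1[of z] unfolding minus_bop.rep_eq inner_diff_left ee by linarith+
    qed (simp add: adj_diff b E)
    have h1: "bdd_by h 1"
      unfolding bdd_by_def
    proof
      fix z
      \<comment> \<open>\<open>e - h\<^sup>2 = 4 b (e - b)\<close>, and \<open>b - b\<^sup>2\<close> is positive because \<open>b\<close> is a positive contraction\<close>
      have "h * h = (b * b + b * b) + (b * b + b * b) - (b + b) - (b + b) + e"
        by (simp add: h_def algebra_simps b eb E)
      then have "inner (bop_apply (h * h) z) z = 4 * inner (bop_apply (b * b) z) z - 4 * inner (bop_apply b z) z + (norm (bop_apply e z))\<^sup>2"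
        by (simp add: minus_bop.rep_eq plus_bop.rep_eq inner_diff_left inner_add_left ee)
      moreover have "inner (bop_apply (b * b) z) z \<le> inner (bop_apply b z) z"
      proof -
        obtain c where c: "adj c = c" "c * c = b" "bdd_by c 1" using ex_sqrt[of b] b by blast
        have "inner (bop_apply (b * b) z) z = (norm (bop_apply c (bop_apply c z)))\<^sup>2"
          using adj_mult_self_apply[of b z] c(2) b(2) by (metis times_bop.rep_eq)
        also have "\<dots> \<le> (norm (bop_apply c z))\<^sup>2"
          using bdd_byD[OF c(3), of "bop_apply c z"] by (simp add: power_mono)
        also have "\<dots> = inner (bop_apply b z) z" using adj_mult_self_apply[of c z] c by simp
        finally show ?thesis .
      qed
      ultimately have "inner (bop_apply (h * h) z) z \<le> (norm z)\<^sup>2" using e1[of z] by linarith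
      then have "(norm (bop_apply h z))\<^sup>2 \<le> (norm z)\<^sup>2" using adj_mult_self_apply[of h z] h(2) by simp
      then show "norm (bop_apply h z) \<le> 1 * norm z" by simp
    qed
    obtain p where p: "p \<in> projs M" "p * h = h * p" "\<And>z. 0 \<le> inner (bop_apply (p * h * p) z) z"
        "\<And>z. inner (bop_apply ((1 - p) * h * (1 - p)) z) z \<le> 0" "\<And>b. h * b = 0 \<Longrightarrow> p * b = 0"
      using ex_spectral_projection[OF M h(1,2) h1] by blast
    note P = projsD[OF p(1)]
    have pe: "p * e = p" using p(5)[of "1 - e"] h(3) by (simp add: algebra_simps)
    have ep: "e * p = p" using proj_comm_le[OF p(1) e] pe by simp
    define b' where "b' = b + b - p"
    \<comment> \<open>On \<open>p\<close> the new remainder is the positive part of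
      \<open>h\<close>; on \<open>e - p\<close> it is the identity plus the negative part. As
      \<open>h\<close> lies between \<open>- e\<close> and \<open>e\<close>, it stays between 0 and
      \<open>e\<close>.\<close>
    have b'h: "b' = p * h * p + ((e - p) + (e - p) * h * (e - p))"
    proof -
      have 1: "p * h * p = h * p" by (simp add: p(2) mult.assoc P)
      have 2: "(e - p) * h * (e - p) = h - h * p"
        by (simp add: algebra_simps h pe ep p(2) P mult_eq_assoc[OF h(4)])
      have 3: "b' = h + e - p" by (simp add: b'_def h_def)
      show ?thesis unfolding 1 2 3 by simp
    qed
    have hp: "(1 - p) * h * (1 - p) = (e - p) * h * (e - p)"
      by (simp add: algebra_simps h pe ep p(2) P mult_eq_assoc[OF h(4)])
    have sand: "inner (bop_apply (s * h * s) z) z = inner (bop_apply h (bop_apply s z)) (bop_apply s z)"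
      if "adj s = s" for s z using that by (simp add: times_bop.rep_eq inner_adj[of s])
    have pr: "inner (bop_apply r z) z = (norm (bop_apply r z))\<^sup>2" if "adj r = r" "r * r = r" for r z
      using adj_mult_self_apply[of r z] that by simp
    have epp: "adj (e - p) = e - p" "(e - p) * (e - p) = e - p" "adj p = p" "p * p = p"
      using E P pe ep by (simp_all add: adj_diff algebra_simps)
    have form: "inner (bop_apply b' z) z = inner (bop_apply h (bop_apply p z)) (bop_apply p z) +
        ((norm (bop_apply (e - p) z))\<^sup>2 + inner (bop_apply h (bop_apply (e - p) z)) (bop_apply (e - p) z))" for z
      unfolding b'h plus_bop.rep_eq inner_add_left by (simp only: sand epp pr)
    have "0 \<le> inner (bop_apply b' z) z \<and> inner (bop_apply b' z) z \<le> (norm z)\<^sup>2" for z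
    proof
      show "0 \<le> inner (bop_apply b' z) z"
        using p(3)[of z] hu(2)[of "bop_apply (e - p) z"] unfolding form sand[OF epp(3)] by linarith
      have "(norm (bop_apply p z))\<^sup>2 + (norm (bop_apply (e - p) z))\<^sup>2 = (norm (bop_apply e z))\<^sup>2"
        using norm_add_orth[of p "e - p" z] by (simp add: P right_diff_distrib pe)
      then show "inner (bop_apply b' z) z \<le> (norm z)\<^sup>2"
        using p(4)[of z] hu(1)[of "bop_apply p z"] e1[of z]
        unfolding form hp sand[OF epp(1)] by linarith
    qed
    moreover have "b' \<in> M" "adj b' = b'" "b' * e = b'"
      using b P vN_add[OF M] vN_diff[OF M] by (simp_all add: b'_def adj_add adj_diff algebra_simps pe)
    moreover have "a = lincomb (xs @ [(complex_of_real ((1/2) ^ Suc n), p)]) + complex_of_real ((1 / 2) ^ Suc n) *\<^sub>C b'"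
    proof -
      have "complex_of_real ((1 / 2) ^ Suc n) *\<^sub>C p + complex_of_real ((1 / 2) ^ Suc n) *\<^sub>C b' =
          complex_of_real ((1 / 2) ^ Suc n) *\<^sub>C (2 *\<^sub>C b)"
        unfolding bop_scaleC_add_right[symmetric] by (simp add: b'_def bop_scaleC_two)
      also have "\<dots> = complex_of_real ((1 / 2) ^ n) *\<^sub>C b" by simp
      finally show ?thesis using xs(2) by (simp add: add.assoc)
    qed
    moreover have "snd ` set (xs @ [(complex_of_real ((1/2) ^ Suc n), p)]) \<subseteq> {p\<in>projs M. p * e = p}"
      using xs(1) p(1) pe by auto
    ultimately show ?case by blast
  qed
  then obtain xs b where xs: "snd ` set xs \<subseteq> {p\<in>projs M. p * e = p}"
      "a = lincomb xs + complex_of_real ((1 / 2) ^ n) *\<^sub>C b" "adj b = b"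
      "\<And>z. 0 \<le> inner (bop_apply b z) z" "\<And>z. inner (bop_apply b z) z \<le> (norm z)\<^sup>2" by blast
  have "bdd_by b 1" by (rule bdd_by_one_if_between) (use xs in auto)
  from bdd_by_scaleC[OF this, of "complex_of_real ((1 / 2) ^ n)"]
  have "bdd_by (a - lincomb xs) ((1 / 2) ^ n)" by (simp add: xs(2) norm_power)
  then show ?thesis using xs(1) by blast
qed

definition approximable :: "'a::complex_hilbert_space bop set \<Rightarrow> 'a bop \<Rightarrow> bool" where
  "approximable P a \<longleftrightarrow> (\<forall>\<epsilon>>0. \<exists>xs. snd ` set xs \<subseteq> P \<and> bdd_by (a - lincomb xs) \<epsilon>)"

lemma approximable_add: "approximable P a \<Longrightarrow> approximable P b \<Longrightarrow> approximable P (a + b)"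
  unfolding approximable_def
proof (intro allI impI)
  fix \<epsilon> :: real
  assume *: "\<forall>\<epsilon>>0. \<exists>xs. snd ` set xs \<subseteq> P \<and> bdd_by (a - lincomb xs) \<epsilon>"
    "\<forall>\<epsilon>>0. \<exists>xs. snd ` set xs \<subseteq> P \<and> bdd_by (b - lincomb xs) \<epsilon>" "0 < \<epsilon>"
  from *(1)[rule_format, of "\<epsilon> / 2"] *(3) obtain xs where xs: "snd ` set xs \<subseteq> P" "bdd_by (a - lincomb xs) (\<epsilon> / 2)"
    by auto
  from *(2)[rule_format, of "\<epsilon> / 2"] *(3) obtain ys where ys: "snd ` set ys \<subseteq> P" "bdd_by (b - lincomb ys) (\<epsilon> / 2)"
    by auto
  have "bdd_by (a + b - lincomb (xs @ ys)) \<epsilon>" using bdd_by_add[OF xs(2) ys(2)] by (simp add: algebra_simps)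
  then show "\<exists>xs. snd ` set xs \<subseteq> P \<and> bdd_by (a + b - lincomb xs) \<epsilon>" using xs(1) ys(1)
    by (intro exI[of _ "xs @ ys"]) auto
qed

lemma approximable_scaleC: "approximable P a \<Longrightarrow> approximable P (d *\<^sub>C a)"
  unfolding approximable_def
proof (intro allI impI)
  fix \<epsilon> :: real
  assume *: "\<forall>\<epsilon>>0. \<exists>xs. snd ` set xs \<subseteq> P \<and> bdd_by (a - lincomb xs) \<epsilon>" "0 < \<epsilon>"
  have d: "0 < cmod d + 1" by (simp add: add_nonneg_pos)
  with * obtain xs where xs: "snd ` set xs \<subseteq> P" "bdd_by (a - lincomb xs) (\<epsilon> / (cmod d + 1))"
    by (meson divide_pos_pos)
  have "cmod d * (\<epsilon> / (cmod d + 1)) \<le> (cmod d + 1) * (\<epsilon> / (cmod d + 1))"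
    using *(2) d by (intro mult_right_mono) auto
  also have "\<dots> = \<epsilon>" using d by simp
  finally have "bdd_by (d *\<^sub>C a - lincomb (map (\<lambda>(c, p). (d * c, p)) xs)) \<epsilon>"
    using bdd_by_mono[OF bdd_by_scaleC[OF xs(2), of d]]
    by (simp add: lincomb_scale bop_scaleC_diff_right)
  moreover have "snd ` set (map (\<lambda>(c, p). (d * c, p)) xs) \<subseteq> P" using xs(1) by force
  ultimately show "\<exists>xs. snd ` set xs \<subseteq> P \<and> bdd_by (d *\<^sub>C a - lincomb xs) \<epsilon>" by blast
qed

lemma approximable_corner:
  assumes M: "von_neumann_algebra M" and e: "e \<in> projs M" and a: "a \<in> M" "e * a = a" "a * e = a"
  shows "approximable {p\<in>projs M. p * e = p} a" (is "approximable ?P a")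
proof -
  note E = projsD[OF e]
  have unit: "approximable ?P b" if b: "b \<in> M" "adj b = b" "b * e = b" "\<And>z. 0 \<le> inner (bop_apply b z) z"
      "\<And>z. inner (bop_apply b z) z \<le> (norm z)\<^sup>2" for b
    unfolding approximable_def
  proof (intro allI impI)
    fix \<epsilon> :: real assume "0 < \<epsilon>"
    then obtain n where "(1 / 2) ^ n < \<epsilon>" using real_arch_pow_inv[of \<epsilon> "1 / 2"] by auto
    with dyadic_approximation[OF M e b, of n] show "\<exists>xs. snd ` set xs \<subseteq> ?P \<and> bdd_by (b - lincomb xs) \<epsilon>"
      by (meson bdd_by_mono less_imp_le)
  qed
  have ae: "approximable ?P e"
  proof (rule unit)
    have "inner (bop_apply e z) z = (norm (bop_apply e z))\<^sup>2" for z
      using adj_mult_self_apply[of e z] E by simp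
    then show "0 \<le> inner (bop_apply e z) z" "inner (bop_apply e z) z \<le> (norm z)\<^sup>2" for z
      using bdd_byD[OF bdd_by_proj[OF E(2,3)], of z] by (simp_all add: power_mono)
  qed (use E in auto)
  have sa: "approximable ?P b" if b: "b \<in> M" "adj b = b" "b * e = b" for b
  proof -
    obtain C where C: "0 < C" "bdd_by b C" using ex_bdd_by by blast
    have eb: "e * b = b" using arg_cong[OF b(3), of adj] by (simp add: adj_mult b(2) E(2))
    \<comment> \<open>Rescaling puts \<open>b\<close> between \<open>- e / 2\<close> and
      \<open>e / 2\<close>; the shift by \<open>e / 2\<close> makes it a positive
      contraction.\<close>
    define c where "c = complex_of_real (1 / (2 * C)) *\<^sub>C b + (1 / 2) *\<^sub>C e"
    have bz: "\<bar>inner (bop_apply b z) z\<bar> \<le> C * (norm (bop_apply e z))\<^sup>2" for z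
    proof -
      let ?y = "bop_apply e z"
      have "inner (bop_apply b z) z = inner (bop_apply b ?y) ?y"
        using b(3) eb inner_adj[of e "bop_apply b z" z] E(2) by (metis times_bop.rep_eq)
      also have "\<bar>\<dots>\<bar> \<le> norm (bop_apply b ?y) * norm ?y" by (rule Cauchy_Schwarz_ineq2)
      also have "\<dots> \<le> C * norm ?y * norm ?y" by (intro mult_right_mono bdd_byD C) simp
      finally show ?thesis by (simp add: power2_eq_square)
    qed
    have ee: "inner (bop_apply e z) z = (norm (bop_apply e z))\<^sup>2" for z
      using adj_mult_self_apply[of e z] E by simp
    have half: "inner (bop_apply ((1/2) *\<^sub>C e) z) z = (norm (bop_apply e z))\<^sup>2 / 2" for z
      using scaleC_of_real[of "1/2" "bop_apply e z"] by (simp add: scaleC_bop.rep_eq ee)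
    have bC: "inner (bop_apply (complex_of_real (1 / (2 * C)) *\<^sub>C b) z) z = inner (bop_apply b z) z / (2 * C)" for z
      by (simp only: scaleC_bop.rep_eq scaleC_of_real inner_scaleR_left) simp
    have cz: "inner (bop_apply c z) z = inner (bop_apply b z) z / (2 * C) + (norm (bop_apply e z))\<^sup>2 / 2" for z
      unfolding c_def plus_bop.rep_eq inner_add_left half bC by (rule refl)
    have q: "\<bar>inner (bop_apply b z) z / (2 * C)\<bar> \<le> (norm (bop_apply e z))\<^sup>2 / 2" for z
      using bz[of z] C(1) by (simp add: abs_divide pos_divide_le_eq mult.commute)
    have "approximable ?P c"
    proof (rule unit)
      show "0 \<le> inner (bop_apply c z) z" for z using q[of z] unfolding cz by linarith
      have "(norm (bop_apply e z))\<^sup>2 \<le> (norm z)\<^sup>2" for z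
        using bdd_byD[OF bdd_by_proj[OF E(2,3)], of z] by (simp add: power_mono)
      then show "inner (bop_apply c z) z \<le> (norm z)\<^sup>2" for z using q[of z] unfolding cz by (smt (verit) field_sum_of_halves)
      show "c \<in> M" unfolding c_def by (intro vN_add M vN_scaleC b E(1))
    qed (simp_all add: c_def adj_add b E distrib_right)
    then have "approximable ?P (complex_of_real (2 * C) *\<^sub>C (c + (- (1/2)) *\<^sub>C e))"
      by (intro approximable_scaleC approximable_add ae)
    moreover have "complex_of_real (2 * C) *\<^sub>C (c + (- (1/2)) *\<^sub>C e) = b"
      using C(1) by (simp add: c_def bop_scaleC_minus_left)
    ultimately show ?thesis by simp
  qed
  have ea: "e * adj a = adj a" "adj a * e = adj a"
    using arg_cong[OF a(2), of adj] arg_cong[OF a(3), of adj] by (simp_all add: adj_mult E)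
  have "approximable ?P ((1/2) *\<^sub>C (a + adj a) + \<i> *\<^sub>C ((- \<i> / 2) *\<^sub>C (a - adj a)))"
  proof (intro approximable_add approximable_scaleC[of _ _ \<i>] sa)
    show "(1/2) *\<^sub>C (a + adj a) \<in> M" "(- \<i> / 2) *\<^sub>C (a - adj a) \<in> M"
      by (intro vN_scaleC vN_add vN_diff vN_adj M a)+
  qed (simp_all add: adj_add adj_diff add.commute bop_scaleC_diff_right bop_scaleC_minus_left a ea
      distrib_right left_diff_distrib)
  moreover have "(1/2) *\<^sub>C (a + adj a) + \<i> *\<^sub>C ((- \<i> / 2) *\<^sub>C (a - adj a)) = a"
    by (simp add: bop_scaleC_add_right bop_scaleC_diff_right) (simp add: bop_half_add_half)
  ultimately show ?thesis by simp
qed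

section \<open>Commutative corners\<close>

text \<open>
  The isomorphism of the projection lattices is given by its graph \<open>P\<close>, which makes the situation
  symmetric in \<open>M\<close> and \<open>N\<close>.
\<close>

locale boolean_pairing =
  fixes M :: "'a::complex_hilbert_space bop set" and N :: "'b::complex_hilbert_space bop set"
    and e f and P :: "('a bop \<times> 'b bop) set"
  assumes M: "von_neumann_algebra M" and N: "von_neumann_algebra N"
    and e: "e \<in> projs M" and f: "f \<in> projs N"
    and dom: "\<And>p p'. (p, p') \<in> P \<Longrightarrow> p \<in> projs M \<and> p * e = p \<and> p' \<in> projs N \<and> p' * f = p'"
    and total: "\<And>p. p \<in> projs M \<Longrightarrow> p * e = p \<Longrightarrow> \<exists>p'. (p, p') \<in> P"
    and surj: "\<And>p'. p' \<in> projs N \<Longrightarrow> p' * f = p' \<Longrightarrow> \<exists>p. (p, p') \<in> P"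
    and unit: "(e, f) \<in> P"
    and mult: "\<And>p p' q q'. (p, p') \<in> P \<Longrightarrow> (q, q') \<in> P \<Longrightarrow> (p * q, p' * q') \<in> P"
    and diff: "\<And>p p' q q'. (p, p') \<in> P \<Longrightarrow> (q, q') \<in> P \<Longrightarrow> (p - p * q, p' - p' * q') \<in> P"
    and zero: "\<And>p p'. (p, p') \<in> P \<Longrightarrow> p = 0 \<longleftrightarrow> p' = 0"
begin

lemma converse: "boolean_pairing N M f e (P\<inverse>)"
  by unfold_locales (use M N e f dom total surj unit mult diff zero in auto)

definition l1 :: "(complex \<times> 'a bop \<times> 'b bop) list \<Rightarrow> 'a bop" where
  "l1 xs = lincomb (map (\<lambda>(c, p, p'). (c, p)) xs)"

definition l2 :: "(complex \<times> 'a bop \<times> 'b bop) list \<Rightarrow> 'b bop" where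
  "l2 xs = lincomb (map (\<lambda>(c, p, p'). (c, p')) xs)"

abbreviation ok :: "(complex \<times> 'a bop \<times> 'b bop) list \<Rightarrow> bool" where
  "ok xs \<equiv> snd ` set xs \<subseteq> P"

lemma l_simps [simp]:
  "l1 [] = 0" "l1 ((c, p, p') # xs) = c *\<^sub>C p + l1 xs" "l1 (xs @ ys) = l1 xs + l1 ys"
  "l2 [] = 0" "l2 ((c, p, p') # xs) = c *\<^sub>C p' + l2 xs" "l2 (xs @ ys) = l2 xs + l2 ys"
  by (simp_all add: l1_def l2_def)

lemma P_comm: "(p, p') \<in> P \<Longrightarrow> (q, q') \<in> P \<Longrightarrow> p * q = q * p \<and> p' * q' = q' * p'"
  using dom[OF mult[of p p' q q']] dom[of p p'] dom[of q q'] by (metis adj_mult projsD(2))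

lemma l_in: "ok xs \<Longrightarrow> l1 xs \<in> M \<and> l1 xs * e = l1 xs \<and> l2 xs \<in> N \<and> l2 xs * f = l2 xs"
proof (induction xs)
  case Nil
  then show ?case using vN_zero[OF M] vN_zero[OF N] by simp
next
  case (Cons x xs)
  obtain c p p' where x: "x = (c, p, p')" by (metis surj_pair)
  then have "p \<in> projs M \<and> p * e = p \<and> p' \<in> projs N \<and> p' * f = p'" using Cons dom by auto
  then show ?case using Cons
    by (simp add: x distrib_right vN_add[OF M] vN_add[OF N] vN_scaleC[OF M] vN_scaleC[OF N]
        projsD(1)[of p M] projsD(1)[of p' N])
qed

lemma l2_comm: "ok xs \<Longrightarrow> (r, r') \<in> P \<Longrightarrow> l2 xs * r' = r' * l2 xs"
proof (induction xs)
  case (Cons x xs)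
  obtain c p p' where x: "x = (c, p, p')" by (metis surj_pair)
  then have "p' * r' = r' * p'" using Cons P_comm[of p p' r r'] by auto
  then show ?case using Cons by (simp add: x distrib_left distrib_right)
qed simp

text \<open>
  Splitting along the first projection of the combination reduces the bound to two combinations
  with fewer terms; here the scalar \<open>\<mu>\<close> collects the coefficients already decided on \<open>r\<close>.
\<close>

lemma bdd_transfer:
  assumes "ok xs" "(r, r') \<in> P" "0 \<le> C" "bdd_by ((\<mu> *\<^sub>C 1 + l1 xs) * r) C"
  shows "bdd_by ((\<mu> *\<^sub>C 1 + l2 xs) * r') C"
  using assms
proof (induction xs arbitrary: \<mu> r r')
  case (Nil \<mu> r r')
  note D = dom[OF Nil(2)]
  show ?case
  proof (cases "r' = 0")
    case False
    then have "r \<noteq> 0" using zero[OF Nil(2)] by simp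
    then obtain y where y: "bop_apply r y \<noteq> 0" using bop_eqI[of r 0] by (auto simp: zero_bop.rep_eq)
    let ?x = "bop_apply r y"
    have "bop_apply r ?x = ?x" using projsD(3)[of r M] D by (metis times_bop.rep_eq)
    then have "norm (\<mu> *\<^sub>C ?x) \<le> C * norm ?x"
      using bdd_byD[OF Nil(4), of ?x] by (simp add: scaleC_bop.rep_eq)
    then have "cmod \<mu> \<le> C" using y by (simp add: norm_scaleC)
    moreover have "bdd_by r' 1" using D by (intro bdd_by_proj) (auto simp: projsD)
    ultimately show ?thesis using bdd_by_scaleC[of r' 1 \<mu>] by (auto intro: bdd_by_mono)
  qed (use Nil in simp)
next
  case (Cons x xs \<mu> r r')
  obtain c p p' where x: "x = (c, p, p')" by (metis surj_pair)
  have p: "(p, p') \<in> P" and ok: "ok xs" using Cons(2) x by auto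
  note r = \<open>(r, r') \<in> P\<close>
  define r1 where "r1 = r * p"
  define r1' where "r1' = r' * p'"
  define r2 where "r2 = r - r * p"
  define r2' where "r2' = r' - r' * p'"
  have R: "(r1, r1') \<in> P" "(r2, r2') \<in> P"
    unfolding r1_def r1'_def r2_def r2'_def by (rule mult[OF r p], rule diff[OF r p])
  note dp = dom[OF p] and dr = dom[OF r] and d1 = dom[OF R(1)] and d2 = dom[OF R(2)]
  have pp: "p * p = p" "p' * p' = p'" "r * r = r" "r' * r' = r'"
    using projsD(3)[of p M] projsD(3)[of p' N] projsD(3)[of r M] projsD(3)[of r' N] dp dr by auto
  have rp: "p * r = r * p" "p' * r' = r' * p'" using P_comm[OF p r] by auto
  have 1: "p * r1 = r1" "p' * r1' = r1'" "p * r2 = 0" "p' * r2' = 0" "r * r1 = r1" "r * r2 = r2"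
    using pp rp by (simp_all add: r1_def r1'_def r2_def r2'_def right_diff_distrib mult_eq_assoc[OF pp(1)]
        mult_eq_assoc[OF pp(2)] mult_eq_assoc[OF pp(3)] mult_eq_assoc[OF rp(1)] mult_eq_assoc[OF rp(2)] mult.assoc)
  have r12': "r1' * r2' = 0"
    using pp rp by (simp add: r1'_def r2'_def algebra_simps mult_eq_assoc[OF pp(2)] mult_eq_assoc[OF pp(4)]
        mult_eq_assoc[OF rp(2)])
  let ?A = "\<mu> *\<^sub>C 1 + l1 (x # xs)"
  have b: "bdd_by (?A * r * s) (C * 1)" if "s \<in> projs M" for s
    using that by (intro bdd_by_mult[OF Cons(5)] bdd_by_proj) (auto simp: projsD Cons(4))
  have "?A * r * r1 = ((\<mu> + c) *\<^sub>C 1 + l1 xs) * r1" "?A * r * r2 = (\<mu> *\<^sub>C 1 + l1 xs) * r2"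
    by (simp_all add: x mult.assoc 1 distrib_right bop_scaleC_add_left)
  then have "bdd_by (((\<mu> + c) *\<^sub>C 1 + l1 xs) * r1) C" "bdd_by ((\<mu> *\<^sub>C 1 + l1 xs) * r2) C"
    using b[of r1] b[of r2] d1 d2 by auto
  then have X: "bdd_by (((\<mu> + c) *\<^sub>C 1 + l2 xs) * r1') C" (is "bdd_by ?X C")
    and Y: "bdd_by ((\<mu> *\<^sub>C 1 + l2 xs) * r2') C" (is "bdd_by ?Y C")
    using Cons(1)[OF ok R(1) Cons(4)] Cons(1)[OF ok R(2) Cons(4)] by auto
  have s: "adj r1' = r1'" "r1' * r1' = r1'" "adj r2' = r2'" "r2' * r2' = r2'"
    using d1 d2 projsD[of r1' N] projsD[of r2' N] by auto
  have "r1' * ?X = ?X" "r2' * ?Y = ?Y"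
    using l2_comm[OF ok R(1)] l2_comm[OF ok R(2)] s
    by (simp_all add: distrib_left distrib_right mult_eq_assoc)
  then have "adj ?X * r1' = adj ?X" "r2' * ?Y = ?Y"
    using arg_cong[of "r1' * ?X" ?X adj] s(1) by (metis adj_mult, blast)
  then have "adj ?X * ?Y = 0" using r12' mult_zero_between by blast
  then have "bdd_by (?X + ?Y) C"
    by (intro bdd_by_orth_sum[OF X _ Y _ Cons(4) _ s(1,2,3,4) r12']) (simp_all add: mult.assoc s)
  moreover have "(\<mu> *\<^sub>C 1 + l2 (x # xs)) * r' = ?X + ?Y"
  proof -
    have r': "r' = r1' + r2'" by (simp add: r1'_def r2'_def)
    show ?thesis unfolding r' by (simp add: x distrib_left distrib_right bop_scaleC_add_left 1)
  qed
  ultimately show ?case by simp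
qed

definition neg :: "(complex \<times> 'a bop \<times> 'b bop) list \<Rightarrow> (complex \<times> 'a bop \<times> 'b bop) list" where
  "neg xs = map (\<lambda>(c, p). (- c, p)) xs"

lemma neg: "l1 (neg xs) = - l1 xs" "l2 (neg xs) = - l2 xs" "snd ` set (neg xs) = snd ` set xs"
  by (induction xs) (auto simp: neg_def bop_scaleC_minus_left)

lemma bdd_transfer_diff:
  assumes "ok xs" "ok ys" "0 \<le> C" "bdd_by (l1 xs - l1 ys) C"
  shows "bdd_by (l2 xs - l2 ys) C"
proof -
  have ok: "ok (xs @ neg ys)" using assms neg(3)[of ys] by (simp add: image_Un)
  have "l1 (xs @ neg ys) = l1 xs - l1 ys" "l2 (xs @ neg ys) = l2 xs - l2 ys" by (simp_all add: neg)
  then show ?thesis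
    using bdd_transfer[OF ok unit assms(3), of 0] l_in[OF ok] assms(4) by simp
qed

text \<open>The closure of the graph of the assignment of \<open>l2 xs\<close> to
  \<open>l1 xs\<close>; as a relation it has an evident converse, and the norm estimate makes it
  single-valued.\<close>

definition R :: "'a bop \<Rightarrow> 'b bop \<Rightarrow> bool" where
  "R a b \<longleftrightarrow> (\<forall>\<epsilon>>0. \<exists>xs. ok xs \<and> bdd_by (a - l1 xs) \<epsilon> \<and> bdd_by (b - l2 xs) \<epsilon>)"

lemma R_D: "R a b \<Longrightarrow> 0 < \<epsilon> \<Longrightarrow> \<exists>xs. ok xs \<and> bdd_by (a - l1 xs) \<epsilon> \<and> bdd_by (b - l2 xs) \<epsilon>"
  unfolding R_def by blast

lemma R_functional:
  assumes "R a b" "R a c" shows "b = c"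
proof -
  have "bdd_by (b - c) \<epsilon>" if "0 < \<epsilon>" for \<epsilon>
  proof -
    have \<epsilon>: "0 < \<epsilon> / 4" using that by simp
    obtain xs where xs: "ok xs" "bdd_by (a - l1 xs) (\<epsilon> / 4)" "bdd_by (b - l2 xs) (\<epsilon> / 4)"
      using R_D[OF assms(1) \<epsilon>] by blast
    obtain ys where ys: "ok ys" "bdd_by (a - l1 ys) (\<epsilon> / 4)" "bdd_by (c - l2 ys) (\<epsilon> / 4)"
      using R_D[OF assms(2) \<epsilon>] by blast
    have "bdd_by (l1 xs - l1 ys) (\<epsilon> / 4 + \<epsilon> / 4)" using bdd_by_diff[OF ys(2) xs(2)] by simp
    then have "bdd_by (l2 xs - l2 ys) (\<epsilon> / 4 + \<epsilon> / 4)"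
      using bdd_transfer_diff[OF xs(1) ys(1)] that by simp
    from bdd_by_diff[OF bdd_by_add[OF xs(3) this] ys(3)]
    show ?thesis using that by (auto intro: bdd_by_mono)
  qed
  then have "b - c = 0" by (rule bdd_by_arbitrarily_small)
  then show ?thesis by simp
qed

lemma R_P: "(p, p') \<in> P \<Longrightarrow> R p p'"
  unfolding R_def by (intro allI impI exI[of _ "[(1, p, p')]"]) simp

lemma R_add:
  assumes "R a b" "R c d" shows "R (a + c) (b + d)"
  unfolding R_def
proof (intro allI impI)
  fix \<epsilon> :: real assume "0 < \<epsilon>"
  then have \<epsilon>: "0 < \<epsilon> / 2" by simp
  obtain xs where xs: "ok xs" "bdd_by (a - l1 xs) (\<epsilon> / 2)" "bdd_by (b - l2 xs) (\<epsilon> / 2)"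
    using R_D[OF assms(1) \<epsilon>] by blast
  obtain ys where ys: "ok ys" "bdd_by (c - l1 ys) (\<epsilon> / 2)" "bdd_by (d - l2 ys) (\<epsilon> / 2)"
    using R_D[OF assms(2) \<epsilon>] by blast
  show "\<exists>xs. ok xs \<and> bdd_by (a + c - l1 xs) \<epsilon> \<and> bdd_by (b + d - l2 xs) \<epsilon>"
    using bdd_by_add[OF xs(2) ys(2)] bdd_by_add[OF xs(3) ys(3)] xs(1) ys(1)
    by (intro exI[of _ "xs @ ys"]) (auto simp: algebra_simps)
qed

lemma R_adj:
  assumes "R a b" shows "R (adj a) (adj b)"
  unfolding R_def
proof (intro allI impI)
  fix \<epsilon> :: real assume \<epsilon>: "0 < \<epsilon>"
  obtain xs where xs: "ok xs" "bdd_by (a - l1 xs) \<epsilon>" "bdd_by (b - l2 xs) \<epsilon>"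
    using R_D[OF assms(1) \<epsilon>] by blast
  let ?ys = "map (\<lambda>(c, p). (cnj c, p)) xs"
  have ys: "ok ?ys" using xs(1) by force
  have "l1 ?ys = adj (l1 xs) \<and> l2 ?ys = adj (l2 xs)"
    using xs(1)
  proof (induction xs)
    case (Cons x xs)
    obtain c p p' where x: "x = (c, p, p')" by (metis surj_pair)
    have "adj p = p" "adj p' = p'" using Cons.prems dom[of p p'] by (auto simp: x projsD)
    then show ?case using Cons by (simp add: x adj_add)
  qed simp
  then have "bdd_by (adj a - l1 ?ys) \<epsilon>" "bdd_by (adj b - l2 ?ys) \<epsilon>"
    using bdd_by_adj[OF xs(2)] bdd_by_adj[OF xs(3)] \<epsilon> by (simp_all add: adj_diff)
  then show "\<exists>xs. ok xs \<and> bdd_by (adj a - l1 xs) \<epsilon> \<and> bdd_by (adj b - l2 xs) \<epsilon>"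
    using ys by blast
qed

definition prodl :: "(complex \<times> 'a bop \<times> 'b bop) list \<Rightarrow> (complex \<times> 'a bop \<times> 'b bop) list \<Rightarrow>
    (complex \<times> 'a bop \<times> 'b bop) list" where
  "prodl xs ys = concat (map (\<lambda>(c, p, p'). map (\<lambda>(d, q, q'). (c * d, p * q, p' * q')) ys) xs)"

lemma prodl:
  "l1 (prodl xs ys) = l1 xs * l1 ys" "l2 (prodl xs ys) = l2 xs * l2 ys"
  "ok xs \<Longrightarrow> ok ys \<Longrightarrow> ok (prodl xs ys)"
proof -
  have 1: "l1 (map (\<lambda>(d, q, q'). (c * d, p * q, p' * q')) ys) = (c *\<^sub>C p) * l1 ys"
    "l2 (map (\<lambda>(d, q, q'). (c * d, p * q, p' * q')) ys) = (c *\<^sub>C p') * l2 ys" for c p p'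
    by (induction ys) (auto simp: bop_scaleC_add_right distrib_left)
  show "l1 (prodl xs ys) = l1 xs * l1 ys" "l2 (prodl xs ys) = l2 xs * l2 ys"
    unfolding prodl_def by (induction xs) (auto simp: 1 distrib_right)
  show "ok xs \<Longrightarrow> ok ys \<Longrightarrow> ok (prodl xs ys)"
    unfolding prodl_def by (fastforce intro: mult)
qed

lemma bdd_by_product_diff:
  assumes "bdd_by a C" "bdd_by c C" "bdd_by (a - x) \<delta>" "bdd_by (c - y) \<delta>" "0 \<le> C" "0 \<le> \<delta>" "\<delta> \<le> 1"
  shows "bdd_by (a * c - x * y) ((2 * C + 1) * \<delta>)"
proof -
  have "bdd_by (a - (a - x)) (C + \<delta>)" by (intro bdd_by_diff assms)
  then have x: "bdd_by x (C + 1)" using assms(7) by (auto intro: bdd_by_mono)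
  have "a * c - x * y = (a - x) * c + x * (c - y)" by (simp add: algebra_simps)
  moreover have "bdd_by ((a - x) * c + x * (c - y)) (\<delta> * C + (C + 1) * \<delta>)"
    by (intro bdd_by_add bdd_by_mult assms x) (use assms in auto)
  ultimately show ?thesis by (simp add: algebra_simps)
qed

lemma R_mult:
  assumes "R a b" "R c d" shows "R (a * c) (b * d)"
  unfolding R_def
proof (intro allI impI)
  fix \<epsilon> :: real assume \<epsilon>: "0 < \<epsilon>"
  obtain Ca Cb Cc Cd where C: "0 < Ca" "bdd_by a Ca" "0 < Cb" "bdd_by b Cb" "0 < Cc" "bdd_by c Cc"
    "0 < Cd" "bdd_by d Cd" using ex_bdd_by by metis
  define C where "C = Ca + Cb + Cc + Cd"
  have bC: "bdd_by a C" "bdd_by b C" "bdd_by c C" "bdd_by d C" "0 < C"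
    using C by (auto simp: C_def intro: bdd_by_mono)
  define \<delta> where "\<delta> = min 1 (\<epsilon> / (2 * C + 1))"
  have \<delta>: "0 < \<delta>" "\<delta> \<le> 1" using \<epsilon> bC(5) by (simp_all add: \<delta>_def)
  have "\<delta> \<le> \<epsilon> / (2 * C + 1)" by (simp add: \<delta>_def)
  then have \<delta>\<epsilon>: "(2 * C + 1) * \<delta> \<le> \<epsilon>" using bC(5) by (simp add: field_simps)
  obtain xs where xs: "ok xs" "bdd_by (a - l1 xs) \<delta>" "bdd_by (b - l2 xs) \<delta>"
    using R_D[OF assms(1) \<delta>(1)] by blast
  obtain ys where ys: "ok ys" "bdd_by (c - l1 ys) \<delta>" "bdd_by (d - l2 ys) \<delta>"
    using R_D[OF assms(2) \<delta>(1)] by blast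
  have "bdd_by (a * c - l1 xs * l1 ys) ((2 * C + 1) * \<delta>)"
    by (rule bdd_by_product_diff[OF bC(1,3) xs(2) ys(2)]) (use bC \<delta> in auto)
  moreover have "bdd_by (b * d - l2 xs * l2 ys) ((2 * C + 1) * \<delta>)"
  proof -
    have "bdd_by (b - (b - l2 xs)) (C + \<delta>)" by (intro bdd_by_diff bC xs)
    then have x: "bdd_by (l2 xs) (C + 1)" using \<delta> by (auto intro: bdd_by_mono)
    have "b * d - l2 xs * l2 ys = (b - l2 xs) * d + l2 xs * (d - l2 ys)" by (simp add: algebra_simps)
    moreover have "bdd_by ((b - l2 xs) * d + l2 xs * (d - l2 ys)) (\<delta> * C + (C + 1) * \<delta>)"
      by (intro bdd_by_add bdd_by_mult bC xs ys x) (use bC \<delta> in auto)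
    ultimately show ?thesis by (simp add: algebra_simps)
  qed
  ultimately have "bdd_by (a * c - l1 (prodl xs ys)) \<epsilon>" "bdd_by (b * d - l2 (prodl xs ys)) \<epsilon>"
    using \<delta>\<epsilon> by (auto simp: prodl intro: bdd_by_mono)
  then show "\<exists>xs. ok xs \<and> bdd_by (a * c - l1 xs) \<epsilon> \<and> bdd_by (b * d - l2 xs) \<epsilon>"
    using prodl(3)[OF xs(1) ys(1)] by blast
qed

text \<open>The norm estimate turns approximants of \<open>a\<close> into a Cauchy sequence on the
  other side, with the same rate up to a factor 2.\<close>

lemma R_total:
  assumes a: "a \<in> M" "e * a = a" "a * e = a"
  shows "\<exists>b\<in>N. R a b"
proof -
  have "\<exists>xs. ok xs \<and> bdd_by (a - l1 xs) (inverse (real (Suc n)))" for n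
  proof -
    obtain xs where xs: "snd ` set xs \<subseteq> {p \<in> projs M. p * e = p}" "bdd_by (a - lincomb xs) (inverse (real (Suc n)))"
      using approximable_corner[OF M e a, unfolded approximable_def, rule_format, of "inverse (real (Suc n))"]
      by auto
    define ys where "ys = map (\<lambda>(c, p). (c, p, SOME p'. (p, p') \<in> P)) xs"
    have "l1 ys = lincomb xs" by (simp add: ys_def l1_def case_prod_beta comp_def)
    moreover have "ok ys"
    proof
      fix z assume "z \<in> snd ` set ys"
      then obtain c p where "(c, p) \<in> set xs" "z = (p, SOME p'. (p, p') \<in> P)" by (auto simp: ys_def)
      moreover then have "p \<in> projs M" "p * e = p" using xs(1) by auto
      ultimately show "z \<in> P" using someI_ex[OF total] by auto
    qed
    ultimately have "ok ys \<and> bdd_by (a - l1 ys) (inverse (real (Suc n)))" using xs(2) by simp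
    then show ?thesis by blast
  qed
  then obtain X where X: "\<And>n. ok (X n)" "\<And>n. bdd_by (a - l1 (X n)) (inverse (real (Suc n)))" by metis
  let ?e = "\<lambda>n. 2 * inverse (real (Suc n))"
  have "bdd_by (l2 (X m) - l2 (X n)) (?e n)" if "n \<le> m" for n m
  proof (rule bdd_transfer_diff[OF X(1) X(1)])
    have "bdd_by (l1 (X m) - l1 (X n)) (inverse (real (Suc n)) + inverse (real (Suc m)))"
      using bdd_by_diff[OF X(2)[of n] X(2)[of m]] by simp
    moreover have "inverse (real (Suc m)) \<le> inverse (real (Suc n))" using that by simp
    ultimately show "bdd_by (l1 (X m) - l1 (X n)) (?e n)" by (auto intro: bdd_by_mono)
  qed simp
  moreover have e0: "?e \<longlonglongrightarrow> 0"
    using tendsto_mult_right_zero[OF LIMSEQ_inverse_real_of_nat, of 2] by simp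
  ultimately obtain T where T: "\<And>n. bdd_by (T - l2 (X n)) (?e n)"
    using bop_complete[of "\<lambda>n. l2 (X n)" ?e] by blast
  have "T \<in> N" by (rule vN_closed_limit[OF N T _ e0]) (use l_in X in blast)
  moreover have "R a T"
    unfolding R_def
  proof (intro allI impI)
    fix \<epsilon> :: real assume "0 < \<epsilon>"
    then have "\<forall>\<^sub>F n in sequentially. ?e n < \<epsilon>" by (rule order_tendstoD(2)[OF e0])
    then obtain n where n: "?e n < \<epsilon>" by (auto simp: eventually_sequentially)
    have "inverse (real (Suc n)) \<le> ?e n" by simp
    then have "bdd_by (a - l1 (X n)) \<epsilon>" by (intro bdd_by_mono[OF X(2)]) (use n in linarith)
    moreover have "bdd_by (T - l2 (X n)) \<epsilon>" by (rule bdd_by_mono[OF T]) (use n in linarith)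
    ultimately show "\<exists>xs. ok xs \<and> bdd_by (a - l1 xs) \<epsilon> \<and> bdd_by (T - l2 xs) \<epsilon>"
      using X(1) by blast
  qed
  ultimately show ?thesis by blast
qed

lemma R_converse: "boolean_pairing.R (P\<inverse>) b a \<longleftrightarrow> R a b"
proof -
  interpret C: boolean_pairing N M f e "P\<inverse>" by (rule converse)
  have 1: "C.l1 (map (\<lambda>(c, p, p'). (c, p', p)) xs) = l2 xs" "C.l2 (map (\<lambda>(c, p, p'). (c, p', p)) xs) = l1 xs"
    "snd ` set (map (\<lambda>(c, p, p'). (c, p', p)) xs) \<subseteq> P\<inverse> \<longleftrightarrow> ok xs" for xs
    by (induction xs) auto
  have 2: "l1 (map (\<lambda>(c, p', p). (c, p, p')) xs) = C.l2 xs" "l2 (map (\<lambda>(c, p', p). (c, p, p')) xs) = C.l1 xs"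
    "ok (map (\<lambda>(c, p', p). (c, p, p')) xs) \<longleftrightarrow> snd ` set xs \<subseteq> P\<inverse>" for xs
    by (induction xs) auto
  show ?thesis unfolding C.R_def R_def using 1 2 by metis
qed

text \<open>\<open>R\<close> and its converse are total on the corners and single-valued, so \<beta>
  is a bijection; compatibility with the units \<open>e\<close> and \<open>f\<close> confines its
  values to the corner.\<close>

lemma ex_corner_iso:
  "\<exists>\<beta>. bij_betw \<beta> {a\<in>M. e * a = a \<and> a * e = a} {b\<in>N. f * b = b \<and> b * f = b} \<and>
    (\<forall>a\<in>{a\<in>M. e * a = a \<and> a * e = a}. \<forall>b\<in>{a\<in>M. e * a = a \<and> a * e = a}.
      \<beta> (a + b) = \<beta> a + \<beta> b \<and> \<beta> (a * b) = \<beta> a * \<beta> b \<and> \<beta> (adj a) = adj (\<beta> a)) \<and>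
    (\<forall>(p, p')\<in>P. \<beta> p = p')"
proof -
  interpret C: boolean_pairing N M f e "P\<inverse>" by (rule converse)
  let ?A = "{a\<in>M. e * a = a \<and> a * e = a}" and ?B = "{b\<in>N. f * b = b \<and> b * f = b}"
  have ef: "R e f" by (rule R_P[OF unit])
  define \<beta> where "\<beta> a = (THE b. R a b)" for a
  have \<beta>_eqI: "\<beta> a = b" if "R a b" for a b
    unfolding \<beta>_def using R_functional that by blast
  have \<beta>: "\<beta> a \<in> ?B \<and> R a (\<beta> a)" if "a \<in> ?A" for a
  proof -
    from that obtain b where b: "b \<in> N" "R a b" using R_total[of a] by blast
    have "R (e * a) (f * b)" "R (a * e) (b * f)" by (intro R_mult ef b)+
    then have "R a (f * b)" "R a (b * f)" using that by simp_all
    then have "f * b = b" "b * f = b" by (blast intro: R_functional[OF _ b(2)])+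
    then show ?thesis using b \<beta>_eqI[OF b(2)] by simp
  qed
  have "bij_betw \<beta> ?A ?B"
  proof (rule bij_betwI')
    fix a b assume ab: "a \<in> ?A" "b \<in> ?A"
    show "\<beta> a = \<beta> b \<longleftrightarrow> a = b"
      using \<beta>[OF ab(1)] \<beta>[OF ab(2)] C.R_functional[of "\<beta> a" a b] R_converse by metis
  next
    fix b assume b: "b \<in> ?B"
    then obtain a where a: "a \<in> M" "R a b" using C.R_total R_converse by blast
    have "R (e * a) (f * b)" "R (a * e) (b * f)" by (intro R_mult ef a)+
    then have "R (e * a) b" "R (a * e) b" using b by simp_all
    then have "e * a = a" "a * e = a"
      using a(2) unfolding R_converse[symmetric] by (blast intro: C.R_functional)+
    then show "\<exists>a\<in>?A. b = \<beta> a" using a \<beta>_eqI[OF a(2)] by blast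
  qed (use \<beta> in blast)
  moreover have "\<beta> (a + b) = \<beta> a + \<beta> b \<and> \<beta> (a * b) = \<beta> a * \<beta> b \<and> \<beta> (adj a) = adj (\<beta> a)"
    if "a \<in> ?A" "b \<in> ?A" for a b
    using \<beta>[OF that(1)] \<beta>[OF that(2)] by (intro conjI \<beta>_eqI R_add R_mult R_adj) blast+
  moreover have "\<forall>(p, p')\<in>P. \<beta> p = p'" using R_P \<beta>_eqI by blast
  ultimately show ?thesis by blast
qed

end

section \<open>Abelian corners and perspective projections\<close>

context ortho_iso
begin

text \<open>\<open>p - p * r\<close> is orthogonal to \<open>r\<close>, so orthogonality and
  additivity together determine the product of the images.\<close>

lemma commuting_transfer:
  assumes "p \<in> projs M" "r \<in> projs M" "p * r = r * p"
  shows "p * r \<in> projs M \<and> \<theta> (p * r) = \<theta> p * \<theta> r"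
proof -
  note p = projsD[OF assms(1)] and r = projsD[OF assms(2)]
  have pr: "p * r \<in> projs M"
    unfolding projs_def using vN_mult[OF M p(1) r(1)] assms(3) p r
    by (auto simp: adj_mult mult.assoc) (metis mult.assoc)
  have le: "p * r * p = p * r" "r * (p * r) = p * r" "p * r * r = p * r"
    using assms(3) p r by (metis mult.assoc)+
  have d: "p - p * r \<in> projs M" by (rule projs_diff[OF M assms(1) pr le(1)])
  have "\<theta> (p - p * r) = \<theta> p - \<theta> (p * r)" by (rule diff[OF assms(1) pr le(1)])
  moreover have "(p - p * r) * r = 0" by (simp add: left_diff_distrib le)
  then have "\<theta> (p - p * r) * \<theta> r = 0" using orth[OF d assms(2)] by simp
  moreover have "\<theta> r * \<theta> (p * r) = \<theta> (p * r)" using le_iff[OF pr assms(2)] le(2) by simp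
  then have "\<theta> (p * r) * \<theta> r = \<theta> (p * r)" using proj_comm_le[OF proj[OF pr] proj[OF assms(2)]] by simp
  ultimately show ?thesis using pr by (simp add: left_diff_distrib)
qed

lemma boolean_pairing_commuting:
  assumes e: "e \<in> projs M"
    and comm: "\<And>p r. p \<in> projs M \<Longrightarrow> r \<in> projs M \<Longrightarrow> p * e = p \<Longrightarrow> r * e = r \<Longrightarrow> p * r = r * p"
  shows "boolean_pairing M N e (\<theta> e) {(p, \<theta> p) | p. p \<in> projs M \<and> p * e = p}"
proof
  let ?P = "{(p, \<theta> p) | p. p \<in> projs M \<and> p * e = p}"
  have le: "\<theta> p * \<theta> e = \<theta> p \<longleftrightarrow> p * e = p" if "p \<in> projs M" for p
    using le_iff[OF that e] proj_comm_le[OF that e] proj_comm_le[OF proj[OF that] proj[OF e]] by simp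
  show "von_neumann_algebra M" "von_neumann_algebra N" "e \<in> projs M" "\<theta> e \<in> projs N"
    by (fact M, fact N, fact e, rule proj[OF e])
  show "p \<in> projs M \<and> p * e = p \<and> p' \<in> projs N \<and> p' * \<theta> e = p'" if "(p, p') \<in> ?P" for p p'
    using that proj le by auto
  show "\<exists>p'. (p, p') \<in> ?P" if "p \<in> projs M" "p * e = p" for p using that by blast
  show "\<exists>p. (p, p') \<in> ?P" if p': "p' \<in> projs N" "p' * \<theta> e = p'" for p'
    using surj[OF p'(1)] p'(2) le by blast
  show "(e, \<theta> e) \<in> ?P" using e projsD(3)[OF e] by blast
  fix p p' r r' assume pr: "(p, p') \<in> ?P" "(r, r') \<in> ?P"
  then have *: "p \<in> projs M" "p * e = p" "p' = \<theta> p" "r \<in> projs M" "r * e = r" "r' = \<theta> r" by auto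
  note c = comm[OF *(1,4,2,5)]
  note ct = commuting_transfer[OF *(1,4) c]
  have pr_e: "p * r * e = p * r" by (simp add: mult.assoc *)
  then show "(p * r, p' * r') \<in> ?P" using ct * by auto
  have le': "p * r * p = p * r" using c projsD(3)[OF *(1)] by (metis mult.assoc)
  have d: "p - p * r \<in> projs M" by (rule projs_diff[OF M *(1) _ le']) (use ct in blast)
  have "\<theta> (p - p * r) = \<theta> p - \<theta> p * \<theta> r" using diff[OF *(1) _ le'] ct by simp
  then show "(p - p * r, p' - p' * r') \<in> ?P" using d pr_e * by (auto simp: left_diff_distrib)
  show "p = 0 \<longleftrightarrow> p' = 0" using inj[OF *(1) projs_zero[OF M]] * by simp
qed

text \<open>The equivalent orthogonal projections \<open>g\<close> and \<open>k\<close> are both in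
  general position to the graph of \<open>v\<close>. The four disjointness facts expressing this are
  transported by \<theta>, and in \<open>N\<close> they force the polar part of
  \<open>f' * G * f\<close> to have initial projection \<open>f\<close> and final projection
  \<open>f'\<close>.\<close>

lemma perspective_image:
  assumes v: "v \<in> M" "v * adj v * v = v" "v * v = 0"
  shows "\<exists>v'\<in>N. adj v' * v' = \<theta> (adj v * v) \<and> v' * adj v' = \<theta> (v * adj v)"
proof -
  define g where "g = adj v * v"
  define k where "k = v * adj v"
  have g: "g \<in> projs M" and k: "k \<in> projs M"
    unfolding g_def k_def using projs_tripotent_right[OF M v(1,2)] projs_tripotent_left[OF M v(1,2)] by auto
  have vg: "v * g = v" "k * v = v" "g * v = 0" "v * k = 0"
    by (simp_all add: g_def k_def mult.assoc v mult_eq_assoc[OF v(3)]) (simp_all add: mult.assoc[symmetric] v)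
  have gk: "g * k = 0" by (simp add: k_def mult_eq_assoc[OF vg(3)])
  have kg: "k * g = 0" by (rule proj_comm_zero[OF g k gk])
  have idem: "(g + v) * (g + v) = g + v" by (simp add: algebra_simps vg v projsD[OF g])
  define r where "r = rp (g + v)"
  have r: "r \<in> projs M" unfolding r_def by (intro rp_projs M vN_add[OF M] v projsD(1)[OF g])
  define G where "G = \<theta> r"
  define f where "f = \<theta> g"
  define f' where "f' = \<theta> k"
  have G: "G \<in> projs N" and f: "f \<in> projs N" and f': "f' \<in> projs N"
    unfolding G_def f_def f'_def using proj g k r by auto
  have pull: "\<exists>t\<in>projs M. \<theta> t = s \<and> (G * s = s \<longrightarrow> (g + v) * t = t) \<and> (f * s = s \<longrightarrow> g * t = t) \<and>
      (f' * s = s \<longrightarrow> k * t = t) \<and> (f * s = 0 \<longrightarrow> g * t = 0) \<and> (f' * s = 0 \<longrightarrow> k * t = 0) \<and>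
      (s * G = 0 \<longrightarrow> t * (g + v) = 0)" if "s \<in> projs N" for s
  proof -
    obtain t where t: "t \<in> projs M" "\<theta> t = s" using surj \<open>s \<in> projs N\<close> by blast
    have "t * (g + v) = 0" if "t * r = 0"
      using that rp_mult[of "g + v"] by (metis r_def mult.assoc mult_zero_left)
    then show ?thesis
      using t le_iff[OF t(1) r] le_iff[OF t(1) g] le_iff[OF t(1) k] orth[OF g t(1)] orth[OF k t(1)] orth[OF t(1) r]
        rp_idempotent_iff[OF idem, of t]
      by (intro bexI[of _ t]) (auto simp: G_def f_def f'_def r_def)
  qed
  \<comment> \<open>\<open>A\<close> and \<open>B\<close> say that no part of the graph is
    orthogonal to \<open>f'\<close> or to \<open>f\<close>; \<open>A'\<close> and \<open>B'\<close>
    say that no part of \<open>f\<close> or \<open>f'\<close> is orthogonal to the graph.\<close>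
  have A: "s = 0" if s: "s \<in> projs N" "G * s = s" "f' * s = 0" for s
  proof -
    obtain t where t: "t \<in> projs M" "\<theta> t = s" "(g + v) * t = t" "k * t = 0" using pull[OF s(1)] s by blast
    have "v * t = k * ((g + v) * t)" by (simp add: algebra_simps mult_eq_assoc[OF vg(2)] mult_eq_assoc[OF kg])
    then have "v * t = 0" using t by simp
    then have "g * t = 0" by (simp add: g_def mult.assoc)
    then show ?thesis using t \<open>v * t = 0\<close> by (simp add: distrib_right)
  qed
  have B: "s = 0" if s: "s \<in> projs N" "G * s = s" "f * s = 0" for s
  proof -
    obtain t where t: "t \<in> projs M" "\<theta> t = s" "(g + v) * t = t" "g * t = 0" using pull[OF s(1)] s by blast
    have "v * t = v * (g * t)" by (simp add: mult_eq_assoc[OF vg(1)])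
    then show ?thesis using t by (simp add: distrib_right)
  qed
  have A': "s = 0" if s: "s \<in> projs N" "f * s = s" "s * G = 0" for s
  proof -
    obtain t where t: "t \<in> projs M" "\<theta> t = s" "g * t = t" "t * (g + v) = 0" using pull[OF s(1)] s by blast
    have tg: "t * g = t" using proj_comm_le[OF t(1) g] t(3) by simp
    have "t * v = 0" using tg vg(3) by (metis mult.assoc mult_zero_right)
    then have "t = 0" using t(4) tg by (simp add: distrib_left)
    then show ?thesis using t(2) by simp
  qed
  have B': "s = 0" if s: "s \<in> projs N" "f' * s = s" "s * G = 0" for s
  proof -
    obtain t where t: "t \<in> projs M" "\<theta> t = s" "k * t = t" "t * (g + v) = 0" using pull[OF s(1)] s by blast
    have tk: "t * k = t" using proj_comm_le[OF t(1) k] t(3) by simp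
    have "t * g = 0" using tk kg by (metis mult.assoc mult_zero_right)
    then have "t * v = 0" using t(4) by (simp add: distrib_left)
    then have "t = 0" using tk by (simp add: k_def mult.assoc[symmetric])
    then show ?thesis using t(2) by simp
  qed
  define T where "T = f' * G * f"
  have TN: "T \<in> N" unfolding T_def by (intro vN_mult[OF N] projsD(1)[OF f] projsD(1)[OF f'] projsD(1)[OF G])
  obtain v' where v': "v' \<in> N" "v' * adj v' * v' = v'" "\<And>b. T * b = 0 \<longleftrightarrow> v' * b = 0" "\<And>b. b * T = 0 \<longleftrightarrow> b * v' = 0"
    using ex_same_annihilator_tripotent[OF N TN] by blast
  have "T * (1 - f) = 0" by (simp add: T_def algebra_simps projsD[OF f])
  then have "v' * (1 - f) = 0" using v'(3) by blast
  then have v'f: "v' * f = v'" by (simp add: algebra_simps)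
  have "(1 - f') * T = 0" by (simp add: T_def algebra_simps projsD[OF f'])
  then have "(1 - f') * v' = 0" using v'(4) by blast
  then have fv': "f' * v' = v'" by (simp add: algebra_simps)
  define a where "a = adj v' * v'"
  define b where "b = v' * adj v'"
  have a: "a \<in> projs N" and b: "b \<in> projs N"
    unfolding a_def b_def using projs_tripotent_right[OF N v'(1,2)] projs_tripotent_left[OF N v'(1,2)] by auto
  have af: "a * f = a" by (simp add: a_def mult.assoc v'f)
  have bf: "b * f' = b" using proj_comm_le[OF b f'] by (simp add: b_def mult.assoc[symmetric] fv')
  have kill: "G * m = 0" if m: "m \<in> N" and z: "f' * (G * m) = 0 \<or> f * (G * m) = 0" for m
  proof -
    have s: "rp (G * m) \<in> projs N" by (intro rp_projs N vN_mult[OF N] projsD(1)[OF G] m)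
    have "G * rp (G * m) = rp (G * m)" by (rule rp_le) (simp add: projsD[OF G])
    then have "rp (G * m) = 0" using A[OF s] B[OF s] z rp_least by blast
    then show ?thesis by (simp add: rp_eq_0_iff)
  qed
  have "f - a = 0"
  proof (rule A')
    show m: "f - a \<in> projs N" by (rule projs_diff[OF N f a af])
    have fm: "f * (f - a) = f - a" using proj_comm_le[OF a f] af by (simp add: right_diff_distrib projsD[OF f])
    then show "f * (f - a) = f - a" .
    have "v' * (f - a) = 0" by (simp add: right_diff_distrib v'f a_def mult.assoc[symmetric] v'(2))
    then have "T * (f - a) = 0" using v'(3) by blast
    then have "f' * (G * (f - a)) = 0" using fm by (simp add: T_def mult.assoc)
    then have "G * (f - a) = 0" using kill projsD(1)[OF m] by blast
    then show "(f - a) * G = 0" using proj_comm_zero[OF G m] by blast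
  qed
  moreover have "f' - b = 0"
  proof (rule B')
    show m: "f' - b \<in> projs N" by (rule projs_diff[OF N f' b bf])
    have fm: "f' * (f' - b) = f' - b" using proj_comm_le[OF b f'] bf by (simp add: right_diff_distrib projsD[OF f'])
    then show "f' * (f' - b) = f' - b" .
    have mf: "(f' - b) * f' = f' - b" using proj_comm_le[OF m f'] fm by simp
    have "(f' - b) * v' = 0" by (simp add: left_diff_distrib fv' b_def v'(2))
    then have "(f' - b) * T = 0" using v'(4) by blast
    then have "(f' - b) * G * f = 0" using mf by (simp add: T_def mult.assoc[symmetric])
    from mult_zero_adj[OF this] have "f * (G * (f' - b)) = 0"
      by (simp add: adj_mult projsD(2)[OF f] projsD(2)[OF G] projsD(2)[OF m])
    then have "G * (f' - b) = 0" using kill projsD(1)[OF m] by blast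
    then show "(f' - b) * G = 0" using proj_comm_zero[OF G m] by blast
  qed
  ultimately show ?thesis using v'(1) by (intro bexI[of _ v']) (auto simp: a_def b_def f_def f'_def g_def k_def)
qed

text \<open>The column of \<open>e\<close> has only two rows, \<open>e\<close> itself and the range
  of \<open>v\<close>, and the entries of both are read in the commutative corner of
  \<open>e\<close>. An isomorphism \<beta> of that corner and the partial isometry \<open>v'\<close>
  therefore suffice to build \<Theta>.\<close>

lemma module_iso_abelian:
  assumes e: "e \<in> projs M"
    and comm: "\<And>p r. p \<in> projs M \<Longrightarrow> r \<in> projs M \<Longrightarrow> p * e = p \<Longrightarrow> r * e = r \<Longrightarrow> p * r = r * p"
    and v: "v \<in> M" "v * adj v * v = v" "v * e = v" "e * v = 0"
    and v': "v' \<in> N" "adj v' * v' = \<theta> (adj v * v)" "v' * adj v' = \<theta> (v * adj v)"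
    and colM: "\<And>x. x \<in> M \<Longrightarrow> x * e = x \<Longrightarrow> x = e * x + v * adj v * x"
    and colN: "\<And>y. y \<in> N \<Longrightarrow> y * \<theta> e = y \<Longrightarrow> y = \<theta> e * y + v' * adj v' * y"
  shows "\<exists>\<Theta>. module_iso M e N (\<theta> e) \<Theta>"
proof -
  define g where "g = adj v * v"
  have g: "g \<in> projs M" unfolding g_def by (rule projs_tripotent_right[OF M v(1,2)])
  have k: "v * adj v \<in> projs M" by (rule projs_tripotent_left[OF M v(1,2)])
  have ge: "g * e = g" by (simp add: g_def mult.assoc v)
  have eg: "e * g = g" using proj_comm_le[OF g e] ge by simp
  let ?A = "{a\<in>M. e * a = a \<and> a * e = a}" and ?B = "{b\<in>N. \<theta> e * b = b \<and> b * \<theta> e = b}"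
  interpret B: boolean_pairing M N e "\<theta> e" "{(p, \<theta> p) | p. p \<in> projs M \<and> p * e = p}"
    by (rule boolean_pairing_commuting[OF e comm])
  obtain \<beta> where b: "bij_betw \<beta> ?A ?B"
      "\<forall>a\<in>?A. \<forall>b\<in>?A. \<beta> (a + b) = \<beta> a + \<beta> b \<and> \<beta> (a * b) = \<beta> a * \<beta> b \<and> \<beta> (adj a) = adj (\<beta> a)"
      "\<forall>(p, p')\<in>{(p, \<theta> p) | p. p \<in> projs M \<and> p * e = p}. \<beta> p = p'"
    using B.ex_corner_iso by blast
  have \<beta>: "bij_betw \<beta> ?A ?B" "\<And>a b. a \<in> ?A \<Longrightarrow> b \<in> ?A \<Longrightarrow> \<beta> (a + b) = \<beta> a + \<beta> b"
      "\<And>a b. a \<in> ?A \<Longrightarrow> b \<in> ?A \<Longrightarrow> \<beta> (a * b) = \<beta> a * \<beta> b" "\<And>a. a \<in> ?A \<Longrightarrow> \<beta> (adj a) = adj (\<beta> a)"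
      "\<And>p. p \<in> projs M \<Longrightarrow> p * e = p \<Longrightarrow> \<beta> p = \<theta> p"
    using b(1,2) by (blast, blast, blast, blast) (use b(3) in auto)
  have \<beta>B: "\<beta> a \<in> N" "\<theta> e * \<beta> a = \<beta> a" "\<beta> a * \<theta> e = \<beta> a" if "a \<in> ?A" for a
    using bij_betwE[OF \<beta>(1)] that by auto
  note E = projsD[OF e] and E' = projsD[OF proj[OF e]]
  have ev: "e * adj v = adj v" using arg_cong[OF v(3), of adj] by (simp add: adj_mult E)
  have c1: "e * x \<in> ?A" if "x \<in> M" "x * e = x" for x
    using that vN_mult[OF M E(1)] by (simp add: mult.assoc E)
  have c2: "adj v * x \<in> ?A" if "x \<in> M" "x * e = x" for x
    using that vN_mult[OF M vN_adj[OF M v(1)]] by (simp add: mult.assoc mult_eq_assoc[OF ev])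
  have gA: "g \<in> ?A" using projsD(1)[OF g] ge eg by simp
  have "\<theta> e * (v' * adj v') = 0"
    unfolding v'(3) using orth[OF e k] by (simp add: mult.assoc[symmetric] v)
  then have "\<theta> e * (v' * adj v') * v' = 0" by simp
  moreover have v't: "v' * adj v' * v' = v'"
    by (rule isometry_tripotent[OF v'(2)]) (rule projsD(3)[OF proj[OF g, unfolded g_def]])
  ultimately have ev': "\<theta> e * v' = 0" by (simp add: mult.assoc)
  have v'e: "adj v' * \<theta> e = 0" using mult_zero_adj[OF ev'] by (simp add: E')
  \<comment> \<open>\<open>v'\<close> is isometric on \<open>\<theta> g\<close> only, and the
    entries of the second row lie there.\<close>
  have gc: "\<theta> g * \<beta> (adj v * x) = \<beta> (adj v * x)" if "x \<in> M" "x * e = x" for x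
  proof -
    have "\<beta> (g * (adj v * x)) = \<beta> g * \<beta> (adj v * x)" by (rule \<beta>(3)[OF gA c2[OF that]])
    moreover have "g * (adj v * x) = adj v * x"
      using adj_tripotent[OF v(2)] by (simp add: g_def mult.assoc[symmetric])
    ultimately show ?thesis using \<beta>(5)[OF g ge] by simp
  qed
  define \<Theta> where "\<Theta> x = \<beta> (e * x) + v' * \<beta> (adj v * x)" for x
  have comp: "\<theta> e * \<Theta> x = \<beta> (e * x)" "adj v' * \<Theta> x = \<beta> (adj v * x)" "\<Theta> x \<in> N" "\<Theta> x * \<theta> e = \<Theta> x"
    if x: "x \<in> M" "x * e = x" for x
  proof -
    note b1 = \<beta>B[OF c1[OF x]] and b2 = \<beta>B[OF c2[OF x]]
    show "\<theta> e * \<Theta> x = \<beta> (e * x)"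
      by (simp add: \<Theta>_def distrib_left b1 mult_eq_assoc[OF ev'])
    have "adj v' * \<beta> (e * x) = 0" using mult_eq_assoc[OF v'e, of "\<beta> (e * x)"] b1 by simp
    then show "adj v' * \<Theta> x = \<beta> (adj v * x)"
      using gc[OF x] by (simp add: \<Theta>_def distrib_left mult.assoc[symmetric] v'(2) g_def)
    show "\<Theta> x \<in> N" "\<Theta> x * \<theta> e = \<Theta> x"
      using b1 b2 vN_add[OF N] vN_mult[OF N v'(1)] by (simp_all add: \<Theta>_def distrib_right mult.assoc)
  qed
  have "module_iso M e N (\<theta> e) \<Theta>"
  proof (rule module_isoI[where \<beta> = \<beta>, OF _ _ _ _ M e])
    fix x y assume x: "x \<in> M" "x * e = x" and y: "y \<in> M" "y * e = y"
    show "\<Theta> (x + y) = \<Theta> x + \<Theta> y"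
      using \<beta>(2)[OF c1[OF x] c1[OF y]] \<beta>(2)[OF c2[OF x] c2[OF y]] by (simp add: \<Theta>_def distrib_left)
    have adjA: "adj a \<in> ?A" if "a \<in> ?A" for a
    proof -
      have "adj a * e = adj (e * a)" "e * adj a = adj (a * e)" by (simp_all add: adj_mult E(2))
      then show ?thesis using that vN_adj[OF M] by simp
    qed
    have mA: "a * b \<in> ?A" if "a \<in> ?A" "b \<in> ?A" for a b
      using that vN_mult[OF M] by (auto simp: mult.assoc mult_eq_assoc)
    have \<beta>i: "adj (\<beta> a) * \<beta> b = \<beta> (adj a * b)" if "a \<in> ?A" "b \<in> ?A" for a b
      using \<beta>(3)[OF adjA[OF that(1)] that(2)] \<beta>(4)[OF that(1)] by simp
    have "adj (\<Theta> x) * \<Theta> y = adj (\<Theta> x) * (\<theta> e * \<Theta> y + v' * adj v' * \<Theta> y)"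
      using colN[OF comp(3,4)[OF y]] by simp
    also have "\<dots> = adj (\<theta> e * \<Theta> x) * (\<theta> e * \<Theta> y) + adj (adj v' * \<Theta> x) * (adj v' * \<Theta> y)"
      by (simp add: adj_mult E' distrib_left mult.assoc)
    also have "\<dots> = \<beta> (adj (e * x) * (e * y)) + \<beta> (adj (adj v * x) * (adj v * y))"
      by (simp only: comp[OF x] comp[OF y] \<beta>i[OF c1[OF x] c1[OF y]] \<beta>i[OF c2[OF x] c2[OF y]])
    also have "\<dots> = \<beta> (adj (e * x) * (e * y) + adj (adj v * x) * (adj v * y))"
      by (rule \<beta>(2)[symmetric]) (intro mA adjA c1 c2 x y)+
    also have "adj (e * x) * (e * y) + adj (adj v * x) * (adj v * y) = adj x * (e * y + v * adj v * y)"
      by (simp add: adj_mult E distrib_left mult.assoc)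
    also have "\<dots> = adj x * y" using colM[OF y] by simp
    finally show "adj (\<Theta> x) * \<Theta> y = \<beta> (adj x * y)" .
  next
    show "inj_on \<beta> ?A" by (rule bij_betw_imp_inj_on[OF \<beta>(1)])
    show "bij_betw \<Theta> {x \<in> M. x * e = x} {y \<in> N. y * \<theta> e = y}"
    proof (rule bij_betwI')
      fix x y assume "x \<in> {x \<in> M. x * e = x}" "y \<in> {x \<in> M. x * e = x}"
      then have x: "x \<in> M" "x * e = x" and y: "y \<in> M" "y * e = y" by auto
      show "\<Theta> x = \<Theta> y \<longleftrightarrow> x = y"
      proof
        assume "\<Theta> x = \<Theta> y"
        then have "\<beta> (e * x) = \<beta> (e * y)" "\<beta> (adj v * x) = \<beta> (adj v * y)"
          using comp(1,2)[OF x] comp(1,2)[OF y] by simp_all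
        then have "e * x = e * y" "adj v * x = adj v * y"
          using inj_onD[OF bij_betw_imp_inj_on[OF \<beta>(1)]] c1[OF x] c1[OF y] c2[OF x] c2[OF y] by blast+
        then show "x = y" using colM[OF x] colM[OF y] by (metis mult.assoc)
      qed simp
    next
      fix x assume "x \<in> {x \<in> M. x * e = x}"
      then show "\<Theta> x \<in> {y \<in> N. y * \<theta> e = y}" using comp by simp
    next
      fix y assume "y \<in> {y \<in> N. y * \<theta> e = y}"
      then have y: "y \<in> N" "y * \<theta> e = y" by auto
      have "\<theta> e * y \<in> ?B" using y vN_mult[OF N E'(1)] by (simp add: mult.assoc E')
      then have "\<theta> e * y \<in> \<beta> ` ?A" by (simp only: bij_betw_imp_surj_on[OF \<beta>(1)])
      then obtain \<alpha> where \<alpha>: "\<beta> \<alpha> = \<theta> e * y" "\<alpha> \<in> ?A" by (rule imageE) (drule sym)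
      have g'v': "\<theta> g * adj v' = adj v'"
        using adj_tripotent[OF v't] by (simp add: g_def v'(2)[symmetric])
      have eg': "\<theta> e * \<theta> g = \<theta> g" using le_iff[OF g e] eg by simp
      have "\<theta> e * adj v' = adj v'" using mult_eq_assoc[OF eg', of "adj v'"] by (simp add: g'v')
      then have "adj v' * y \<in> ?B"
        using y vN_mult[OF N vN_adj[OF N v'(1)]] by (simp add: mult.assoc mult_eq_assoc)
      then have "adj v' * y \<in> \<beta> ` ?A" by (simp only: bij_betw_imp_surj_on[OF \<beta>(1)])
      then obtain \<gamma> where \<gamma>: "\<beta> \<gamma> = adj v' * y" "\<gamma> \<in> ?A" by (rule imageE) (drule sym)
      have "\<beta> (g * \<gamma>) = \<beta> \<gamma>"
        using \<beta>(3)[OF gA \<gamma>(2)] \<beta>(5)[OF g ge] \<gamma>(1) by (simp add: mult.assoc[symmetric] g'v')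
      moreover have "g * \<gamma> \<in> ?A"
        using gA \<gamma>(2) vN_mult[OF M] by (auto simp: mult.assoc mult_eq_assoc[OF eg])
      ultimately have g\<gamma>: "g * \<gamma> = \<gamma>" using inj_onD[OF bij_betw_imp_inj_on[OF \<beta>(1)]] \<gamma>(2) by blast
      let ?x = "\<alpha> + v * \<gamma>"
      have x: "?x \<in> M" "?x * e = ?x"
        using \<alpha>(2) \<gamma>(2) vN_add[OF M] vN_mult[OF M v(1)] by (auto simp: distrib_right mult.assoc)
      have ve: "adj v * e = 0" using mult_zero_adj[OF v(4)] by (simp add: E)
      have "adj v * \<alpha> = 0" using mult_eq_assoc[OF ve, of \<alpha>] \<alpha>(2) by simp
      then have "e * ?x = \<alpha>" "adj v * ?x = \<gamma>"
        using \<alpha>(2) g\<gamma> by (simp_all add: distrib_left mult_eq_assoc[OF v(4)] g_def mult.assoc)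
      then have "\<Theta> ?x = \<theta> e * y + v' * adj v' * y" by (simp add: \<Theta>_def \<alpha>(1) \<gamma>(1) mult.assoc)
      then have "y = \<Theta> ?x" using colN[OF y] by simp
      then show "\<exists>x\<in>{x \<in> M. x * e = x}. y = \<Theta> x" using x by blast
    qed
  qed
  then show ?thesis by blast
qed

end

section \<open>Central decomposition\<close>

text \<open>Zorn's lemma for pairwise related families, with both orders of each pair recorded
  because \<rho> is an arbitrary relation.\<close>

lemma ex_maximal_pairwise:
  "\<exists>C\<subseteq>X. (\<forall>x\<in>C. \<forall>y\<in>C. x \<noteq> y \<longrightarrow> \<rho> x y) \<and> (\<forall>z\<in>X. (\<forall>x\<in>C. \<rho> x z \<and> \<rho> z x) \<longrightarrow> z \<in> C)"
proof -
  let ?A = "{C. C \<subseteq> X \<and> (\<forall>x\<in>C. \<forall>y\<in>C. x \<noteq> y \<longrightarrow> \<rho> x y)}"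
  have "\<exists>M\<in>?A. \<forall>X\<in>?A. M \<subseteq> X \<longrightarrow> X = M"
  proof (rule subset_Zorn')
    fix \<C> assume ch: "subset.chain ?A \<C>"
    have "\<rho> x y" if "x \<in> \<Union>\<C>" "y \<in> \<Union>\<C>" "x \<noteq> y" for x y
    proof -
      from that(1,2) obtain A B where AB: "A \<in> \<C>" "x \<in> A" "B \<in> \<C>" "y \<in> B" by blast
      then have "A \<subseteq> B \<or> B \<subseteq> A" using ch AB(1,3) unfolding subset_chain_def by blast
      moreover have "\<rho> x y" if "x \<in> D" "y \<in> D" "D \<in> \<C>" for D
        using ch that \<open>x \<noteq> y\<close> unfolding subset_chain_def by auto
      ultimately show ?thesis using AB by (meson subsetD)
    qed
    moreover have "\<Union>\<C> \<subseteq> X" using ch unfolding subset.chain_def by blast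
    ultimately show "\<Union>\<C> \<in> ?A" by blast
  qed
  then obtain C where C0: "C \<in> ?A" "\<forall>D\<in>?A. C \<subseteq> D \<longrightarrow> D = C" by (elim bexE) (rule that)
  from C0(1) have C: "C \<subseteq> X" "\<forall>x\<in>C. \<forall>y\<in>C. x \<noteq> y \<longrightarrow> \<rho> x y" by auto
  have "z \<in> C" if "z \<in> X" "\<forall>x\<in>C. \<rho> x z \<and> \<rho> z x" for z
  proof -
    have "insert z C \<in> ?A" using C that by auto
    from mp[OF bspec[OF C0(2) this] subset_insertI] have "insert z C = C" .
    then show ?thesis by blast
  qed
  then show ?thesis using C(1,2) by blast
qed

text \<open>No convergence has to be discussed: the sum is the isometric extension of the pairs
  \<open>e i\<close>, \<open>v i\<close>, whose mixed Gram operators vanish because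
  \<open>adj (v j) * v i\<close> lies in the block \<open>e j M e i\<close>.\<close>

lemma ex_central_sum:
  fixes v :: "'i \<Rightarrow> 'a::complex_hilbert_space bop"
  assumes M: "von_neumann_algebra M" and v: "\<And>i. i \<in> C \<Longrightarrow> v i \<in> M"
    and e: "\<And>i. i \<in> C \<Longrightarrow> e i \<in> projs M" "\<And>i. i \<in> C \<Longrightarrow> adj (v i) * v i = e i"
    and orth: "\<And>i j m. i \<in> C \<Longrightarrow> j \<in> C \<Longrightarrow> i \<noteq> j \<Longrightarrow> m \<in> M \<Longrightarrow> e i * m * e j = 0"
  shows "\<exists>V\<in>M. V * adj V * V = V \<and> (\<forall>i\<in>C. V * e i = v i \<and> adj V * V * e i = e i) \<and>
    (\<forall>b. (\<forall>i\<in>C. e i * b = 0) \<longrightarrow> V * b = 0) \<and> (\<forall>b. (\<forall>i\<in>C. b * v i = 0) \<longrightarrow> b * V = 0)"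
proof -
  let ?S = "(\<lambda>i. (e i, v i)) ` C"
  have "\<exists>T\<in>M. T * adj T * T = T \<and> (\<forall>(A, B)\<in>?S. T * A = B \<and> adj T * T * A = A) \<and>
    (\<forall>b. (\<forall>(A, B)\<in>?S. adj A * b = 0) \<longrightarrow> T * b = 0) \<and>
    (\<forall>b. (\<forall>(A, B)\<in>?S. b * B = 0) \<longrightarrow> b * T = 0)"
  proof (rule ex_tripotent_extension[OF M])
    show "?S \<subseteq> M \<times> M" using v projsD(1)[OF e(1)] by auto
    fix A B A' B' assume "(A, B) \<in> ?S" "(A', B') \<in> ?S"
    then obtain i j where i: "i \<in> C" "A = e i" "B = v i" and j: "j \<in> C" "A' = e j" "B' = v j" by blast
    note Ei = projsD[OF e(1)[OF i(1)]] and Ej = projsD[OF e(1)[OF j(1)]]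
    show "adj A' * A = adj B' * B"
    proof (cases "i = j")
      case True
      then show ?thesis using Ei e(2) i j by simp
    next
      case False
      have ve: "v i * e i = v i" "v j * e j = v j" using isometry_support e(2) i j Ei Ej by blast+
      have "e j * adj (v j) = adj (v j)"
        using arg_cong[OF ve(2), of adj] unfolding adj_mult Ej(2) .
      then have "adj (v j) * v i = e j * (adj (v j) * v i) * e i" using ve(1) by (metis mult.assoc)
      also have "\<dots> = 0" using False i j v by (intro orth vN_mult[OF M] vN_adj[OF M]) auto
      finally show ?thesis using orth[OF j(1) i(1) False[symmetric] vN_one[OF M]] i j Ej by simp
    qed
  qed
  then obtain T where T: "T \<in> M" "T * adj T * T = T"
      "\<forall>(A, B)\<in>?S. T * A = B \<and> adj T * T * A = A"
      "\<forall>b. (\<forall>(A, B)\<in>?S. adj A * b = 0) \<longrightarrow> T * b = 0" "\<forall>b. (\<forall>(A, B)\<in>?S. b * B = 0) \<longrightarrow> b * T = 0"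
    by blast
  have "T * b = 0" if "\<forall>i\<in>C. e i * b = 0" for b
  proof -
    have "\<forall>(A, B)\<in>?S. adj A * b = 0" using that by (auto simp: projsD(2)[OF e(1)])
    then show ?thesis using T(4) by blast
  qed
  moreover have "b * T = 0" if "\<forall>i\<in>C. b * v i = 0" for b
  proof -
    have "\<forall>(A, B)\<in>?S. b * B = 0" using that by auto
    then show ?thesis using T(5) by blast
  qed
  moreover have "T * e i = v i \<and> adj T * T * e i = e i" if "i \<in> C" for i using T(3) that by auto
  ultimately show ?thesis using T(1,2) by blast
qed

text \<open>A maximal family of centrally orthogonal frames adds up to one frame, and a nonzero
  frame centrally orthogonal to the sum would enlarge the family.\<close>

lemma ex_maximal_frame:
  assumes M: "von_neumann_algebra M"
  shows "\<exists>E V W. frame M E V W \<and> (\<forall>e v w. frame M e v w \<longrightarrow> (\<forall>m\<in>M. e * m * E = 0) \<longrightarrow> e = 0)"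
proof -
  let ?X = "{(e, v, w). frame M e v w \<and> e \<noteq> 0}"
  obtain C where C0: "C \<subseteq> ?X"
      "\<forall>x\<in>C. \<forall>y\<in>C. x \<noteq> y \<longrightarrow> (\<forall>m\<in>M. fst x * m * fst y = 0)"
      "\<forall>z\<in>?X. (\<forall>x\<in>C. (\<forall>m\<in>M. fst x * m * fst z = 0) \<and> (\<forall>m\<in>M. fst z * m * fst x = 0)) \<longrightarrow> z \<in> C"
    using ex_maximal_pairwise[of ?X "\<lambda>x y. \<forall>m\<in>M. fst x * m * fst y = 0"]
    by (elim exE conjE) (rule that)
  note C = C0(1) C0(2)[rule_format] C0(3)[rule_format]
  define e where "e = (\<lambda>x :: 'a bop \<times> 'a bop \<times> 'a bop. fst x)"
  define v where "v = (\<lambda>x :: 'a bop \<times> 'a bop \<times> 'a bop. fst (snd x))"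
  define w where "w = (\<lambda>x :: 'a bop \<times> 'a bop \<times> 'a bop. snd (snd x))"
  have fr: "frame M (e x) (v x) (w x)" "e x \<noteq> 0" if "x \<in> C" for x
    using C(1) that by (auto simp: e_def v_def w_def)
  note F = frameD[OF fr(1)]
  have o: "e i * m * e j = 0" if "i \<in> C" "j \<in> C" "i \<noteq> j" "m \<in> M" for i j m
    using C(2) that by (auto simp: e_def)
  have "\<exists>V\<in>M. V * adj V * V = V \<and> (\<forall>i\<in>C. V * e i = v i \<and> adj V * V * e i = e i) \<and>
      (\<forall>b. (\<forall>i\<in>C. e i * b = 0) \<longrightarrow> V * b = 0) \<and> (\<forall>b. (\<forall>i\<in>C. b * v i = 0) \<longrightarrow> b * V = 0)"
    by (rule ex_central_sum[OF M]) (use F(1,2,4) o in simp_all)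
  then obtain V where V0: "V \<in> M" "V * adj V * V = V"
      "\<forall>i\<in>C. V * e i = v i \<and> adj V * V * e i = e i"
      "\<forall>b. (\<forall>i\<in>C. e i * b = 0) \<longrightarrow> V * b = 0" "\<forall>b. (\<forall>i\<in>C. b * v i = 0) \<longrightarrow> b * V = 0"
    by (elim bexE conjE) (rule that)
  note V = V0(1,2) V0(3)[rule_format, THEN conjunct1] V0(3)[rule_format, THEN conjunct2]
    V0(4,5)[rule_format]
  have "\<exists>V\<in>M. V * adj V * V = V \<and> (\<forall>i\<in>C. V * e i = w i \<and> adj V * V * e i = e i) \<and>
      (\<forall>b. (\<forall>i\<in>C. e i * b = 0) \<longrightarrow> V * b = 0) \<and> (\<forall>b. (\<forall>i\<in>C. b * w i = 0) \<longrightarrow> b * V = 0)"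
    by (rule ex_central_sum[OF M]) (use F(1,3,5) o in simp_all)
  then obtain W where W0: "W \<in> M" "W * adj W * W = W"
      "\<forall>i\<in>C. W * e i = w i \<and> adj W * W * e i = e i"
      "\<forall>b. (\<forall>i\<in>C. e i * b = 0) \<longrightarrow> W * b = 0" "\<forall>b. (\<forall>i\<in>C. b * w i = 0) \<longrightarrow> b * W = 0"
    by (elim bexE conjE) (rule that)
  note W = W0(1,2) W0(3)[rule_format, THEN conjunct1] W0(3)[rule_format, THEN conjunct2]
    W0(4,5)[rule_format]
  define E where "E = adj V * V"
  define E' where "E' = adj W * W"
  have E: "E \<in> projs M" and E'p: "E' \<in> projs M" unfolding E_def E'_def
    using projs_tripotent_right[OF M V(1,2)] projs_tripotent_right[OF M W(1,2)] by auto
  have eE: "e i * E = e i" "e i * E' = e i" if "i \<in> C" for i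
    using proj_comm_le[OF F(1)[OF that] E] proj_comm_le[OF F(1)[OF that] E'p] V(4)[OF that] W(4)[OF that]
    by (simp_all add: E_def E'_def)
  have "W * (1 - E) = 0" "V * (1 - E') = 0"
    by (rule W(5), simp add: right_diff_distrib eE, rule V(5), simp add: right_diff_distrib eE)
  then have "E' * (1 - E) = 0" "E * (1 - E') = 0" by (simp_all add: E_def E'_def mult.assoc)
  then have "E' * E = E'" "E * E' = E" by (simp_all add: right_diff_distrib)
  then have EE: "E' = E" using proj_comm_le[OF E'p E] by simp
  have ev: "e i * v j = 0 \<and> e i * w j = 0 \<and> adj (w i) * v j = 0" if ij: "i \<in> C" "j \<in> C" for i j
  proof (cases "i = j")
    case True
    then show ?thesis using F ij by simp
  next
    case False
    have "e i * v j = e i * v j * e j" "e i * w j = e i * w j * e j"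
      "adj (w i) * v j = e i * (adj (w i) * v j) * e j"
      using F(10,11,15) ij by (metis mult.assoc)+
    then show ?thesis using o[OF ij False] F(2,3)[OF ij(2)] F(3)[OF ij(1)] vN_mult[OF M] vN_adj[OF M] by metis
  qed
  have "V * V = 0"
    by (rule V(6), rule V(5)) (use ev in blast)
  then have EV: "E * V = 0" by (simp add: E_def mult.assoc)
  have "V * W = 0"
    by (rule W(6), rule V(5)) (use ev in blast)
  then have EW: "E * W = 0" by (simp add: E_def mult.assoc)
  have "adj V * W = 0"
  proof (rule W(6))
    fix i assume i: "i \<in> C"
    have "adj (w i) * V = 0" by (rule V(6)) (use ev i in blast)
    then show "adj V * w i = 0" using mult_zero_adj by fastforce
  qed
  then have "frame M E V W"
    unfolding frame_def using E V(1) W(1) EV EW EE by (simp add: E_def E'_def)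
  moreover have "e' = 0" if e': "frame M e' v' w'" "\<forall>m\<in>M. e' * m * E = 0" for e' v' w'
  proof (rule ccontr)
    assume ne: "e' \<noteq> 0"
    note F' = frameD[OF e'(1)]
    have 1: "e' * m * e i = 0" if "i \<in> C" "m \<in> M" for i m
    proof -
      have "e' * m * e i = e' * m * E * e i" using V(4)[OF that(1)] by (simp add: E_def mult.assoc)
      then show ?thesis using e'(2) that(2) by simp
    qed
    have 2: "e i * m * e' = 0" if "i \<in> C" "m \<in> M" for i m
      using mult_zero_adj[of "e' * adj m" "e i"] 1[OF that(1) vN_adj[OF M that(2)]] F'(17) F(17)[OF that(1)]
      by (simp add: adj_mult mult.assoc)
    \<comment> \<open>By maximality \<open>e'\<close> belongs to the family to which it is centrally
      orthogonal, hence is orthogonal to itself.\<close>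
    have "(e', v', w') \<in> C"
      by (rule C(3)) (use e'(1) ne 1 2 in \<open>auto simp: e_def\<close>)
    then have "e' * 1 * e' = 0" using 1[of "(e', v', w')" 1] vN_one[OF M] by (simp add: e_def)
    then show False using ne F'(16) by simp
  qed
  ultimately show ?thesis by blast
qed

text \<open>The analogue with two legs: \<open>u * u = 0\<close> says that the initial and final
  projections of \<open>u\<close> are orthogonal, and \<open>Y\<close> will confine it to a
  summand.\<close>

lemma ex_maximal_pair:
  assumes M: "von_neumann_algebra M"
  shows "\<exists>u\<in>M. u * adj u * u = u \<and> u * u = 0 \<and> Y * u = u \<and>
    (\<forall>t\<in>M. t * adj t * t = t \<longrightarrow> t * t = 0 \<longrightarrow> Y * t = t \<longrightarrow>
      (\<forall>m\<in>M. adj t * t * m * (adj u * u) = 0) \<longrightarrow> t = 0)"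
proof -
  let ?X = "{t\<in>M. t * adj t * t = t \<and> t * t = 0 \<and> Y * t = t \<and> t \<noteq> 0}"
  define e where "e t = adj t * t" for t :: "'a bop"
  obtain C where C0: "C \<subseteq> ?X"
      "\<forall>x\<in>C. \<forall>y\<in>C. x \<noteq> y \<longrightarrow> (\<forall>m\<in>M. e x * m * e y = 0)"
      "\<forall>z\<in>?X. (\<forall>x\<in>C. (\<forall>m\<in>M. e x * m * e z = 0) \<and> (\<forall>m\<in>M. e z * m * e x = 0)) \<longrightarrow> z \<in> C"
    using ex_maximal_pairwise[of ?X "\<lambda>x y. \<forall>m\<in>M. e x * m * e y = 0"]
    by (elim exE conjE) (rule that)
  note C = C0(1) C0(2)[rule_format] C0(3)[rule_format]
  have X: "t \<in> M" "t * adj t * t = t" "t * t = 0" "Y * t = t" "t \<noteq> 0" if "t \<in> C" for t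
    using C(1) that by blast+
  have ep: "e t \<in> projs M" if "t \<in> M" "t * adj t * t = t" for t
    unfolding e_def by (rule projs_tripotent_right[OF M that])
  have o: "e i * m * e j = 0" if "i \<in> C" "j \<in> C" "i \<noteq> j" "m \<in> M" for i j m
    using C(2) that by auto
  have "\<exists>V\<in>M. V * adj V * V = V \<and> (\<forall>i\<in>C. V * e i = i \<and> adj V * V * e i = e i) \<and>
      (\<forall>b. (\<forall>i\<in>C. e i * b = 0) \<longrightarrow> V * b = 0) \<and> (\<forall>b. (\<forall>i\<in>C. b * i = 0) \<longrightarrow> b * V = 0)"
    by (rule ex_central_sum[OF M]) (use X(1) ep[OF X(1,2)] o in \<open>simp_all add: e_def\<close>)
  then obtain V where V0: "V \<in> M" "V * adj V * V = V"
      "\<forall>i\<in>C. V * e i = i \<and> adj V * V * e i = e i"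
      "\<forall>b. (\<forall>i\<in>C. e i * b = 0) \<longrightarrow> V * b = 0" "\<forall>b. (\<forall>i\<in>C. b * i = 0) \<longrightarrow> b * V = 0"
    by (elim bexE conjE) (rule that)
  note V = V0(1,2) V0(3)[rule_format, THEN conjunct1] V0(3)[rule_format, THEN conjunct2]
    V0(4,5)[rule_format]
  have "e i * j = 0" if ij: "i \<in> C" "j \<in> C" for i j
  proof (cases "i = j")
    case True
    then show ?thesis using X(3)[OF ij(1)] by (simp add: e_def mult.assoc)
  next
    case False
    have "e i * j = e i * j * e j" using X(2)[OF ij(2)] by (simp add: e_def mult.assoc)
    then show ?thesis using o[OF ij False X(1)[OF ij(2)]] by simp
  qed
  then have "V * V = 0" by (intro V(6) V(5)) blast
  moreover have "(1 - Y) * V = 0" by (rule V(6)) (simp add: left_diff_distrib X)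
  then have "Y * V = V" by (simp add: left_diff_distrib)
  moreover have "t = 0" if t: "t \<in> M" "t * adj t * t = t" "t * t = 0" "Y * t = t" "\<forall>m\<in>M. adj t * t * m * (adj V * V) = 0" for t
  proof (rule ccontr)
    assume ne: "t \<noteq> 0"
    have 1: "e t * m * e i = 0" if "i \<in> C" "m \<in> M" for i m
    proof -
      have "e t * m * e i = e t * m * (adj V * V) * e i" using V(4)[OF that(1)] by (simp add: mult.assoc)
      then show ?thesis using t(5) that(2) by (simp add: e_def)
    qed
    have 2: "e i * m * e t = 0" if "i \<in> C" "m \<in> M" for i m
      using mult_zero_adj[of "e t * adj m" "e i"] 1[OF that(1) vN_adj[OF M that(2)]]
      by (simp add: adj_mult e_def mult.assoc)
    have "t \<in> C" by (rule C(3)) (use t ne 1 2 in auto)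
    then have "e t * 1 * e t = 0" using 1 vN_one[OF M] by blast
    then have "e t = 0" using projsD(3)[OF ep[OF t(1,2)]] by simp
    then show False using ne by (simp add: e_def)
  qed
  ultimately show ?thesis using V(1,2) by blast
qed

text \<open>Outside the central support \<open>Z\<close> of a maximal frame there is no nonzero
  frame. A maximal pair there, with initial projection \<open>g\<close> and final projection
  \<open>k\<close>, splits the rest into the summand \<open>g + k\<close> of type I2 and a
  commutative remainder \<open>r\<close>; the abelian projection \<open>a = g + r\<close> reaches
  both.\<close>

lemma structure_decomposition:
  assumes M: "von_neumann_algebra M"
  shows "\<exists>E V W Z a u. frame M E V W \<and> Z \<in> projs M \<and> (\<forall>m\<in>M. Z * m = m * Z) \<and> Z * E = E \<and>
    (\<forall>b. (\<forall>m\<in>M. b * m * E = 0) \<longrightarrow> b * Z = 0) \<and> a \<in> projs M \<and> a * Z = 0 \<and>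
    (\<forall>p\<in>projs M. \<forall>r\<in>projs M. p * a = p \<longrightarrow> r * a = r \<longrightarrow> p * r = r * p) \<and>
    u \<in> M \<and> u * adj u * u = u \<and> u * a = u \<and> a * u = 0 \<and> a + u * adj u = 1 - Z"
proof -
  obtain E V W where fr: "frame M E V W" and noframe: "\<And>e v w. frame M e v w \<Longrightarrow> (\<And>m. m \<in> M \<Longrightarrow> e * m * E = 0) \<Longrightarrow> e = 0"
    using ex_maximal_frame[OF M] by blast
  obtain Z where Z: "Z \<in> projs M" "\<And>m. m \<in> M \<Longrightarrow> Z * m = m * Z" "Z * E = E"
      "\<And>b. \<forall>m\<in>M. b * m * E = 0 \<Longrightarrow> b * Z = 0"
    using ex_central_support[OF M frameD(1)[OF fr]] by blast
  note ZP = projsD[OF Z(1)]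
  have noframe': "e = 0" if "frame M e v w" "e * Z = 0" for e v w
  proof (rule noframe[OF that(1)])
    fix m assume m: "m \<in> M"
    have "e * m * E = e * Z * m * E" using Z(2)[OF m] Z(3) by (metis mult.assoc)
    then show "e * m * E = 0" using that(2) by simp
  qed
  obtain u where u: "u \<in> M" "u * adj u * u = u" "u * u = 0" "(1 - Z) * u = u"
    and nopair: "\<forall>t\<in>M. t * adj t * t = t \<longrightarrow> t * t = 0 \<longrightarrow> (1 - Z) * t = t \<longrightarrow>
      (\<forall>m\<in>M. adj t * t * m * (adj u * u) = 0) \<longrightarrow> t = 0"
    using ex_maximal_pair[OF M, of "1 - Z"] by (elim bexE conjE) (rule that)
  note nopair = nopair[rule_format]
  define g where "g = adj u * u"
  define k where "k = u * adj u"
  have g: "g \<in> projs M" and k: "k \<in> projs M" unfolding g_def k_def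
    using projs_tripotent_right[OF M u(1,2)] projs_tripotent_left[OF M u(1,2)] by auto
  note G = projsD[OF g] and K = projsD[OF k]
  have Zu: "Z * u = 0" "u * Z = 0" using u(4) Z(2)[OF u(1)] by (simp_all add: left_diff_distrib)
  have ug: "u * g = u" "k * u = u" "g * u = 0" "u * k = 0" "adj u * k = adj u" "g * adj u = adj u"
    using adj_tripotent[OF u(2)] by (simp_all add: g_def k_def mult.assoc[symmetric] u) (simp_all add: mult.assoc u)
  have gk: "g * k = 0" by (simp add: k_def mult_eq_assoc[OF ug(3)])
  have kg: "k * g = 0" by (rule proj_comm_zero[OF g k gk])
  have gZ: "g * Z = 0" by (simp add: g_def mult.assoc Zu)
  have Zg: "Z * g = 0" using Z(2)[OF G(1)] gZ by simp
  have kZ: "Z * k = 0" "k * Z = 0" using Z(2)[OF K(1)] by (simp_all add: k_def mult_eq_assoc[OF Zu(1)])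
  obtain Z2 where Z2: "Z2 \<in> projs M" "\<And>m. m \<in> M \<Longrightarrow> Z2 * m = m * Z2" "Z2 * g = g"
      "\<And>b. \<forall>m\<in>M. b * m * g = 0 \<Longrightarrow> b * Z2 = 0"
    using ex_central_support[OF M g] by blast
  define r where "r = 1 - Z - g - k"
  have rM: "r \<in> M" unfolding r_def by (intro vN_diff[OF M] vN_one[OF M] ZP(1) G(1) K(1))
  have ru: "r * u = 0" "r * g = 0" "g * r = 0" "Z * r = 0" "r * Z = 0"
    by (simp_all add: r_def algebra_simps Zu ug gZ Zg gk kg kZ G ZP)
  have rr: "r * r = r" "adj r = r"
    by (simp add: r_def algebra_simps Zu ug gZ Zg gk kg kZ G K ZP)
      (simp add: r_def adj_diff ZP(2) G(2) K(2))
  \<comment> \<open>A nonzero block would contain a partial isometry \<open>t\<close> from below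
    \<open>g\<close> into \<open>r\<close>; together with \<open>u\<close> it gives three equivalent
    orthogonal projections outside \<open>Z\<close>.\<close>
  have rmg: "r * m * g = 0" if m: "m \<in> M" for m
  proof (rule ccontr)
    assume ne: "r * m * g \<noteq> 0"
    have "r * m * g \<in> M" using rM m G(1) vN_mult[OF M] by blast
    moreover have "r * (r * m * g) = r * m * g" "r * m * g * g = r * m * g"
      by (simp_all add: mult.assoc[symmetric] rr) (simp_all add: mult.assoc G)
    ultimately obtain t where t: "t \<in> M" "t * adj t * t = t" "r * t = t" "t * g = t" "t \<noteq> 0"
      using ex_tripotent_between[OF M] ne by blast
    define e where "e = adj t * t"
    have e: "e \<in> projs M" unfolding e_def by (rule projs_tripotent_right[OF M t(1,2)])
    note EP = projsD[OF e]
    have eg: "e * g = e" by (simp add: e_def mult.assoc t)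
    have ge: "g * e = e" using proj_comm_le[OF e g] eg by simp
    have eu: "e * u = 0" using mult_eq_assoc[OF eg, of u] by (simp add: ug)
    have er: "e * r = 0" using mult_eq_assoc[OF eg, of r] by (simp add: ru)
    have et: "e * t = 0" using mult_eq_assoc[OF er, of t] by (simp add: t)
    have "adj u * r = 0" using mult_zero_adj[OF ru(1)] by (simp add: rr)
    then have ut: "adj u * t = 0" using mult_eq_assoc[of "adj u" r 0 t] by (simp add: t)
    have "frame M e (u * e) t"
      unfolding frame_def
    proof (intro conjI)
      show "adj (u * e) * (u * e) = e"
        by (simp add: adj_mult EP mult.assoc mult_eq_assoc[OF g_def[symmetric]] ge)
      show "e * (u * e) = 0" by (simp add: mult_eq_assoc[OF eu])
      show "adj (u * e) * t = 0" by (simp add: adj_mult mult.assoc ut)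
    qed (use e t u vN_mult[OF M] EP(1) et in \<open>simp_all add: e_def\<close>)
    moreover have "e * Z = 0" using mult_eq_assoc[OF eg, of Z] by (simp add: gZ)
    ultimately have "e = 0" by (rule noframe')
    then show False using t(5) by (simp add: e_def)
  qed
  then have rZ2: "r * Z2 = 0" using Z2(4) by blast
  have "Z * m * g = 0" if "m \<in> M" for m using Z(2)[OF that] by (simp add: mult.assoc Zg)
  then have ZZ2: "Z * Z2 = 0" using Z2(4) by blast
  have "Z2 * u = u"
  proof -
    have "Z2 * u = u * (Z2 * g)" using Z2(2) u(1) G(1) by (metis mult.assoc ug(1))
    then show ?thesis using Z2(3) ug(1) by simp
  qed
  then have "Z2 * k = k" by (simp add: k_def mult.assoc[symmetric])
  then have "k * Z2 = k" "g * Z2 = g" using Z2(2,3) G(1) K(1) by auto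
  moreover have "1 * Z2 = (r + Z + g + k) * Z2" by (simp add: r_def)
  \<comment> \<open>The central support of \<open>g\<close> misses \<open>r\<close> and
    \<open>Z\<close> and contains \<open>g\<close> and \<open>k\<close>; these four sum to 1, so it
    equals \<open>g + k\<close>, and thus \<open>r\<close> is central.\<close>
  ultimately have Z2eq: "Z2 = g + k" using rZ2 ZZ2 by (simp add: distrib_right)
  have rc: "r * m = m * r" if "m \<in> M" for m
  proof -
    have "r = 1 - Z - Z2" by (simp add: r_def Z2eq)
    then show ?thesis using Z(2)[OF that] Z2(2)[OF that] by (simp add: left_diff_distrib right_diff_distrib)
  qed
  define a where "a = g + r"
  have rP: "r \<in> projs M" using rM rr by (simp add: projs_def)
  have a: "a \<in> projs M" unfolding a_def by (rule projs_add[OF M g rP ru(3)])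
  have ur: "u * r = 0" using rc[OF u(1)] ru by simp
  have "p * q = q * p" if pq: "p \<in> projs M" "q \<in> projs M" "p * a = p" "q * a = q" for p q
  proof (rule ccontr)
    assume ne: "p * q \<noteq> q * p"
    note P = projsD[OF pq(1)] and Q = projsD[OF pq(2)]
    have ap: "a * p = p" using proj_comm_le[OF pq(1) a] pq(3) by simp
    \<comment> \<open>If \<open>q\<close> has no block from \<open>a - p\<close> to
      \<open>p\<close>, it commutes with \<open>p\<close>.\<close>
    have "p * q * (a - p) \<noteq> 0"
    proof
      assume "p * q * (a - p) = 0"
      then have pqp: "p * q = p * (q * p)" by (simp add: right_diff_distrib mult.assoc pq(4))
      have "q * p = p * q * p" using arg_cong[OF pqp, of adj] unfolding adj_mult P(2) Q(2) .
      from ne trans[OF pqp trans[OF mult.assoc[symmetric] this[symmetric]]] show False ..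
    qed
    moreover have "p * q * (a - p) \<in> M" by (intro vN_mult[OF M] vN_diff[OF M] P(1) Q(1) projsD(1)[OF a])
    moreover have "p * (p * q * (a - p)) = p * q * (a - p)" by (simp add: mult.assoc P)
    moreover have "(a - p) * (a - p) = a - p" by (simp add: algebra_simps projsD[OF a] P pq(3) ap)
    then have "p * q * (a - p) * (a - p) = p * q * (a - p)" by (simp add: mult.assoc)
    ultimately obtain t where t: "t \<in> M" "t * adj t * t = t" "p * t = t" "t * (a - p) = t" "t \<noteq> 0"
      using ex_tripotent_between[OF M, of "p * q * (a - p)" p "a - p"] by blast
    have apz: "(a - p) * p = 0" by (simp add: left_diff_distrib P ap)
    have tt: "t * t = 0" using mult_zero_between[OF t(4,3) apz] .
    have at: "a * t = t" using mult_eq_assoc[OF ap, of t] t(3) by simp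
    have apa: "(a - p) * a = a - p" by (simp add: left_diff_distrib projsD[OF a] pq(3))
    have ta: "t * a = t" by (metis apa mult.assoc t(4))
    \<comment> \<open>On the central part \<open>r\<close> the operator \<open>t\<close> would be a
      pair centrally orthogonal to \<open>u\<close>, against maximality.\<close>
    have "t * r = 0"
    proof (rule nopair)
      have tr: "r * t = t * r" by (rule rc[OF t(1)])
      show "t * r \<in> M" by (rule vN_mult[OF M t(1) rM])
      have ar: "adj t * r = r * adj t" using rc[OF vN_adj[OF M t(1)]] by simp
      have "t * r * adj (t * r) * (t * r) = t * (r * (r * adj t) * t) * r"
        by (simp add: adj_mult rr mult.assoc)
      also have "\<dots> = (t * adj t * t) * r" using rr ar tr by (metis mult.assoc)
      finally show "t * r * adj (t * r) * (t * r) = t * r" using t(2) by simp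
      show "t * r * (t * r) = 0" using tr tt by (metis mult.assoc mult_zero_left)
      show "(1 - Z) * (t * r) = t * r" by (simp add: tr[symmetric] left_diff_distrib mult.assoc[symmetric] ru(4))
      fix m assume m: "m \<in> M"
      have "adj (t * r) * (t * r) * m * (adj u * u) = adj (t * r) * t * (r * m * g)"
        by (simp add: mult.assoc g_def)
      then show "adj (t * r) * (t * r) * m * (adj u * u) = 0" using rmg[OF m] by simp
    qed
    then have tg: "t * g = t" and gt: "g * t = t"
      using ta at rc[OF t(1)] by (simp_all add: a_def distrib_left distrib_right)
    define e where "e = adj t * t"
    have e: "e \<in> projs M" unfolding e_def by (rule projs_tripotent_right[OF M t(1,2)])
    note EP = projsD[OF e]
    have eg: "e * g = e" by (simp add: e_def mult.assoc tg)
    have ge: "g * e = e" using proj_comm_le[OF e g] eg by simp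
    have eu: "e * u = 0" using mult_eq_assoc[OF eg, of u] by (simp add: ug)
    have "adj t * g = adj t" using arg_cong[OF gt, of adj] by (simp add: adj_mult G)
    then have tu: "adj t * u = 0" using mult_eq_assoc[of "adj t" g "adj t" u] by (simp add: ug)
    \<comment> \<open>\<open>t\<close> stays inside \<open>g\<close> while \<open>u\<close> maps
      \<open>g\<close> to the orthogonal \<open>k\<close>, so the two form a frame outside
      \<open>Z\<close>.\<close>
    have "frame M e t (u * e)"
      unfolding frame_def
    proof (intro conjI)
      show "adj (u * e) * (u * e) = e"
        by (simp add: adj_mult EP mult.assoc mult_eq_assoc[OF g_def[symmetric]] ge)
      show "e * (u * e) = 0" by (simp add: mult_eq_assoc[OF eu])
      show "adj t * (u * e) = 0" by (simp add: mult_eq_assoc[OF tu])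
      show "e * t = 0" by (simp add: e_def mult.assoc tt)
    qed (use e t u vN_mult[OF M] EP(1) in \<open>simp_all add: e_def\<close>)
    moreover have "e * Z = 0" using mult_eq_assoc[OF eg, of Z] by (simp add: gZ)
    ultimately have "e = 0" by (rule noframe')
    then show False using t(5) by (simp add: e_def)
  qed
  moreover have "a * Z = 0" "u * a = u" "a * u = 0" "a + u * adj u = 1 - Z"
    by (simp_all add: a_def distrib_left distrib_right gZ ru ug ur) (simp add: r_def k_def)
  ultimately show ?thesis using fr Z a u by blast
qed

text \<open>A nonzero block \<open>(1 - q) * n * q\<close> would have a graph over \<open>q\<close>
  whose projection does not commute with \<open>q\<close>.\<close>

lemma central_if_commutes_with_projections:
  assumes N: "von_neumann_algebra N" and q: "q \<in> projs N"
    and comm: "\<And>p. p \<in> projs N \<Longrightarrow> q * p = p * q" and n: "n \<in> N"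
  shows "q * n = n * q"
proof -
  note Q = projsD[OF q]
  have off: "(1 - q) * n * q = 0" if n: "n \<in> N" for n
  proof -
    define a where "a = (1 - q) * n * q"
    have a: "a \<in> N" unfolding a_def by (intro vN_mult[OF N] vN_diff[OF N] vN_one[OF N] Q(1) n)
    have aq: "a * q = a" by (simp add: a_def mult.assoc Q)
    have qa: "q * a = 0" by (simp add: a_def algebra_simps Q)
    define G where "G = rp (q + a)"
    have "G \<in> projs N" unfolding G_def by (intro rp_projs N vN_add[OF N] Q(1) a)
    then have qG: "q * G = G * q" by (rule comm)
    have 1: "G * (q + a) = q + a" by (simp add: G_def rp_mult)
    have "q * (q + a) = q" "q * (G * (q + a)) = G * q"
      by (simp_all add: distrib_left Q qa mult_eq_assoc[OF qG] mult.assoc)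
    then have Gq: "G * q = q" using 1 by simp
    have "(q + a) * (q + a) = q + a"
      using mult_eq_assoc[OF aq, of a] by (simp add: algebra_simps Q aq qa)
    then have "(q + a) * G = G" unfolding G_def by (rule rp_le)
    then have "(q + a) * (G * q) = G * q" by (simp add: mult.assoc[symmetric])
    then have "a = 0" by (simp add: Gq distrib_right Q aq)
    then show ?thesis by (simp add: a_def)
  qed
  have "n * q = q * n * q" using off[OF n] by (simp add: algebra_simps)
  moreover have "q * n = q * n * q"
    using mult_zero_adj[OF off[OF vN_adj[OF N n]]]
    by (simp add: adj_mult adj_diff Q algebra_simps)
  ultimately show ?thesis by simp
qed

section \<open>The star-ring isomorphism assembled from both parts\<close>

context ortho_iso
begin

text \<open>Centrality can be tested on projections, and \<theta> respects products of commuting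
  projections.\<close>

lemma central_transfer:
  assumes z: "z \<in> projs M" "\<And>m. m \<in> M \<Longrightarrow> z * m = m * z" and n: "n \<in> N"
  shows "\<theta> z * n = n * \<theta> z"
proof (rule central_if_commutes_with_projections[OF N proj[OF z(1)] _ n])
  fix p assume "p \<in> projs N"
  then obtain r where r: "r \<in> projs M" "\<theta> r = p" using surj by blast
  have "z * r = r * z" by (rule z(2)[OF projsD(1)[OF r(1)]])
  then show "\<theta> z * p = p * \<theta> z"
    using commuting_transfer[OF z(1) r(1)] commuting_transfer[OF r(1) z(1)] r(2) by simp
qed

text \<open>\<open>E\<close> generates the summand \<open>Z\<close>, while \<open>a\<close> and its
  translate by \<open>u\<close> exhaust the complement; hence \<open>E + a\<close> is full and the
  two ideal isomorphisms glue.\<close>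

theorem ex_star_ring_iso:
  "\<exists>J. bij_betw J M N \<and> (\<forall>a\<in>M. \<forall>b\<in>M. J (a + b) = J a + J b) \<and>
    (\<forall>a\<in>M. \<forall>b\<in>M. J (a * b) = J a * J b) \<and> (\<forall>a\<in>M. J (adj a) = adj (J a))"
proof -
  obtain E V W Z a u where fr: "frame M E V W" and Z: "Z \<in> projs M" "\<forall>m\<in>M. Z * m = m * Z" "Z * E = E"
      "\<forall>b. (\<forall>m\<in>M. b * m * E = 0) \<longrightarrow> b * Z = 0" and a: "a \<in> projs M" "a * Z = 0"
      "\<forall>p\<in>projs M. \<forall>r\<in>projs M. p * a = p \<longrightarrow> r * a = r \<longrightarrow> p * r = r * p"
    and u: "u \<in> M" "u * adj u * u = u" "u * a = u" "a * u = 0" "a + u * adj u = 1 - Z"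
    using structure_decomposition[OF M] by blast
  have E: "E \<in> projs M" by (rule frameD(1)[OF fr])
  have z': "\<theta> Z * n = n * \<theta> Z" if "n \<in> N" for n
    by (rule central_transfer[OF Z(1) _ that]) (use Z(2) in blast)
  have EZ: "E * Z = E" using proj_comm_le[OF E Z(1)] Z(3) by simp
  have Za: "Z * a = 0" by (rule proj_comm_zero[OF a(1) Z(1) a(2)])
  have EMa: "E * m * a = 0" if "m \<in> M" for m
  proof -
    have "E * m * a = E * (Z * m) * a" by (simp add: mult.assoc[symmetric] EZ)
    also have "\<dots> = E * m * (Z * a)" using Z(2) that by (simp add: mult.assoc)
    finally show ?thesis by (simp add: Za)
  qed
  have EZ': "\<theta> E * \<theta> Z = \<theta> E"
    using le_iff[OF E Z(1)] Z(3) proj_comm_le[OF proj[OF E] proj[OF Z(1)]] by simp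
  have Za': "\<theta> Z * \<theta> a = 0" using orth[OF Z(1) a(1)] Za by simp
  have ENa: "\<theta> E * n * \<theta> a = 0" if "n \<in> N" for n
  proof -
    have "\<theta> E * n * \<theta> a = \<theta> E * (\<theta> Z * n) * \<theta> a" by (simp add: mult.assoc[symmetric] EZ')
    also have "\<dots> = \<theta> E * n * (\<theta> Z * \<theta> a)" using z'[OF that] by (simp add: mult.assoc)
    finally show ?thesis by (simp add: Za')
  qed
  have Ea: "E * a = 0" using EMa[OF vN_one[OF M]] by simp
  have k: "u * adj u \<in> projs M" by (rule projs_tripotent_left[OF M u(1,2)])
  have ak: "a * (u * adj u) = 0" by (simp add: mult.assoc[symmetric] u)
  have uu: "u * u = 0" using mult_eq_assoc[OF u(3), of u] u(4) by simp
  obtain u' where u': "u' \<in> N" "adj u' * u' = \<theta> (adj u * u)" "u' * adj u' = \<theta> (u * adj u)"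
    using perspective_image[OF u(1,2) uu] by blast
  have "\<theta> a + \<theta> (u * adj u) = \<theta> (1 - Z)" using add[OF a(1) k ak] u(5) by simp
  also have "\<dots> = 1 - \<theta> Z" using diff[OF projs_one[OF M] Z(1)] by simp
  finally have sum': "\<theta> a + u' * adj u' = 1 - \<theta> Z" by (simp add: u'(3))
  obtain \<Theta>1 where m1: "module_iso M E N (\<theta> E) \<Theta>1" using module_iso_frame[OF fr] by blast
  have "\<exists>\<Theta>. module_iso M a N (\<theta> a) \<Theta>"
  proof (rule module_iso_abelian[OF a(1) _ u(1-4) u'])
    fix x assume x: "x \<in> M" "x * a = x"
    have "Z * x = x * (Z * a)" using Z(2) x by (metis mult.assoc Za mult_zero_right)
    then have "(1 - Z) * x = x" by (simp add: left_diff_distrib Za)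
    then show "x = a * x + u * adj u * x" using u(5) by (metis distrib_right)
  next
    fix y assume y: "y \<in> N" "y * \<theta> a = y"
    have "\<theta> Z * y = y * (\<theta> Z * \<theta> a)" using z'[OF y(1)] y(2) by (metis mult.assoc Za' mult_zero_right)
    then have "(1 - \<theta> Z) * y = y" by (simp add: left_diff_distrib Za')
    then show "y = \<theta> a * y + u' * adj u' * y" using sum' by (metis distrib_right)
  qed (use a(3) in blast)
  then obtain \<Theta>2 where m2: "module_iso M a N (\<theta> a) \<Theta>2" by blast
  have m: "module_iso M (E + a) N (\<theta> E + \<theta> a) (\<lambda>x. \<Theta>1 (x * E) + \<Theta>2 (x * a))"
    by (rule module_iso_sum[OF M N E a(1) proj[OF E] proj[OF a(1)] EMa ENa m1 m2])
  have e: "E + a \<in> projs M" by (rule projs_add[OF M E a(1) Ea])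
  have f: "\<theta> E + \<theta> a \<in> projs N" using proj[OF e] add[OF E a(1) Ea] by simp
  have fullM: "full M (E + a)"
    unfolding full_def
  proof (intro allI impI)
    fix b assume b: "\<forall>m\<in>M. b * m * (E + a) = 0"
    have aE: "a * E = 0" by (rule proj_comm_zero[OF E a(1) Ea])
    have eE: "(E + a) * E = E" "(E + a) * a = a" by (simp_all add: distrib_right projsD[OF E] projsD[OF a(1)] Ea aE)
    have bE: "b * m * E = 0" "b * m * a = 0" if "m \<in> M" for m
      using b that eE by (metis mult.assoc mult_zero_left)+
    have "b * Z = 0" using Z(4) bE(1) by blast
    moreover have "b * a = 0" using bE(2)[OF vN_one[OF M]] by simp
    moreover have "b * u = 0" using bE(2)[OF u(1)] u(3) by (simp add: mult.assoc)
    then have "b * (u * adj u) = 0" by (simp add: mult.assoc[symmetric])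
    moreover have "b = b * (a + u * adj u) + b * Z" unfolding u(5) by (simp add: right_diff_distrib)
    ultimately show "b = 0" by (simp add: distrib_left)
  qed
  have fullN: "full N (\<theta> E + \<theta> a)"
    unfolding full_def
  proof (intro allI impI)
    fix b assume b: "\<forall>n\<in>N. b * n * (\<theta> E + \<theta> a) = 0"
    \<comment> \<open>Fullness in \<open>N\<close> is pulled back: the complement of the central
      support is the image of a central projection of \<open>M\<close> orthogonal to
      \<open>E + a\<close>, which vanishes because \<open>E + a\<close> is full.\<close>
    obtain C where C: "C \<in> projs N" "\<forall>n\<in>N. C * n = n * C" "C * (\<theta> E + \<theta> a) = \<theta> E + \<theta> a"
        "\<forall>b. (\<forall>n\<in>N. b * n * (\<theta> E + \<theta> a) = 0) \<longrightarrow> b * C = 0"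
      using ex_central_support[OF N f] by blast
    interpret I: ortho_iso N M "inv_into (projs M) \<theta>" by (rule inverse)
    have D: "1 - C \<in> projs N" by (rule projs_compl[OF N C(1)])
    define z where "z = inv_into (projs M) \<theta> (1 - C)"
    have z: "z \<in> projs M" "\<theta> z = 1 - C"
      unfolding z_def using I.proj[OF D] bij_betw_inv_into_right[OF bij D] by auto
    have zc: "z * m = m * z" if "m \<in> M" for m
      unfolding z_def using C(2) by (intro I.central_transfer[OF D _ that]) (simp add: algebra_simps)
    have "\<theta> z * \<theta> (E + a) = 0" using C(3) by (simp add: z add[OF E a(1) Ea] left_diff_distrib)
    then have ze: "z * (E + a) = 0" using orth[OF z(1) e] by simp
    have "z * m * (E + a) = 0" if "m \<in> M" for m
      using zc[OF that] ze by (simp add: mult.assoc)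
    then have "z = 0" by (rule fullD[OF fullM])
    then have "C = 1" using z(2) by simp
    then show "b = 0" using C(4) b by simp
  qed
  show ?thesis by (rule star_ring_iso_of_module_iso[OF M N e f m fullM fullN])
qed

end

section \<open>Real and imaginary scalars under star-ring isomorphisms\<close>

text \<open>Rational scalars are an algebraic matter; continuity comes from order. For
  \<open>\<bar>t\<bar> \<le> q\<close> the number \<open>q\<^sup>2 - t\<^sup>2\<close> is a square,
  its image is the square of a self-adjoint operator, and this bounds the image of \<open>t\<close>
  by that of \<open>q\<close>.\<close>

lemma star_ring_iso_real_scale:
  fixes J :: "'a::complex_hilbert_space bop \<Rightarrow> 'b::complex_hilbert_space bop"
  assumes M: "von_neumann_algebra M"
    and add: "\<And>a b. a \<in> M \<Longrightarrow> b \<in> M \<Longrightarrow> J (a + b) = J a + J b"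
    and mult: "\<And>a b. a \<in> M \<Longrightarrow> b \<in> M \<Longrightarrow> J (a * b) = J a * J b"
    and adj: "\<And>a. a \<in> M \<Longrightarrow> J (adj a) = adj (J a)" and one: "J 1 = 1"
  shows "J (complex_of_real r *\<^sub>C 1) = complex_of_real r *\<^sub>C 1"
proof -
  define S where "S r = (complex_of_real r *\<^sub>C 1 :: 'a bop)" for r
  have SM: "S r \<in> M" for r unfolding S_def by (intro vN_scaleC vN_one M)
  have Sadd: "S (r + s) = S r + S s" and Smult: "S (r * s) = S r * S s" and Sadj: "adj (S r) = S r" for r s
    by (simp_all add: S_def bop_scaleC_add_left mult.commute)
  define j where "j r = J (S r)" for r
  have jadd: "j (r + s) = j r + j s" and jmult: "j (r * s) = j r * j s" and jadj: "adj (j r) = j r" for r s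
    unfolding j_def by (simp_all add: Sadd Smult add SM mult adj[symmetric] Sadj)
  have j0: "j 0 = 0" using jadd[of 0 0] by simp
  have j1: "j 1 = 1" by (simp add: j_def S_def one)
  have jnat: "j (of_nat n) = of_nat n *\<^sub>C 1" for n
    by (induction n) (simp_all add: j0 j1 jadd bop_scaleC_add_left)
  have jneg: "j (- r) = - j r" for r
  proof -
    have "j r + j (- r) = 0" using jadd[of r "- r"] by (simp add: j0)
    then show ?thesis by (simp only: add_eq_0_iff)
  qed
  have jfrac: "j (of_nat m / of_nat (Suc n)) = complex_of_real (of_nat m / of_nat (Suc n)) *\<^sub>C 1" for m n
  proof -
    let ?q = "real m / real (Suc n)"
    have "j (of_nat (Suc n) * ?q) = of_nat (Suc n) *\<^sub>C j ?q"
      unfolding jmult jnat by simp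
    moreover have "of_nat (Suc n) * ?q = of_nat m" by simp
    ultimately have "of_nat (Suc n) *\<^sub>C j ?q = of_nat m *\<^sub>C 1" by (simp only: jnat)
    then have "inverse (of_nat (Suc n)) *\<^sub>C (of_nat (Suc n) *\<^sub>C j ?q) = inverse (of_nat (Suc n)) *\<^sub>C (of_nat m *\<^sub>C 1)"
      by (rule arg_cong)
    moreover have "inverse (of_nat (Suc n)) * (of_nat (Suc n) :: complex) = 1" by (simp del: of_nat_Suc)
    moreover have "inverse (of_nat (Suc n)) * (of_nat m :: complex) = complex_of_real ?q"
      by (simp add: divide_inverse mult.commute del: of_nat_Suc)
    ultimately show ?thesis by (simp only: bop_scaleC_scaleC bop_scaleC_one)
  qed
  have small: "bdd_by (j t) (1 / real (Suc n))" if t: "\<bar>t\<bar> \<le> 1 / real (Suc n)" for t n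
    unfolding bdd_by_def
  proof
    fix x
    let ?q = "1 / real (Suc n)"
    have "t\<^sup>2 \<le> ?q\<^sup>2" using t by (simp add: abs_le_square_iff[symmetric])
    then have "(sqrt (?q\<^sup>2 - t\<^sup>2))\<^sup>2 = ?q\<^sup>2 - t\<^sup>2" by (intro real_sqrt_pow2) linarith
    then obtain s where s: "?q * ?q = t * t + s * s"
      by (metis add.commute diff_add_cancel power2_eq_square)
    have jq: "j ?q = complex_of_real ?q *\<^sub>C 1" using jfrac[of 1 n] by simp
    have nn: "inner (bop_apply (j r * j r) x) x = (norm (bop_apply (j r) x))\<^sup>2" for r
      using adj_mult_self_apply[of "j r" x] by (simp add: jadj)
    have "j ?q * j ?q = j t * j t + j s * j s" unfolding jmult[symmetric] jadd[symmetric] s by (rule refl)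
    then have "(norm (bop_apply (j ?q) x))\<^sup>2 = (norm (bop_apply (j t) x))\<^sup>2 + (norm (bop_apply (j s) x))\<^sup>2"
      unfolding nn[symmetric] by (simp add: plus_bop.rep_eq inner_add_left)
    moreover have "norm (bop_apply (j ?q) x) = ?q * norm x"
      unfolding jq scaleC_bop.rep_eq one_bop.rep_eq norm_scaleC norm_of_real by simp
    ultimately have "(norm (bop_apply (j t) x))\<^sup>2 \<le> (?q * norm x)\<^sup>2" by simp
    then show "norm (bop_apply (j t) x) \<le> ?q * norm x" by (rule power2_le_imp_le) simp
  qed
  have pos: "j r = complex_of_real r *\<^sub>C 1" if r: "0 \<le> r" for r
  proof -
    have "bdd_by (j r - complex_of_real r *\<^sub>C 1) (2 * inverse (real (Suc n)))" for n
    proof -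
      define m where "m = nat \<lfloor>r * real (Suc n)\<rfloor>"
      define t where "t = r - real m / real (Suc n)"
      have "real m \<le> r * real (Suc n)" "r * real (Suc n) < real m + 1"
        using r by (simp_all add: m_def del: of_nat_Suc)
      then have "real m / real (Suc n) \<le> r" "r \<le> (real m + 1) / real (Suc n)"
        by (simp_all add: pos_divide_le_eq pos_le_divide_eq del: of_nat_Suc)
      then have t: "\<bar>t\<bar> \<le> 1 / real (Suc n)" by (simp add: t_def add_divide_distrib abs_le_iff del: of_nat_Suc)
      have r': "r = real m / real (Suc n) + t" by (simp add: t_def)
      have eq: "j r - complex_of_real r *\<^sub>C 1 = j t - complex_of_real t *\<^sub>C 1"
        by (subst (1 2) r') (simp only: jadd jfrac of_real_add bop_scaleC_add_left, simp)
      have b1: "bdd_by (complex_of_real t *\<^sub>C 1 :: 'b bop) (1 / real (Suc n))"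
        using bdd_by_scaleC[OF bdd_by_one, of "complex_of_real t"] t
        by (auto intro: bdd_by_mono simp del: of_nat_Suc)
      have "1 / real (Suc n) + 1 / real (Suc n) = 2 * inverse (real (Suc n))"
        by (simp add: divide_inverse del: of_nat_Suc)
      then show ?thesis using bdd_by_diff[OF small[OF t] b1] by (simp only: eq)
    qed
    moreover have "(\<lambda>n. 2 * inverse (real (Suc n))) \<longlonglongrightarrow> 0"
      using tendsto_mult_right_zero[OF LIMSEQ_inverse_real_of_nat, of 2] by simp
    ultimately have "j r - complex_of_real r *\<^sub>C 1 = 0" by (rule bop_eq_bdd_by_limit)
    then show ?thesis by simp
  qed
  have "j r = complex_of_real r *\<^sub>C 1"
    using pos[of r] pos[of "- r"] jneg[of r] by (cases "0 \<le> r") (simp_all add: bop_scaleC_minus_left)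
  then show ?thesis by (simp add: j_def S_def)
qed

lemma jordan_star_isomorphic_of_star_ring_iso:
  fixes J :: "'a::complex_hilbert_space bop \<Rightarrow> 'b::complex_hilbert_space bop"
  assumes M: "von_neumann_algebra M" and N: "von_neumann_algebra N" and bij: "bij_betw J M N"
    and add: "\<And>a b. a \<in> M \<Longrightarrow> b \<in> M \<Longrightarrow> J (a + b) = J a + J b"
    and mult: "\<And>a b. a \<in> M \<Longrightarrow> b \<in> M \<Longrightarrow> J (a * b) = J a * J b"
    and adj: "\<And>a. a \<in> M \<Longrightarrow> J (adj a) = adj (J a)"
  shows "jordan_star_isomorphic M N"
proof -
  have JN: "J a \<in> N" if "a \<in> M" for a using bij bij_betwE that by blast
  have surj: "\<exists>a\<in>M. J a = n" if "n \<in> N" for n using bij that by (metis bij_betw_imp_surj_on imageE)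
  obtain o1 where o1: "o1 \<in> M" "J o1 = 1" using surj vN_one[OF N] by blast
  have one: "J 1 = 1" using mult[OF o1(1) vN_one[OF M]] o1 by simp
  define I where "I = (\<i> *\<^sub>C 1 :: 'a bop)"
  have I: "I \<in> M" unfolding I_def by (intro vN_scaleC vN_one M)
  define j where "j = J I"
  have scaleM: "c *\<^sub>C a \<in> M" if "a \<in> M" for c a using vN_scaleC[OF M that] .
  have real: "J (complex_of_real r *\<^sub>C a) = complex_of_real r *\<^sub>C J a" if a: "a \<in> M" for r a
    using mult[OF scaleM[OF vN_one[OF M]] a, of "complex_of_real r"]
      star_ring_iso_real_scale[OF M add mult adj one, of r] by simp
  have jc: "j * n = n * j" if "n \<in> N" for n
  proof -
    from surj[OF that] obtain a where a: "a \<in> M" "J a = n" by blast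
    have "I * a = a * I" by (simp add: I_def)
    then show ?thesis using mult[OF I a(1)] mult[OF a(1) I] a(2) by (simp add: j_def)
  qed
  have Jneg: "J (- a) = - J a" if a: "a \<in> M" for a
    using real[OF a, of "-1"] by (simp add: bop_scaleC_minus_left)
  have jj: "j * j = - 1"
  proof -
    have "I * I = - 1" by (simp add: I_def bop_scaleC_minus_left)
    then show ?thesis using mult[OF I I] Jneg[OF vN_one[OF M]] by (simp add: j_def one)
  qed
  have ja: "adj j = - j"
  proof -
    have "adj I = - I" by (simp add: I_def bop_scaleC_minus_left)
    then show ?thesis using adj[OF I] Jneg[OF I] by (simp add: j_def)
  qed
  \<comment> \<open>\<open>z\<close> and \<open>y\<close> are the spectral projections of
    \<open>j\<close> for the eigenvalues \<open>\<i>\<close> and \<open>- \<i>\<close>.\<close>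
  define z where "z = (1/2) *\<^sub>C (1 - \<i> *\<^sub>C j)"
  define y where "y = (1/2) *\<^sub>C (1 + \<i> *\<^sub>C j)"
  have jN: "j \<in> N" unfolding j_def by (rule JN[OF I])
  have zN: "z \<in> N" "y \<in> N" unfolding z_def y_def by (intro vN_scaleC vN_diff vN_add vN_one N jN)+
  have zy: "z + y = 1"
    unfolding z_def y_def bop_scaleC_add_right[symmetric] by (simp add: bop_half_double)
  have zc: "z * n = n * z" "y * n = n * y" if "n \<in> N" for n
    unfolding z_def y_def by (simp_all add: left_diff_distrib right_diff_distrib distrib_left distrib_right jc[OF that])
  have jz: "j * z = \<i> *\<^sub>C z" "j * y = (- \<i>) *\<^sub>C y"
    unfolding z_def y_def
    by (simp_all add: right_diff_distrib distrib_left jj bop_scaleC_diff_right bop_scaleC_add_right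
        bop_scaleC_minus_right bop_scaleC_minus_left)
  have zz: "z * z = z" "y * y = y" "z * y = 0"
  proof -
    have "z * z = (1/2) *\<^sub>C (z - \<i> *\<^sub>C (j * z))" "y * y = (1/2) *\<^sub>C (y + \<i> *\<^sub>C (j * y))"
      by (subst (1) z_def, simp add: left_diff_distrib, subst (1) y_def, simp add: distrib_right)
    then show 1: "z * z = z" "y * y = y"
      unfolding jz by (simp_all add: bop_scaleC_minus_left bop_scaleC_minus_right bop_scaleC_scaleC bop_half_double)
    have "z * (z + y) = z" by (simp add: zy)
    then show "z * y = 0" by (simp add: distrib_left 1)
  qed
  have yz: "y * z = 0" using zc(2)[OF zN(1)] zz(3) by simp
  have za: "adj z = z" "adj y = y"
    unfolding z_def y_def by (simp_all add: adj_diff adj_add ja bop_scaleC_minus_left bop_scaleC_minus_right)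
  \<comment> \<open>\<open>J\<close> is linear on the central part \<open>z\<close> and antilinear on \<open>y\<close>, where it is precomposed with \<open>adj\<close>.\<close>
  define K where "K a = J a * z + J (adj a) * y" for a
  have aM: "adj a \<in> M" if "a \<in> M" for a using vN_adj[OF M that] .
  have Kz: "K a * z = J a * z" "K a * y = J (adj a) * y" for a
    by (simp_all add: K_def distrib_right mult.assoc zz yz)
  have KN: "K a \<in> N" if "a \<in> M" for a
    unfolding K_def by (intro vN_add[OF N] vN_mult[OF N] JN that aM zN)
  have K_eqI: "K a = n" if "J a * z = n * z" "J (adj a) * y = n * y" for a n
    unfolding K_def that using zy by (metis distrib_left mult.right_neutral)
  have Kadd: "K (a + b) = K a + K b" if "a \<in> M" "b \<in> M" for a b
    using that by (simp add: K_def adj_add add aM distrib_right)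
  have cplx: "J (c *\<^sub>C a) = complex_of_real (Re c) *\<^sub>C J a + complex_of_real (Im c) *\<^sub>C (j * J a)"
    if a: "a \<in> M" for c a
  proof -
    have "c *\<^sub>C a = complex_of_real (Re c) *\<^sub>C a + complex_of_real (Im c) *\<^sub>C (I * a)"
      by (simp add: I_def bop_scaleC_add_left[symmetric] complex_eq[symmetric] mult.commute)
    then show ?thesis
      using a I by (simp add: add scaleM vN_mult[OF M] real mult j_def)
  qed
  have Kscale: "K (c *\<^sub>C a) = c *\<^sub>C K a" if a: "a \<in> M" for c a
  proof (rule K_eqI)
    have c: "complex_of_real (Re c) + complex_of_real (Im c) * \<i> = c"
      by (metis complex_eq mult.commute)
    have "j * (J a * z) = \<i> *\<^sub>C (J a * z)"
      using jc[OF JN[OF a]] jz(1) by (metis bop_scaleC_mult_right mult.assoc)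
    then show "J (c *\<^sub>C a) * z = c *\<^sub>C K a * z"
      unfolding cplx[OF a] bop_scaleC_mult_left Kz
      by (simp add: distrib_right mult.assoc bop_scaleC_add_left[symmetric] c)
    have "j * (J (adj a) * y) = (- \<i>) *\<^sub>C (J (adj a) * y)"
      using jc[OF JN[OF aM[OF a]]] jz(2) by (metis bop_scaleC_mult_right mult.assoc)
    then show "J (adj (c *\<^sub>C a)) * y = c *\<^sub>C K a * y"
      unfolding adj_scaleC cplx[OF aM[OF a]] bop_scaleC_mult_left Kz
      by (simp add: distrib_right mult.assoc bop_scaleC_add_left[symmetric] c)
  qed
  \<comment> \<open>On \<open>y\<close> the map \<open>K\<close> reverses products, so only the
    symmetric sum is respected on both summands.\<close>
  have Kjordan: "K (a * b + b * a) = K a * K b + K b * K a" if a: "a \<in> M" and b: "b \<in> M" for a b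
  proof (rule K_eqI)
    have m: "a * b \<in> M" "b * a \<in> M" using vN_mult[OF M] a b by auto
    have Kprod: "K a * K b * z = J a * J b * z" "K a * K b * y = J (adj a) * J (adj b) * y"
      if "a \<in> M" "b \<in> M" for a b
    proof -
      have "K a * K b * z = K a * z * (K b * z)"
        using zc(1)[OF KN[OF that(2)]] zz(1) by (metis mult.assoc)
      also have "\<dots> = J a * J b * z"
        unfolding Kz using zc(1)[OF JN[OF that(2)]] zz(1) by (metis mult.assoc)
      finally show "K a * K b * z = J a * J b * z" .
      have "K a * K b * y = K a * y * (K b * y)"
        using zc(2)[OF KN[OF that(2)]] zz(2) by (metis mult.assoc)
      also have "\<dots> = J (adj a) * J (adj b) * y"
        unfolding Kz using zc(2)[OF JN[OF aM[OF that(2)]]] zz(2) by (metis mult.assoc)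
      finally show "K a * K b * y = J (adj a) * J (adj b) * y" .
    qed
    show "J (a * b + b * a) * z = (K a * K b + K b * K a) * z"
      by (simp add: distrib_right Kprod a b add m mult)
    show "J (adj (a * b + b * a)) * y = (K a * K b + K b * K a) * y"
      using vN_mult[OF M] aM[OF a] aM[OF b]
      by (simp add: distrib_right Kprod a b add mult adj_add adj_mult add.commute)
  qed
  have Kadj: "K (adj a) = adj (K a)" if a: "a \<in> M" for a
    using adj[OF a] adj[OF aM[OF a]] zc[OF JN[OF a]] zc[OF JN[OF aM[OF a]]]
    by (simp add: K_def adj_add adj_mult za)
  have "bij_betw K M N"
  proof (rule bij_betwI')
    fix a b assume ab: "a \<in> M" "b \<in> M"
    show "K a = K b \<longleftrightarrow> a = b"
    proof
      assume "K a = K b"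
      then have 1: "J a * z = J b * z" "J (adj a) * y = J (adj b) * y" using Kz by metis+
      have "y * J a = y * J b"
        using arg_cong[OF 1(2), of adj] ab by (simp add: adj_mult za adj[symmetric] aM)
      then have "J a * y = J b * y" using zc(2) JN ab by simp
      then have "J a * (z + y) = J b * (z + y)" using 1(1) by (simp add: distrib_left)
      then have "J a = J b" by (simp add: zy)
      then show "a = b" using bij ab by (meson bij_betw_imp_inj_on inj_onD)
    qed simp
  next
    fix n assume n: "n \<in> N"
    \<comment> \<open>On \<open>y\<close> the adjoint undoes the one built into
      \<open>K\<close>.\<close>
    have "n * z + adj n * y \<in> N" by (intro vN_add[OF N] vN_mult[OF N] vN_adj[OF N] n zN)
    then obtain a where a: "a \<in> M" "J a = n * z + adj n * y" using surj by blast
    have "K a = n"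
    proof (rule K_eqI)
      show "J a * z = n * z" by (simp add: a distrib_right mult.assoc zz yz)
      have "J (adj a) = z * adj n + y * n" by (simp add: adj[OF a(1)] a(2) adj_add adj_mult za)
      also have "\<dots> = adj n * z + n * y" using zc n vN_adj[OF N n] by simp
      finally show "J (adj a) * y = n * y" by (simp add: distrib_right mult.assoc zz)
    qed
    then show "\<exists>a\<in>M. n = K a" using a(1) by blast
  qed (rule KN)
  moreover have "K (jordan_product a b) = jordan_product (K a) (K b)" if "a \<in> M" "b \<in> M" for a b
    using that vN_mult[OF M] vN_add[OF M]
    by (simp add: jordan_product_def Kscale Kjordan)
  ultimately show ?thesis unfolding jordan_star_isomorphic_def using Kadd Kscale Kadj by blast
qed

section \<open>From tripotents to projections\<close>

text \<open>For a central idempotent \<open>c\<close> the mixture is the pair with components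
  \<open>a\<close> on \<open>1 - c\<close> and \<open>b\<close> on \<open>c\<close>, multiplied
  componentwise.\<close>

lemma central_mix_mult:
  assumes c: "\<And>n. n \<in> N \<Longrightarrow> c * n = n * c" "c * c = c"
    and N: "a \<in> N" "b \<in> N"
  shows "((1 - c) * a + c * b) * ((1 - c) * a' + c * b') = (1 - c) * (a * a') + c * (b * (b' :: 'a::complex_hilbert_space bop))"
proof -
  have m: "a * c = c * a" "b * c = c * b" using c(1) N by simp_all
  have ml: "a * (c * x) = c * (a * x)" "b * (c * x) = c * (b * x)" "c * (c * x) = c * x" for x
    by (simp_all only: mult.assoc[symmetric] m c(2))
  show ?thesis by (simp add: algebra_simps m ml)
qed

lemma central_mix_eq_0:
  assumes "(c::'a::complex_hilbert_space bop) * c = c" "(1 - c) * a + c * b = 0"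
  shows "(1 - c) * a = 0" "c * b = 0"
proof -
  have "c * ((1 - c) * a + c * b) = c * b"
    by (simp add: distrib_left left_diff_distrib right_diff_distrib mult_eq_assoc[OF assms(1)])
  then show "c * b = 0" by (simp add: assms(2))
  with assms(2) show "(1 - c) * a = 0" by simp
qed

lemma projs_tripotents: "p \<in> projs M \<Longrightarrow> p \<in> tripotents M"
  by (simp add: tripotents_def projsD)

locale tripotent_iso =
  fixes M :: "'a::complex_hilbert_space bop set" and N :: "'b::complex_hilbert_space bop set"
    and \<phi> :: "'a bop \<Rightarrow> 'b bop"
  assumes M: "von_neumann_algebra M" and N: "von_neumann_algebra N"
    and bij: "bij_betw \<phi> (tripotents M) (tripotents N)"
    and orth_iff: "\<And>u v. u \<in> tripotents M \<Longrightarrow> v \<in> tripotents M \<Longrightarrow>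
      \<phi> u * adj (\<phi> v) = 0 \<and> adj (\<phi> v) * \<phi> u = 0 \<longleftrightarrow> u * adj v = 0 \<and> adj v * u = 0"
    and add: "\<And>u v. u \<in> tripotents M \<Longrightarrow> v \<in> tripotents M \<Longrightarrow> u * adj v = 0 \<Longrightarrow> adj v * u = 0 \<Longrightarrow>
      \<phi> (u + v) = \<phi> u + \<phi> v"
begin

abbreviation "w \<equiv> \<phi> 1"

lemma trip: "u \<in> tripotents M \<Longrightarrow> \<phi> u \<in> tripotents N"
  using bij bij_betwE by blast

lemma trip_surj: assumes "y \<in> tripotents N" obtains u where "u \<in> tripotents M" "\<phi> u = y"
  using bij_betw_imp_surj_on[OF bij] assms by (metis imageE)

lemma trip_inj: "u \<in> tripotents M \<Longrightarrow> u' \<in> tripotents M \<Longrightarrow> \<phi> u = \<phi> u' \<Longrightarrow> u = u'"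
  using bij_betw_imp_inj_on[OF bij] by (rule inj_onD)

lemma one_trip: "1 \<in> tripotents M"
  using projs_tripotents[OF projs_one[OF M]] .

lemma zero_trip: "0 \<in> tripotents M"
  using projs_tripotents[OF projs_zero[OF M]] .

lemma w: "w \<in> N" "w * adj w * w = w"
  using trip[OF one_trip] by (auto simp: tripotents_def)

lemma trip_zero: "\<phi> 0 = 0"
  using add[OF zero_trip zero_trip] by simp

text \<open>Only 0 is orthogonal to the tripotent 1, and \<phi> reflects orthogonality.\<close>

lemma w_maximal:
  assumes y: "y \<in> tripotents N" "y * adj w = 0" "adj w * y = 0"
  shows "y = 0"
proof -
  obtain s where s: "s \<in> tripotents M" "\<phi> s = y" using trip_surj[OF y(1)] .
  have "s = 0" using orth_iff[OF s(1) one_trip] y(2,3) s(2) by (simp add: adj_one)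
  then show ?thesis using s(2) trip_zero by simp
qed

text \<open>
  Maximality of \<open>w\<close> forces \<open>(1 - w w\<^sup>*) N (1 - w\<^sup>* w) = 0\<close>, so a central projection separates
  the part where \<open>w\<close> is an isometry from the part where it is a co-isometry.
\<close>

lemma ex_central_splitting:
  "\<exists>c\<in>projs N. (\<forall>n\<in>N. c * n = n * c) \<and> (1 - c) * (w * adj w) = 1 - c \<and> c * (adj w * w) = c"
proof -
  have w': "w * (adj w * w) = w" "adj w * (w * adj w) = adj w"
    using w(2) adj_tripotent[OF w(2)] by (simp_all only: mult.assoc)
  have pw: "w * adj w \<in> projs N" and qw: "adj w * w \<in> projs N"
    using projs_tripotent_left[OF N w] projs_tripotent_right[OF N w] by auto
  have off: "(1 - w * adj w) * n * (1 - adj w * w) = 0" if n: "n \<in> N" for n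
  proof (rule ccontr)
    let ?f = "1 - w * adj w" and ?e = "1 - adj w * w"
    assume ne: "?f * n * ?e \<noteq> 0"
    have f: "?f \<in> projs N" and e: "?e \<in> projs N" using projs_compl[OF N] pw qw by auto
    have T: "?f * n * ?e \<in> N" "?f * (?f * n * ?e) = ?f * n * ?e" "?f * n * ?e * ?e = ?f * n * ?e"
      by (intro vN_mult[OF N] projsD(1)[OF f] projsD(1)[OF e] n)
        (simp_all only: mult.assoc projsD(3)[OF e] projsD(4)[OF f])
    \<comment> \<open>A partial isometry in this block is orthogonal to \<open>w\<close>.\<close>
    obtain y where y: "y \<in> N" "y * adj y * y = y" "?f * y = y" "y * ?e = y" "?f * n * ?e \<noteq> 0 \<longrightarrow> y \<noteq> 0"
      using ex_tripotent_between[OF N T] by (elim bexE conjE) (rule that)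
    have "adj w * (?f * y) = 0" "(y * ?e) * adj w = 0"
      by (simp_all add: algebra_simps w' mult_eq_assoc[OF w'(2), unfolded mult.assoc])
    then have "y * adj w = 0" "adj w * y = 0" using y(3,4) by simp_all
    moreover have "y \<in> tripotents N" using y(1,2) by (simp add: tripotents_def)
    ultimately have "y = 0" using w_maximal by blast
    with y(5) ne show False by blast
  qed
  let ?f = "1 - w * adj w" and ?e = "1 - adj w * w"
  \<comment> \<open>\<open>c\<close> is the central support of \<open>1 - w * adj w\<close>: on
    \<open>1 - c\<close> the final projection of \<open>w\<close> is everything, and by
    \<open>off\<close> the projection \<open>1 - adj w * w\<close> is orthogonal to
    \<open>c\<close>.\<close>
  obtain c where c: "c \<in> projs N" "\<forall>m\<in>N. c * m = m * c" "c * ?f = ?f"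
      "\<forall>b. (\<forall>m\<in>N. b * m * ?f = 0) \<longrightarrow> b * c = 0"
    using ex_central_support[OF N projs_compl[OF N pw]] by (elim bexE conjE) (rule that)
  have "?e * m * ?f = 0" if "m \<in> N" for m
    using mult_zero_adj[of "?f * adj m" ?e] off[OF vN_adj[OF N that]]
    by (simp add: adj_mult adj_diff adj_one mult.assoc)
  then have "?e * c = 0" using c(4) by blast
  then have "c = adj w * w * c" by (simp add: left_diff_distrib)
  then have "c * (adj w * w) = c" using c(2) projsD(1)[OF qw] by simp
  moreover have "(1 - c) * (w * adj w) = 1 - c" using c(3) by (simp add: algebra_simps)
  ultimately show ?thesis using c(1,2) by blast
qed

text \<open>\<open>w\<close> is the orthogonal sum of \<open>\<phi> p\<close> and
  \<open>\<phi> (1 - p)\<close>, so in a product with \<open>\<phi> p\<close> it acts as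
  \<open>\<phi> p\<close>.\<close>

lemma on_proj:
  assumes p: "p \<in> projs M"
  shows "\<phi> p \<in> N" "\<phi> p * adj (\<phi> p) * \<phi> p = \<phi> p"
    "\<phi> p * adj w = \<phi> p * adj (\<phi> p)" "adj w * \<phi> p = adj (\<phi> p) * \<phi> p"
    "w * adj (\<phi> p) = \<phi> p * adj (\<phi> p)" "adj (\<phi> p) * w = adj (\<phi> p) * \<phi> p"
proof -
  let ?x = "\<phi> p" and ?y = "\<phi> (1 - p)"
  have t: "p \<in> tripotents M" "1 - p \<in> tripotents M"
    using projs_tripotents[OF p] projs_tripotents[OF projs_compl[OF M p]] .
  show "?x \<in> N" "?x * adj ?x * ?x = ?x" using trip[OF t(1)] by (auto simp: tripotents_def)
  have o: "p * adj (1 - p) = 0" "adj (1 - p) * p = 0"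
    by (simp_all add: adj_diff adj_one projsD[OF p] algebra_simps)
  have o1: "?x * adj ?y = 0" "adj ?y * ?x = 0" using orth_iff[OF t] o by auto
  have o2: "?y * adj ?x = 0" "adj ?x * ?y = 0" using mult_zero_adj[OF o1(1)] mult_zero_adj[OF o1(2)] by simp_all
  have "w = ?x + ?y" using add[OF t o] by simp
  then show "?x * adj w = ?x * adj ?x" "adj w * ?x = adj ?x * ?x"
      "w * adj ?x = ?x * adj ?x" "adj ?x * w = adj ?x * ?x"
    by (simp_all add: adj_add distrib_left distrib_right o1 o2)
qed

text \<open>For a projection \<open>r\<close> of \<open>N\<close>, \<open>r * w\<close> is a
  tripotent with final projection \<open>r\<close> where \<open>w\<close> is a co-isometry, and
  \<open>w * r\<close> is one with initial projection \<open>r\<close> where \<open>w\<close> is an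
  isometry; this is what makes every \<open>r\<close> a value of \<theta>.\<close>

theorem ex_ortho_iso: "\<exists>\<theta>. ortho_iso M N \<theta>"
proof -
  obtain c where c: "c \<in> projs N" "\<forall>n\<in>N. c * n = n * c" "(1 - c) * (w * adj w) = 1 - c"
      "c * (adj w * w) = c"
    using ex_central_splitting by (elim bexE conjE) (rule that)
  note cc = projsD(3)[OF c(1)]
  define \<theta> where "\<theta> p = (1 - c) * (\<phi> p * adj (\<phi> p)) + c * (adj (\<phi> p) * \<phi> p)" for p
  have mix: "((1 - c) * a + c * b) * ((1 - c) * a' + c * b') = (1 - c) * (a * a') + c * (b * b')"
    if "a \<in> N" "b \<in> N" for a b a' b'
    by (rule central_mix_mult[of N]) (use c(2) cc that in blast)+
  have ca: "n * c = c * n" if "n \<in> N" for n using c(2) that by metis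
  have zc: "n * (1 - c) = (1 - c) * n" if "n \<in> N" for n
    by (simp add: left_diff_distrib right_diff_distrib ca[OF that])
  have mN: "(1 - c) * a + c * b \<in> N" if "a \<in> N" "b \<in> N" for a b
    using that by (intro vN_add vN_mult vN_diff vN_one N projsD(1)[OF c(1)])
  have madj: "adj ((1 - c) * a + c * b) = (1 - c) * adj a + c * adj b" if "a \<in> N" "b \<in> N" for a b
    by (simp add: adj_add adj_mult adj_diff adj_one projsD(2)[OF c(1)] ca zc vN_adj[OF N] that)
  have fN: "\<phi> p * adj (\<phi> p) \<in> projs N" "adj (\<phi> p) * \<phi> p \<in> projs N" if "p \<in> projs M" for p
    using projs_tripotent_left[OF N on_proj(1,2)[OF that]]
      projs_tripotent_right[OF N on_proj(1,2)[OF that]] .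
  have prod: "\<theta> p * \<theta> q = (1 - c) * (\<phi> p * adj (\<phi> p) * (\<phi> q * adj (\<phi> q)))
      + c * (adj (\<phi> p) * \<phi> p * (adj (\<phi> q) * \<phi> q))" if "p \<in> projs M" for p q
    unfolding \<theta>_def by (rule mix[OF projsD(1)[OF fN(1)[OF that]] projsD(1)[OF fN(2)[OF that]]])
  have proj: "\<theta> p \<in> projs N" if p: "p \<in> projs M" for p
  proof -
    note P = projsD[OF fN(1)[OF p]] and Q = projsD[OF fN(2)[OF p]]
    have "\<theta> p * \<theta> p = \<theta> p" unfolding prod[OF p] P(3) Q(3) by (simp add: \<theta>_def)
    moreover have "adj (\<theta> p) = \<theta> p" unfolding \<theta>_def madj[OF P(1) Q(1)] P(2) Q(2) ..
    moreover have "\<theta> p \<in> N" unfolding \<theta>_def by (rule mN[OF P(1) Q(1)])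
    ultimately show ?thesis by (simp add: projs_def)
  qed
  \<comment> \<open>In this form \<theta> depends additively on \<open>\<phi> p\<close>.\<close>
  have linear: "\<theta> p = (1 - c) * (\<phi> p * adj w) + c * (adj w * \<phi> p)" if "p \<in> projs M" for p
    unfolding \<theta>_def on_proj(3,4)[OF that] ..
  have orth1: "p * adj q = 0" "adj q * p = 0" if "p \<in> projs M" "q \<in> projs M" "p * q = 0" for p q
    using that proj_comm_zero[OF that] by (simp_all add: projsD)
  have tadd: "\<theta> (p + q) = \<theta> p + \<theta> q" if "p \<in> projs M" "q \<in> projs M" "p * q = 0" for p q
  proof -
    have "\<phi> (p + q) = \<phi> p + \<phi> q"
      using add[OF projs_tripotents[OF that(1)] projs_tripotents[OF that(2)]] orth1[OF that] by blast
    then show ?thesis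
      unfolding linear[OF projs_add[OF M that]] linear[OF that(1)] linear[OF that(2)]
      by (simp add: distrib_left distrib_right)
  qed
  have orth: "\<theta> p * \<theta> q = 0 \<longleftrightarrow> p * q = 0" if p: "p \<in> projs M" and q: "q \<in> projs M" for p q
  proof
    let ?x = "\<phi> p" and ?y = "\<phi> q"
    note X = on_proj[OF p] and Y = on_proj[OF q]
    assume "p * q = 0"
    then have "?x * adj ?y = 0" "adj ?y * ?x = 0"
      using orth_iff[OF projs_tripotents[OF p] projs_tripotents[OF q]] orth1[OF p q] by auto
    then have "?x * adj ?y = 0" "adj ?x * ?y = 0" using mult_zero_adj[of "adj ?y" ?x] by simp_all
    then have "?x * (adj ?x * ?y) * adj ?y = 0" "adj ?x * (?x * adj ?y) * ?y = 0" by simp_all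
    then have "?x * adj ?x * (?y * adj ?y) = 0" "adj ?x * ?x * (adj ?y * ?y) = 0" by (simp_all only: mult.assoc)
    then show "\<theta> p * \<theta> q = 0" unfolding prod[OF p] by simp
  next
    let ?x = "\<phi> p" and ?y = "\<phi> q"
    note X = on_proj[OF p] and Y = on_proj[OF q]
    have xa: "adj ?x \<in> N" by (rule vN_adj[OF N X(1)])
    assume "\<theta> p * \<theta> q = 0"
    from central_mix_eq_0[OF cc this[unfolded prod[OF p]]]
    have z0: "(1 - c) * (?x * adj ?x * (?y * adj ?y)) = 0"
      and c0: "c * (adj ?x * ?x * (adj ?y * ?y)) = 0" .
    have xy1: "?x * adj ?y = ?x * adj ?x * (?y * adj ?y)"
    proof -
      have "?x * adj ?x * (?y * adj ?y) = ?x * (adj ?x * w) * adj ?y" unfolding Y(5)[symmetric] by (simp only: mult.assoc)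
      then show ?thesis unfolding X(6) by (simp only: mult.assoc[symmetric] X(2))
    qed
    have xy2: "adj ?x * ?y = adj ?x * ?x * (adj ?y * ?y)"
    proof -
      have "adj ?x * ?x * (adj ?y * ?y) = adj ?x * (w * adj ?y) * ?y" unfolding X(6)[symmetric] by (simp only: mult.assoc)
      then show ?thesis unfolding Y(5) by (simp only: mult.assoc[symmetric]) (simp only: mult.assoc Y(2)[unfolded mult.assoc])
    qed
    have "(1 - c) * (?x * adj ?y) = 0" "c * (adj ?x * ?y) = 0" unfolding xy1 xy2 by (fact z0 c0)+
    \<comment> \<open>The hypothesis controls final projections on \<open>1 - c\<close> and initial
      ones on \<open>c\<close> only; multiplying from both sides passes to the other half of
      orthogonality.\<close>
    moreover have "(1 - c) * (adj ?x * ?y) = adj ?x * ((1 - c) * (?x * adj ?x * (?y * adj ?y))) * ?y"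
    proof -
      have "adj ?x * ((1 - c) * (?x * adj ?x * (?y * adj ?y))) * ?y
          = (adj ?x * (1 - c)) * (?x * adj ?x * (?y * adj ?y * ?y))" by (simp only: mult.assoc)
      also have "\<dots> = (1 - c) * (adj ?x * ?x * adj ?x * ?y)"
        unfolding Y(2) zc[OF xa] by (simp only: mult.assoc)
      finally show ?thesis unfolding adj_tripotent[OF X(2)] ..
    qed
    moreover have "c * (?x * adj ?y) = ?x * (c * (adj ?x * ?x * (adj ?y * ?y))) * adj ?y"
    proof -
      have "?x * (c * (adj ?x * ?x * (adj ?y * ?y))) * adj ?y
          = (?x * c) * (adj ?x * ?x * (adj ?y * ?y * adj ?y))" by (simp only: mult.assoc)
      also have "\<dots> = c * (?x * adj ?x * ?x * adj ?y)"
        unfolding adj_tripotent[OF Y(2)] ca[OF X(1)] by (simp only: mult.assoc)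
      finally show ?thesis unfolding X(2) ..
    qed
    ultimately have "(1 - c) * (?x * adj ?y) = 0" "c * (?x * adj ?y) = 0"
        "(1 - c) * (adj ?x * ?y) = 0" "c * (adj ?x * ?y) = 0"
      unfolding z0 c0 by simp_all
    then have "?x * adj ?y = 0" "adj ?x * ?y = 0" by (simp_all add: left_diff_distrib)
    then have "?x * adj ?y = 0" "adj ?y * ?x = 0" using mult_zero_adj[of "adj ?x" ?y] by simp_all
    then have "p * adj q = 0"
      using orth_iff[OF projs_tripotents[OF p] projs_tripotents[OF q]] by blast
    then show "p * q = 0" by (simp add: projsD[OF q])
  qed
  \<comment> \<open>The tripotent belonging to \<open>r\<close>: multiplying by \<open>w\<close>
    reverses the passage from \<open>\<phi> p\<close> to \<open>\<theta> p\<close>.\<close>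
  define T where "T r = (1 - c) * (r * w) + c * (w * r)" for r
  have recover: "T (\<theta> p) = \<phi> p" if p: "p \<in> projs M" for p
  proof -
    let ?x = "\<phi> p"
    note X = on_proj[OF p]
    have 1: "(1 - c) * \<theta> p = (1 - c) * (?x * adj ?x)" "c * \<theta> p = c * (adj ?x * ?x)"
      by (simp_all add: \<theta>_def distrib_left left_diff_distrib right_diff_distrib mult_eq_assoc[OF cc])
    have "T (\<theta> p) = (1 - c) * \<theta> p * w + w * (c * \<theta> p)"
      using arg_cong[OF ca[OF w(1)], of "\<lambda>x. x * \<theta> p"] by (simp only: T_def mult.assoc)
    also have "\<dots> = (1 - c) * (?x * (adj ?x * w)) + c * (w * adj ?x * ?x)"
      unfolding 1 using arg_cong[OF ca[OF w(1)], of "\<lambda>x. x * (adj ?x * ?x)"] by (simp only: mult.assoc)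
    also have "\<dots> = (1 - c) * ?x + c * ?x" unfolding X(5,6) using X(2) by (simp add: mult.assoc)
    finally show ?thesis by (simp add: left_diff_distrib)
  qed
  have inj: "inj_on \<theta> (projs M)"
  proof (rule inj_onI)
    fix p q assume pq: "p \<in> projs M" "q \<in> projs M" "\<theta> p = \<theta> q"
    then have "\<phi> p = \<phi> q" using recover[OF pq(1)] recover[OF pq(2)] by simp
    then show "p = q" by (rule trip_inj[OF projs_tripotents[OF pq(1)] projs_tripotents[OF pq(2)]])
  qed
  have surj: "\<exists>s\<in>projs M. \<theta> s = r" if r: "r \<in> projs N" for r
  proof -
    have TN: "T s \<in> N" if "s \<in> projs N" for s
      unfolding T_def by (intro mN vN_mult N w(1) projsD(1)[OF that])
    have Tadj: "adj (T s) = (1 - c) * (adj w * s) + c * (s * adj w)" if "s \<in> projs N" for s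
      unfolding T_def
      by (subst madj) (simp_all add: vN_mult[OF N] w(1) projsD[OF that] adj_mult)
    have Tl: "T s * adj (T t) = (1 - c) * (s * t) + c * (w * (s * t) * adj w)"
      if s: "s \<in> projs N" and t: "t \<in> projs N" for s t
    proof -
      have "T s * adj (T t) = (1 - c) * (s * w * (adj w * t)) + c * (w * s * (t * adj w))"
        unfolding Tadj[OF t] unfolding T_def
        by (rule mix) (intro vN_mult[OF N] w(1) projsD(1)[OF s])+
      moreover have "(1 - c) * (s * w * (adj w * t)) = s * ((1 - c) * (w * adj w)) * t"
        using arg_cong[OF zc[OF projsD(1)[OF s]], of "\<lambda>x. x * (w * (adj w * t))"] by (simp only: mult.assoc)
      moreover have "s * (1 - c) * t = (1 - c) * (s * t)"
        using arg_cong[OF zc[OF projsD(1)[OF s]], of "\<lambda>x. x * t"] by (simp only: mult.assoc)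
      ultimately show ?thesis unfolding c(3) by (simp add: mult.assoc)
    qed
    have Tr: "adj (T s) * T t = (1 - c) * (adj w * (s * t) * w) + c * (s * t)"
      if s: "s \<in> projs N" and t: "t \<in> projs N" for s t
    proof -
      have "adj (T s) * T t = (1 - c) * (adj w * s * (t * w)) + c * (s * adj w * (w * t))"
        unfolding Tadj[OF s] unfolding T_def
        by (rule mix) (intro vN_mult[OF N] vN_adj[OF N] w(1) projsD(1)[OF s])+
      moreover have "c * (s * adj w * (w * t)) = s * (c * (adj w * w)) * t"
        using arg_cong[OF ca[OF projsD(1)[OF s]], of "\<lambda>x. x * (adj w * (w * t))"] by (simp only: mult.assoc)
      moreover have "s * c * t = c * (s * t)"
        using arg_cong[OF ca[OF projsD(1)[OF s]], of "\<lambda>x. x * t"] by (simp only: mult.assoc)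
      ultimately show ?thesis unfolding c(4) by (simp add: mult.assoc)
    qed
    have Ttrip: "T s \<in> tripotents N" if s: "s \<in> projs N" for s
    proof -
      have sN: "s \<in> N" using projsD(1)[OF s] .
      have "T s * adj (T s) * T s = (1 - c) * (s * (s * w)) + c * (w * s * adj w * (w * s))"
        unfolding Tl[OF s s] projsD(3)[OF s] unfolding T_def
        by (rule mix) (intro vN_mult[OF N] vN_adj[OF N] w(1) sN)+
      moreover have "c * (w * s * adj w * (w * s)) = w * s * (c * (adj w * w)) * s"
        using arg_cong[OF ca[OF vN_mult[OF N w(1) sN]], of "\<lambda>x. x * (adj w * (w * s))"] by (simp only: mult.assoc)
      moreover have "w * s * c * s = c * (w * s)"
        using arg_cong[OF ca[OF vN_mult[OF N w(1) sN]], of "\<lambda>x. x * s"] by (simp only: mult.assoc projsD(3)[OF s])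
      ultimately have "T s * adj (T s) * T s = T s"
        unfolding c(4) by (simp add: T_def projsD(4)[OF s])
      then show ?thesis using TN[OF s] by (simp add: tripotents_def)
    qed
    \<comment> \<open>The preimages of \<open>T r\<close> and \<open>T (1 - r)\<close> are
      orthogonal tripotents with sum 1; from \<open>s + t = 1\<close> and
      \<open>s * adj t = 0\<close> it follows that \<open>s = s * adj s\<close>, so \<open>s\<close>
      is a projection.\<close>
    have r': "1 - r \<in> projs N" by (rule projs_compl[OF N r])
    have rr': "r * (1 - r) = 0" by (simp add: right_diff_distrib projsD[OF r])
    have o: "T r * adj (T (1 - r)) = 0" using Tl[OF r r'] by (simp add: rr')
    have "adj (T r) * T (1 - r) = 0" using Tr[OF r r'] by (simp add: rr')
    then have o': "adj (T (1 - r)) * T r = 0" using mult_zero_adj[of "adj (T r)"] by simp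
    obtain s where s: "s \<in> tripotents M" "\<phi> s = T r" using trip_surj[OF Ttrip[OF r]] .
    obtain t where t: "t \<in> tripotents M" "\<phi> t = T (1 - r)" using trip_surj[OF Ttrip[OF r']] .
    have st: "s * adj t = 0" "adj t * s = 0" using orth_iff[OF s(1) t(1)] o o' s(2) t(2) by auto
    have "\<phi> (s + t) = T r + T (1 - r)" using add[OF s(1) t(1) st] s(2) t(2) by simp
    also have "\<dots> = w" by (simp add: T_def algebra_simps)
    finally have w: "\<phi> (s + t) = w" .
    have "s + t \<in> tripotents M"
      using trip_sum[OF M s(1) t(1)] st trip_orth_iff[OF t(1)] by blast
    then have 1: "s + t = 1" using trip_inj[OF _ one_trip w] by blast
    have "s * adj (s + t) = s * adj s" by (simp add: adj_add distrib_left st)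
    then have ss: "s = s * adj s" unfolding 1 by (simp add: adj_one)
    have "adj s = s * adj s" using arg_cong[OF ss, of adj] unfolding adj_mult adj_adj .
    then have sa: "adj s = s" by (rule trans[OF _ ss[symmetric]])
    have sP: "s \<in> projs M" using s(1) ss[symmetric] sa by (simp add: projs_def tripotents_def)
    have "\<theta> s = (1 - c) * (T r * adj (T r)) + c * (adj (T r) * T r)" by (simp add: \<theta>_def s(2))
    also have "\<dots> = (1 - c) * r + c * r"
      unfolding Tl[OF r r] Tr[OF r r] projsD(3)[OF r]
      by (simp add: distrib_left left_diff_distrib right_diff_distrib mult_eq_assoc[OF cc])
    finally show ?thesis using sP by (intro bexI[of _ s]) (simp_all add: left_diff_distrib)
  qed
  have "bij_betw \<theta> (projs M) (projs N)"
    unfolding bij_betw_def using inj proj surj by blast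
  then have "ortho_iso M N \<theta>" using orth tadd M N by (intro ortho_iso.intro)
  then show ?thesis by blast
qed

end

lemma tripotent_iso_of_quantum_logic_isomorphic:
  assumes M: "von_neumann_algebra M" and N: "von_neumann_algebra N"
    and iso: "quantum_logic_isomorphic M N"
  shows "\<exists>\<phi>. tripotent_iso M N \<phi>"
proof -
  obtain \<phi> where bij: "bij_betw \<phi> (tripotents M) (tripotents N)"
    and mor: "quantum_logic_morphism M N \<phi>"
    and inv: "quantum_logic_morphism N M (inv_into (tripotents M) \<phi>)"
    using iso unfolding quantum_logic_isomorphic_def by (elim exE conjE) (rule that)
  have trip: "\<phi> u \<in> tripotents N" if "u \<in> tripotents M" for u using bij bij_betwE that by blast
  have inv_left: "inv_into (tripotents M) \<phi> (\<phi> u) = u" if "u \<in> tripotents M" for u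
    by (rule bij_betw_inv_into_left[OF bij that])
  have "trip_orth N (\<phi> u) (\<phi> v) \<longleftrightarrow> trip_orth M u v"
    if uv: "u \<in> tripotents M" "v \<in> tripotents M" for u v
  proof
    assume "trip_orth M u v"
    then show "trip_orth N (\<phi> u) (\<phi> v)"
      using mor uv unfolding quantum_logic_morphism_def by blast
  next
    assume "trip_orth N (\<phi> u) (\<phi> v)"
    then have "trip_orth M (inv_into (tripotents M) \<phi> (\<phi> u)) (inv_into (tripotents M) \<phi> (\<phi> v))"
      using inv trip[OF uv(1)] trip[OF uv(2)] unfolding quantum_logic_morphism_def by blast
    then show "trip_orth M u v" unfolding inv_left[OF uv(1)] inv_left[OF uv(2)] .
  qed
  then have "\<phi> u * adj (\<phi> v) = 0 \<and> adj (\<phi> v) * \<phi> u = 0 \<longleftrightarrow> u * adj v = 0 \<and> adj v * u = 0"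
    if "u \<in> tripotents M" "v \<in> tripotents M" for u v
    using that trip_orth_iff[OF that(2)] trip_orth_iff[OF trip[OF that(2)]] by blast
  moreover have "\<phi> (u + v) = \<phi> u + \<phi> v"
    if uv: "u \<in> tripotents M" "v \<in> tripotents M" "u * adj v = 0" "adj v * u = 0" for u v
  proof -
    have o: "trip_orth M u v" using trip_orth_iff[OF uv(2)] uv(3,4) by blast
    then have "trip_orth N (\<phi> u) (\<phi> v)" "\<phi> (trip_join M u v) = trip_join N (\<phi> u) (\<phi> v)"
      using mor uv(1,2) unfolding quantum_logic_morphism_def by blast+
    then show ?thesis
      using trip_join_eq_sum[OF M uv(1,2) o] trip_join_eq_sum[OF N trip[OF uv(1)] trip[OF uv(2)]] by simp
  qed
  ultimately have "tripotent_iso M N \<phi>" using M N bij by (intro tripotent_iso.intro)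
  then show ?thesis by blast
qed

theorem theorem7p5:
  fixes M :: "'a::complex_hilbert_space bop set"
    and N :: "'b::complex_hilbert_space bop set"
  assumes "von_neumann_algebra M" and "von_neumann_algebra N"
    and "quantum_logic_isomorphic M N"
  shows "jordan_star_isomorphic M N"
proof -
  obtain \<phi> where "tripotent_iso M N \<phi>"
    using tripotent_iso_of_quantum_logic_isomorphic[OF assms] ..
  then obtain \<theta> where "ortho_iso M N \<theta>" using tripotent_iso.ex_ortho_iso by blast
  from ortho_iso.ex_star_ring_iso[OF this] obtain J where J: "bij_betw J M N"
      "\<forall>a\<in>M. \<forall>b\<in>M. J (a + b) = J a + J b" "\<forall>a\<in>M. \<forall>b\<in>M. J (a * b) = J a * J b"
      "\<forall>a\<in>M. J (adj a) = adj (J a)"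
    by (elim exE conjE) (rule that)
  show ?thesis
    by (rule jordan_star_isomorphic_of_star_ring_iso[OF assms(1,2) J(1)]) (simp_all add: J(2-4))
qed

end
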